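(* Fix integers $0<k<n$. Consider the arcs in the Grassmannian $G(k,n)$, their invariant factor profiles $\beta=(\beta_{i,j})_{1\le i\le k,\,1\le j\le n-k}$, and the contact strata $\mathcal C_\beta\subset J_\infty G(k,n)$. Then: (1) The invariant factor profile of an arc is determined by the orders of contact of the arc with respect to the Schubert varieties, and vice versa; i.e. two arcs $\Lambda,\Lambda'$ in $G(k,n)$ have the same invariant factor profile if and only if $\operatorname{ord}_\Lambda(\Omega_\lambda)=\operatorname{ord}_{\Lambda'}(\Omega_\lambda)$ for every partition $\lambda$ with at most $k$ parts of size at most $n-k$. (2) The invariant factor profile of an arc is a plane partition, i.e. $\beta_{i,j}\ge\beta_{i+1,j}$ and $\beta_{i,j}\ge\beta_{i,j+1}$ whenever both entries are defined. (3) Every plane partition of size $k\times(n-k)$ (with entries in $\{0,1,2,\ldots,\infty\}$) is the invariant factor profile of some arc in $G(k,n)$. (4) Every contact stratum $\mathcal C_\beta$ is an irreducible subset of $J_\infty G(k,n)$.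
   Context: Work over $\mathbb C$. $G(k,n)$ is the Grassmannian of $k$-dimensional subspaces of $\mathbb C^n$, viewed as row spans of $k\times n$ matrices. $F_i\subset\mathbb C^n$ is the span of the last $i$ standard basis vectors. For a partition $\lambda=(\lambda_1\ge\dots\ge\lambda_k\ge0)$ with $\lambda_1\le n-k$ put $i_s=s+\lambda_{k+1-s}$; the Schubert variety is $\Omega_\lambda=\{V\in G(k,n)\mid \dim V\cap F_{n+1-i_s}\ge k+1-s,\ 1\le s\le k\}$ with its reduced structure (codimension $|\lambda|=\sum\lambda_i$). $J_\infty G(k,n)$ is the arc space of $G(k,n)$, the scheme with $A$-points $\operatorname{Hom}(\operatorname{Spec}A[[t]],G(k,n))$. A $\mathbb C$-valued arc corresponds to a submodule $\Lambda\subset\mathbb C[[t]]^n$ such that $\mathbb C[[t]]^n/\Lambda$ is free of rank $n-k$ (similarly over $K[[t]]$ for a point with residue field $K$, to which all definitions below apply verbatim). For a closed subscheme $Y$ with ideal $\mathfrak a$, $\operatorname{ord}_\Lambda(Y)=e\in\{0,1,\ldots,\infty\}$ is defined by: the inverse image of $\mathfrak a$ under the arc is $(t^e)$, where $t^\infty=0$. Also write $F_i\subset\mathbb C[[t]]^n$ for the $\mathbb C[[t]]$-span of the last $i$ standard basis vectors. For an arc $\Lambda$ write $$\mathbb C[[t]]^n/(\Lambda+F_i)\simeq\bigoplus_{j=1}^{n-k}\mathbb C[[t]]/(t^{b_{i,j}}),\qquad b_{i,j}\in\{0,1,\ldots,\infty\},\quad b_{i,j}\ge b_{i,j+1}.$$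 The invariant factor profile of $\Lambda$ is the $k\times(n-k)$ matrix $\beta=(\beta_{i,j})$ given by $\beta_{i+k-n+j,\,j}=b_{i,j}$ (for those indices with $1\le i+k-n+j\le k$, $1\le j\le n-k$). The contact stratum $\mathcal C_\beta\subset J_\infty G(k,n)$ is the set of arcs with invariant factor profile $\beta$. A plane partition (here) is a $k\times(n-k)$ matrix with entries in $\{0,1,\ldots,\infty\}$ that are non-increasing along rows and along columns. *)

theory Defs
  imports
    "HOL-Library.Poly_Mapping"
    "HOL-Library.Extended_Nat"
    "HOL-Computational_Algebra.Formal_Power_Series"
    "HOL-Computational_Algebra.Fraction_Field"
    "HOL-Algebra.Algebraic_Closure_Type"
    "HOL-Analysis.Abstract_Topology"
    "Jordan_Normal_Form.VS_Connect"
    "Jordan_Normal_Form.DL_Submatrix"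
begin

no_notation fps_nth (infixl \<open>$\<close> 75)
hide_const (open) Multiset.mult Polynomial.smult

section \<open>Modules: quotients, direct sums, isomorphism\<close>

text \<open>
  Modules over a commutative ring are records of HOL-Algebra; rings given by a type class are
  turned into records by \<^term>\<open>class_ring\<close>, and \<open>R^n\<close> is \<open>module_vec TYPE('a) n\<close>.
  Coordinates of vectors and entries of matrices are counted from 0.
  The fields \<open>mult\<close> and \<open>one\<close> of a module record carry no information.
\<close>

definition quot_module :: "('r, 'm) module \<Rightarrow> 'm set \<Rightarrow> ('r, 'm set) module" where
  "quot_module M N = \<lparr>carrier = a_rcosets\<^bsub>M\<^esub> N, mult = undefined, one = undefined, zero = N,
     add = set_add M, smult = (\<lambda>r C. set_add M N ((\<lambda>x. r \<odot>\<^bsub>M\<^esub> x) ` C))\<rparr>"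

definition dsum_module :: "'i set \<Rightarrow> ('i \<Rightarrow> ('r, 'm) module) \<Rightarrow> ('r, 'i \<Rightarrow> 'm) module" where
  "dsum_module J M = \<lparr>carrier = (\<Pi>\<^sub>E j\<in>J. carrier (M j)), mult = undefined, one = undefined,
     zero = (\<lambda>j\<in>J. \<zero>\<^bsub>M j\<^esub>), add = (\<lambda>x y. \<lambda>j\<in>J. x j \<oplus>\<^bsub>M j\<^esub> y j),
     smult = (\<lambda>r x. \<lambda>j\<in>J. r \<odot>\<^bsub>M j\<^esub> x j)\<rparr>"

definition module_iso ::
  "('r, 'c) ring_scheme \<Rightarrow> ('r, 'm, 'd) module_scheme \<Rightarrow> ('r, 'p, 'e) module_scheme \<Rightarrow> bool" where
  "module_iso R M N \<longleftrightarrow> (\<exists>h \<in> module_hom R M N. bij_betw h (carrier M) (carrier N))"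

definition regular_module :: "('a::comm_ring_1, 'a) module" where
  "regular_module = \<lparr>carrier = UNIV, mult = (*), one = 1, zero = 0, add = (+), smult = (*)\<rparr>"

definition vspan :: "nat \<Rightarrow> 'a::comm_ring_1 vec set \<Rightarrow> 'a vec set" where
  "vspan n S = LinearCombinations.module.span class_ring (module_vec TYPE('a) n) S"

text \<open>The span of the last \<open>i\<close> standard basis vectors, over any ring.\<close>
definition flag :: "nat \<Rightarrow> nat \<Rightarrow> 'a::comm_ring_1 vec set" where
  "flag n i = vspan n {unit_vec n j | j. n - i \<le> j \<and> j < n}"


section \<open>The Grassmannian and its Schubert varieties\<close>

definition sub_dim :: "nat \<Rightarrow> complex vec set \<Rightarrow> nat" where
  "sub_dim n W = vectorspace.dim class_ring ((module_vec TYPE(complex) n)\<lparr>carrier := W\<rparr>)"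

text \<open>The closed points of \<open>G(k,n)\<close>.\<close>
definition grassmannian :: "nat \<Rightarrow> nat \<Rightarrow> complex vec set set" where
  "grassmannian k n =
     {V. VectorSpace.subspace class_ring V (module_vec TYPE(complex) n) \<and> sub_dim n V = k}"

text \<open>Only the values \<open>\<mu> 1, \<dots>, \<mu> k\<close> are relevant.\<close>
definition is_partition :: "nat \<Rightarrow> nat \<Rightarrow> (nat \<Rightarrow> nat) \<Rightarrow> bool" where
  "is_partition k n \<mu> \<longleftrightarrow>
     (\<forall>s\<in>{1..k}. \<mu> s \<le> n - k) \<and> (\<forall>s\<in>{1..<k}. \<mu> s \<ge> \<mu> (s + 1))"

text \<open>The closed points of the Schubert variety \<open>\<Omega>\<^sub>\<mu>\<close>; here \<open>s + \<mu> (k + 1 - s)\<close> is \<open>i\<^sub>s\<close>.\<close>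
definition schubert :: "nat \<Rightarrow> nat \<Rightarrow> (nat \<Rightarrow> nat) \<Rightarrow> complex vec set set" where
  "schubert k n \<mu> = {V \<in> grassmannian k n.
     \<forall>s\<in>{1..k}. sub_dim n (V \<inter> flag n (n + 1 - (s + \<mu> (k + 1 - s)))) \<ge> k + 1 - s}"


section \<open>Affine charts\<close>

text \<open>
  For a \<open>k\<close>-element set \<open>I\<close> of columns, the chart \<open>U\<^sub>I\<close> of \<open>G(k,n)\<close> is the affine space of
  \<open>k \<times> n\<close> matrices whose columns in \<open>I\<close> form the identity matrix, a matrix standing for its row
  span; its coordinates are the entries in the columns outside \<open>I\<close>.  The definitions below are for
  points with values in a ring \<open>A\<close>, and are used for \<open>A = \<complex>\<close> (points) and \<open>A = K[[t]]\<close> (arcs).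
\<close>

definition is_chart :: "nat \<Rightarrow> nat \<Rightarrow> nat set \<Rightarrow> bool" where
  "is_chart k n I \<longleftrightarrow> I \<subseteq> {..<n} \<and> card I = k"

definition represents ::
  "nat \<Rightarrow> nat \<Rightarrow> nat set \<Rightarrow> 'a::comm_ring_1 mat \<Rightarrow> 'a vec set \<Rightarrow> bool" where
  "represents k n I A W \<longleftrightarrow>
     A \<in> carrier_mat k n \<and> submatrix A UNIV I = 1\<^sub>m k \<and> W = vspan n (set (rows A))"

definition in_chart :: "nat \<Rightarrow> nat \<Rightarrow> nat set \<Rightarrow> 'a::comm_ring_1 vec set \<Rightarrow> bool" where
  "in_chart k n I W \<longleftrightarrow> (\<exists>A. represents k n I A W)"

definition chart_mat :: "nat \<Rightarrow> nat \<Rightarrow> nat set \<Rightarrow> 'a::comm_ring_1 vec set \<Rightarrow> 'a mat" where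
  "chart_mat k n I W = (THE A. represents k n I A W)"

text \<open>
  Polynomials over \<open>\<complex>\<close> in variables indexed by a type: finitely supported functions from monomials
  to coefficients, a monomial being a finitely supported function from variables to exponents.
  They are evaluated in a ring \<open>A\<close> along a ring homomorphism \<open>\<phi>\<close> from \<open>\<complex>\<close> to \<open>A\<close>.
\<close>
type_synonym 'v cpoly = "('v \<Rightarrow>\<^sub>0 nat) \<Rightarrow>\<^sub>0 complex"

definition cpolys :: "'v set \<Rightarrow> 'v cpoly set" where
  "cpolys vs = {f. \<forall>m \<in> Poly_Mapping.keys f. Poly_Mapping.keys m \<subseteq> vs}"

definition eval_cpoly :: "(complex \<Rightarrow> 'a::comm_ring_1) \<Rightarrow> ('v \<Rightarrow> 'a) \<Rightarrow> 'v cpoly \<Rightarrow> 'a" where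
  "eval_cpoly \<phi> x f = (\<Sum>m \<in> Poly_Mapping.keys f.
     \<phi> (Poly_Mapping.lookup f m) * (\<Prod>v \<in> Poly_Mapping.keys m. x v ^ Poly_Mapping.lookup m v))"

text \<open>
  The ideal, on the chart \<open>U\<^sub>I\<close>, of the closed subset \<open>Y\<close> with its reduced structure.
\<close>
definition vanishing_ideal ::
  "nat \<Rightarrow> nat \<Rightarrow> nat set \<Rightarrow> complex vec set set \<Rightarrow> (nat \<times> nat) cpoly set" where
  "vanishing_ideal k n I Y = {f \<in> cpolys ({..<k} \<times> ({..<n} - I)).
     \<forall>V\<in>Y. in_chart k n I V \<longrightarrow> eval_cpoly (\<lambda>z. z) (\<lambda>v. chart_mat k n I V $$ v) f = 0}"


section \<open>Arcs, orders of contact, invariant factor profiles\<close>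

text \<open>Arcs with coefficients in the field \<open>'k\<close>.\<close>
definition is_arc :: "nat \<Rightarrow> nat \<Rightarrow> 'k::field fps vec set \<Rightarrow> bool" where
  "is_arc k n \<Lambda> \<longleftrightarrow>
     submodule class_ring \<Lambda> (module_vec TYPE('k fps) n) \<and>
     module_iso class_ring (quot_module (module_vec TYPE('k fps) n) \<Lambda>)
       (module_vec TYPE('k fps) (n - k))"

definition t_power :: "enat \<Rightarrow> 'k::field fps" where
  "t_power e = (case e of enat m \<Rightarrow> fps_X ^ m | \<infinity> \<Rightarrow> 0)"

text \<open>
  The inverse image under \<open>\<Lambda>\<close> of the ideal sheaf of \<open>Y\<close>, as an ideal of \<open>K[[t]]\<close>.
  As \<open>K[[t]]\<close> is local, an arc factors through every chart containing its closed point; each of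
  these charts yields the same ideal, so that all of them may be used.
  \<open>K\<close> is an extension of \<open>\<complex>\<close> by means of \<open>\<phi>\<close>.
\<close>
definition contact_ideal ::
  "(complex \<Rightarrow> 'k::field) \<Rightarrow> nat \<Rightarrow> nat \<Rightarrow> 'k fps vec set \<Rightarrow> complex vec set set \<Rightarrow> 'k fps set" where
  "contact_ideal \<phi> k n \<Lambda> Y = Idl\<^bsub>class_ring\<^esub>
     {eval_cpoly (\<lambda>z. fps_const (\<phi> z)) (\<lambda>v. chart_mat k n I \<Lambda> $$ v) f | I f.
        is_chart k n I \<and> in_chart k n I \<Lambda> \<and> f \<in> vanishing_ideal k n I Y}"

definition contact_order ::
  "(complex \<Rightarrow> 'k::field) \<Rightarrow> nat \<Rightarrow> nat \<Rightarrow> 'k fps vec set \<Rightarrow> complex vec set set \<Rightarrow> enat" where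
  "contact_order \<phi> k n \<Lambda> Y =
     (THE e. contact_ideal \<phi> k n \<Lambda> Y = PIdl\<^bsub>class_ring\<^esub> (t_power e))"

text \<open>The sequence \<open>b\<^sub>i\<^sub>,\<^sub>1, \<dots>, b\<^sub>i\<^sub>,\<^sub>n\<^sub>-\<^sub>k\<close>, indexed from 1 and extended by 0.\<close>
definition inv_factors :: "nat \<Rightarrow> nat \<Rightarrow> 'k::field fps vec set \<Rightarrow> nat \<Rightarrow> (nat \<Rightarrow> enat)" where
  "inv_factors k n \<Lambda> i = (THE b.
     (\<forall>j\<in>{1..<n - k}. b j \<ge> b (j + 1)) \<and> (\<forall>j. j \<notin> {1..n - k} \<longrightarrow> b j = 0) \<and>
     module_iso class_ring
       (quot_module (module_vec TYPE('k fps) n)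
         (set_add (module_vec TYPE('k fps) n) \<Lambda> (flag n i)))
       (dsum_module {1..n - k}
         (\<lambda>j. quot_module regular_module (PIdl\<^bsub>class_ring\<^esub> (t_power (b j) :: 'k fps)))))"

text \<open>
  The entry \<open>\<beta>\<^sub>r\<^sub>,\<^sub>j\<close> is \<open>b\<^sub>i\<^sub>,\<^sub>j\<close> with \<open>i = r + (n - k) - j\<close>. As matrix indices start at 0, the entry
  at index \<open>(r, c)\<close> is \<open>\<beta>\<close> in row \<open>r + 1\<close> and column \<open>c + 1\<close>.
\<close>
definition profile :: "nat \<Rightarrow> nat \<Rightarrow> 'k::field fps vec set \<Rightarrow> enat mat" where
  "profile k n \<Lambda> = mat k (n - k) (\<lambda>(r, c). inv_factors k n \<Lambda> (r + (n - k) - c) (c + 1))"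

definition plane_partition :: "nat \<Rightarrow> nat \<Rightarrow> enat mat \<Rightarrow> bool" where
  "plane_partition p q \<beta> \<longleftrightarrow> \<beta> \<in> carrier_mat p q \<and>
     (\<forall>r c. r + 1 < p \<and> c < q \<longrightarrow> \<beta> $$ (r, c) \<ge> \<beta> $$ (r + 1, c)) \<and>
     (\<forall>r c. r < p \<and> c + 1 < q \<longrightarrow> \<beta> $$ (r, c) \<ge> \<beta> $$ (r, c + 1))"


section \<open>The topological space underlying the arc space\<close>

text \<open>
  The arc space of the chart \<open>U\<^sub>I\<close> is the spectrum of the polynomial ring \<open>R\<^sub>I\<close> over \<open>\<complex>\<close> in the
  coefficients of \<open>t^m\<close> in the coordinates of \<open>U\<^sub>I\<close>, the variable \<open>(a, c, m)\<close> being the coefficient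
  of \<open>t^m\<close> in the matrix entry \<open>(a, c)\<close>; the arc space \<open>J\<^sub>\<infinity>G(k,n)\<close> is obtained by
  glueing these spectra.
\<close>
definition arc_vars :: "nat \<Rightarrow> nat \<Rightarrow> nat set \<Rightarrow> (nat \<times> nat \<times> nat) set" where
  "arc_vars k n I = {..<k} \<times> ({..<n} - I) \<times> UNIV"

text \<open>
  The point of the arc space (not necessarily closed) that is the image of the arc \<open>\<Lambda>\<close> over the
  extension \<open>K\<close> of \<open>\<complex>\<close>.  In the chart \<open>I\<close> it is the prime ideal of \<open>R\<^sub>I\<close> that is the kernel of
  the homomorphism from \<open>R\<^sub>I\<close> to \<open>K\<close> given by \<open>\<Lambda>\<close>.
  A point of the glued space is the set of all pairs of a chart containing it and the prime ideal
  by which it is given in that chart, i.e. a class of points identified by the glueing.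
\<close>
definition arc_point ::
  "(complex \<Rightarrow> 'k::field) \<Rightarrow> nat \<Rightarrow> nat \<Rightarrow> 'k fps vec set
     \<Rightarrow> (nat set \<times> (nat \<times> nat \<times> nat) cpoly set) set" where
  "arc_point \<phi> k n \<Lambda> =
     {(I, {f \<in> cpolys (arc_vars k n I).
             eval_cpoly \<phi> (\<lambda>(a, c, m). fps_nth (chart_mat k n I \<Lambda> $$ (a, c)) m) f = 0}) | I.
        is_chart k n I \<and> in_chart k n I \<Lambda>}"

text \<open>
  An algebraically closed field of infinite transcendence degree over \<open>\<complex>\<close>. The residue field of a
  point of the arc space is a countably generated field extension of \<open>\<complex>\<close>, so it embeds over \<open>\<complex>\<close>
  into this field.  Hence every point of the arc space is the image of an arc with
  coefficients in this field. The invariant factor profile does not change under field extensions,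
  so it can be computed from any such arc instead of the one over the residue field.
\<close>
type_synonym udom = "((nat \<Rightarrow>\<^sub>0 nat) \<Rightarrow>\<^sub>0 complex) fract alg_closure"

definition to_udom :: "complex \<Rightarrow> udom" where
  "to_udom z = to_ac (Fract (Poly_Mapping.single 0 z) 1)"

lemma field_hom_to_udom: "field_hom to_udom"
  by unfold_locales
    (auto simp: to_udom_def single_add Poly_Mapping.mult_single Zero_fract_def One_fract_def
       simp flip: to_ac_add to_ac_mult)

definition arc_points :: "nat \<Rightarrow> nat \<Rightarrow> (nat set \<times> (nat \<times> nat \<times> nat) cpoly set) set set" where
  "arc_points k n = {arc_point to_udom k n \<Lambda> | \<Lambda>. is_arc k n \<Lambda>}"

text \<open>
  The glued Zariski topology: a basis is formed by the principal open subsets, given by an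
  \<open>f \<in> R\<^sub>I\<close> not in the prime ideal, of the open subspaces \<open>Spec R\<^sub>I\<close>.
\<close>
definition arc_space ::
  "nat \<Rightarrow> nat \<Rightarrow> (nat set \<times> (nat \<times> nat \<times> nat) cpoly set) set topology" where
  "arc_space k n = topology_generated_by
     {{x \<in> arc_points k n. \<exists>\<pp>. (I, \<pp>) \<in> x \<and> f \<notin> \<pp>} | I f.
        is_chart k n I \<and> f \<in> cpolys (arc_vars k n I)}"

definition contact_stratum ::
  "nat \<Rightarrow> nat \<Rightarrow> enat mat \<Rightarrow> (nat set \<times> (nat \<times> nat \<times> nat) cpoly set) set set" where
  "contact_stratum k n \<beta> = {arc_point to_udom k n \<Lambda> | \<Lambda>. is_arc k n \<Lambda> \<and> profile k n \<Lambda> = \<beta>}"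

definition irreducible_space :: "'a topology \<Rightarrow> bool" where
  "irreducible_space T \<longleftrightarrow> topspace T \<noteq> {} \<and>
     (\<forall>A B. closedin T A \<and> closedin T B \<and> A \<union> B = topspace T
        \<longrightarrow> A = topspace T \<or> B = topspace T)"

definition irreducible_subset :: "'a topology \<Rightarrow> 'a set \<Rightarrow> bool" where
  "irreducible_subset T S \<longleftrightarrow> S \<subseteq> topspace T \<and> irreducible_space (subtopology T S)"

end

theory Submission
  imports Defs
begin

text \<open>
  An arc \<open>\<Lambda>\<close> is the kernel of a matrix \<open>H\<close> over \<open>K[[t]]\<close> with \<open>q = n - k\<close> rows and a right inverse, and
  \<open>K[[t]]^n/(\<Lambda> + F i)\<close> is the cokernel of the last \<open>i\<close> columns of \<open>H\<close>.  Adding one column makes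
  the invariant factors interlace, so the profile is a plane partition.  Conversely, a planar
  network of bidiagonal matrices, with powers of \<open>t\<close> prescribed by a plane partition, is an \<open>H\<close> with
  this profile.  Up to row operations every \<open>H\<close> with the profile arises from such a network, whose
  remaining parameters are subject to open conditions only; joining the parameters of two arcs by a line, on which a
  polynomial condition fails only finitely often, shows that nonempty open subsets of a contact
  stratum meet.

  The Schubert variety of \<open>\<mu>\<close> is the set of kernels of matrices for which the minors of size
  \<open>q + 1 - \<mu> p\<close> of the last \<open>q + p - \<mu> p\<close> columns vanish, \<open>1 \<le> p \<le> k\<close>.  Such minors have as greatest
  common divisor \<open>t\<close> to the sum of the smallest invariant factors, which is the sum of the profile
  along the diagonal from position \<open>(p, \<mu> p)\<close>.  The order of contact is the minimum of these sums:
  that the remaining functions vanishing on the Schubert variety have no smaller order follows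
  by diagonalising \<open>H\<close> on nested sets of columns, without knowing that the minors generate a
  radical ideal.  Rectangular partitions single out one diagonal sum, and differences of
  diagonal sums are the entries of the profile.
\<close>

section \<open>Diagonalisation of matrices\<close>

text \<open>Zero invariant factors, with exponent \<infinity>, shape most of the definitions. A
  relation multiplied by \<open>t_power \<infinity>\<close> carries no information and cannot be
  cancelled, so transition matrices are known only outside such rows. They are therefore kept as
  separate parameters \<open>E\<close> next to \<open>S\<close>, and the rows with exponent
  \<infinity> are filled up by a free matrix before a determinant is taken. For a fixed profile the
  relation between \<open>S\<close> and \<open>E\<close> is linear, which is why a straight line
  joins two arcs of one stratum; every remaining condition asks that some determinant be a unit of
  K[[t]], that is, have nonzero constant term. Constant terms also decide the uniqueness and the
  interlacing of invariant factors: both come down to the fact that an identity matrix does not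
  factor through fewer dimensions. Matrices are functions with explicit index sets, since one matrix
  is restricted to many sets of columns and to many supports of diagonal entries. Divisibility of
  all minors by a given element, which may be 0, treats complex points and arcs at once.\<close>

definition mm :: "'c set \<Rightarrow> ('a \<Rightarrow> 'c \<Rightarrow> 'r::comm_ring_1) \<Rightarrow> ('c \<Rightarrow> 'b \<Rightarrow> 'r) \<Rightarrow> 'a \<Rightarrow> 'b \<Rightarrow> 'r" where
  "mm S A B i j = (\<Sum>k\<in>S. A i k * B k j)"

definition idm :: "'a \<Rightarrow> 'a \<Rightarrow> 'r::comm_ring_1" where
  "idm i j = (if i = j then 1 else 0)"

lemma mm_assoc: "mm T (mm S A B) C = mm S A (mm T B C)"
  by (auto simp: mm_def fun_eq_iff sum_distrib_left sum_distrib_right mult.assoc intro: sum.swap)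

lemma mm_cong:
  assumes "\<And>k. k \<in> S \<Longrightarrow> A i k = A' i' k" "\<And>k. k \<in> S \<Longrightarrow> B k j = B' k j'"
  shows "mm S A B i j = mm S A' B' i' j'"
  using assms by (simp add: mm_def)

lemma mm_idm_left: "finite S \<Longrightarrow> i \<in> S \<Longrightarrow> mm S idm B i j = B i j"
  by (simp add: mm_def idm_def if_distrib if_distribR sum.delta cong: if_cong)

lemma mm_idm_right: "finite S \<Longrightarrow> j \<in> S \<Longrightarrow> mm S A idm i j = A i j"
  by (simp add: mm_def idm_def if_distrib if_distribR sum.delta' cong: if_cong)

definition inv_pair :: "'a set \<Rightarrow> ('a \<Rightarrow> 'a \<Rightarrow> 'r::comm_ring_1) \<Rightarrow> ('a \<Rightarrow> 'a \<Rightarrow> 'r) \<Rightarrow> bool" where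
  "inv_pair S T T' \<longleftrightarrow> (\<forall>i\<in>S. \<forall>j\<in>S. mm S T T' i j = idm i j \<and> mm S T' T i j = idm i j)"

lemma inv_pair_sym: "inv_pair S T T' \<Longrightarrow> inv_pair S T' T"
  by (simp add: inv_pair_def)

lemma inv_pair_idm: "finite S \<Longrightarrow> inv_pair S idm idm"
  by (simp add: inv_pair_def mm_idm_left)

lemma inv_pair_cancel:
  assumes "inv_pair S T T'" "finite S" "i \<in> S"
  shows "mm S T (mm S T' B) i j = B i j"
proof -
  have "mm S T (mm S T' B) i j = mm S (mm S T T') B i j" by (simp add: mm_assoc)
  also have "\<dots> = mm S idm B i j" using assms by (intro mm_cong) (auto simp: inv_pair_def)
  finally show ?thesis using assms by (simp add: mm_idm_left)
qed

lemma inv_pair_mm: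
  assumes "inv_pair S A A'" "inv_pair S B B'" "finite S"
  shows "inv_pair S (mm S A B) (mm S B' A')"
proof -
  { fix A A' B B' :: "'a \<Rightarrow> 'a \<Rightarrow> 'b" and i j
    assume *: "inv_pair S A A'" "inv_pair S B B'" "i \<in> S" "j \<in> S"
    have "mm S (mm S A B) (mm S B' A') i j = mm S A (mm S B (mm S B' A')) i j"
      by (simp add: mm_assoc)
    also have "\<dots> = mm S A A' i j"
      using * assms(3) by (intro mm_cong) (auto simp: inv_pair_cancel)
    finally have "mm S (mm S A B) (mm S B' A') i j = idm i j" using * by (simp add: inv_pair_def) }
  from this[of A A' B B'] this[of B' B A' A] assms show ?thesis
    unfolding inv_pair_def by (metis (no_types, lifting))
qed

text \<open>The columns of \<open>H\<close> in \<open>C\<close> and the columns of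
  \<open>T diag(d)\<close> span the same module: \<open>Q\<close> expresses the first by the second
  and \<open>Y\<close> the second by the first. Column operations enter only through these two
  expressions, so \<open>d\<close> can be indexed by the rows even if \<open>C\<close> is smaller,
  and the conditions compose well when columns are added.\<close>

definition smith ::
  "'i set \<Rightarrow> 'c set \<Rightarrow> ('i \<Rightarrow> 'c \<Rightarrow> 'r::comm_ring_1) \<Rightarrow> ('i \<Rightarrow> 'i \<Rightarrow> 'r) \<Rightarrow> ('i \<Rightarrow> 'i \<Rightarrow> 'r)
    \<Rightarrow> ('i \<Rightarrow> 'r) \<Rightarrow> ('i \<Rightarrow> 'c \<Rightarrow> 'r) \<Rightarrow> ('c \<Rightarrow> 'i \<Rightarrow> 'r) \<Rightarrow> bool" where
  "smith S C H T T' d Q Y \<longleftrightarrow> inv_pair S T T'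
     \<and> (\<forall>i\<in>S. \<forall>c\<in>C. mm S T' H i c = d i * Q i c)
     \<and> (\<forall>i\<in>S. \<forall>j\<in>S. mm C H Y i j = T i j * d j)"

lemma finite_total_dvd_min:
  fixes f :: "'a \<Rightarrow> 'r::comm_ring_1"
  assumes tot: "\<And>x y::'r. x dvd y \<or> y dvd x" and "finite A" "A \<noteq> {}"
  shows "\<exists>a\<in>A. \<forall>b\<in>A. f a dvd f b"
  using assms(2,3)
proof (induction rule: finite_ne_induct)
  case (insert x F)
  then obtain a where a: "a \<in> F" "\<forall>b\<in>F. f a dvd f b" by blast
  show ?case
  proof (cases "f a dvd f x")
    case False
    then have "f x dvd f a" using tot by blast
    then show ?thesis using a dvd_trans by auto
  qed (use a in auto)
qed auto

text \<open>One step of elimination: the pivot divides all entries, so that its column can be cleared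
  by row operations and the quotients of its row are available for column operations.\<close>

lemma smith_exists:
  fixes H :: "'i \<Rightarrow> 'c \<Rightarrow> 'r::comm_ring_1"
  assumes tot: "\<And>x y::'r. x dvd y \<or> y dvd x" and "finite S" "finite C"
  shows "\<exists>T T' d Q Y. smith S C H T T' d Q Y"
  using assms(2)
proof (induction "card S" arbitrary: S H)
  case 0
  then have "S = {}" by simp
  then show ?case by (auto simp: smith_def inv_pair_def)
next
  case (Suc n)
  show ?case
  proof (cases "C = {}")
    case True
    have "smith S C H idm idm (\<lambda>_. 0) (\<lambda>_ _. 0) (\<lambda>_ _. 0)"
      using True Suc by (simp add: smith_def inv_pair_idm mm_def)
    then show ?thesis by blast
  next
    case False
    have "S \<noteq> {}" using Suc by auto
    then have "S \<times> C \<noteq> {}" "finite (S \<times> C)" using False Suc.prems assms(3) by auto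
    from finite_total_dvd_min[OF tot this(2,1), of "\<lambda>x. H (fst x) (snd x)"]
    obtain x where x: "x \<in> S \<times> C" "\<forall>y\<in>S \<times> C. H (fst x) (snd x) dvd H (fst y) (snd y)" by blast
    define i c where "i = fst x" and "c = snd x"
    have ic: "i \<in> S" "c \<in> C" using x by (auto simp: i_def c_def)
    have div: "\<And>a b. a \<in> S \<Longrightarrow> b \<in> C \<Longrightarrow> H i c dvd H a b"
      using x(2) unfolding i_def c_def by force
    define e where "e = H i c"
    have "\<forall>a\<in>S. \<exists>x. H a c = e * x" using div ic(2) by (auto simp: e_def dvd_def)
    from bchoice[OF this] obtain m0 where m0: "\<forall>a\<in>S. H a c = e * m0 a" ..
    \<comment> \<open>If \<open>e\<close> is 0, the quotients are arbitrary. At the pivot row the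
      value 1 is prescribed, as it becomes a diagonal entry of \<open>T\<close>.\<close>
    define m where "m = m0(i := 1)"
    have mi: "m i = 1" by (simp add: m_def)
    have m: "H a c = e * m a" if "a \<in> S" for a
      using bspec[OF m0 that] by (cases "a = i") (simp_all add: m_def e_def)
    have "\<forall>b\<in>C. \<exists>x. H i b = e * x" using div ic(1) by (auto simp: e_def dvd_def)
    from bchoice[OF this] obtain w where w': "\<forall>b\<in>C. H i b = e * w b" ..
    then have w: "\<And>b. b \<in> C \<Longrightarrow> H i b = e * w b" by (rule bspec)
    define S' where "S' = S - {i}"
    have fS: "finite S'" "i \<notin> S'" and S: "S = insert i S'" using Suc.prems ic by (auto simp: S'_def)
    \<comment> \<open>Row \<open>i\<close> and column \<open>c\<close> of \<open>H'\<close> vanish.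
      The column stays in \<open>C\<close>, since only the rows are counted down.\<close>
    define H' where "H' = (\<lambda>a b. H a b - m a * H i b)"
    have "n = card S'" using Suc.hyps(2) fS S by simp
    from Suc.hyps(1)[OF this fS(1), of H'] obtain T1 T1' d1 Q1 Y1
      where sm: "smith S' C H' T1 T1' d1 Q1 Y1" by blast
    have i1: "mm S' T1 T1' a b = idm a b" "mm S' T1' T1 a b = idm a b" if "a \<in> S'" "b \<in> S'" for a b
      using sm that by (auto simp: smith_def inv_pair_def)
    define s where "s = (\<lambda>j. \<Sum>b\<in>C. w b * Y1 b j)"
    have s: "(\<Sum>b\<in>C. H i b * Y1 b j) = e * s j" for j
      by (simp add: s_def sum_distrib_left w mult.assoc)
    \<comment> \<open>\<open>T\<close> consists of the column \<open>m\<close> and the block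
      \<open>T1\<close>. As \<open>u\<close> solves \<open>T1 u = m\<close>, the inverse consists of
      row \<open>i\<close> of the identity, the column \<open>- u\<close> and the block
      \<open>T1'\<close>.\<close>
    define T where "T = (\<lambda>a j. if j = i then m a else if a = i then 0 else T1 a j)"
    define u where "u = (\<lambda>j. \<Sum>a\<in>S'. T1' j a * m a)"
    define T' where "T' = (\<lambda>j a. if j = i then idm i a else if a = i then - u j else T1' j a)"
    define d where "d = d1(i := e)"
    define Q where "Q = Q1(i := w)"
    \<comment> \<open>Column \<open>i\<close> of \<open>Y\<close> picks the pivot column of
      \<open>H\<close>. Every other column of \<open>Y1\<close> is corrected by the multiple
      \<open>s j\<close> of the unit vector at \<open>c\<close> that makes row \<open>i\<close> of
      \<open>H Y\<close> vanish.\<close>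
    define Y where "Y = (\<lambda>b j. if j = i then idm b c else Y1 b j - idm b c * s j)"
    have sumS: "(\<Sum>a\<in>S. f a) = f i + (\<Sum>a\<in>S'. f a)" for f :: "'i \<Rightarrow> 'r"
      using fS S by simp
    have ne: "a \<noteq> i" if "a \<in> S'" for a using that fS by auto
    have split: "mm S A B a b = A a i * B i b + mm S' A B a b" for A B :: "'i \<Rightarrow> 'i \<Rightarrow> 'r" and a b
      by (simp add: mm_def sumS)
    have split': "mm S A B a b = A a i * B i b + mm S' A B a b" for A and B :: "'i \<Rightarrow> 'c \<Rightarrow> 'r" and a b
      by (simp add: mm_def sumS)
    have T1u: "(\<Sum>j\<in>S'. T1 a j * u j) = m a" if "a \<in> S'" for a
    proof -
      have "(\<Sum>j\<in>S'. T1 a j * u j) = mm S' T1 (mm S' T1' (\<lambda>a _. m a)) a ()"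
        by (simp add: mm_def u_def)
      also have "\<dots> = m a" using sm that fS by (subst inv_pair_cancel) (auto simp: smith_def)
      finally show ?thesis .
    qed
    have cT: "mm S' T T' a b = mm S' T1 T1' a b" if "a \<noteq> i" "b \<noteq> i" for a b
      using that ne by (intro mm_cong) (simp_all add: T_def T'_def)
    have cT': "mm S' T' T a b = mm S' T1' T1 a b" if "a \<noteq> i" "b \<noteq> i" for a b
      using that ne by (intro mm_cong) (simp_all add: T_def T'_def)
    have z1: "mm S' T T' i b = 0" for b
      unfolding mm_def using ne by (intro sum.neutral) (simp add: T_def)
    have z2: "mm S' T' T i b = 0" for b
      unfolding mm_def using ne by (intro sum.neutral ballI) (force simp: T'_def idm_def)
    have c3: "mm S' T T' a i = - m a" if "a \<in> S'" for a
    proof -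
      have "mm S' T T' a i = (\<Sum>j\<in>S'. - (T1 a j * u j))"
        unfolding mm_def using that ne by (intro sum.cong) (simp_all add: T_def T'_def)
      then show ?thesis using T1u[OF that] by (simp add: sum_negf)
    qed
    have c4: "mm S' T' T a i = u a" if "a \<noteq> i" for a
      unfolding mm_def u_def using that ne by (intro sum.cong) (simp_all add: T_def T'_def)
    have Tv: "T a i = m a" "j \<noteq> i \<Longrightarrow> T i j = 0" "T' i a = idm i a" "j \<noteq> i \<Longrightarrow> T' j i = - u j" for a j
      by (simp_all add: T_def T'_def)
    have S'I: "a \<in> S'" if "a \<in> S" "a \<noteq> i" for a using that by (simp add: S'_def)
    have inv: "inv_pair S T T'"
      unfolding inv_pair_def
    proof (intro ballI conjI)
      fix a b assume ab: "a \<in> S" "b \<in> S"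
      show "mm S T T' a b = idm a b"
        unfolding split using S'I[OF ab(1)] S'I[OF ab(2)] mi
        by (cases "a = i"; cases "b = i") (simp_all add: cT z1 c3 i1 Tv idm_def)
      show "mm S T' T a b = idm a b"
        unfolding split using S'I[OF ab(1)] S'I[OF ab(2)] mi
        by (cases "a = i"; cases "b = i") (simp_all add: cT' z2 c4 i1 Tv idm_def)
    qed
    have "mm S T' H a b = d a * Q a b" if ab: "a \<in> S" "b \<in> C" for a b
    proof (cases "a = i")
      case True
      have "mm S' T' H i b = 0"
        unfolding mm_def using ne by (intro sum.neutral ballI) (force simp: T'_def idm_def)
      then show ?thesis using True ab w by (simp add: split' d_def Q_def T'_def idm_def)
    next
      case False
      then have a: "a \<in> S'" using ab S'I by blast
      have "mm S' T' H a b = mm S' T1' H a b"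
        using False ne by (intro mm_cong) (simp_all add: T'_def)
      moreover have "mm S' T1' H' a b = mm S' T1' H a b - u a * H i b"
        by (simp add: mm_def H'_def u_def algebra_simps sum_subtractf sum_distrib_left)
      moreover have "mm S' T1' H' a b = d1 a * Q1 a b" using sm a ab by (simp add: smith_def)
      ultimately show ?thesis using False by (simp add: split' T'_def d_def Q_def)
    qed
    moreover have "mm C H Y a j = T a j * d j" if aj: "a \<in> S" "j \<in> S" for a j
    proof (cases "j = i")
      case True
      have "mm C H Y a j = mm C H idm a c" using True by (simp add: Y_def mm_def)
      then show ?thesis using True m[OF aj(1)] ic assms(3)
        by (simp add: mm_idm_right T_def d_def)
    next
      case False
      then have j: "j \<in> S'" using aj S'I by blast
      have "mm C H Y a j = mm C H Y1 a j - mm C H idm a c * s j"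
        using False by (simp add: Y_def mm_def algebra_simps sum_subtractf sum_distrib_left)
      then have e1: "mm C H Y a j = mm C H Y1 a j - m a * e * s j"
        using ic assms(3) m[OF aj(1)] by (simp add: mm_idm_right)
      have "mm C H' Y1 a j = mm C H Y1 a j - m a * (\<Sum>b\<in>C. H i b * Y1 b j)"
        by (simp add: mm_def H'_def algebra_simps sum_subtractf sum_distrib_left)
      then have e2: "mm C H Y a j = mm C H' Y1 a j" using e1 by (simp add: s mult.assoc)
      show ?thesis
      proof (cases "a = i")
        case True
        then have "mm C H' Y1 a j = 0" by (simp add: mm_def H'_def mi)
        then show ?thesis using e2 True False by (simp add: T_def)
      next
        case a: False
        have "mm C H' Y1 a j = T1 a j * d1 j" using sm S'I[OF aj(1) a] j by (simp add: smith_def)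
        then show ?thesis using e2 False a by (simp add: T_def d_def)
      qed
    qed
    ultimately show ?thesis using inv unfolding smith_def by blast
  qed
qed

lemma smith_reindex:
  fixes H :: "'i \<Rightarrow> 'c \<Rightarrow> 'r::comm_ring_1"
  assumes "smith S C H T T' d Q Y" "bij_betw \<sigma> S S"
  shows "smith S C H (\<lambda>i j. T i (\<sigma> j)) (\<lambda>j i. T' (\<sigma> j) i) (\<lambda>j. d (\<sigma> j)) (\<lambda>j c. Q (\<sigma> j) c) (\<lambda>c j. Y c (\<sigma> j))"
proof -
  have s: "\<sigma> j \<in> S" if "j \<in> S" for j using assms(2) that by (auto simp: bij_betw_def)
  have inj: "\<sigma> j = \<sigma> j' \<longleftrightarrow> j = j'" if "j \<in> S" "j' \<in> S" for j j'
    using assms(2) that by (auto simp: bij_betw_def inj_on_def)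
  have "mm S (\<lambda>i j. T i (\<sigma> j)) (\<lambda>j i. T' (\<sigma> j) i) a b = mm S T T' a b" for a b
    unfolding mm_def using sum.reindex_bij_betw[OF assms(2), of "\<lambda>j. T a j * T' j b"] by simp
  moreover have "mm S (\<lambda>j i. T' (\<sigma> j) i) (\<lambda>i j. T i (\<sigma> j)) a b = mm S T' T (\<sigma> a) (\<sigma> b)" for a b
    by (simp add: mm_def)
  moreover have "mm S (\<lambda>j i. T' (\<sigma> j) i) H a c = mm S T' H (\<sigma> a) c" for a c
    by (simp add: mm_def)
  moreover have "mm C H (\<lambda>c j. Y c (\<sigma> j)) a b = mm C H Y a (\<sigma> b)" for a b
    by (simp add: mm_def)
  ultimately show ?thesis using assms(1) unfolding smith_def inv_pair_def
    by (simp only: s idm_def inj simp_thms ball_simps) (simp add: s inj idm_def)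
qed

text \<open>Units move from the diagonal into \<open>T\<close>; over K[[t]] this leaves powers of
  \<open>t\<close> on the diagonal.\<close>

lemma smith_scale:
  fixes H :: "'i \<Rightarrow> 'c \<Rightarrow> 'r::comm_ring_1"
  assumes "smith S C H T T' d Q Y" "\<And>j. j \<in> S \<Longrightarrow> d j = u j * d' j"
    "\<And>j. j \<in> S \<Longrightarrow> u j * v j = 1"
  shows "smith S C H (\<lambda>i j. T i j * u j) (\<lambda>j i. v j * T' j i) d' Q Y"
proof -
  have uv: "u j * (v j * x) = x" "v j * (u j * x) = x" if "j \<in> S" for j x
    using assms(3)[OF that] by (metis mult.assoc mult.commute mult_1)+
  have "mm S (\<lambda>i j. T i j * u j) (\<lambda>j i. v j * T' j i) a b = mm S T T' a b" for a b
    unfolding mm_def by (intro sum.cong) (auto simp: mult.assoc uv)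
  moreover have "mm S (\<lambda>j i. v j * T' j i) (\<lambda>i j. T i j * u j) a b = v a * u b * mm S T' T a b" for a b
    by (simp add: mm_def sum_distrib_left mult_ac)
  moreover have "v a * u b * idm a b = idm a b" if "a \<in> S" for a b
    using assms(3)[OF that] by (auto simp: idm_def mult.commute)
  moreover have "mm S (\<lambda>j i. v j * T' j i) H a c = v a * mm S T' H a c" for a c
    by (simp add: mm_def sum_distrib_left mult_ac)
  moreover have "v a * (d a * Q a c) = d' a * Q a c" if "a \<in> S" for a c
    using assms(2) uv that by (simp add: mult.assoc)
  moreover have "T a b * d b = T a b * u b * d' b" if "b \<in> S" for a b
    using assms(2)[OF that] by (simp add: mult.assoc)
  ultimately show ?thesis using assms(1) unfolding smith_def inv_pair_def by simp
qed

lemma exists_antitone_reindexing: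
  fixes b :: "nat \<Rightarrow> 'b::linorder"
  shows "\<exists>\<sigma>. bij_betw \<sigma> {..<q} {..<q} \<and> (\<forall>i j. i \<le> j \<longrightarrow> j < q \<longrightarrow> b (\<sigma> j) \<le> b (\<sigma> i))"
proof -
  define xs where "xs = rev (sort_key b [0..<q])"
  have xs: "distinct xs" "set xs = {..<q}" "length xs = q" by (auto simp: xs_def)
  have "sorted (map b (rev xs))" by (simp add: xs_def)
  then have "sorted_wrt (\<ge>) (map b xs)" using sorted_wrt_rev[of "(\<le>)" "map b xs"] by (simp add: rev_map)
  then have *: "b (xs ! j) \<le> b (xs ! i)" if "i \<le> j" "j < q" for i j
    using that xs(3) by (cases "i = j") (simp_all add: sorted_wrt_iff_nth_less)
  have "bij_betw (nth xs) {..<q} {..<q}" by (rule bij_betw_nth) (simp_all add: xs)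
  then show ?thesis using * by blast
qed

section \<open>Determinants and invertible square matrices\<close>

definition mof :: "nat \<Rightarrow> (nat \<Rightarrow> nat \<Rightarrow> 'r) \<Rightarrow> 'r mat" where
  "mof q M = mat q q (\<lambda>(i, j). M i j)"

lemma mof_carrier [simp]: "mof q M \<in> carrier_mat q q"
  by (simp add: mof_def)

lemma mof_mult:
  fixes A :: "nat \<Rightarrow> nat \<Rightarrow> 'r::comm_ring_1"
  shows "mof q A * mof q B = mof q (mm {..<q} A B)"
  by (intro eq_matI) (auto simp: mof_def mm_def scalar_prod_def lessThan_atLeast0 intro!: sum.cong)

lemma mof_eq_one: fixes M :: "nat \<Rightarrow> nat \<Rightarrow> 'r::comm_ring_1"
  shows "mof q M = 1\<^sub>m q \<longleftrightarrow> (\<forall>i<q. \<forall>j<q. M i j = idm i j)"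
  by (auto simp: mof_def mat_eq_iff idm_def)

lemma inv_pair_det:
  fixes M :: "nat \<Rightarrow> nat \<Rightarrow> 'r::comm_ring_1"
  assumes "inv_pair {..<q} M N"
  shows "det (mof q M) * det (mof q N) = 1"
proof -
  have "mof q M * mof q N = 1\<^sub>m q" using assms by (simp add: mof_mult mof_eq_one inv_pair_def)
  then show ?thesis using det_mult[of "mof q M" q "mof q N"] by simp
qed

text \<open>The inverse is given by the adjugate: this explicit form later makes the chart
  coordinates of a kernel polynomial in the entries of a matrix and the inverse of one
  minor.\<close>

lemma det_unit_inverse:
  fixes M :: "nat \<Rightarrow> nat \<Rightarrow> 'r::comm_ring_1"
  assumes "det (mof q M) * u = 1"
  shows "inv_pair {..<q} M (\<lambda>i j. u * adj_mat (mof q M) $$ (i, j))"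
proof -
  let ?A = "adj_mat (mof q M)"
  have A: "?A \<in> carrier_mat q q" using adj_mat(1)[OF mof_carrier] .
  have A': "?A = mof q (\<lambda>i j. ?A $$ (i, j))" using A by (auto simp: mof_def)
  have 1: "mof q (mm {..<q} M (\<lambda>i j. ?A $$ (i, j))) = det (mof q M) \<cdot>\<^sub>m 1\<^sub>m q"
    using adj_mat(2)[OF mof_carrier, of q M] by (subst (asm) A') (simp add: mof_mult)
  have 2: "mof q (mm {..<q} (\<lambda>i j. ?A $$ (i, j)) M) = det (mof q M) \<cdot>\<^sub>m 1\<^sub>m q"
    using adj_mat(3)[OF mof_carrier, of q M] by (subst (asm) A') (simp add: mof_mult)
  have "mm {..<q} M (\<lambda>i j. ?A $$ (i, j)) i j = det (mof q M) * idm i j"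
       "mm {..<q} (\<lambda>i j. ?A $$ (i, j)) M i j = det (mof q M) * idm i j"
    if "i < q" "j < q" for i j
    using arg_cong[OF 1, of "\<lambda>A. A $$ (i, j)"] arg_cong[OF 2, of "\<lambda>A. A $$ (i, j)"] that
    by (auto simp: mof_def idm_def)
  moreover have "mm {..<q} M (\<lambda>i j. u * ?A $$ (i, j)) i j = u * mm {..<q} M (\<lambda>i j. ?A $$ (i, j)) i j"
    "mm {..<q} (\<lambda>i j. u * ?A $$ (i, j)) M i j = u * mm {..<q} (\<lambda>i j. ?A $$ (i, j)) M i j" for i j
    by (simp_all add: mm_def sum_distrib_left mult_ac)
  ultimately show ?thesis using assms by (auto simp: inv_pair_def idm_def mult.commute)
qed

lemma left_inverse_imp_inv_pair:
  fixes M :: "nat \<Rightarrow> nat \<Rightarrow> 'r::comm_ring_1"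
  assumes "\<And>i j. i < q \<Longrightarrow> j < q \<Longrightarrow> mm {..<q} N M i j = idm i j"
  shows "inv_pair {..<q} M N"
proof -
  have "mof q N * mof q M = 1\<^sub>m q" using assms by (simp add: mof_mult mof_eq_one)
  then have "det (mof q M) * det (mof q N) = 1"
    using det_mult[of "mof q N" q "mof q M"] by (simp add: mult.commute)
  from det_unit_inverse[OF this] obtain N' where N': "inv_pair {..<q} M N'" by blast
  have "N i j = N' i j" if "i < q" "j < q" for i j
  proof -
    have "N i j = mm {..<q} N idm i j" using that by (simp add: mm_idm_right)
    also have "\<dots> = mm {..<q} N (mm {..<q} M N') i j"
      using N' that by (intro mm_cong) (auto simp: inv_pair_def)
    also have "\<dots> = mm {..<q} (mm {..<q} N M) N' i j" by (simp add: mm_assoc)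
    also have "\<dots> = mm {..<q} idm N' i j" using assms that by (intro mm_cong) auto
    finally show ?thesis using that by (simp add: mm_idm_left)
  qed
  then have "mm {..<q} M N i j = mm {..<q} M N' i j" if "j < q" for i j
    using that by (intro mm_cong) auto
  then show ?thesis using assms N' by (auto simp: inv_pair_def)
qed

text \<open>Padding both factors with zeros to square matrices of size \<open>card R\<close> gives
  an inverse pair with a zero column in one member, so that 0 would be a unit. Applied to constant
  terms, this is the dimension count behind the uniqueness and the interlacing of invariant
  factors.\<close>

lemma no_identity_factorization:
  fixes B :: "'a \<Rightarrow> 'b \<Rightarrow> 'r::comm_ring_1"
  assumes "finite R" "finite T" "card T < card R"
    and id: "\<And>a a'. a \<in> R \<Longrightarrow> a' \<in> R \<Longrightarrow> mm T B C a a' = idm a a'"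
  shows False
proof -
  let ?r = "card R" and ?s = "card T"
  obtain f where f: "bij_betw f {..<?r} R" using assms(1) ex_bij_betw_nat_finite lessThan_atLeast0 by metis
  obtain g where g: "bij_betw g {..<?s} T" using assms(2) ex_bij_betw_nat_finite lessThan_atLeast0 by metis
  define B' where "B' = (\<lambda>i j. if j < ?s then B (f i) (g j) else 0)"
  define C' where "C' = (\<lambda>j i. if j < ?s then C (g j) (f i) else 0)"
  have "mm {..<?r} B' C' i j = idm i j" if "i < ?r" "j < ?r" for i j
  proof -
    have "mm {..<?r} B' C' i j = (\<Sum>k<?s. B (f i) (g k) * C (g k) (f j))"
      unfolding mm_def using assms(3)
      by (intro sum.mono_neutral_cong_right) (auto simp: B'_def C'_def)
    also have "\<dots> = mm T B C (f i) (f j)" unfolding mm_def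
      using sum.reindex_bij_betw[OF g, of "\<lambda>k. B (f i) k * C k (f j)"] by simp
    also have "\<dots> = idm (f i) (f j)" using f that by (intro id) (auto simp: bij_betw_def)
    also have "\<dots> = idm i j" using f that by (auto simp: idm_def bij_betw_def inj_on_def)
    finally show ?thesis .
  qed
  then have "inv_pair {..<?r} C' B'" by (intro left_inverse_imp_inv_pair) auto
  then have "det (mof ?r B') * det (mof ?r C') = 1"
    using inv_pair_det[OF inv_pair_sym] by blast
  moreover have "det (mof ?r B') = 0"
  proof -
    have "(\<Prod>j = 0..<?r. mof ?r B' $$ (p j, j)) = 0" if "p permutes {0..<?r}" for p
    proof (rule prod_zero)
      show "\<exists>j\<in>{0..<?r}. mof ?r B' $$ (p j, j) = 0"
        using assms(3) permutes_in_image[OF that, of ?s] by (auto simp: mof_def B'_def intro!: bexI[of _ ?s])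
    qed simp
    then show ?thesis by (simp add: det_col[OF mof_carrier] lessThan_atLeast0)
  qed
  ultimately show False by simp
qed

section \<open>Powers of t, with exponent infinity for 0, and Smith forms over K[[t]]\<close>

lemma t_power_infty [simp]: "t_power \<infinity> = 0"
  by (simp add: t_power_def)

lemma t_power_enat: "t_power (enat m) = fps_X ^ m"
  by (simp add: t_power_def)

lemma t_power_0 [simp]: "t_power 0 = 1"
  by (simp add: t_power_def zero_enat_def)

lemma t_power_dvd_iff:
  "t_power e dvd (f :: 'k::field fps) \<longleftrightarrow> (\<forall>i. enat i < e \<longrightarrow> fps_nth f i = 0)"
proof (cases e)
  case (enat m)
  show ?thesis
  proof (cases "f = 0")
    case False
    have "t_power e dvd f \<longleftrightarrow> m \<le> subdegree f"
      using False by (simp add: enat t_power_enat fps_dvd_iff)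
    also have "\<dots> \<longleftrightarrow> (\<forall>i<m. fps_nth f i = 0)"
      using False by (metis less_le_trans nth_less_subdegree_zero subdegree_geI)
    finally show ?thesis by (simp add: enat)
  qed simp
qed (auto simp: fps_eq_iff)

lemma fps_nth_t_power: "fps_nth (t_power e :: 'k::field fps) i = (if enat i = e then 1 else 0)"
  by (cases e) (auto simp: t_power_def)

lemma t_power_dvd_t_power_iff: "(t_power a :: 'k::field fps) dvd t_power b \<longleftrightarrow> a \<le> b"
proof
  assume "(t_power a :: 'k fps) dvd t_power b"
  then show "a \<le> b"
    by (cases b) (auto simp: t_power_dvd_iff fps_nth_t_power not_less[symmetric])
qed (auto simp: t_power_dvd_iff fps_nth_t_power)

lemma t_power_add: "t_power (a + b) = t_power a * t_power b"
  by (cases a; cases b) (auto simp: t_power_def power_add)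

lemma fps_total_dvd: "(x :: 'k::field fps) dvd y \<or> y dvd x"
  by (cases "x = 0"; cases "y = 0") (auto simp: fps_dvd_iff)

lemma fps_unit_t_power:
  "\<exists>u v b. (f :: 'k::field fps) = u * t_power b \<and> u * v = 1"
proof (cases "f = 0")
  case False
  let ?u = "fps_shift (subdegree f) f"
  have "f = ?u * t_power (enat (subdegree f))"
    using subdegree_decompose[of f] by (simp add: t_power_enat)
  moreover have "?u dvd 1" using False by simp
  then obtain v where "1 = ?u * v" by (rule dvdE)
  ultimately show ?thesis by metis
qed (intro exI[of _ 1] exI[of _ \<infinity>], simp)

lemma smith_fps:
  fixes H :: "nat \<Rightarrow> 'c \<Rightarrow> 'k::field fps"
  assumes "finite C"
  shows "\<exists>T T' b Q Y. smith {..<q} C H T T' (\<lambda>j. t_power (b j)) Q Y \<and>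
    (\<forall>i j. i \<le> j \<longrightarrow> j < q \<longrightarrow> b j \<le> b i)"
proof -
  obtain T T' d Q Y where s: "smith {..<q} C H T T' d Q Y"
    using smith_exists[OF fps_total_dvd finite_lessThan assms] by blast
  have "\<forall>j. \<exists>u v b. d j = u * t_power b \<and> u * v = 1" using fps_unit_t_power by blast
  then obtain u v b where ub: "\<And>j. d j = u j * t_power (b j)" "\<And>j. u j * v j = 1" by metis
  obtain \<sigma> where \<sigma>: "bij_betw \<sigma> {..<q} {..<q}" "\<forall>i j. i \<le> j \<longrightarrow> j < q \<longrightarrow> b (\<sigma> j) \<le> b (\<sigma> i)"
    using exists_antitone_reindexing by blast
  from smith_reindex[OF smith_scale[OF s ub] \<sigma>(1)] \<sigma>(2)
  show ?thesis by (intro exI conjI) auto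
qed

section \<open>Presentations of quotients of K[[t]]^n and their exponents\<close>

definition app :: "nat \<Rightarrow> (nat \<Rightarrow> nat \<Rightarrow> 'r::comm_ring_1) \<Rightarrow> 'r vec \<Rightarrow> nat \<Rightarrow> 'r" where
  "app n G v j = (\<Sum>c<n. G j c * v $ c)"

lemma app_add: "v \<in> carrier_vec n \<Longrightarrow> w \<in> carrier_vec n \<Longrightarrow> app n G (v + w) j = app n G v j + app n G w j"
  by (auto simp: app_def algebra_simps sum.distrib intro!: sum.cong)

lemma app_diff: "v \<in> carrier_vec n \<Longrightarrow> w \<in> carrier_vec n \<Longrightarrow> app n G (v - w) j = app n G v j - app n G w j"
  by (auto simp: app_def algebra_simps sum_subtractf intro!: sum.cong)

lemma app_smult: "v \<in> carrier_vec n \<Longrightarrow> app n G (r \<cdot>\<^sub>v v) j = r * app n G v j"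
  by (auto simp: app_def algebra_simps sum_distrib_left intro!: sum.cong)

lemma app_zero: "app n G (0\<^sub>v n) j = 0"
  by (simp add: app_def)

lemma app_mm: "app n (mm S A G) v j = (\<Sum>k\<in>S. A j k * app n G v k)"
  unfolding app_def mm_def by (simp add: sum_distrib_left sum_distrib_right mult.assoc) (rule sum.swap)

text \<open>\<open>N\<close> is the kernel of a surjection of \<open>K[[t]]^n\<close> onto the direct sum of the
  \<open>K[[t]]/(t^(b j))\<close>, \<open>j < q\<close>, that is given by the rows of \<open>G\<close>.\<close>
definition presents ::
  "nat \<Rightarrow> nat \<Rightarrow> 'k::field fps vec set \<Rightarrow> (nat \<Rightarrow> nat \<Rightarrow> 'k fps) \<Rightarrow> (nat \<Rightarrow> enat) \<Rightarrow> bool" where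
  "presents n q N G b \<longleftrightarrow> N = {v \<in> carrier_vec n. \<forall>j<q. t_power (b j) dvd app n G v j} \<and>
     (\<forall>y. \<exists>v\<in>carrier_vec n. \<forall>j<q. t_power (b j) dvd (app n G v j - y j))"

lemma presents_lift:
  assumes "presents n q N G b"
  obtains v where "v \<in> carrier_vec n" "\<And>j. j < q \<Longrightarrow> t_power (b j) dvd (app n G v j - y j)"
proof -
  from assms have "\<forall>y. \<exists>v\<in>carrier_vec n. \<forall>j<q. t_power (b j) dvd (app n G v j - y j)"
    unfolding presents_def by (rule conjunct2)
  from spec[OF this, of y] show ?thesis using that by blast
qed

lemma presents_mem:
  "presents n q N G b \<Longrightarrow> v \<in> N \<longleftrightarrow> v \<in> carrier_vec n \<and> (\<forall>j<q. t_power (b j) dvd app n G v j)"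
  by (simp add: presents_def)

text \<open>The surjection of quotients induced by \<open>N \<subseteq> N'\<close> has the matrix
  \<open>Z\<close>, and \<open>Z a c\<close> is divisible by \<open>t\<close> wherever
  \<open>b c < b' a\<close>. If \<open>b j < b' j\<close>, this concerns all
  \<open>a \<le> j \<le> c\<close>, so modulo \<open>t\<close> the first \<open>j + 1\<close>
  summands of the target would be generated by the first \<open>j\<close> generators.\<close>

lemma presents_mono:
  assumes P: "presents n q N G b" and P': "presents n q N' G' b'" and "N \<subseteq> N'"
    and anti: "\<And>i j. i \<le> j \<Longrightarrow> j < q \<Longrightarrow> b j \<le> b i" "\<And>i j. i \<le> j \<Longrightarrow> j < q \<Longrightarrow> b' j \<le> b' i"
    and "j < q"
  shows "b' j \<le> (b j :: enat)"
proof (rule ccontr)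
  assume "\<not> b' j \<le> b j"
  then have lt: "b j < b' j" by simp
  have "\<exists>v. v \<in> carrier_vec n \<and> (\<forall>j<q. t_power (b j) dvd (app n G v j - idm j c))" for c
    by (rule presents_lift[OF P, where y = "\<lambda>j. idm j c"]) blast
  from choice[OF allI[OF this]] obtain V where V':
    "\<forall>c. V c \<in> carrier_vec n \<and> (\<forall>j<q. t_power (b j) dvd (app n G (V c) j - idm j c))" ..
  then have V: "V c \<in> carrier_vec n" "j < q \<Longrightarrow> t_power (b j) dvd (app n G (V c) j - idm j c)" for c j
    by simp_all
  define Z where "Z = (\<lambda>a c. app n G' (V c) a)"
  have 1: "t_power (b' a) dvd t_power (b c) * Z a c" if "a < q" "c < q" for a c
  proof -
    have "t_power (b i) dvd app n G (t_power (b c) \<cdot>\<^sub>v V c) i" if "i < q" for i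
    proof -
      have "t_power (b i) dvd t_power (b c) * (app n G (V c) i - idm i c) + t_power (b c) * idm i c"
        using V(2)[OF that, of c] by (intro dvd_add) (auto simp: idm_def)
      then show ?thesis by (simp add: app_smult[OF V(1)] right_diff_distrib)
    qed
    then have "t_power (b c) \<cdot>\<^sub>v V c \<in> N" using V(1) by (simp add: presents_mem[OF P])
    then have "t_power (b c) \<cdot>\<^sub>v V c \<in> N'" using assms(3) by blast
    then show ?thesis using that by (simp add: presents_mem[OF P'] app_smult[OF V(1)] Z_def)
  qed
  have Z0: "fps_nth (Z a c) 0 = 0" if "a \<le> j" "j \<le> c" "c < q" for a c
  proof -
    have "b c < b' a" using anti(1)[of j c] anti(2)[of a j] that lt \<open>j < q\<close> by (meson le_less_trans less_le_trans)
    then obtain m where m: "b c = enat m" by (cases "b c") auto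
    from 1[of a c] that have "fps_nth (t_power (b c) * Z a c) m = 0"
      using \<open>b c < b' a\<close> \<open>j < q\<close> unfolding t_power_dvd_iff m by simp
    then show ?thesis by (simp add: m t_power_enat fps_X_power_mult_nth)
  qed
  have 2: "\<exists>y. \<forall>a<q. t_power (b' a) dvd (\<Sum>c<q. Z a c * y c) - idm a a'" for a'
  proof -
    obtain v where v: "v \<in> carrier_vec n" "\<And>a. a < q \<Longrightarrow> t_power (b' a) dvd (app n G' v a - idm a a')"
      using presents_lift[OF P', where y = "\<lambda>a. idm a a'"] by blast
    define y where "y = app n G v"
    \<comment> \<open>Subtracting the lifts \<open>V c\<close>, weighted by the coordinates of
      \<open>v\<close>, puts \<open>w\<close> into \<open>N\<close> and hence into
      \<open>N'\<close>. Modulo the exponents \<open>b'\<close> the image of \<open>v\<close> is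
      therefore \<open>Z y\<close>.\<close>
    define w where "w = vec n (\<lambda>i. v $ i - (\<Sum>c<q. y c * V c $ i))"
    have w: "app n F w i = app n F v i - (\<Sum>c<q. app n F (V c) i * y c)" for F i
    proof -
      have "app n F w i = (\<Sum>k<n. F i k * v $ k - (\<Sum>c<q. F i k * V c $ k * y c))"
        unfolding app_def w_def by (intro sum.cong) (auto simp: algebra_simps sum_distrib_left)
      also have "\<dots> = app n F v i - (\<Sum>k<n. \<Sum>c<q. F i k * V c $ k * y c)"
        by (simp add: app_def sum_subtractf)
      also have "(\<Sum>k<n. \<Sum>c<q. F i k * V c $ k * y c) = (\<Sum>c<q. \<Sum>k<n. F i k * V c $ k * y c)"
        by (rule sum.swap)
      finally show ?thesis by (simp add: app_def sum_distrib_right)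
    qed
    have "t_power (b i) dvd app n G w i" if "i < q" for i
    proof -
      have "(\<Sum>c<q. idm i c * y c) = y i" using that mm_idm_left[of "{..<q}" i "\<lambda>c _. y c"] by (simp add: mm_def)
      then have "app n G w i = - (\<Sum>c<q. (app n G (V c) i - idm i c) * y c)"
        by (simp add: w left_diff_distrib sum_subtractf y_def)
      also have "t_power (b i) dvd \<dots>"
        using V(2)[OF that] by (simp add: dvd_sum)
      finally show ?thesis .
    qed
    then have "w \<in> N" using P by (simp add: presents_mem w_def[symmetric]) (simp add: w_def)
    then have "w \<in> N'" using assms(3) by blast
    then have 3: "t_power (b' a) dvd app n G' v a - (\<Sum>c<q. Z a c * y c)" if "a < q" for a
      using that by (simp add: presents_mem[OF P'] w Z_def)
    have "t_power (b' a) dvd (\<Sum>c<q. Z a c * y c) - idm a a'" if "a < q" for a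
      using dvd_diff[OF v(2)[OF that] 3[OF that]] by simp
    then show ?thesis by blast
  qed
  then have "\<forall>a'. \<exists>y. \<forall>a<q. t_power (b' a) dvd (\<Sum>c<q. Z a c * y c) - idm a a'" by blast
  from choice[OF this] obtain y where
    "\<forall>a'. \<forall>a<q. t_power (b' a) dvd (\<Sum>c<q. Z a c * y a' c) - idm a a'" ..
  then have y: "t_power (b' a) dvd (\<Sum>c<q. Z a c * y a' c) - idm a a'" if "a < q" for a a'
    using that by simp
  \<comment> \<open>A congruence modulo \<open>t_power (b' a)\<close> determines the constant term,
    because \<open>b' a \<ge> b' j > b j\<close> for \<open>a \<le> j\<close>.\<close>
  have "mm {..<j} (\<lambda>a c. fps_nth (Z a c) 0) (\<lambda>c a'. fps_nth (y a' c) 0) a a' = idm a a'"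
    if "a \<le> j" for a a'
  proof -
    have "0 < b' a" using anti(2)[of a j] that lt \<open>j < q\<close> by (metis le_less_trans less_le_trans zero_le)
    then have "fps_nth ((\<Sum>c<q. Z a c * y a' c) - idm a a') 0 = 0"
      using y[of a a'] that \<open>j < q\<close> unfolding t_power_dvd_iff by (simp add: zero_enat_def)
    then have "(\<Sum>c<q. fps_nth (Z a c) 0 * fps_nth (y a' c) 0) = idm a a'"
      by (simp add: fps_sum_nth idm_def split: if_splits)
    moreover have "(\<Sum>c<q. fps_nth (Z a c) 0 * fps_nth (y a' c) 0) = (\<Sum>c<j. fps_nth (Z a c) 0 * fps_nth (y a' c) 0)"
      using \<open>j < q\<close> Z0[OF that] by (intro sum.mono_neutral_right) auto
    ultimately show ?thesis by (simp add: mm_def)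
  qed
  then show False
    by (intro no_identity_factorization[of "{..j}" "{..<j}"]) auto
qed

section \<open>Quotients of R^n by submodules\<close>

definition subm :: "nat \<Rightarrow> 'a::comm_ring_1 vec set \<Rightarrow> bool" where
  "subm n N \<longleftrightarrow> N \<subseteq> carrier_vec n \<and> 0\<^sub>v n \<in> N \<and> (\<forall>v\<in>N. \<forall>w\<in>N. v + w \<in> N) \<and> (\<forall>r. \<forall>v\<in>N. r \<cdot>\<^sub>v v \<in> N)"

lemma submodule_iff_subm:
  "submodule class_ring N (module_vec TYPE('a::comm_ring_1) n) \<longleftrightarrow> subm n N"
proof -
  interpret vec_module "TYPE('a)" n .
  have "Module.module class_ring (module_vec TYPE('a) n)" by (rule module_axioms)
  then show ?thesis
    by (auto simp: submodule_def subm_def module_vec_simps class_ring_simps)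
qed

lemma subm_diff:
  assumes "subm n N" "v \<in> N" "w \<in> N"
  shows "v - w \<in> N"
proof -
  have "v - w = v + (- 1) \<cdot>\<^sub>v w" using assms by (intro eq_vecI) (auto simp: subm_def)
  then show ?thesis using assms unfolding subm_def by metis
qed

lemma presents_subm: "presents n q N G b \<Longrightarrow> subm n N"
  unfolding presents_def subm_def by (auto simp: app_zero app_add app_smult)

definition vcoset :: "'a::comm_ring_1 vec set \<Rightarrow> 'a vec \<Rightarrow> 'a vec set" where
  "vcoset N v = (\<lambda>h. h + v) ` N"

lemma carrier_quot_module_vec:
  "carrier (quot_module (module_vec TYPE('a::comm_ring_1) n) N) = vcoset N ` carrier_vec n"
  by (auto simp: quot_module_def A_RCOSETS_def' a_r_coset_def' vcoset_def module_vec_simps)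

lemma mem_vcoset_iff:
  assumes "subm n N" "v \<in> carrier_vec n"
  shows "x \<in> vcoset N v \<longleftrightarrow> x \<in> carrier_vec n \<and> x - v \<in> N"
proof
  assume "x \<in> vcoset N v"
  then obtain h where h: "h \<in> N" "x = h + v" by (auto simp: vcoset_def)
  then have "h \<in> carrier_vec n" using assms by (auto simp: subm_def)
  then have "x - v = h" using h assms by auto
  then show "x \<in> carrier_vec n \<and> x - v \<in> N" using h assms \<open>h \<in> carrier_vec n\<close> by auto
next
  assume *: "x \<in> carrier_vec n \<and> x - v \<in> N"
  then have "x = (x - v) + v" using assms by auto
  then show "x \<in> vcoset N v" using * by (auto simp: vcoset_def)
qed

lemma vcoset_eq_iff:
  assumes "subm n N" "v \<in> carrier_vec n" "w \<in> carrier_vec n"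
  shows "vcoset N v = vcoset N w \<longleftrightarrow> v - w \<in> N"
proof
  assume "vcoset N v = vcoset N w"
  moreover have "v \<in> vcoset N v" using assms by (auto simp: mem_vcoset_iff subm_def)
  ultimately show "v - w \<in> N" using assms by (auto simp: mem_vcoset_iff)
next
  assume *: "v - w \<in> N"
  have "x \<in> vcoset N v \<longleftrightarrow> x \<in> vcoset N w" for x
  proof (cases "x \<in> carrier_vec n")
    case True
    then have "x - w = (x - v) + (v - w)" "x - v = (x - w) - (v - w)" using assms by auto
    moreover have "a + (v - w) \<in> N" "a - (v - w) \<in> N" if "a \<in> N" for a
      using * that subm_diff[OF assms(1)] assms(1) by (auto simp: subm_def)
    ultimately have "x - v \<in> N \<longleftrightarrow> x - w \<in> N" by metis
    then show ?thesis using True by (simp add: mem_vcoset_iff[OF assms(1)] assms)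
  qed (simp add: mem_vcoset_iff[OF assms(1)] assms)
  then show "vcoset N v = vcoset N w" by blast
qed

lemma add_quot_module_vec:
  assumes "subm n N" "v \<in> carrier_vec n" "w \<in> carrier_vec n"
  shows "vcoset N v \<oplus>\<^bsub>quot_module (module_vec TYPE('a::comm_ring_1) n) N\<^esub> vcoset N w = vcoset N (v + w)"
proof -
  have "(\<exists>a\<in>vcoset N v. \<exists>b\<in>vcoset N w. x = a + b) \<longleftrightarrow> x \<in> vcoset N (v + w)" for x
  proof
    assume "\<exists>a\<in>vcoset N v. \<exists>b\<in>vcoset N w. x = a + b"
    then obtain a b where ab: "a \<in> vcoset N v" "b \<in> vcoset N w" "x = a + b" by blast
    then have "x - (v + w) = (a - v) + (b - w)"
      using assms by (intro eq_vecI) (auto simp: mem_vcoset_iff)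
    then show "x \<in> vcoset N (v + w)"
      using ab assms by (auto simp: mem_vcoset_iff subm_def)
  next
    assume x: "x \<in> vcoset N (v + w)"
    then have "x = (x - w) + w" "x - w - v = x - (v + w)" "w \<in> vcoset N w"
      using assms by (auto simp: mem_vcoset_iff subm_def)
    then show "\<exists>a\<in>vcoset N v. \<exists>b\<in>vcoset N w. x = a + b"
      using x assms by (intro bexI[of _ "x - w"] bexI[of _ w]) (auto simp: mem_vcoset_iff)
  qed
  then show ?thesis
    by (auto simp: quot_module_def set_add_def' module_vec_simps)
qed

lemma smult_quot_module_vec:
  assumes "subm n N" "v \<in> carrier_vec n"
  shows "r \<odot>\<^bsub>quot_module (module_vec TYPE('a::comm_ring_1) n) N\<^esub> vcoset N v = vcoset N (r \<cdot>\<^sub>v v)"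
proof -
  have "(\<exists>a\<in>N. \<exists>b\<in>vcoset N v. x = a + r \<cdot>\<^sub>v b) \<longleftrightarrow> x \<in> vcoset N (r \<cdot>\<^sub>v v)" for x
  proof
    assume "\<exists>a\<in>N. \<exists>b\<in>vcoset N v. x = a + r \<cdot>\<^sub>v b"
    then obtain a b where ab: "a \<in> N" "b \<in> vcoset N v" "x = a + r \<cdot>\<^sub>v b" by blast
    then have c: "a \<in> carrier_vec n" "b \<in> carrier_vec n" using assms by (auto simp: mem_vcoset_iff subm_def)
    then have "x - r \<cdot>\<^sub>v v = a + r \<cdot>\<^sub>v (b - v)"
      using assms ab by (intro eq_vecI) (auto simp: algebra_simps)
    then show "x \<in> vcoset N (r \<cdot>\<^sub>v v)"
      using ab c assms by (auto simp: mem_vcoset_iff subm_def)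
  next
    assume x: "x \<in> vcoset N (r \<cdot>\<^sub>v v)"
    then have "x = (x - r \<cdot>\<^sub>v v) + r \<cdot>\<^sub>v v" "v \<in> vcoset N v" "x - r \<cdot>\<^sub>v v \<in> N"
      using assms by (auto simp: mem_vcoset_iff subm_def)
    then show "\<exists>a\<in>N. \<exists>b\<in>vcoset N v. x = a + r \<cdot>\<^sub>v b" by blast
  qed
  then show ?thesis
    by (auto simp: quot_module_def set_add_def' module_vec_simps)
qed

text \<open>The universal property of the quotient: an isomorphism corresponds to a surjective
  linear map whose fibres are the cosets of \<open>N\<close>. It frees all later arguments from
  cosets in R^n.\<close>

lemma module_iso_quot_iff:
  assumes N: "subm n N"
  shows "module_iso class_ring (quot_module (module_vec TYPE('a::comm_ring_1) n) N) D \<longleftrightarrow>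
    (\<exists>\<pi>. \<pi> ` carrier_vec n = carrier D \<and>
      (\<forall>v\<in>carrier_vec n. \<forall>w\<in>carrier_vec n. \<pi> (v + w) = \<pi> v \<oplus>\<^bsub>D\<^esub> \<pi> w) \<and>
      (\<forall>r. \<forall>v\<in>carrier_vec n. \<pi> (r \<cdot>\<^sub>v v) = r \<odot>\<^bsub>D\<^esub> \<pi> v) \<and>
      (\<forall>v\<in>carrier_vec n. \<forall>w\<in>carrier_vec n. \<pi> v = \<pi> w \<longleftrightarrow> v - w \<in> N))"
    (is "module_iso _ ?M D \<longleftrightarrow> (\<exists>\<pi>. ?P \<pi>)")
proof
  assume "module_iso class_ring ?M D"
  then obtain h where h: "h \<in> module_hom class_ring ?M D" "bij_betw h (carrier ?M) (carrier D)"
    by (auto simp: module_iso_def)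
  have c: "vcoset N v \<in> carrier ?M" if "v \<in> carrier_vec n" for v
    using that by (simp add: carrier_quot_module_vec)
  have "?P (\<lambda>v. h (vcoset N v))"
  proof (intro conjI ballI allI)
    show "(\<lambda>v. h (vcoset N v)) ` carrier_vec n = carrier D"
      using h(2) by (simp add: bij_betw_def carrier_quot_module_vec image_image)
    fix v w :: "'a vec" assume v: "v \<in> carrier_vec n"
    show "h (vcoset N (r \<cdot>\<^sub>v v)) = r \<odot>\<^bsub>D\<^esub> h (vcoset N v)" for r
      using module_hom_smult[OF h(1) _ c[OF v], of r] v N
      by (simp add: smult_quot_module_vec class_ring_simps)
    assume w: "w \<in> carrier_vec n"
    show "h (vcoset N (v + w)) = h (vcoset N v) \<oplus>\<^bsub>D\<^esub> h (vcoset N w)"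
      using module_hom_add[OF h(1) c[OF v] c[OF w]] v w N by (simp add: add_quot_module_vec)
    show "h (vcoset N v) = h (vcoset N w) \<longleftrightarrow> v - w \<in> N"
      using h(2) c[OF v] c[OF w] vcoset_eq_iff[OF N v w] by (auto simp: bij_betw_def inj_on_def)
  qed
  then show "\<exists>\<pi>. ?P \<pi>" by (rule exI[of _ "\<lambda>v. h (vcoset N v)"])
next
  assume "\<exists>\<pi>. ?P \<pi>"
  then obtain \<pi> where \<pi>: "\<pi> ` carrier_vec n = carrier D"
    "\<And>v w. v \<in> carrier_vec n \<Longrightarrow> w \<in> carrier_vec n \<Longrightarrow> \<pi> (v + w) = \<pi> v \<oplus>\<^bsub>D\<^esub> \<pi> w"
    "\<And>r v. v \<in> carrier_vec n \<Longrightarrow> \<pi> (r \<cdot>\<^sub>v v) = r \<odot>\<^bsub>D\<^esub> \<pi> v"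
    "\<And>v w. v \<in> carrier_vec n \<Longrightarrow> w \<in> carrier_vec n \<Longrightarrow> \<pi> v = \<pi> w \<longleftrightarrow> v - w \<in> N" by blast
  define h where "h = (\<lambda>C. \<pi> (SOME v. v \<in> carrier_vec n \<and> vcoset N v = C))"
  have h: "h (vcoset N v) = \<pi> v" if "v \<in> carrier_vec n" for v
  proof -
    define w where "w = (SOME w. w \<in> carrier_vec n \<and> vcoset N w = vcoset N v)"
    have "w \<in> carrier_vec n \<and> vcoset N w = vcoset N v"
      unfolding w_def by (rule someI[of _ v]) (simp add: that)
    then have "\<pi> w = \<pi> v" using \<pi>(4) vcoset_eq_iff[OF N _ that] that by blast
    then show ?thesis by (simp add: h_def w_def)
  qed
  have "h \<in> module_hom class_ring ?M D"
    unfolding module_hom_def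
  proof (intro CollectI conjI allI impI funcsetI; (elim conjE)?)
    show "h C \<in> carrier D" if "C \<in> carrier ?M" for C
      using that h \<pi>(1) by (auto simp: carrier_quot_module_vec)
    show "h (C \<oplus>\<^bsub>?M\<^esub> C') = h C \<oplus>\<^bsub>D\<^esub> h C'" if "C \<in> carrier ?M" "C' \<in> carrier ?M" for C C'
      using that N h \<pi>(2) by (auto simp: carrier_quot_module_vec add_quot_module_vec)
    show "h (r \<odot>\<^bsub>?M\<^esub> C) = r \<odot>\<^bsub>D\<^esub> h C" if "C \<in> carrier ?M" for r C
      using that N h \<pi>(3) by (auto simp: carrier_quot_module_vec smult_quot_module_vec)
  qed
  moreover have "bij_betw h (carrier ?M) (carrier D)"
    unfolding bij_betw_def
  proof
    show "inj_on h (carrier ?M)"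
      using h \<pi>(4) vcoset_eq_iff[OF N] by (auto simp: inj_on_def carrier_quot_module_vec)
    show "h ` carrier ?M = carrier D"
      using h \<pi>(1) by (force simp: carrier_quot_module_vec image_image)
  qed
  ultimately show "module_iso class_ring ?M D" unfolding module_iso_def by blast
qed

section \<open>Invariant factors of arcs\<close>

text \<open>A set-valued \<open>\<rho>\<close> covers maps into K[[t]], by singletons, and maps into
  K[[t]]/(t^b), where a value is itself a residue class and a representative is followed through the
  coordinates.\<close>

lemma linear_extension_mem:
  fixes \<rho> :: "'a::comm_ring_1 vec \<Rightarrow> 'a set"
  assumes zero: "0 \<in> \<rho> (0\<^sub>v n)"
    and add: "\<And>v w x y. v \<in> carrier_vec n \<Longrightarrow> w \<in> carrier_vec n \<Longrightarrow> x \<in> \<rho> v \<Longrightarrow> y \<in> \<rho> w \<Longrightarrow> x + y \<in> \<rho> (v + w)"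
    and smult: "\<And>v x r. v \<in> carrier_vec n \<Longrightarrow> x \<in> \<rho> v \<Longrightarrow> r * x \<in> \<rho> (r \<cdot>\<^sub>v v)"
    and gen: "\<And>c. c < n \<Longrightarrow> g c \<in> \<rho> (unit_vec n c)"
    and v: "v \<in> carrier_vec n"
  shows "(\<Sum>c<n. g c * v $ c) \<in> \<rho> v"
proof -
  define p where "p m = vec n (\<lambda>c. if c < m then v $ c else 0)" for m
  have "(\<Sum>c<m. g c * v $ c) \<in> \<rho> (p m)" if "m \<le> n" for m
    using that
  proof (induction m)
    case 0
    have "p 0 = 0\<^sub>v n" by (auto simp: p_def)
    then show ?case using zero by simp
  next
    case (Suc m)
    have "p (Suc m) = p m + v $ m \<cdot>\<^sub>v unit_vec n m"
      using Suc.prems by (intro eq_vecI) (auto simp: p_def less_Suc_eq)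
    moreover have "v $ m * g m \<in> \<rho> (v $ m \<cdot>\<^sub>v unit_vec n m)"
      using Suc.prems by (intro smult gen) auto
    ultimately show ?case
      using add[of "p m" "v $ m \<cdot>\<^sub>v unit_vec n m"] Suc by (simp add: p_def mult.commute)
  qed
  moreover have "p n = v" using v by (auto simp: p_def)
  ultimately show ?thesis by (metis order_refl)
qed

section \<open>Cyclic modules and matrices presenting direct sums of them\<close>

definition residue_class :: "enat \<Rightarrow> 'k::field fps \<Rightarrow> 'k fps set" where
  "residue_class b x = {y. t_power b dvd y - x}"

lemma residue_class_eq_iff: "residue_class b x = residue_class b y \<longleftrightarrow> t_power b dvd x - y"
proof
  assume "residue_class b x = residue_class b y"
  moreover have "x \<in> residue_class b x" by (simp add: residue_class_def)
  ultimately show "t_power b dvd x - y" by (simp add: residue_class_def)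
next
  assume *: "t_power b dvd x - y"
  have "t_power b dvd z - x \<longleftrightarrow> t_power b dvd z - y" for z
    using dvd_add[of "t_power b" "z - x" "x - y"] dvd_diff[of "t_power b" "z - y" "x - y"] * by auto
  then show "residue_class b x = residue_class b y" by (simp add: residue_class_def)
qed

lemma residue_class_self: "x \<in> residue_class b x"
  by (simp add: residue_class_def)

lemma mem_residue_class_imp_eq: "x \<in> residue_class b y \<Longrightarrow> residue_class b y = residue_class b x"
  using residue_class_eq_iff[of b x y] by (simp add: residue_class_def)

lemma PIdl_t_power: "PIdl\<^bsub>class_ring\<^esub> (a :: 'a::comm_ring_1) = {x. a dvd x}"
  by (auto simp: cgenideal_def class_ring_simps dvd_def mult.commute)

abbreviation cyc :: "enat \<Rightarrow> ('k::field fps, 'k fps set) module" where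
  "cyc b \<equiv> quot_module regular_module (PIdl\<^bsub>class_ring\<^esub> (t_power b))"

lemma carrier_cyc: "carrier (cyc b) = range (residue_class b)"
proof -
  have "{h + x | h. t_power b dvd h} = residue_class b x" for x :: "'a fps"
    by (auto simp: residue_class_def intro!: exI[of _ "_ - x"])
  moreover have "(\<Union>h\<in>{h. t_power b dvd h}. {h + x}) = {h + x | h. t_power b dvd h}" for x :: "'a fps"
    by auto
  ultimately show ?thesis
    by (auto simp: quot_module_def A_RCOSETS_def' a_r_coset_def' regular_module_def PIdl_t_power)
qed

lemma add_cyc: "residue_class b x \<oplus>\<^bsub>cyc b\<^esub> residue_class b y = residue_class b (x + y)"
proof -
  have "(\<exists>p\<in>residue_class b x. \<exists>q\<in>residue_class b y. z = p + q) \<longleftrightarrow> z \<in> residue_class b (x + y)" for z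
  proof
    assume "\<exists>p\<in>residue_class b x. \<exists>q\<in>residue_class b y. z = p + q"
    then obtain p q where pq: "t_power b dvd p - x" "t_power b dvd q - y" "z = p + q"
      by (auto simp: residue_class_def)
    have eq: "z - (x + y) = (p - x) + (q - y)" using pq by simp
    show "z \<in> residue_class b (x + y)"
      unfolding residue_class_def mem_Collect_eq eq by (rule dvd_add[OF pq(1,2)])
  next
    assume "z \<in> residue_class b (x + y)"
    then have "z - y \<in> residue_class b x" by (simp add: residue_class_def algebra_simps)
    moreover have "z = (z - y) + y" by simp
    ultimately show "\<exists>p\<in>residue_class b x. \<exists>q\<in>residue_class b y. z = p + q"
      using residue_class_self by blast
  qed
  then show ?thesis by (auto simp: quot_module_def set_add_def' regular_module_def)
qed

lemma smult_cyc: "r \<odot>\<^bsub>cyc b\<^esub> residue_class b x = residue_class b (r * x)"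
proof -
  have "(\<exists>p. t_power b dvd p \<and> (\<exists>q\<in>residue_class b x. z = p + r * q)) \<longleftrightarrow> z \<in> residue_class b (r * x)" for z
  proof
    assume "\<exists>p. t_power b dvd p \<and> (\<exists>q\<in>residue_class b x. z = p + r * q)"
    then obtain p q where pq: "t_power b dvd p" "t_power b dvd q - x" "z = p + r * q"
      by (auto simp: residue_class_def)
    have eq: "z - r * x = p + r * (q - x)" using pq by (simp add: algebra_simps)
    show "z \<in> residue_class b (r * x)"
      unfolding residue_class_def mem_Collect_eq eq by (rule dvd_add[OF pq(1) dvd_mult[OF pq(2)]])
  next
    assume "z \<in> residue_class b (r * x)"
    then have "t_power b dvd z - r * x" by (simp add: residue_class_def)
    moreover have "z = (z - r * x) + r * x" by simp
    ultimately show "\<exists>p. t_power b dvd p \<and> (\<exists>q\<in>residue_class b x. z = p + r * q)"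
      using residue_class_self by blast
  qed
  then show ?thesis
    by (auto simp: quot_module_def set_add_def' regular_module_def PIdl_t_power)
qed

text \<open>The passage from an abstract isomorphism to a matrix: row \<open>j\<close> of
  \<open>G\<close> consists of representatives of the images of the unit vectors in summand
  \<open>Suc j\<close>. A summand with exponent \<infinity> is K[[t]] itself, so the free part and
  the torsion are treated alike.\<close>

lemma module_iso_dsum_iff_presents:
  fixes N :: "'k::field fps vec set"
  assumes N: "subm n N"
  shows "module_iso class_ring (quot_module (module_vec TYPE('k fps) n) N) (dsum_module {1..q} (\<lambda>j. cyc (b j)))
    \<longleftrightarrow> (\<exists>G. presents n q N G (\<lambda>j. b (Suc j)))"
    (is "_ \<longleftrightarrow> ?R")
proof -
  let ?D = "dsum_module {1..q} (\<lambda>j. cyc (b j)) :: ('k fps, nat \<Rightarrow> 'k fps set) module"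
  have cD: "carrier ?D = (\<Pi>\<^sub>E j\<in>{1..q}. range (residue_class (b j)))"
    by (simp add: dsum_module_def carrier_cyc)
  have aD: "x \<oplus>\<^bsub>?D\<^esub> y = (\<lambda>j\<in>{1..q}. x j \<oplus>\<^bsub>cyc (b j)\<^esub> y j)" for x y
    by (simp add: dsum_module_def)
  have sD: "r \<odot>\<^bsub>?D\<^esub> y = (\<lambda>j\<in>{1..q}. r \<odot>\<^bsub>cyc (b j)\<^esub> y j)" for r y
    by (simp add: dsum_module_def)
  show ?thesis
    unfolding module_iso_quot_iff[OF N]
  proof
    assume ?R
    then obtain G where G: "presents n q N G (\<lambda>j. b (Suc j))" by blast
    define \<pi> where "\<pi> v = (\<lambda>j\<in>{1..q}. residue_class (b j) (app n G v (j - 1)))" for v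
    show "\<exists>\<pi>. \<pi> ` carrier_vec n = carrier ?D \<and>
      (\<forall>v\<in>carrier_vec n. \<forall>w\<in>carrier_vec n. \<pi> (v + w) = \<pi> v \<oplus>\<^bsub>?D\<^esub> \<pi> w) \<and>
      (\<forall>r. \<forall>v\<in>carrier_vec n. \<pi> (r \<cdot>\<^sub>v v) = r \<odot>\<^bsub>?D\<^esub> \<pi> v) \<and>
      (\<forall>v\<in>carrier_vec n. \<forall>w\<in>carrier_vec n. \<pi> v = \<pi> w \<longleftrightarrow> v - w \<in> N)"
    proof (intro exI[of _ \<pi>] conjI ballI allI)
      show "\<pi> ` carrier_vec n = carrier ?D"
      proof (intro equalityI subsetI)
        show "x \<in> carrier ?D" if "x \<in> \<pi> ` carrier_vec n" for x
          using that unfolding cD by (auto simp: \<pi>_def)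
        fix x assume x: "x \<in> carrier ?D"
        then have "\<forall>j\<in>{1..q}. \<exists>y. x j = residue_class (b j) y" unfolding cD by (auto simp: PiE_iff)
        from bchoice[OF this] obtain y where y: "\<forall>j\<in>{1..q}. x j = residue_class (b j) (y j)" ..
        obtain v where v: "v \<in> carrier_vec n" "\<And>j. j < q \<Longrightarrow> t_power (b (Suc j)) dvd (app n G v j - y (Suc j))"
          by (rule presents_lift[OF G, where y = "\<lambda>j. y (Suc j)"]) blast
        have "\<pi> v = x"
        proof
          fix j show "\<pi> v j = x j"
          proof (cases "j \<in> {1..q}")
            case True
            then obtain i where "j = Suc i" "i < q" by (cases j) auto
            then show ?thesis using v(2)[of i] y by (simp add: \<pi>_def residue_class_eq_iff)
          next
            case False
            then show ?thesis using x unfolding cD by (auto simp: \<pi>_def PiE_iff extensional_def)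
          qed
        qed
        then show "x \<in> \<pi> ` carrier_vec n" using v(1) by blast
      qed
      fix v w :: "'k fps vec" assume v: "v \<in> carrier_vec n"
      show "\<pi> (r \<cdot>\<^sub>v v) = r \<odot>\<^bsub>?D\<^esub> \<pi> v" for r
        unfolding sD unfolding \<pi>_def by (rule restrict_ext) (use v in \<open>simp add: smult_cyc app_smult\<close>)
      assume w: "w \<in> carrier_vec n"
      show "\<pi> (v + w) = \<pi> v \<oplus>\<^bsub>?D\<^esub> \<pi> w"
        unfolding aD unfolding \<pi>_def by (rule restrict_ext) (use v w in \<open>simp add: add_cyc app_add\<close>)
      have "\<pi> v = \<pi> w \<longleftrightarrow> (\<forall>j<q. \<pi> v (Suc j) = \<pi> w (Suc j))"
      proof
        assume *: "\<forall>j<q. \<pi> v (Suc j) = \<pi> w (Suc j)"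
        show "\<pi> v = \<pi> w"
        proof
          fix j
          show "\<pi> v j = \<pi> w j"
          proof (cases "j \<in> {1..q}")
            case True
            then obtain i where "j = Suc i" "i < q" by (cases j) auto
            then show ?thesis using * by simp
          qed (auto simp: \<pi>_def)
        qed
      qed simp
      also have "\<dots> \<longleftrightarrow> (\<forall>j<q. t_power (b (Suc j)) dvd app n G (v - w) j)"
        using v w by (simp add: \<pi>_def residue_class_eq_iff app_diff)
      finally show "\<pi> v = \<pi> w \<longleftrightarrow> v - w \<in> N"
        using v w by (simp add: presents_mem[OF G])
    qed
  next
    assume "\<exists>\<pi>. \<pi> ` carrier_vec n = carrier ?D \<and>
      (\<forall>v\<in>carrier_vec n. \<forall>w\<in>carrier_vec n. \<pi> (v + w) = \<pi> v \<oplus>\<^bsub>?D\<^esub> \<pi> w) \<and>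
      (\<forall>r. \<forall>v\<in>carrier_vec n. \<pi> (r \<cdot>\<^sub>v v) = r \<odot>\<^bsub>?D\<^esub> \<pi> v) \<and>
      (\<forall>v\<in>carrier_vec n. \<forall>w\<in>carrier_vec n. \<pi> v = \<pi> w \<longleftrightarrow> v - w \<in> N)"
    then obtain \<pi> where im: "\<pi> ` carrier_vec n = carrier ?D"
      and add: "\<And>v w. v \<in> carrier_vec n \<Longrightarrow> w \<in> carrier_vec n \<Longrightarrow> \<pi> (v + w) = \<pi> v \<oplus>\<^bsub>?D\<^esub> \<pi> w"
      and sm: "\<And>r v. v \<in> carrier_vec n \<Longrightarrow> \<pi> (r \<cdot>\<^sub>v v) = r \<odot>\<^bsub>?D\<^esub> \<pi> v"
      and eq: "\<And>v w. v \<in> carrier_vec n \<Longrightarrow> w \<in> carrier_vec n \<Longrightarrow> \<pi> v = \<pi> w \<longleftrightarrow> v - w \<in> N" by blast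
    have r: "\<exists>x. \<pi> v j = residue_class (b j) x" if "v \<in> carrier_vec n" "j \<in> {1..q}" for v j
    proof -
      have "\<pi> v \<in> carrier ?D" using im that by blast
      then have "\<pi> v j \<in> range (residue_class (b j))" using that unfolding cD by (simp add: PiE_iff)
      then show ?thesis by (rule rangeE) blast
    qed
    have "\<forall>j c. \<exists>x. j < q \<longrightarrow> c < n \<longrightarrow> \<pi> (unit_vec n c) (Suc j) = residue_class (b (Suc j)) x"
      using r by auto
    then obtain G where G: "\<And>j c. j < q \<Longrightarrow> c < n \<Longrightarrow> \<pi> (unit_vec n c) (Suc j) = residue_class (b (Suc j)) (G j c)"
      by metis
    have main: "\<pi> v (Suc j) = residue_class (b (Suc j)) (app n G v j)" if v: "v \<in> carrier_vec n" and j: "j < q" for v j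
    proof -
      have j': "Suc j \<in> {1..q}" using j by simp
      have r': "\<pi> v (Suc j) = residue_class (b (Suc j)) x"
        if v: "v \<in> carrier_vec n" and x: "x \<in> \<pi> v (Suc j)" for v x
      proof -
        from r[OF v j'] obtain x' where *: "\<pi> v (Suc j) = residue_class (b (Suc j)) x'" by blast
        then show ?thesis using mem_residue_class_imp_eq[OF x[unfolded *]] by simp
      qed
      have "app n G v j \<in> \<pi> v (Suc j)"
        unfolding app_def
      proof (rule linear_extension_mem[where \<rho> = "\<lambda>v. \<pi> v (Suc j)"])
        \<comment> \<open>That zero goes to zero is not among the properties of
          \<open>\<pi>\<close>; it follows from multiplication by the scalar 0.\<close>
        obtain x where x: "\<pi> (0\<^sub>v n) (Suc j) = residue_class (b (Suc j)) x" using r[OF _ j', of "0\<^sub>v n"] by auto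
        have "0 \<cdot>\<^sub>v 0\<^sub>v n = (0\<^sub>v n :: 'k fps vec)" by (intro eq_vecI) auto
        then have "\<pi> (0\<^sub>v n) = 0 \<odot>\<^bsub>?D\<^esub> \<pi> (0\<^sub>v n)" using sm[of "0\<^sub>v n" 0] by simp
        then have "\<pi> (0\<^sub>v n) (Suc j) = residue_class (b (Suc j)) (0 * x)"
          using j' x by (metis (no_types, lifting) sD restrict_apply' smult_cyc)
        then show "0 \<in> \<pi> (0\<^sub>v n) (Suc j)" using residue_class_self by simp
        show "G j c \<in> \<pi> (unit_vec n c) (Suc j)" if "c < n" for c
          using G[OF j that] residue_class_self by simp
        show "v \<in> carrier_vec n" by (fact v)
        show "x + y \<in> \<pi> (v + w) (Suc j)"
          if "v \<in> carrier_vec n" "w \<in> carrier_vec n" "x \<in> \<pi> v (Suc j)" "y \<in> \<pi> w (Suc j)" for v w x y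
        proof -
          have "\<pi> v (Suc j) = residue_class (b (Suc j)) x" "\<pi> w (Suc j) = residue_class (b (Suc j)) y"
            using r' that by blast+
          then have "\<pi> (v + w) (Suc j) = residue_class (b (Suc j)) (x + y)"
            unfolding add[OF that(1,2)] aD using j' by (simp add: add_cyc)
          then show ?thesis using residue_class_self by simp
        qed
        show "t * x \<in> \<pi> (t \<cdot>\<^sub>v v) (Suc j)"
          if "v \<in> carrier_vec n" "x \<in> \<pi> v (Suc j)" for v x t
        proof -
          have "\<pi> v (Suc j) = residue_class (b (Suc j)) x"
            using r' that by blast
          then have "\<pi> (t \<cdot>\<^sub>v v) (Suc j) = residue_class (b (Suc j)) (t * x)"
            unfolding sm[OF that(1)] sD using j' by (simp add: smult_cyc)
          then show ?thesis using residue_class_self by simp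
        qed
      qed
      then show ?thesis using r[OF v j'] mem_residue_class_imp_eq by metis
    qed
    have ext: "\<pi> v j = undefined" if "v \<in> carrier_vec n" "j \<notin> {1..q}" for v j
    proof -
      have "\<pi> v \<in> carrier ?D" using im that by blast
      then show ?thesis using that unfolding cD by (auto simp: PiE_iff extensional_def)
    qed
    have eq_iff: "\<pi> v = x \<longleftrightarrow> (\<forall>j<q. x (Suc j) = residue_class (b (Suc j)) (app n G v j))"
      if v: "v \<in> carrier_vec n" and x: "\<And>j. j \<notin> {1..q} \<Longrightarrow> x j = undefined" for v x
    proof
      assume *: "\<forall>j<q. x (Suc j) = residue_class (b (Suc j)) (app n G v j)"
      show "\<pi> v = x"
      proof
        fix j show "\<pi> v j = x j"
        proof (cases "j \<in> {1..q}")
          case True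
          then obtain i where "j = Suc i" "i < q" by (cases j) auto
          then show ?thesis using main[OF v] * by simp
        qed (simp add: ext[OF v] x)
      qed
    next
      assume eq: "\<pi> v = x"
      show "\<forall>j<q. x (Suc j) = residue_class (b (Suc j)) (app n G v j)"
        using main[OF v] unfolding eq by blast
    qed
    have "presents n q N G (\<lambda>j. b (Suc j))"
      unfolding presents_def
    proof (intro conjI allI)
      have "v \<in> N \<longleftrightarrow> v \<in> {v \<in> carrier_vec n. \<forall>j<q. t_power (b (Suc j)) dvd app n G v j}" for v
      proof (cases "v \<in> carrier_vec n")
        case True
        have "v \<in> N \<longleftrightarrow> \<pi> v = \<pi> (0\<^sub>v n)" using eq[OF True, of "0\<^sub>v n"] True by simp
        also have "\<dots> \<longleftrightarrow> (\<forall>j<q. t_power (b (Suc j)) dvd app n G v j)"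
          by (subst eq_iff[OF True]) (simp_all add: ext main residue_class_eq_iff app_zero)
        finally show ?thesis using True by simp
      qed (use N in \<open>auto simp: subm_def\<close>)
      then show "N = {v \<in> carrier_vec n. \<forall>j<q. t_power (b (Suc j)) dvd app n G v j}" by (rule Set.set_eqI)
    next
      fix y :: "nat \<Rightarrow> 'k fps"
      define x where "x = (\<lambda>j\<in>{1..q}. residue_class (b j) (y (j - 1)))"
      have "x \<in> \<pi> ` carrier_vec n" unfolding im cD by (auto simp: x_def)
      then obtain v where "x = \<pi> v" and v1: "v \<in> carrier_vec n" by (rule imageE)
      then have v: "v \<in> carrier_vec n" "\<pi> v = x" by simp_all
      have "t_power (b (Suc j)) dvd app n G v j - y j" if "j < q" for j
        using main[OF v(1) that, symmetric] that unfolding v(2) by (simp add: x_def residue_class_eq_iff)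
      then show "\<exists>v\<in>carrier_vec n. \<forall>j<q. t_power (b (Suc j)) dvd app n G v j - y j" using v(1) by blast
    qed
    then show ?R by blast
  qed
qed

lemma module_iso_vec_iff_presents:
  fixes N :: "'k::field fps vec set"
  assumes N: "subm n N"
  shows "module_iso class_ring (quot_module (module_vec TYPE('k fps) n) N) (module_vec TYPE('k fps) q)
    \<longleftrightarrow> (\<exists>G. presents n q N G (\<lambda>_. \<infinity>))"
    (is "_ \<longleftrightarrow> ?R")
  unfolding module_iso_quot_iff[OF N]
proof
  assume ?R
  then obtain G where G: "presents n q N G (\<lambda>_. \<infinity>)" by blast
  define \<pi> where "\<pi> v = vec q (app n G v)" for v
  show "\<exists>\<pi>. \<pi> ` carrier_vec n = carrier (module_vec TYPE('k fps) q) \<and>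
      (\<forall>v\<in>carrier_vec n. \<forall>w\<in>carrier_vec n. \<pi> (v + w) = \<pi> v \<oplus>\<^bsub>module_vec TYPE('k fps) q\<^esub> \<pi> w) \<and>
      (\<forall>r. \<forall>v\<in>carrier_vec n. \<pi> (r \<cdot>\<^sub>v v) = r \<odot>\<^bsub>module_vec TYPE('k fps) q\<^esub> \<pi> v) \<and>
      (\<forall>v\<in>carrier_vec n. \<forall>w\<in>carrier_vec n. \<pi> v = \<pi> w \<longleftrightarrow> v - w \<in> N)"
  proof (intro exI[of _ \<pi>] conjI ballI allI)
    have "x \<in> \<pi> ` carrier_vec n" if "x \<in> carrier_vec q" for x
    proof -
      obtain v where "v \<in> carrier_vec n" "\<And>j. j < q \<Longrightarrow> t_power \<infinity> dvd (app n G v j - x $ j)"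
        by (rule presents_lift[OF G, where y = "\<lambda>j. x $ j"]) blast
      moreover from this have "\<pi> v = x" using that by (auto simp: \<pi>_def)
      ultimately show ?thesis by blast
    qed
    then show "\<pi> ` carrier_vec n = carrier (module_vec TYPE('k fps) q)"
      by (auto simp: \<pi>_def module_vec_simps)
    fix v w :: "'k fps vec" assume v: "v \<in> carrier_vec n"
    show "\<pi> (r \<cdot>\<^sub>v v) = r \<odot>\<^bsub>module_vec TYPE('k fps) q\<^esub> \<pi> v" for r
      using v by (auto simp: \<pi>_def module_vec_simps app_smult)
    assume w: "w \<in> carrier_vec n"
    show "\<pi> (v + w) = \<pi> v \<oplus>\<^bsub>module_vec TYPE('k fps) q\<^esub> \<pi> w"
      using v w by (auto simp: \<pi>_def module_vec_simps app_add)
    show "\<pi> v = \<pi> w \<longleftrightarrow> v - w \<in> N"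
      using v w by (auto simp: presents_mem[OF G] \<pi>_def app_diff vec_eq_iff)
  qed
next
  assume "\<exists>\<pi>. \<pi> ` carrier_vec n = carrier (module_vec TYPE('k fps) q) \<and>
      (\<forall>v\<in>carrier_vec n. \<forall>w\<in>carrier_vec n. \<pi> (v + w) = \<pi> v \<oplus>\<^bsub>module_vec TYPE('k fps) q\<^esub> \<pi> w) \<and>
      (\<forall>r. \<forall>v\<in>carrier_vec n. \<pi> (r \<cdot>\<^sub>v v) = r \<odot>\<^bsub>module_vec TYPE('k fps) q\<^esub> \<pi> v) \<and>
      (\<forall>v\<in>carrier_vec n. \<forall>w\<in>carrier_vec n. \<pi> v = \<pi> w \<longleftrightarrow> v - w \<in> N)"
  then obtain \<pi> where im: "\<pi> ` carrier_vec n = carrier_vec q"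
    and add: "\<And>v w. v \<in> carrier_vec n \<Longrightarrow> w \<in> carrier_vec n \<Longrightarrow> \<pi> (v + w) = \<pi> v + \<pi> w"
    and sm: "\<And>r v. v \<in> carrier_vec n \<Longrightarrow> \<pi> (r \<cdot>\<^sub>v v) = r \<cdot>\<^sub>v \<pi> v"
    and eq: "\<And>v w. v \<in> carrier_vec n \<Longrightarrow> w \<in> carrier_vec n \<Longrightarrow> \<pi> v = \<pi> w \<longleftrightarrow> v - w \<in> N"
    unfolding module_vec_simps by blast
  have c: "\<pi> v \<in> carrier_vec q" if "v \<in> carrier_vec n" for v using im that by blast
  define G where "G j c = \<pi> (unit_vec n c) $ j" for j c
  have main: "\<pi> v $ j = app n G v j" if v: "v \<in> carrier_vec n" and j: "j < q" for v j
  proof -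
    have "app n G v j \<in> {\<pi> v $ j}"
      unfolding app_def
    proof (rule linear_extension_mem[where \<rho> = "\<lambda>v. {\<pi> v $ j}"])
      have "0 \<cdot>\<^sub>v 0\<^sub>v n = (0\<^sub>v n :: 'k fps vec)" by (intro eq_vecI) auto
      then have "\<pi> (0\<^sub>v n) = 0 \<cdot>\<^sub>v \<pi> (0\<^sub>v n)" using sm[of "0\<^sub>v n" 0] by simp
      then have "\<pi> (0\<^sub>v n) $ j = (0 \<cdot>\<^sub>v \<pi> (0\<^sub>v n)) $ j" by simp
      then show "0 \<in> {\<pi> (0\<^sub>v n) $ j}" using c[of "0\<^sub>v n"] j by simp
    qed (use v j carrier_vecD[OF c] in \<open>auto simp: G_def add sm\<close>)
    then show ?thesis by simp
  qed
  have "presents n q N G (\<lambda>_. \<infinity>)"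
    unfolding presents_def
  proof (intro conjI allI)
    have "v \<in> N \<longleftrightarrow> v \<in> {v \<in> carrier_vec n. \<forall>j<q. t_power \<infinity> dvd app n G v j}" for v
    proof (cases "v \<in> carrier_vec n")
      case True
      have "v \<in> N \<longleftrightarrow> \<pi> v = \<pi> (0\<^sub>v n)" using eq[OF True, of "0\<^sub>v n"] True by simp
      also have "\<dots> \<longleftrightarrow> (\<forall>j<q. \<pi> v $ j = \<pi> (0\<^sub>v n) $ j)"
        using c[OF True] c[of "0\<^sub>v n"] by (auto simp: vec_eq_iff)
      finally show ?thesis using True by (simp add: main app_zero)
    qed (use N in \<open>auto simp: subm_def\<close>)
    then show "N = {v \<in> carrier_vec n. \<forall>j<q. t_power \<infinity> dvd app n G v j}" by (rule Set.set_eqI)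
  next
    fix y :: "nat \<Rightarrow> 'k fps"
    have "vec q y \<in> carrier_vec q" by simp
    then have "vec q y \<in> \<pi> ` carrier_vec n" unfolding im .
    then obtain v where "vec q y = \<pi> v" and v1: "v \<in> carrier_vec n" by (rule imageE)
    then have v: "v \<in> carrier_vec n" "\<pi> v = vec q y" by simp_all
    then have "app n G v j - y j = 0" if "j < q" for j
      using main[OF v(1) that] that by simp
    then show "\<exists>v\<in>carrier_vec n. \<forall>j<q. t_power \<infinity> dvd app n G v j - y j"
      using v(1) by (intro bexI[of _ v]) simp_all
  qed
  then show ?R by blast
qed

text \<open>With all exponents \<infinity>, divisibility is vanishing: \<open>\<Lambda>\<close> is
  the kernel of \<open>H\<close>, and \<open>H\<close> maps K[[t]]^n onto K[[t]]^q.\<close>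

abbreviation arc_mat :: "nat \<Rightarrow> nat \<Rightarrow> 'k::field fps vec set \<Rightarrow> (nat \<Rightarrow> nat \<Rightarrow> 'k fps) \<Rightarrow> bool" where
  "arc_mat n q \<Lambda> H \<equiv> presents n q \<Lambda> H (\<lambda>_. \<infinity>)"

lemma is_arc_iff: "is_arc k n \<Lambda> \<longleftrightarrow> (\<exists>H. arc_mat n (n - k) \<Lambda> H)"
  using presents_subm module_iso_vec_iff_presents
  unfolding is_arc_def submodule_iff_subm by blast

lemma presents_unique:
  assumes "presents n q N G b" "presents n q N G' b'"
    and "\<And>i j. i \<le> j \<Longrightarrow> j < q \<Longrightarrow> b j \<le> b i" "\<And>i j. i \<le> j \<Longrightarrow> j < q \<Longrightarrow> b' j \<le> b' i" "j < q"
  shows "b j = b' j"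
  using presents_mono[OF assms(1,2) order_refl assms(3,4,5)]
    presents_mono[OF assms(2,1) order_refl assms(4,3,5)] by simp

text \<open>Uniqueness of the exponents of a presentation, together with the padding by 0 outside
  \<open>{1..n - k}\<close>, makes the definite description well defined.\<close>

lemma inv_factors_eq:
  fixes \<Lambda> :: "'k::field fps vec set"
  assumes P: "presents n (n - k) (set_add (module_vec TYPE('k fps) n) \<Lambda> (flag n i)) G b"
    and anti: "\<And>i j. i \<le> j \<Longrightarrow> j < n - k \<Longrightarrow> b j \<le> b i"
  shows "inv_factors k n \<Lambda> i = (\<lambda>j. if j \<in> {1..n - k} then b (j - 1) else 0)"
  unfolding inv_factors_def
proof (rule the_equality, goal_cases)
  case 1
  let ?b = "\<lambda>j. if j \<in> {1..n - k} then b (j - 1) else 0"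
  have "presents n (n - k) (set_add (module_vec TYPE('k fps) n) \<Lambda> (flag n i)) G (\<lambda>j. ?b (Suc j))"
    using P unfolding presents_def by simp
  then have "module_iso class_ring (quot_module (module_vec TYPE('k fps) n)
      (set_add (module_vec TYPE('k fps) n) \<Lambda> (flag n i))) (dsum_module {1..n - k} (\<lambda>j. cyc (?b j)))"
    by (intro module_iso_dsum_iff_presents[OF presents_subm[OF P], of "n - k" ?b, THEN iffD2] exI)
  moreover have "?b (j + 1) \<le> ?b j" if "j \<in> {1..<n - k}" for j
    using that anti[of "j - 1" j] by auto
  ultimately show ?case by simp
next
  case (2 b')
  then obtain G' where G': "presents n (n - k) (set_add (module_vec TYPE('k fps) n) \<Lambda> (flag n i)) G' (\<lambda>j. b' (Suc j))"
    using module_iso_dsum_iff_presents[OF presents_subm[OF P]] by blast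
  have "b' (Suc j) \<le> b' (Suc i)" if "i \<le> j" "j < n - k" for i j
    using that
  proof (induction rule: dec_induct)
    case (step m)
    then have "b' (Suc m + 1) \<le> b' (Suc m)" using 2 by auto
    then show ?case using step by (auto intro: order_trans)
  qed simp
  from presents_unique[OF G' P this anti]
  have e: "b' (Suc j) = b j" if "j < n - k" for j using that by blast
  have z: "b' j = 0" if "j \<notin> {1..n - k}" for j using 2 that by blast
  show ?case
  proof
    fix j
    show "b' j = (if j \<in> {1..n - k} then b (j - 1) else 0)"
    proof (cases "j \<in> {1..n - k}")
      case True
      then obtain i where "j = Suc i" "i < n - k" by (cases j) auto
      then show ?thesis using e True by simp
    qed (use z in auto)
  qed
qed

section \<open>Spans, flags and the quotient by an arc plus a flag\<close>

lemma vspan_image: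
  fixes f :: "'i \<Rightarrow> 'a::comm_ring_1 vec"
  assumes J: "finite J" and f: "\<And>j. j \<in> J \<Longrightarrow> f j \<in> carrier_vec n"
  shows "vspan n (f ` J) = range (\<lambda>x. vec n (\<lambda>c. \<Sum>j\<in>J. x j * f j $ c))" (is "_ = range ?w")
proof -
  interpret vec_module "TYPE('a)" n .
  have fJ: "f ` J \<subseteq> carrier_vec n" using f by auto
  have "subm n (range ?w)"
    unfolding subm_def
  proof (intro conjI ballI allI)
    show "range ?w \<subseteq> carrier_vec n" by auto
    have "0\<^sub>v n = ?w (\<lambda>_. 0)" by (auto simp: zero_vec_def)
    then show "0\<^sub>v n \<in> range ?w" by (rule range_eqI[where x = "\<lambda>_. 0"])
    show "v + w \<in> range ?w" if "v \<in> range ?w" "w \<in> range ?w" for v w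
    proof -
      from that(1) obtain x where x: "v = ?w x" by (rule rangeE)
      from that(2) obtain y where "w = ?w y" by (rule rangeE)
      with x have "v + w = ?w (\<lambda>j. x j + y j)" by (auto simp: sum.distrib algebra_simps)
      then show ?thesis by (rule range_eqI[where x = "\<lambda>j. x j + y j"])
    qed
    show "r \<cdot>\<^sub>v v \<in> range ?w" if "v \<in> range ?w" for r v
    proof -
      from that obtain x where "v = ?w x" by (rule rangeE)
      then have "r \<cdot>\<^sub>v v = ?w (\<lambda>j. r * x j)" by (auto simp: sum_distrib_left algebra_simps)
      then show ?thesis by (rule range_eqI[where x = "\<lambda>j. r * x j"])
    qed
  qed
  moreover have "f ` J \<subseteq> range ?w"
  proof
    fix v assume "v \<in> f ` J"
    then obtain j where j: "j \<in> J" "v = f j" by blast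
    have "v = ?w (\<lambda>i. if i = j then 1 else 0)"
      using j f[OF j(1)] J by (auto simp: if_distrib if_distribR cong: if_cong)
    then show "v \<in> range ?w" by (rule range_eqI[where x = "\<lambda>i. if i = j then 1 else 0"])
  qed
  ultimately have 1: "span (f ` J) \<subseteq> range ?w"
    by (intro span_is_subset) (simp_all add: submodule_iff_subm)
  have sp: "subm n (span (f ` J))"
    using span_is_submodule[OF fJ] by (simp add: submodule_iff_subm)
  have "vec n (\<lambda>c. \<Sum>j\<in>J'. x j * f j $ c) \<in> span (f ` J)" if "J' \<subseteq> J" for J' x
    using finite_subset[OF that J] that
  proof (induction J' rule: finite_induct)
    case empty
    have "vec n (\<lambda>c. 0) = (0\<^sub>v n :: 'a vec)" by (auto simp: zero_vec_def)
    then show ?case using sp by (simp add: subm_def)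
  next
    case (insert j J')
    have "vec n (\<lambda>c. \<Sum>j\<in>insert j J'. x j * f j $ c) = x j \<cdot>\<^sub>v f j + vec n (\<lambda>c. \<Sum>j\<in>J'. x j * f j $ c)"
      using insert f[of j] by (intro eq_vecI) auto
    moreover have "f j \<in> span (f ` J)" using in_own_span[OF fJ] insert by blast
    ultimately show ?case using sp insert unfolding subm_def by auto
  qed
  then have "range ?w \<subseteq> span (f ` J)" by auto
  with 1 show ?thesis by (simp add: vspan_def)
qed

lemma flag_eq: "flag n i = {v \<in> carrier_vec n. \<forall>c<n - i. v $ c = (0 :: 'a::comm_ring_1)}"
proof -
  have "{unit_vec n j | j. n - i \<le> j \<and> j < n} = (unit_vec n :: nat \<Rightarrow> 'a vec) ` {n - i..<n}" by auto
  then have "flag n i = range (\<lambda>x. vec n (\<lambda>c. \<Sum>j\<in>{n - i..<n}. x j * (unit_vec n j :: 'a vec) $ c))"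
    unfolding flag_def using vspan_image[of "{n - i..<n}" "unit_vec n :: nat \<Rightarrow> 'a vec" n] by simp
  moreover have "(\<Sum>j\<in>{n - i..<n}. x j * (unit_vec n j :: 'a vec) $ c) = (if n - i \<le> c then x c else 0)"
    if "c < n" for x c
  proof -
    have "(\<Sum>j\<in>{n - i..<n}. x j * (unit_vec n j :: 'a vec) $ c) = (\<Sum>j\<in>{n - i..<n}. if j = c then x j else 0)"
      using that by (intro sum.cong) (auto simp: unit_vec_def)
    then show ?thesis using that by simp
  qed
  then have "vec n (\<lambda>c. \<Sum>j\<in>{n - i..<n}. x j * (unit_vec n j :: 'a vec) $ c) = vec n (\<lambda>c. if n - i \<le> c then x c else 0)" for x
    by (intro eq_vecI) simp_all
  ultimately have *: "flag n i = range (\<lambda>x. vec n (\<lambda>c. if n - i \<le> c then x c else 0 :: 'a))"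
    by simp
  show ?thesis
    unfolding *
  proof (intro equalityI subsetI)
    fix v :: "'a vec" assume v: "v \<in> {v \<in> carrier_vec n. \<forall>c<n - i. v $ c = 0}"
    then have "v = vec n (\<lambda>c. if n - i \<le> c then v $ c else 0)" by (auto simp: not_le)
    then show "v \<in> range (\<lambda>x. vec n (\<lambda>c. if n - i \<le> c then x c else 0))"
      by (rule range_eqI[where x = "\<lambda>c. v $ c"])
  qed auto
qed

text \<open>\<open>H\<close> identifies K[[t]]^n/\<Lambda> with K[[t]]^q and takes the flag to the
  span of the last columns of \<open>H\<close>, which is the span of \<open>T diag(t^b)\<close>. In
  the coordinates given by \<open>T'\<close> the quotient is a sum of cyclic modules.\<close>

lemma presents_add_flag:
  fixes H :: "nat \<Rightarrow> nat \<Rightarrow> 'k::field fps"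
  assumes A: "arc_mat n q \<Lambda> H" and S: "smith {..<q} {n - i..<n} H T T' (\<lambda>j. t_power (b j)) Q Y"
  shows "presents n q (set_add (module_vec TYPE('k fps) n) \<Lambda> (flag n i)) (mm {..<q} T' H) b"
proof -
  let ?C = "{n - i..<n}"
  have T: "inv_pair {..<q} T T'" using S by (simp add: smith_def)
  have TT: "(\<Sum>k<q. T a k * app n (mm {..<q} T' H) v k) = app n H v a" if "a < q" for a v
    using inv_pair_cancel[OF T, of a "\<lambda>k _. app n H v k" "()"] that
    by (simp add: app_mm mm_def)
  have mem: "v \<in> set_add (module_vec TYPE('k fps) n) \<Lambda> (flag n i) \<longleftrightarrow>
      v \<in> carrier_vec n \<and> (\<forall>j<q. t_power (b j) dvd app n (mm {..<q} T' H) v j)" for v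
  proof -
    have "v \<in> set_add (module_vec TYPE('k fps) n) \<Lambda> (flag n i) \<longleftrightarrow> (\<exists>u\<in>\<Lambda>. \<exists>w\<in>flag n i. v = u + w)"
      by (auto simp: set_add_def' module_vec_simps)
    also have "\<dots> \<longleftrightarrow> v \<in> carrier_vec n \<and> (\<exists>w\<in>flag n i. \<forall>j<q. app n H v j = app n H w j)"
    proof
      assume "\<exists>u\<in>\<Lambda>. \<exists>w\<in>flag n i. v = u + w"
      then obtain u w where uw: "u \<in> \<Lambda>" "w \<in> flag n i" "v = u + w" by blast
      then have "u \<in> carrier_vec n" "w \<in> carrier_vec n" "\<forall>j<q. app n H u j = 0"
        by (auto simp: presents_mem[OF A] flag_eq)
      then show "v \<in> carrier_vec n \<and> (\<exists>w\<in>flag n i. \<forall>j<q. app n H v j = app n H w j)"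
        using uw by (auto simp: app_add)
    next
      assume *: "v \<in> carrier_vec n \<and> (\<exists>w\<in>flag n i. \<forall>j<q. app n H v j = app n H w j)"
      then obtain w where w: "w \<in> flag n i" "\<forall>j<q. app n H v j = app n H w j" by blast
      then have "w \<in> carrier_vec n" by (simp add: flag_eq)
      then have "v - w \<in> \<Lambda>" "v = (v - w) + w" using * w by (auto simp: presents_mem[OF A] app_diff)
      then show "\<exists>u\<in>\<Lambda>. \<exists>w\<in>flag n i. v = u + w" using w by blast
    qed
    also have "\<dots> \<longleftrightarrow> v \<in> carrier_vec n \<and> (\<forall>j<q. t_power (b j) dvd app n (mm {..<q} T' H) v j)"
    proof (intro conj_cong refl iffI allI impI)
      fix j assume j: "j < q" and "\<exists>w\<in>flag n i. \<forall>j<q. app n H v j = app n H w j"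
      then obtain w where w: "w \<in> flag n i" "\<forall>j<q. app n H v j = app n H w j" by blast
      have "app n (mm {..<q} T' H) v j = app n (mm {..<q} T' H) w j"
        using w by (simp add: app_mm)
      also have "\<dots> = (\<Sum>c\<in>?C. mm {..<q} T' H j c * w $ c)"
        unfolding app_def using w(1) by (intro sum.mono_neutral_right) (auto simp: flag_eq)
      also have "t_power (b j) dvd \<dots>"
        using S j by (intro dvd_sum) (simp add: smith_def)
      finally show "t_power (b j) dvd app n (mm {..<q} T' H) v j" .
    next
      assume "v \<in> carrier_vec n" and *: "\<forall>j<q. t_power (b j) dvd app n (mm {..<q} T' H) v j"
      have "\<forall>j\<in>{..<q}. \<exists>z. app n (mm {..<q} T' H) v j = t_power (b j) * z"
        using * by (auto simp: dvd_def)
      from bchoice[OF this] obtain z where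
        z: "\<forall>j\<in>{..<q}. app n (mm {..<q} T' H) v j = t_power (b j) * z j" ..
      \<comment> \<open>\<open>Y\<close> turns the combination \<open>z\<close> of the columns of
        \<open>T diag(t^b)\<close> into a combination of the last columns of \<open>H\<close>, that
        is, into a vector of the flag.\<close>
      define w where "w = vec n (\<lambda>c. if c \<in> ?C then \<Sum>j<q. Y c j * z j else 0)"
      have "app n H w a = app n H v a" if a: "a < q" for a
      proof -
        have "app n H w a = (\<Sum>c\<in>?C. H a c * w $ c)"
          unfolding app_def by (intro sum.mono_neutral_right) (auto simp: w_def)
        also have "\<dots> = (\<Sum>c\<in>?C. \<Sum>j<q. H a c * Y c j * z j)"
          by (intro sum.cong) (auto simp: w_def sum_distrib_left mult.assoc)
        also have "\<dots> = (\<Sum>j<q. mm ?C H Y a j * z j)"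
          by (subst sum.swap) (simp add: mm_def sum_distrib_right)
        also have "\<dots> = (\<Sum>j<q. T a j * app n (mm {..<q} T' H) v j)"
          using S a z by (intro sum.cong) (auto simp: smith_def mult.assoc)
        finally show ?thesis using TT[OF a] by simp
      qed
      moreover have "w \<in> flag n i" by (auto simp: flag_eq w_def)
      ultimately show "\<exists>w\<in>flag n i. \<forall>j<q. app n H v j = app n H w j" by metis
    qed
    finally show ?thesis .
  qed
  have "\<exists>v\<in>carrier_vec n. \<forall>j<q. t_power (b j) dvd app n (mm {..<q} T' H) v j - y j" for y
  proof -
    obtain v where v: "v \<in> carrier_vec n" "\<And>j. j < q \<Longrightarrow> t_power \<infinity> dvd app n H v j - (\<Sum>k<q. T j k * y k)"
      by (rule presents_lift[OF A, where y = "\<lambda>j. \<Sum>k<q. T j k * y k"]) blast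
    have "app n (mm {..<q} T' H) v j = y j" if "j < q" for j
    proof -
      have "app n (mm {..<q} T' H) v j = mm {..<q} T' (mm {..<q} T (\<lambda>k _. y k)) j ()"
        using v(2) by (simp add: app_mm) (simp add: mm_def)
      then show ?thesis using inv_pair_cancel[OF inv_pair_sym[OF T], of j] that by simp
    qed
    then show ?thesis by (intro bexI[OF _ v(1)]) simp
  qed
  then show ?thesis unfolding presents_def using mem by blast
qed

lemma inv_factors_smith:
  fixes H :: "nat \<Rightarrow> nat \<Rightarrow> 'k::field fps"
  assumes "arc_mat n (n - k) \<Lambda> H" "smith {..<n - k} {n - i..<n} H T T' (\<lambda>j. t_power (b j)) Q Y"
    and "\<And>i j. i \<le> j \<Longrightarrow> j < n - k \<Longrightarrow> b j \<le> b i"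
  shows "inv_factors k n \<Lambda> i = (\<lambda>j. if j \<in> {1..n - k} then b (j - 1) else 0)"
  using inv_factors_eq[OF presents_add_flag[OF assms(1,2)] assms(3)] .

section \<open>Interlacing of invariant factors\<close>

lemma smith_factor:
  assumes "smith S C H T T' d Q Y" "finite S" "a \<in> S" "c \<in> C"
  shows "H a c = (\<Sum>k\<in>S. T a k * (d k * Q k c))"
proof -
  have "H a c = mm S T (mm S T' H) a c"
    using assms by (subst inv_pair_cancel) (auto simp: smith_def)
  also have "\<dots> = (\<Sum>k\<in>S. T a k * (d k * Q k c))"
    unfolding mm_def[of S T] using assms by (intro sum.cong) (auto simp: smith_def)
  finally show ?thesis .
qed

text \<open>For \<open>C \<subseteq> C2\<close> the span of \<open>T diag(d)\<close> lies in that of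
  \<open>T2 diag(d2)\<close>. The inclusion has the matrix \<open>Q2 Y\<close>, which is the change
  of basis \<open>T2' T\<close> with the diagonal factors moved across.\<close>

lemma smith_transition:
  assumes 1: "smith S C H T T' d Q Y" and "C \<subseteq> C2" and 2: "smith S C2 H T2 T2' d2 Q2 Y2"
    and aj: "a \<in> S" "j \<in> S"
  shows "mm S T2' T a j * d j = d2 a * mm C Q2 Y a j"
proof -
  have "mm S T2' T a j * d j = (\<Sum>k\<in>S. T2' a k * mm C H Y k j)"
    using 1 aj by (auto simp: smith_def mm_def[of S] sum_distrib_right mult.assoc intro!: sum.cong)
  also have "\<dots> = mm S T2' (mm C H Y) a j" by (simp add: mm_def[of S])
  also have "\<dots> = mm C (mm S T2' H) Y a j" by (simp add: mm_assoc)
  also have "\<dots> = (\<Sum>c\<in>C. d2 a * Q2 a c * Y c j)"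
    unfolding mm_def[of C] using 2 assms(2) aj by (intro sum.cong) (auto simp: smith_def)
  finally show ?thesis by (simp add: mm_def sum_distrib_left mult.assoc)
qed

text \<open>The span with column \<open>c\<close> is generated by the span without it and by the new
  column, so the inclusion matrix and the coordinates \<open>Q2 a c\<close> together split the
  identity. The factor \<open>d2 a\<close> may be 0 and has to remain.\<close>

lemma smith_generation:
  assumes 1: "smith S C H T T' d Q Y" and 2: "smith S (insert c C) H T2 T2' d2 Q2 Y2"
    and "c \<notin> C" "finite C" "finite S" and aj: "a \<in> S" "j \<in> S"
  shows "d2 a * (mm S (mm C Q2 Y) (mm C Q Y2) a j + Q2 a c * Y2 c j) = d2 a * idm a j"
proof -
  have inv: "inv_pair S T2 T2'" using 2 by (simp add: smith_def)
  have "mm S (mm S T2' T2) (\<lambda>a j. if a = j then d2 j else 0) a j = d2 a * idm a j"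
  proof -
    have "mm S (mm S T2' T2) (\<lambda>a j. if a = j then d2 j else 0) a j = mm S idm (\<lambda>a j. if a = j then d2 j else 0) a j"
      using inv aj by (intro mm_cong) (auto simp: inv_pair_def)
    then show ?thesis using assms(5) aj by (simp add: mm_idm_left idm_def)
  qed
  moreover have "mm S (mm S T2' T2) (\<lambda>a j. if a = j then d2 j else 0) a j = mm S T2' T2 a j * d2 j"
    using assms(5) aj by (simp add: mm_def if_distrib cong: if_cong)
  ultimately have "d2 a * idm a j = mm S T2' T2 a j * d2 j" by simp
  also have "\<dots> = mm S T2' (mm (insert c C) H Y2) a j"
    using 2 aj by (auto simp: smith_def mm_def[of S] sum_distrib_right mult.assoc intro!: sum.cong)
  also have "\<dots> = mm (insert c C) (mm S T2' H) Y2 a j" by (simp add: mm_assoc)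
  also have "\<dots> = mm S T2' H a c * Y2 c j + mm C (mm S T2' H) Y2 a j"
    using assms by (simp add: mm_def)
  also have "mm S T2' H a c = d2 a * Q2 a c" using 2 aj by (simp add: smith_def)
  also have "mm C (mm S T2' H) Y2 a j = d2 a * mm S (mm C Q2 Y) (mm C Q Y2) a j"
  proof -
    have "mm S T2' H a c' = (\<Sum>k\<in>S. d2 a * mm C Q2 Y a k * Q k c')" if "c' \<in> C" for c'
    proof -
      have "mm S T2' H a c' = mm S T2' (mm S T (\<lambda>k c. d k * Q k c)) a c'"
        unfolding mm_def using smith_factor[OF 1 assms(5) _ that]
        by (intro sum.cong) (simp_all add: mm_def)
      also have "\<dots> = mm S (mm S T2' T) (\<lambda>k c. d k * Q k c) a c'" by (simp add: mm_assoc)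
      also have "\<dots> = (\<Sum>k\<in>S. (mm S T2' T a k * d k) * Q k c')"
        by (simp add: mm_def[of _ "mm S T2' T"] mult.assoc)
      also have "\<dots> = (\<Sum>k\<in>S. d2 a * mm C Q2 Y a k * Q k c')"
        by (intro sum.cong refl) (simp add: smith_transition[OF 1 subset_insertI 2 aj(1)])
      finally show ?thesis .
    qed
    then have "mm C (mm S T2' H) Y2 a j = (\<Sum>c'\<in>C. (\<Sum>k\<in>S. d2 a * mm C Q2 Y a k * Q k c') * Y2 c' j)"
      unfolding mm_def[of C "mm S T2' H"] by (intro sum.cong) auto
    also have "\<dots> = mm C (mm S (\<lambda>a k. d2 a * mm C Q2 Y a k) Q) Y2 a j"
      by (simp add: mm_def)
    also have "\<dots> = mm S (\<lambda>a k. d2 a * mm C Q2 Y a k) (mm C Q Y2) a j"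
      by (simp add: mm_assoc)
    also have "\<dots> = d2 a * mm S (mm C Q2 Y) (mm C Q Y2) a j"
      unfolding mm_def[of S] by (simp add: sum_distrib_left mult.assoc)
    finally show ?thesis .
  qed
  finally show ?thesis by (simp add: algebra_simps)
qed

text \<open>The data that \<open>smith_transition\<close> and \<open>smith_generation\<close>
  extract from two Smith forms suffice to build the second from the first: \<open>T = P R\<close>
  compares the bases, \<open>E\<close> is the inclusion, and \<open>w\<close> gives the coordinates
  of the new column.\<close>

lemma smith_extend:
  assumes 1: "smith S C H T T' d Q Y" and "c \<notin> C" "finite C" "finite S"
    and P: "inv_pair S P P'" and T: "\<And>a j. a \<in> S \<Longrightarrow> j \<in> S \<Longrightarrow> T a j = mm S P R a j"
    and RE: "\<And>a j. a \<in> S \<Longrightarrow> j \<in> S \<Longrightarrow> R a j * d j = d2 a * E a j"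
    and Hc: "\<And>a. a \<in> S \<Longrightarrow> H a c = (\<Sum>k\<in>S. P a k * (d2 k * w k))"
    and gen: "\<And>a j. a \<in> S \<Longrightarrow> j \<in> S \<Longrightarrow> d2 a * (mm S E Z a j + w a * y j) = d2 a * idm a j"
  shows "\<exists>Q2 Y2. smith S (insert c C) H P P' d2 Q2 Y2"
proof -
  define Q2 where "Q2 = (\<lambda>a c'. if c' = c then w a else mm S E Q a c')"
  define Y2 where "Y2 = (\<lambda>c' j. if c' = c then y j else mm S Y Z c' j)"
  have "mm S P' H a c' = d2 a * Q2 a c'" if a: "a \<in> S" and c': "c' \<in> insert c C" for a c'
  proof (cases "c' = c")
    case True
    have "mm S P' H a c = mm S P' (mm S P (\<lambda>k _. d2 k * w k)) a ()"
      by (simp add: mm_def Hc)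
    also have "\<dots> = d2 a * w a" using inv_pair_sym[OF P] a assms(4) by (simp add: inv_pair_cancel)
    finally show ?thesis using True by (simp add: Q2_def)
  next
    case False
    then have c': "c' \<in> C" using c' by simp
    have "mm S P' H a c' = mm S P' (mm S P (mm S R (\<lambda>k c. d k * Q k c))) a c'"
    proof (rule mm_cong)
      fix k assume k: "k \<in> S"
      have "H k c' = mm S T (\<lambda>k c. d k * Q k c) k c'"
        using smith_factor[OF 1 assms(4) k c'] by (simp add: mm_def)
      also have "\<dots> = mm S (mm S P R) (\<lambda>k c. d k * Q k c) k c'"
        using T k by (intro mm_cong) auto
      finally show "H k c' = mm S P (mm S R (\<lambda>k c. d k * Q k c)) k c'" by (simp add: mm_assoc)
    qed simp
    also have "\<dots> = mm S R (\<lambda>k c. d k * Q k c) a c'"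
      using inv_pair_sym[OF P] a assms(4) by (simp add: inv_pair_cancel)
    also have "\<dots> = (\<Sum>k\<in>S. (d2 a * E a k) * Q k c')"
      unfolding mm_def using RE[OF a] by (intro sum.cong) (simp_all add: mult.assoc[symmetric])
    finally show ?thesis using False by (simp add: Q2_def mm_def sum_distrib_left mult.assoc)
  qed
  moreover have "mm (insert c C) H Y2 a j = P a j * d2 j" if aj: "a \<in> S" "j \<in> S" for a j
  proof -
    have "mm (insert c C) H Y2 a j = H a c * y j + mm C H Y2 a j"
      using assms by (simp add: mm_def Y2_def)
    also have "mm C H Y2 a j = mm C H (mm S Y Z) a j"
      using assms by (intro mm_cong) (auto simp: Y2_def)
    also have "\<dots> = mm S (mm C H Y) Z a j" by (simp add: mm_assoc)
    also have "\<dots> = mm S (mm S P (\<lambda>k j. d2 k * E k j)) Z a j"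
    proof (rule mm_cong)
      fix k assume k: "k \<in> S"
      have "mm C H Y a k = mm S P R a k * d k" using 1 aj k T by (simp add: smith_def)
      also have "\<dots> = mm S P (\<lambda>k j. d2 k * E k j) a k"
        unfolding mm_def sum_distrib_right using RE k by (intro sum.cong) (auto simp: mult.assoc)
      finally show "mm C H Y a k = mm S P (\<lambda>k j. d2 k * E k j) a k" .
    qed simp
    also have "\<dots> = (\<Sum>k\<in>S. P a k * (d2 k * mm S E Z k j))"
      by (simp add: mm_assoc) (simp add: mm_def sum_distrib_left mult.assoc)
    also have "H a c * y j = (\<Sum>k\<in>S. P a k * (d2 k * (w k * y j)))"
      using Hc[OF aj(1)] by (simp add: sum_distrib_right mult.assoc)
    finally have "mm (insert c C) H Y2 a j = (\<Sum>k\<in>S. P a k * (d2 k * (mm S E Z k j + w k * y j)))"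
      by (simp add: distrib_left sum.distrib add.commute)
    also have "\<dots> = (\<Sum>k\<in>S. P a k * (d2 k * idm k j))"
      using gen aj by (intro sum.cong) auto
    also have "\<dots> = mm S P idm a j * d2 j"
      unfolding mm_def sum_distrib_right by (intro sum.cong) (auto simp: idm_def)
    finally show ?thesis using aj assms(4) by (simp add: mm_idm_right)
  qed
  ultimately have "smith S (insert c C) H P P' d2 Q2 Y2"
    using P unfolding smith_def by blast
  then show ?thesis by blast
qed

definition antitone_below :: "nat \<Rightarrow> (nat \<Rightarrow> enat) \<Rightarrow> bool" where
  "antitone_below q b \<longleftrightarrow> (\<forall>i j. i \<le> j \<longrightarrow> j < q \<longrightarrow> b j \<le> b i)"

lemma fps_nth_mult_t_power_eq_0:
  "enat m < b \<Longrightarrow> fps_nth (f * t_power b) m = (0 :: 'k::field)"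
  using t_power_dvd_iff[of b "f * t_power b"] by simp

text \<open>If \<open>b2 j > b j\<close>, the constant terms of the invertible matrix
  \<open>S\<close> vanish in rows up to \<open>j\<close> and columns from \<open>j\<close> on, which
  leaves \<open>j + 1\<close> independent rows in \<open>j\<close> columns. If
  \<open>b2 j < b (j + 1)\<close>, the constant terms of the inclusion \<open>E\<close> vanish in
  rows from \<open>j\<close> on and columns up to \<open>j + 1\<close>, so the last
  \<open>q - j\<close> coordinates would be generated by \<open>q - j - 2\<close> old columns and
  one new column.\<close>

lemma smith_chain_interlacing:
  fixes H :: "nat \<Rightarrow> nat \<Rightarrow> 'k::field fps"
  assumes 1: "smith {..<q} C H T T' (\<lambda>j. t_power (b j)) Q Y"
    and 2: "smith {..<q} (insert c C) H T2 T2' (\<lambda>j. t_power (b2 j)) Q2 Y2"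
    and "c \<notin> C" "finite C" and anti: "antitone_below q b" "antitone_below q b2"
  shows "j < q \<Longrightarrow> b2 j \<le> b j" and "j + 1 < q \<Longrightarrow> b (j + 1) \<le> b2 j"
proof -
  define S where "S = mm {..<q} T2' T"
  define S' where "S' = mm {..<q} T' T2"
  define E where "E = mm C Q2 Y"
  have SE: "S a k * t_power (b k) = t_power (b2 a) * E a k" if "a < q" "k < q" for a k
    unfolding S_def E_def using that by (intro smith_transition[OF 1 _ 2]) auto
  have inv: "inv_pair {..<q} S S'"
    using 1 2 unfolding S_def S'_def by (intro inv_pair_mm) (auto simp: smith_def inv_pair_sym)
  show "b2 j \<le> b j" if "j < q"
  proof (rule ccontr)
    assume "\<not> b2 j \<le> b j"
    then have lt: "b j < b2 j" by simp
    have S0: "fps_nth (S a k) 0 = 0" if "a \<le> j" "j \<le> k" "k < q" for a k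
    proof -
      have "b k < b2 a" using anti that lt \<open>j < q\<close> unfolding antitone_below_def
        by (meson le_less_trans less_le_trans)
      then obtain m where m: "b k = enat m" by (cases "b k") auto
      have "fps_nth (S a k * t_power (b k)) m = 0"
        using SE[of a k] that \<open>b k < b2 a\<close> m fps_nth_mult_t_power_eq_0[of m "b2 a" "E a k"]
        by (simp add: mult.commute)
      then show ?thesis by (simp add: m t_power_enat fps_X_power_mult_right_nth)
    qed
    have "mm {..<j} (\<lambda>a k. fps_nth (S a k) 0) (\<lambda>a k. fps_nth (S' a k) 0) a a' = idm a a'"
      if "a \<le> j" "a' \<le> j" for a a'
    proof -
      have "fps_nth (mm {..<q} S S' a a') 0 = idm a a'"
        using inv that \<open>j < q\<close> by (simp add: inv_pair_def idm_def)
      then have "(\<Sum>k<q. fps_nth (S a k) 0 * fps_nth (S' k a') 0) = idm a a'"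
        by (simp add: mm_def fps_sum_nth)
      moreover have "(\<Sum>k<q. fps_nth (S a k) 0 * fps_nth (S' k a') 0) = (\<Sum>k<j. fps_nth (S a k) 0 * fps_nth (S' k a') 0)"
        using \<open>j < q\<close> S0[OF that(1)] by (intro sum.mono_neutral_right) auto
      ultimately show ?thesis by (simp add: mm_def)
    qed
    then show False
      by (intro no_identity_factorization[of "{..j}" "{..<j}"]) auto
  qed
  show "b (j + 1) \<le> b2 j" if "j + 1 < q"
  proof (rule ccontr)
    assume "\<not> b (j + 1) \<le> b2 j"
    then have lt: "b2 j < b (j + 1)" by simp
    define Z where "Z = mm C Q Y2"
    \<comment> \<open>From row \<open>j\<close> on the exponents \<open>b2\<close> are finite, so
      that the powers of \<open>t\<close> can be cancelled there.\<close>
    have fin: "\<exists>m. b2 a = enat m" if "j \<le> a" "a < q" for a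
    proof -
      have "b2 a \<le> b2 j" using anti that unfolding antitone_below_def by blast
      then have "b2 a < \<infinity>" using lt by (metis enat_ord_simps(6) le_less_trans less_le_trans linorder_not_less)
      then show ?thesis by auto
    qed
    have E0: "fps_nth (E a k) 0 = 0" if "j \<le> a" "a < q" "k \<le> j + 1" for a k
    proof -
      have "b2 a < b k" using anti that lt \<open>j + 1 < q\<close> unfolding antitone_below_def
        by (meson le_less_trans less_le_trans)
      moreover from fin[OF that(1,2)] obtain m where m: "b2 a = enat m" ..
      ultimately have "fps_nth (t_power (b2 a) * E a k) m = 0"
        using SE[of a k] that \<open>j + 1 < q\<close> fps_nth_mult_t_power_eq_0[of m "b k" "S a k"] by simp
      then show ?thesis by (simp add: m t_power_enat fps_X_power_mult_nth)
    qed
    have gen: "mm {..<q} E Z a a' + Q2 a c * Y2 c a' = idm a a'"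
      if "j \<le> a" "a < q" "a' < q" for a a'
    proof -
      from fin[OF that(1,2)] obtain m where m: "b2 a = enat m" ..
      have "t_power (b2 a) * (mm {..<q} E Z a a' + Q2 a c * Y2 c a') = t_power (b2 a) * idm a a'"
        unfolding E_def Z_def using that assms by (intro smith_generation[OF 1 2]) auto
      then show ?thesis by (simp add: m t_power_enat)
    qed
    \<comment> \<open>The index \<open>j + 1\<close>, at which the constant terms of
      \<open>E\<close> vanish, is reused for the new column.\<close>
    define B where "B = (\<lambda>a k. if k = j + 1 then fps_nth (Q2 a c) 0 else fps_nth (E a k) 0)"
    define B' where "B' = (\<lambda>k a. if k = j + 1 then fps_nth (Y2 c a) 0 else fps_nth (Z k a) 0)"
    have "mm {j + 1..<q} B B' a a' = idm a a'" if "j \<le> a" "a < q" "a' < q" for a a'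
    proof -
      have "fps_nth (mm {..<q} E Z a a' + Q2 a c * Y2 c a') 0 = idm a a'"
        by (simp only: gen[OF that]) (simp add: idm_def)
      then have "(\<Sum>k<q. fps_nth (E a k) 0 * fps_nth (Z k a') 0) + fps_nth (Q2 a c) 0 * fps_nth (Y2 c a') 0 = idm a a'"
        by (simp add: mm_def fps_sum_nth)
      moreover have "(\<Sum>k<q. fps_nth (E a k) 0 * fps_nth (Z k a') 0) = (\<Sum>k\<in>{j + 2..<q}. fps_nth (E a k) 0 * fps_nth (Z k a') 0)"
        using E0[OF that(1,2)] by (intro sum.mono_neutral_right) auto
      moreover have "{j + 1..<q} = insert (j + 1) {j + 2..<q}" using \<open>j + 1 < q\<close> by auto
      moreover have "(\<Sum>k\<in>{j + 2..<q}. B a k * B' k a') = (\<Sum>k\<in>{j + 2..<q}. fps_nth (E a k) 0 * fps_nth (Z k a') 0)"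
        by (intro sum.cong) (auto simp: B_def B'_def)
      ultimately show ?thesis by (simp add: mm_def) (simp add: B_def B'_def algebra_simps)
    qed
    then show False using \<open>j + 1 < q\<close>
      by (intro no_identity_factorization[of "{j..<q}" "{j + 1..<q}"]) auto
  qed
qed

section \<open>The chain of Smith forms of an arc and its profile\<close>

lemma arc_smith_chain:
  fixes H :: "nat \<Rightarrow> nat \<Rightarrow> 'k::field fps"
  shows "\<exists>T T' b Q Y. \<forall>i. smith {..<q} {n - i..<n} H (T i) (T' i) (\<lambda>j. t_power (b i j)) (Q i) (Y i)
    \<and> antitone_below q (b i)"
proof -
  have "\<forall>i. \<exists>x. smith {..<q} {n - i..<n} H (fst x) (fst (snd x)) (\<lambda>j. t_power (fst (snd (snd x)) j))
      (fst (snd (snd (snd x)))) (snd (snd (snd (snd x)))) \<and> antitone_below q (fst (snd (snd x)))"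
  proof
    fix i
    obtain T T' b Q Y where "smith {..<q} {n - i..<n} H T T' (\<lambda>j. t_power (b j)) Q Y" "antitone_below q b"
      using smith_fps[of "{n - i..<n}" q H] unfolding antitone_below_def by blast
    then show "\<exists>x. smith {..<q} {n - i..<n} H (fst x) (fst (snd x)) (\<lambda>j. t_power (fst (snd (snd x)) j))
      (fst (snd (snd (snd x)))) (snd (snd (snd (snd x)))) \<and> antitone_below q (fst (snd (snd x)))"
      by (intro exI[of _ "(T, T', b, Q, Y)"]) simp
  qed
  from choice[OF this] obtain f where f: "\<forall>i. smith {..<q} {n - i..<n} H (fst (f i)) (fst (snd (f i)))
      (\<lambda>j. t_power (fst (snd (snd (f i))) j)) (fst (snd (snd (snd (f i))))) (snd (snd (snd (snd (f i)))))
      \<and> antitone_below q (fst (snd (snd (f i))))" ..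
  show ?thesis
    by (rule exI[of _ "\<lambda>i. fst (f i)"], rule exI[of _ "\<lambda>i. fst (snd (f i))"],
        rule exI[of _ "\<lambda>i. fst (snd (snd (f i)))"], rule exI[of _ "\<lambda>i. fst (snd (snd (snd (f i))))"],
        rule exI[of _ "\<lambda>i. snd (snd (snd (snd (f i))))"]) (rule f)
qed

lemma smith_empty_infty:
  fixes H :: "nat \<Rightarrow> nat \<Rightarrow> 'k::field fps"
  assumes "smith {..<q} {} H T T' (\<lambda>j. t_power (b j)) Q Y" "j < q"
  shows "b j = \<infinity>"
proof -
  have *: "T a j * t_power (b j) = 0" if "a < q" for a
    using assms that by (simp add: smith_def mm_def)
  have "mm {..<q} T' T j j * t_power (b j) = 0"
    unfolding mm_def sum_distrib_right using * by (intro sum.neutral) (simp add: mult.assoc)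
  then have "t_power (b j) = (0 :: 'k fps)"
    using assms by (simp add: smith_def inv_pair_def idm_def)
  then show ?thesis by (cases "b j") (auto simp: t_power_def)
qed

text \<open>\<open>H\<close> is onto, so the cokernel of all its columns is 0.\<close>

lemma smith_full_zero:
  fixes H :: "nat \<Rightarrow> nat \<Rightarrow> 'k::field fps"
  assumes A: "arc_mat n q \<Lambda> H" and S: "smith {..<q} {..<n} H T T' (\<lambda>j. t_power (b j)) Q Y" and j: "j < q"
  shows "b j = 0"
proof -
  obtain v where v: "v \<in> carrier_vec n" "\<And>a. a < q \<Longrightarrow> t_power \<infinity> dvd app n H v a - T a j"
    by (rule presents_lift[OF A, where y = "\<lambda>a. T a j"]) blast
  have "t_power (b j) dvd app n (mm {..<q} T' H) v j"
    unfolding app_def using S j by (intro dvd_sum) (simp add: smith_def)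
  also have "app n (mm {..<q} T' H) v j = mm {..<q} T' T j j"
    using v by (simp add: app_mm mm_def)
  also have "\<dots> = 1" using S j by (simp add: smith_def inv_pair_def idm_def)
  finally have "(t_power (b j) :: 'k fps) dvd t_power 0" by simp
  then show ?thesis unfolding t_power_dvd_t_power_iff by simp
qed

text \<open>The invariant factors \<open>b\<close> of all \<open>\<Lambda> + F i\<close> from the profile: \<open>i\<close> is the number of the last
  basis vectors and \<open>j\<close> is counted from 0; outside the profile the value is forced.\<close>
definition full_profile :: "nat \<Rightarrow> nat \<Rightarrow> enat mat \<Rightarrow> nat \<Rightarrow> nat \<Rightarrow> enat" where
  "full_profile k q \<beta> i j =
     (if i + j < q then \<infinity> else if q + k \<le> i + j then 0 else \<beta> $$ (i + j - q, j))"

text \<open>A pattern of Gelfand-Tsetlin type: a new column lowers each exponent, but not below the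
  next old one. Without columns the cokernel is free, with all columns it is 0.\<close>

definition interlacing :: "nat \<Rightarrow> nat \<Rightarrow> (nat \<Rightarrow> nat \<Rightarrow> enat) \<Rightarrow> bool" where
  "interlacing n q b \<longleftrightarrow>
     (\<forall>i<n. \<forall>j<q. b (Suc i) j \<le> b i j) \<and> (\<forall>i<n. \<forall>j. j + 1 < q \<longrightarrow> b i (j + 1) \<le> b (Suc i) j) \<and>
     (\<forall>j<q. b 0 j = \<infinity>) \<and> (\<forall>j<q. b n j = 0)"

lemma interlacing_antitone:
  assumes "interlacing n q b" "i \<le> n"
  shows "antitone_below q (b i)"
proof -
  have s: "b i (j + 1) \<le> b i j" if "j + 1 < q" for j
  proof (cases "i < n")
    case True
    then show ?thesis using assms that unfolding interlacing_def by (meson add_lessD1 order_trans)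
  next
    case False
    then show ?thesis using assms that unfolding interlacing_def by auto
  qed
  have "b i j \<le> b i a" if "a \<le> j" "j < q" for a j
    using that
  proof (induction rule: dec_induct)
    case (step m)
    then show ?case using s[of m] by (auto intro: order_trans)
  qed simp
  then show ?thesis unfolding antitone_below_def by blast
qed

text \<open>The second inequality compares neighbours with the same \<open>i + j\<close>. Going back
  to \<open>i = 0\<close>, where all exponents are \<infinity>, gives this lemma, and going on to
  \<open>i = n\<close> gives the next one. This leaves the \<open>k (n - k)\<close> exponents with
  \<open>q \<le> i + j < n\<close>, which are the entries of the profile.\<close>

lemma interlacing_infty:
  assumes "interlacing n q b" "i \<le> n" "i + j < q"
  shows "b i j = \<infinity>"
  using assms(2,3)
proof (induction i arbitrary: j)
  case 0
  then show ?case using assms(1) by (simp add: interlacing_def)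
next
  case (Suc i)
  then have "b i (j + 1) = \<infinity>" by simp
  moreover have "b i (j + 1) \<le> b (Suc i) j" using assms(1) Suc.prems by (simp add: interlacing_def)
  ultimately show ?case by simp
qed

lemma interlacing_zero:
  assumes "interlacing n q b" "i \<le> n" "n \<le> i + j" "j < q"
  shows "b i j = 0"
  using assms(2-)
proof (induction "n - i" arbitrary: i j)
  case 0
  then show ?case using assms(1) by (simp add: interlacing_def)
next
  case (Suc d)
  then obtain j' where j: "j = j' + 1" by (cases j) auto
  have "i < n" "j' + 1 < q" using Suc.hyps(2) Suc.prems j by auto
  then have "b i (j' + 1) \<le> b (Suc i) j'" using assms(1) unfolding interlacing_def by blast
  moreover have "b (Suc i) j' = 0" using Suc j by simp
  ultimately show ?case using j by simp
qed

lemma arc_chain: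
  fixes H :: "nat \<Rightarrow> nat \<Rightarrow> 'k::field fps"
  assumes A: "arc_mat n (n - k) \<Lambda> H" and "k \<le> n"
  obtains T T' b Q Y where
    "\<And>i. smith {..<n - k} {n - i..<n} H (T i) (T' i) (\<lambda>j. t_power (b i j)) (Q i) (Y i)"
    "\<And>i. antitone_below (n - k) (b i)" "interlacing n (n - k) b"
    "\<And>i j. j < n - k \<Longrightarrow> inv_factors k n \<Lambda> i (j + 1) = b i j"
    "\<And>i j. i \<le> n \<Longrightarrow> j < n - k \<Longrightarrow> b i j = full_profile k (n - k) (profile k n \<Lambda>) i j"
proof -
  let ?q = "n - k"
  obtain T T' b Q Y where S': "\<forall>i. smith {..<?q} {n - i..<n} H (T i) (T' i) (\<lambda>j. t_power (b i j)) (Q i) (Y i)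
      \<and> antitone_below ?q (b i)"
    using arc_smith_chain by blast
  then have S: "\<And>i. smith {..<?q} {n - i..<n} H (T i) (T' i) (\<lambda>j. t_power (b i j)) (Q i) (Y i)"
    and anti: "\<And>i. antitone_below ?q (b i)" by blast+
  have ins: "{n - Suc i..<n} = insert (n - Suc i) {n - i..<n}" if "i < n" for i using that by auto
  have il: "interlacing n ?q b"
    unfolding interlacing_def
  proof (intro conjI allI impI)
    fix i j assume i: "i < n"
    note * = smith_chain_interlacing[OF S[of i] S[of "Suc i", unfolded ins[OF i]] _ _ anti anti]
    show "b (Suc i) j \<le> b i j" if "j < ?q" using * that i by simp
    show "b i (j + 1) \<le> b (Suc i) j" if "j + 1 < ?q" using * that i by simp
  next
    fix j assume j: "j < ?q"
    show "b 0 j = \<infinity>" using smith_empty_infty[OF _ j] S[of 0] by simp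
    show "b n j = 0" using smith_full_zero[OF A _ j] S[of n] by (simp add: lessThan_atLeast0)
  qed
  have inv: "inv_factors k n \<Lambda> i (j + 1) = b i j" if "j < ?q" for i j
    using inv_factors_smith[OF A S[of i]] anti[of i] that by (simp add: antitone_below_def)
  have full: "b i j = full_profile k ?q (profile k n \<Lambda>) i j" if "i \<le> n" "j < ?q" for i j
  proof -
    consider "i + j < ?q" | "n \<le> i + j" | "?q \<le> i + j" "i + j < n" by linarith
    then show ?thesis
    proof cases
      case 3
      then have "full_profile k ?q (profile k n \<Lambda>) i j = inv_factors k n \<Lambda> i (j + 1)"
        using that assms(2) by (auto simp: full_profile_def profile_def)
      then show ?thesis using inv that by simp
    qed (use that assms(2) interlacing_infty[OF il] interlacing_zero[OF il] in \<open>auto simp: full_profile_def\<close>)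
  qed
  show ?thesis by (rule that[OF S anti il inv full])
qed

text \<open>In the profile a step down keeps \<open>j\<close> and raises \<open>i\<close> by one,
  and a step to the right raises \<open>j\<close> and lowers \<open>i\<close> by one. The
  inequalities of a plane partition are thus the two interlacing inequalities.\<close>

lemma profile_plane_partition:
  fixes \<Lambda> :: "'k::field fps vec set"
  assumes "is_arc k n \<Lambda>" "k \<le> n"
  shows "plane_partition k (n - k) (profile k n \<Lambda>)"
proof -
  let ?q = "n - k"
  obtain H where A: "arc_mat n ?q \<Lambda> H" using assms(1) is_arc_iff by blast
  obtain b where il: "interlacing n ?q b"
    and inv: "\<And>i j. j < ?q \<Longrightarrow> inv_factors k n \<Lambda> i (j + 1) = b i j"
    using arc_chain[OF A assms(2)] by metis
  have p: "profile k n \<Lambda> $$ (r, c) = b (r + ?q - c) c" if "r < k" "c < ?q" for r c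
    using that inv[of c] by (simp add: profile_def)
  show ?thesis
    unfolding plane_partition_def
  proof (intro conjI allI impI)
    show "profile k n \<Lambda> \<in> carrier_mat k ?q" by (simp add: profile_def)
    fix r c
    assume rc: "r + 1 < k \<and> c < ?q"
    then have "r + 1 + ?q - c = Suc (r + ?q - c)" "r + ?q - c < n" using assms(2) by auto
    then show "profile k n \<Lambda> $$ (r + 1, c) \<le> profile k n \<Lambda> $$ (r, c)"
      using rc il by (simp add: p interlacing_def)
  next
    fix r c
    assume rc: "r < k \<and> c + 1 < ?q"
    then have "r + ?q - c = Suc (r + ?q - (c + 1))" "r + ?q - (c + 1) < n" using assms(2) by auto
    then have "b (r + ?q - (c + 1)) (c + 1) \<le> b (r + ?q - c) c" using rc il unfolding interlacing_def by metis
    then show "profile k n \<Lambda> $$ (r, c + 1) \<le> profile k n \<Lambda> $$ (r, c)"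
      using rc p[of r c] p[of r "c + 1"] by simp
  qed
qed

lemma full_profile_interlacing:
  assumes "plane_partition k (n - k) \<beta>" "k \<le> n"
  shows "interlacing n (n - k) (full_profile k (n - k) \<beta>)"
proof -
  let ?q = "n - k"
  have row: "\<beta> $$ (r + 1, c) \<le> \<beta> $$ (r, c)" if "r + 1 < k" "c < ?q" for r c
    using assms(1) that by (simp add: plane_partition_def)
  have col: "\<beta> $$ (r, c + 1) \<le> \<beta> $$ (r, c)" if "r < k" "c + 1 < ?q" for r c
    using assms(1) that by (simp add: plane_partition_def)
  show ?thesis
    unfolding interlacing_def
  proof (intro conjI allI impI)
    fix i j assume "i < n" "j < ?q"
    then show "full_profile k ?q \<beta> (Suc i) j \<le> full_profile k ?q \<beta> i j"
      using row[of "i + j - ?q" j] by (auto simp: full_profile_def Suc_diff_le)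
  next
    fix i j assume "i < n" "j + 1 < ?q"
    then show "full_profile k ?q \<beta> i (j + 1) \<le> full_profile k ?q \<beta> (Suc i) j"
      using col[of "Suc (i + j) - ?q" j] by (auto simp: full_profile_def)
  qed (use assms(2) in \<open>auto simp: full_profile_def\<close>)
qed

section \<open>Arcs with a prescribed profile\<close>

text \<open>The basis \<open>T i\<close> in the Smith form of the last \<open>i\<close> columns is
  the product of \<open>S n\<close>, \<open>S (n - 1)\<close>, down to \<open>S i\<close>; the
  argument \<open>c\<close> stands for \<open>n - i\<close>. For \<open>i < n\<close> the factor
  \<open>S i\<close> is the change of basis between the stages \<open>i\<close> and
  \<open>i + 1\<close>, while \<open>S n\<close> is an invertible row operation.\<close>

primrec chain_prod :: "nat \<Rightarrow> nat \<Rightarrow> (nat \<Rightarrow> nat \<Rightarrow> nat \<Rightarrow> 'r::comm_ring_1) \<Rightarrow> nat \<Rightarrow> nat \<Rightarrow> nat \<Rightarrow> 'r" where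
  "chain_prod n q S 0 = S n"
| "chain_prod n q S (Suc c) = mm {..<q} (chain_prod n q S c) (S (n - Suc c))"

text \<open>Column \<open>c\<close> enters at stage \<open>i = n - c\<close>; there
  \<open>w i\<close> are its coordinates in the basis \<open>T i\<close> scaled by the powers of
  \<open>t\<close>. This turns a chain of Smith forms back into a matrix.\<close>

definition family_mat ::
  "nat \<Rightarrow> nat \<Rightarrow> (nat \<Rightarrow> nat \<Rightarrow> enat) \<Rightarrow> (nat \<Rightarrow> nat \<Rightarrow> nat \<Rightarrow> 'k::field fps) \<Rightarrow> (nat \<Rightarrow> nat \<Rightarrow> 'k fps)
    \<Rightarrow> nat \<Rightarrow> nat \<Rightarrow> 'k fps" where
  "family_mat n q b S w j c = (\<Sum>a<q. chain_prod n q S c j a * (t_power (b (n - c) a) * w (n - c) a))"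

text \<open>The relation of \<open>smith_transition\<close> for prescribed exponents. It is linear
  in the pair of \<open>S\<close> and \<open>E\<close>, and \<open>S\<close> does not determine the
  rows of \<open>E\<close> with exponent \<infinity>.\<close>

definition admissible ::
  "nat \<Rightarrow> nat \<Rightarrow> (nat \<Rightarrow> nat \<Rightarrow> enat) \<Rightarrow> (nat \<Rightarrow> nat \<Rightarrow> nat \<Rightarrow> 'k::field fps)
    \<Rightarrow> (nat \<Rightarrow> nat \<Rightarrow> nat \<Rightarrow> 'k fps) \<Rightarrow> bool" where
  "admissible n q b S E \<longleftrightarrow>
     (\<forall>i<n. \<forall>a<q. \<forall>j<q. S i a j * t_power (b i j) = t_power (b (Suc i) a) * E i a j)"

text \<open>For finite exponents the rows are those that \<open>smith_generation\<close> makes rows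
  of the identity. About the rows with exponent \<infinity> that relation says nothing, and
  \<open>N\<close> fills them.\<close>

definition gen_mat ::
  "nat \<Rightarrow> (nat \<Rightarrow> enat) \<Rightarrow> (nat \<Rightarrow> nat \<Rightarrow> 'k::field fps) \<Rightarrow> (nat \<Rightarrow> 'k fps) \<Rightarrow> (nat \<Rightarrow> nat \<Rightarrow> 'k fps)
    \<Rightarrow> (nat \<Rightarrow> 'k fps) \<Rightarrow> (nat \<Rightarrow> nat \<Rightarrow> 'k fps) \<Rightarrow> nat \<Rightarrow> nat \<Rightarrow> 'k fps" where
  "gen_mat q b E w Z y N a j = mm {..<q} E Z a j + w a * y j + (if b a = \<infinity> then N a j else 0)"

text \<open>Asking for a unit determinant instead of the identity matrix makes each condition open
  once \<open>Z\<close>, \<open>y\<close> and \<open>N\<close> are fixed.\<close>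

definition nondegenerate ::
  "nat \<Rightarrow> nat \<Rightarrow> (nat \<Rightarrow> nat \<Rightarrow> enat) \<Rightarrow> (nat \<Rightarrow> nat \<Rightarrow> nat \<Rightarrow> 'k::field fps)
    \<Rightarrow> (nat \<Rightarrow> nat \<Rightarrow> nat \<Rightarrow> 'k fps) \<Rightarrow> (nat \<Rightarrow> nat \<Rightarrow> 'k fps) \<Rightarrow> bool" where
  "nondegenerate n q b S E w \<longleftrightarrow> (\<forall>i\<le>n. det (mof q (S i)) dvd 1) \<and>
     (\<forall>i<n. \<exists>Z y N. det (mof q (gen_mat q (b (Suc i)) (E i) (w (Suc i)) Z y N)) dvd 1)"

lemma det_dvd_one_inverse:
  fixes M :: "nat \<Rightarrow> nat \<Rightarrow> 'r::comm_ring_1"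
  assumes "det (mof q M) dvd 1"
  obtains N where "inv_pair {..<q} M N"
proof -
  from assms obtain u where "1 = det (mof q M) * u" by (rule dvdE)
  then have "det (mof q M) * u = 1" by simp
  from that[OF det_unit_inverse[OF this]] show ?thesis .
qed

lemma chain_prod_inverse:
  assumes "\<forall>i\<le>n. det (mof q (S i)) dvd (1 :: 'r::comm_ring_1)" "c \<le> n"
  shows "\<exists>P'. inv_pair {..<q} (chain_prod n q S c) P'"
  using assms(2)
proof (induction c)
  case 0
  show ?case using assms(1) det_dvd_one_inverse by (metis chain_prod.simps(1) order_refl)
next
  case (Suc c)
  then obtain P' where P': "inv_pair {..<q} (chain_prod n q S c) P'" by auto
  have "det (mof q (S (n - Suc c))) dvd 1" using assms(1) by simp
  then obtain N where N: "inv_pair {..<q} (S (n - Suc c)) N" by (rule det_dvd_one_inverse)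
  have "inv_pair {..<q} (chain_prod n q S (Suc c)) (mm {..<q} N P')"
    using inv_pair_mm[OF P' N] by simp
  then show ?case by blast
qed

text \<open>Multiplication by the inverse from the right replaces \<open>Z\<close>, \<open>y\<close>
  and \<open>N\<close> by other matrices and yields the identity. The filled rows then disappear,
  because their factor \<open>t_power \<infinity>\<close> is 0.\<close>

lemma gen_mat_absorb:
  fixes E :: "nat \<Rightarrow> nat \<Rightarrow> 'k::field fps"
  assumes "det (mof q (gen_mat q b E w Z y N)) dvd 1"
  shows "\<exists>Z' y'. \<forall>a<q. \<forall>j<q.
    t_power (b a) * (mm {..<q} E Z' a j + w a * y' j) = t_power (b a) * idm a j"
proof -
  obtain V where V: "inv_pair {..<q} (gen_mat q b E w Z y N) V"
    using det_dvd_one_inverse[OF assms] by blast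
  define y' where "y' = (\<lambda>j. \<Sum>k<q. y k * V k j)"
  have "t_power (b a) * (mm {..<q} E (mm {..<q} Z V) a j + w a * y' j) = t_power (b a) * idm a j"
    if "a < q" "j < q" for a j
  proof -
    have ifs: "(\<Sum>k<q. (if P then f k else 0) * g k) = (if P then \<Sum>k<q. f k * g k else 0)"
      for P and f g :: "nat \<Rightarrow> 'k fps" by simp
    have "idm a j = mm {..<q} (gen_mat q b E w Z y N) V a j"
      using V that by (simp add: inv_pair_def)
    also have "\<dots> = mm {..<q} (mm {..<q} E Z) V a j + w a * y' j + (if b a = \<infinity> then mm {..<q} N V a j else 0)"
      unfolding mm_def[of _ "gen_mat q b E w Z y N"] mm_def[of _ "mm {..<q} E Z" V] mm_def[of _ N V]
      by (simp add: gen_mat_def y'_def distrib_right sum.distrib sum_distrib_left mult.assoc ifs)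
    finally have "t_power (b a) * idm a j
      = t_power (b a) * (mm {..<q} E (mm {..<q} Z V) a j + w a * y' j + (if b a = \<infinity> then mm {..<q} N V a j else 0))"
      by (simp only: mm_assoc)
    then show ?thesis by (cases "b a = \<infinity>") auto
  qed
  then show ?thesis by blast
qed

text \<open>Columns are added from the right by \<open>smith_extend\<close>; the start is the empty
  set of columns, where all exponents are \<infinity>.\<close>

lemma family_smith:
  fixes S :: "nat \<Rightarrow> nat \<Rightarrow> nat \<Rightarrow> 'k::field fps"
  assumes adm: "admissible n q b S E" and nd: "nondegenerate n q b S E w"
    and b0: "\<And>j. j < q \<Longrightarrow> b 0 j = \<infinity>" and "i \<le> n"
  shows "\<exists>T' Q Y. smith {..<q} {n - i..<n} (family_mat n q b S w) (chain_prod n q S (n - i)) T' (\<lambda>j. t_power (b i j)) Q Y"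
  using assms(4)
proof (induction i)
  case 0
  obtain T' where "inv_pair {..<q} (chain_prod n q S n) T'"
    using chain_prod_inverse[of n q S n] nd by (auto simp: nondegenerate_def)
  then have "smith {..<q} {n - 0..<n} (family_mat n q b S w) (chain_prod n q S (n - 0)) T' (\<lambda>j. t_power (b 0 j)) (\<lambda>_ _. 0) (\<lambda>_ _. 0)"
    using b0 by (simp add: smith_def mm_def)
  then show ?case by blast
next
  case (Suc i)
  let ?c = "n - Suc i"
  have c: "n - i = Suc ?c" "n - ?c = Suc i" "n - Suc ?c = i" using Suc.prems by auto
  obtain T' Q Y where sm: "smith {..<q} {n - i..<n} (family_mat n q b S w) (chain_prod n q S (n - i)) T' (\<lambda>j. t_power (b i j)) Q Y"
    using Suc by auto
  obtain P' where P': "inv_pair {..<q} (chain_prod n q S ?c) P'"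
    using chain_prod_inverse[of n q S ?c] nd by (auto simp: nondegenerate_def)
  from nd have "\<forall>i<n. \<exists>Z y N. det (mof q (gen_mat q (b (Suc i)) (E i) (w (Suc i)) Z y N)) dvd 1"
    unfolding nondegenerate_def by (rule conjunct2)
  then obtain Z y N where "det (mof q (gen_mat q (b (Suc i)) (E i) (w (Suc i)) Z y N)) dvd 1"
    using Suc.prems Suc_le_lessD by blast
  from gen_mat_absorb[OF this] obtain Z' y' where
    gen: "\<forall>a<q. \<forall>j<q. t_power (b (Suc i) a) * (mm {..<q} (E i) Z' a j + w (Suc i) a * y' j) = t_power (b (Suc i) a) * idm a j"
    by blast
  have "\<exists>Q2 Y2. smith {..<q} (insert ?c {n - i..<n}) (family_mat n q b S w) (chain_prod n q S ?c) P' (\<lambda>j. t_power (b (Suc i) j)) Q2 Y2"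
  proof (rule smith_extend[OF sm _ _ _ P', where R = "S i" and E = "E i" and w = "w (Suc i)" and Z = Z' and y = y'])
    show "chain_prod n q S (n - i) a j = mm {..<q} (chain_prod n q S ?c) (S i) a j" for a j
      unfolding c(1) by (simp add: c)
    show "S i a j * t_power (b i j) = t_power (b (Suc i) a) * E i a j" if "a \<in> {..<q}" "j \<in> {..<q}" for a j
      using adm Suc.prems that by (simp add: admissible_def)
    show "family_mat n q b S w a ?c = (\<Sum>k<q. chain_prod n q S ?c a k * (t_power (b (Suc i) k) * w (Suc i) k))" for a
      unfolding family_mat_def c(2) ..
  qed (use gen c(1) in auto)
  moreover have "insert ?c {n - i..<n} = {n - Suc i..<n}" using Suc.prems by auto
  ultimately show ?case by auto
qed

definition mat_kernel_set :: "nat \<Rightarrow> nat \<Rightarrow> (nat \<Rightarrow> nat \<Rightarrow> 'r::comm_ring_1) \<Rightarrow> 'r vec set" where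
  "mat_kernel_set n q H = {v \<in> carrier_vec n. \<forall>j<q. app n H v j = 0}"

lemma arc_mat_imp_kernel: "arc_mat n q \<Lambda> H \<Longrightarrow> \<Lambda> = mat_kernel_set n q H"
  by (simp add: presents_def mat_kernel_set_def)

lemma mat_kernel_set_cong:
  "(\<And>j c. j < q \<Longrightarrow> c < n \<Longrightarrow> H j c = H' j c) \<Longrightarrow> mat_kernel_set n q H = mat_kernel_set n q H'"
  by (simp add: mat_kernel_set_def app_def)

lemma arc_mat_kernelI:
  fixes H :: "nat \<Rightarrow> nat \<Rightarrow> 'k::field fps"
  assumes "\<And>a j. a < q \<Longrightarrow> j < q \<Longrightarrow> mm {..<n} H Y a j = T a j" "inv_pair {..<q} T T'"
  shows "arc_mat n q (mat_kernel_set n q H) H"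
  unfolding presents_def
proof (intro conjI allI)
  show "mat_kernel_set n q H = {v \<in> carrier_vec n. \<forall>j<q. t_power \<infinity> dvd app n H v j}"
    by (simp add: mat_kernel_set_def)
  fix y :: "nat \<Rightarrow> 'k fps"
  define z where "z = mm {..<q} T' (\<lambda>j (_ :: unit). y j)"
  define v where "v = vec n (\<lambda>c. \<Sum>j<q. Y c j * z j ())"
  have "app n H v a = y a" if "a < q" for a
  proof -
    have "app n H v a = mm {..<n} H (mm {..<q} Y z) a ()"
      by (simp add: app_def mm_def v_def)
    also have "\<dots> = mm {..<q} (mm {..<n} H Y) z a ()" by (simp add: mm_assoc)
    also have "\<dots> = mm {..<q} T z a ()" using assms(1) that by (intro mm_cong) auto
    also have "\<dots> = y a" unfolding z_def using assms(2) that by (simp add: inv_pair_cancel)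
    finally show ?thesis .
  qed
  then show "\<exists>v\<in>carrier_vec n. \<forall>j<q. t_power \<infinity> dvd app n H v j - y j"
    by (intro bexI[of _ v]) (simp_all add: v_def)
qed

lemma full_profile_entry: "r < k \<Longrightarrow> c < q \<Longrightarrow> full_profile k q \<beta> (r + q - c) c = \<beta> $$ (r, c)"
  by (simp add: full_profile_def)

text \<open>At the last stage all exponents are 0, so its Smith form contains a right inverse of
  \<open>H\<close> up to an invertible matrix, and the kernel is an arc. The earlier stages give the
  profile.\<close>

lemma family_arc:
  fixes S :: "nat \<Rightarrow> nat \<Rightarrow> nat \<Rightarrow> 'k::field fps"
  assumes \<beta>: "plane_partition k (n - k) \<beta>" and "k \<le> n"
    and adm: "admissible n (n - k) (full_profile k (n - k) \<beta>) S E"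
    and nd: "nondegenerate n (n - k) (full_profile k (n - k) \<beta>) S E w"
  defines "H \<equiv> family_mat n (n - k) (full_profile k (n - k) \<beta>) S w"
  shows "arc_mat n (n - k) (mat_kernel_set n (n - k) H) H"
    and "profile k n (mat_kernel_set n (n - k) H) = \<beta>"
proof -
  let ?q = "n - k" and ?b = "full_profile k (n - k) \<beta>"
  have il: "interlacing n ?q ?b" using full_profile_interlacing[OF \<beta> assms(2)] .
  have sm: "\<exists>T' Q Y. smith {..<?q} {n - i..<n} H (chain_prod n ?q S (n - i)) T' (\<lambda>j. t_power (?b i j)) Q Y"
    if "i \<le> n" for i
    unfolding H_def by (rule family_smith[OF adm nd _ that]) (use il in \<open>simp add: interlacing_def\<close>)
  obtain T' Q Y where *: "smith {..<?q} {..<n} H (chain_prod n ?q S 0) T' (\<lambda>j. t_power (?b n j)) Q Y"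
    using sm[of n] by (auto simp: lessThan_atLeast0)
  show A: "arc_mat n ?q (mat_kernel_set n ?q H) H"
  proof (rule arc_mat_kernelI)
    show "inv_pair {..<?q} (chain_prod n ?q S 0) T'" using * by (simp add: smith_def)
    show "mm {..<n} H Y a j = chain_prod n ?q S 0 a j" if "a < ?q" "j < ?q" for a j
      using * that il by (simp add: smith_def interlacing_def del: chain_prod.simps)
  qed
  have f: "inv_factors k n (mat_kernel_set n ?q H) i (j + 1) = ?b i j" if "i \<le> n" "j < ?q" for i j
  proof -
    from sm[OF that(1)] obtain T' Q Y where
      "smith {..<?q} {n - i..<n} H (chain_prod n ?q S (n - i)) T' (\<lambda>j. t_power (?b i j)) Q Y" by blast
    from inv_factors_smith[OF A this] show ?thesis
      using interlacing_antitone[OF il that(1)] that(2) by (auto simp: antitone_below_def)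
  qed
  show "profile k n (mat_kernel_set n ?q H) = \<beta>"
  proof (rule eq_matI)
    have d: "\<beta> \<in> carrier_mat k ?q" using \<beta> by (simp add: plane_partition_def)
    fix r c assume "r < dim_row \<beta>" "c < dim_col \<beta>"
    then have rc: "r < k" "c < ?q" using d by auto
    then have "profile k n (mat_kernel_set n ?q H) $$ (r, c) = ?b (r + ?q - c) c"
      using f[of "r + ?q - c" c] assms(2) by (simp add: profile_def)
    then show "profile k n (mat_kernel_set n ?q H) $$ (r, c) = \<beta> $$ (r, c)"
      by (simp only: full_profile_entry[OF rc])
  qed (use \<beta> in \<open>auto simp: profile_def plane_partition_def\<close>)
qed

text \<open>The changes of basis \<open>T' (Suc i) T i\<close> telescope. With \<open>T n\<close> as
  first factor their products are the bases of the given chain, so that the family reproduces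
  \<open>H\<close> itself.\<close>

lemma arc_in_family:
  fixes H :: "nat \<Rightarrow> nat \<Rightarrow> 'k::field fps"
  assumes A: "arc_mat n (n - k) \<Lambda> H" and "k \<le> n"
  defines "b \<equiv> full_profile k (n - k) (profile k n \<Lambda>)"
  shows "\<exists>S E w. admissible n (n - k) b S E \<and> nondegenerate n (n - k) b S E w \<and>
    \<Lambda> = mat_kernel_set n (n - k) (family_mat n (n - k) b S w)"
proof -
  let ?q = "n - k"
  obtain T T' b' Q Y where
    sm': "\<And>i. smith {..<?q} {n - i..<n} H (T i) (T' i) (\<lambda>j. t_power (b' i j)) (Q i) (Y i)"
    and bb: "\<And>i j. i \<le> n \<Longrightarrow> j < ?q \<Longrightarrow> b' i j = b i j"
    using arc_chain[OF A assms(2)] unfolding b_def by metis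
  have sm: "smith {..<?q} {n - i..<n} H (T i) (T' i) (\<lambda>j. t_power (b i j)) (Q i) (Y i)" if "i \<le> n" for i
    using sm'[of i] bb[OF that] by (simp add: smith_def)
  have inv: "inv_pair {..<?q} (T i) (T' i)" for i using sm'[of i] by (simp add: smith_def)
  have ins: "{n - Suc i..<n} = insert (n - Suc i) {n - i..<n}" if "i < n" for i using that by auto
  define S where "S i = (if i < n then mm {..<?q} (T' (Suc i)) (T i) else T n)" for i
  define E where "E i = mm {n - i..<n} (Q (Suc i)) (Y i)" for i
  define w where "w i a = Q i a (n - i)" for i a
  have adm: "admissible n ?q b S E"
    unfolding admissible_def
  proof (intro allI impI)
    fix i a j assume *: "i < n" "a < ?q" "j < ?q"
    have "mm {..<?q} (T' (Suc i)) (T i) a j * t_power (b i j) = t_power (b (Suc i) a) * mm {n - i..<n} (Q (Suc i)) (Y i) a j"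
      using * by (intro smith_transition[OF sm _ sm]) auto
    then show "S i a j * t_power (b i j) = t_power (b (Suc i) a) * E i a j"
      using * by (simp add: S_def E_def)
  qed
  have "det (mof ?q (S i)) dvd 1" for i
  proof -
    have "\<exists>N. inv_pair {..<?q} (S i) N"
      using inv_pair_mm[OF inv_pair_sym[OF inv[of "Suc i"]] inv[of i]] inv[of n] by (auto simp: S_def)
    then obtain N where "det (mof ?q (S i)) * det (mof ?q N) = 1" using inv_pair_det by blast
    then show ?thesis by (metis dvd_triv_left)
  qed
  moreover have "\<exists>Z y N. det (mof ?q (gen_mat ?q (b (Suc i)) (E i) (w (Suc i)) Z y N)) dvd 1" if i: "i < n" for i
  proof -
    let ?c = "n - Suc i"
    define Z where "Z = mm {n - i..<n} (Q i) (Y (Suc i))"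
    \<comment> \<open>On rows with exponent \<infinity> this choice makes the matrix the identity
      outright; on the other rows the finite power of \<open>t\<close> is cancelled.\<close>
    define N where "N = (\<lambda>a j. idm a j - mm {..<?q} (E i) Z a j - w (Suc i) a * Y (Suc i) ?c j)"
    have "gen_mat ?q (b (Suc i)) (E i) (w (Suc i)) Z (Y (Suc i) ?c) N a j = idm a j" if aj: "a < ?q" "j < ?q" for a j
    proof (cases "b (Suc i) a = \<infinity>")
      case True
      then show ?thesis by (simp add: gen_mat_def N_def)
    next
      case False
      have "t_power (b (Suc i) a) * (mm {..<?q} (E i) Z a j + Q (Suc i) a ?c * Y (Suc i) ?c j) = t_power (b (Suc i) a) * idm a j"
        unfolding E_def Z_def using i aj sm[of i] sm[of "Suc i", unfolded ins[OF i]]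
        by (intro smith_generation) auto
      then show ?thesis using False by (auto simp: gen_mat_def w_def t_power_enat)
    qed
    then have "mof ?q (gen_mat ?q (b (Suc i)) (E i) (w (Suc i)) Z (Y (Suc i) ?c) N) = 1\<^sub>m ?q"
      by (simp add: mof_eq_one)
    then have "det (mof ?q (gen_mat ?q (b (Suc i)) (E i) (w (Suc i)) Z (Y (Suc i) ?c) N)) dvd 1" by simp
    then show ?thesis by blast
  qed
  ultimately have nd: "nondegenerate n ?q b S E w" by (simp add: nondegenerate_def)
  have ch: "chain_prod n ?q S c a j = T (n - c) a j" if "c \<le> n" "a < ?q" "j < ?q" for c a j
    using that
  proof (induction c arbitrary: a j)
    case 0
    then show ?case by (simp add: S_def)
  next
    case (Suc c)
    have "S (n - Suc c) = mm {..<?q} (T' (n - c)) (T (n - Suc c))"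
      using Suc.prems by (simp add: S_def Suc_diff_Suc)
    then have "chain_prod n ?q S (Suc c) a j = mm {..<?q} (T (n - c)) (mm {..<?q} (T' (n - c)) (T (n - Suc c))) a j"
      using Suc.prems Suc.IH by (auto intro!: mm_cong)
    then show ?case using inv Suc.prems by (simp add: inv_pair_cancel)
  qed
  have "H j c = family_mat n ?q b S w j c" if "j < ?q" "c < n" for j c
  proof -
    have "H j c = (\<Sum>k<?q. T (n - c) j k * (t_power (b (n - c) k) * Q (n - c) k c))"
      using that by (intro smith_factor[OF sm]) auto
    also have "\<dots> = family_mat n ?q b S w j c"
      unfolding family_mat_def using that ch by (intro sum.cong) (auto simp: w_def)
    finally show ?thesis .
  qed
  then have "\<Lambda> = mat_kernel_set n ?q (family_mat n ?q b S w)"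
    unfolding arc_mat_imp_kernel[OF A] by (rule mat_kernel_set_cong)
  then show ?thesis using adm nd by blast
qed

lemma prod_list_diag_one:
  "(\<And>i. i < q \<Longrightarrow> M i i = 1) \<Longrightarrow> prod_list (diag_mat (mof q M)) = (1 :: 'r::comm_ring_1)"
proof -
  assume "\<And>i. i < q \<Longrightarrow> M i i = 1"
  then have "diag_mat (mof q M) = map (\<lambda>_. 1) [0..<q]" by (auto simp: diag_mat_def mof_def)
  then show ?thesis by (simp add: map_replicate_const)
qed

text \<open>The planar network: bidiagonal unipotent factors whose off-diagonal entries are as large as
  admissible make the new column a generator of the cokernel.\<close>

lemma exists_nondegenerate:
  assumes il: "interlacing n q b"
  shows "\<exists>S E w. admissible n q b S E \<and> nondegenerate n q b (S :: nat \<Rightarrow> nat \<Rightarrow> nat \<Rightarrow> 'k::field fps) E w"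
proof -
  \<comment> \<open>The entry above the diagonal has the least exponent for which \<open>E\<close>
    has an entry in K[[t]] there, namely 1; interlacing makes the differences of exponents
    meaningful. If both exponents are \<infinity>, both sides of the relation are 0.\<close>
  define S :: "nat \<Rightarrow> nat \<Rightarrow> nat \<Rightarrow> 'k fps" where
    "S i a j = (if a = j then 1 else if j = Suc a \<and> i < n then t_power (b (Suc i) a - b i j) else 0)" for i a j
  define E :: "nat \<Rightarrow> nat \<Rightarrow> nat \<Rightarrow> 'k fps" where
    "E i a j = (if a = j then t_power (b i a - b (Suc i) a) else if j = Suc a then 1 else 0)" for i a j
  define w :: "nat \<Rightarrow> nat \<Rightarrow> 'k fps" where "w i a = (if Suc a = q then 1 else 0)" for i a
  have ed: "t_power (x - y) * t_power y = (t_power x :: 'k fps)" if "y \<le> x" "y \<noteq> \<infinity>" for x y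
    using that by (cases x; cases y) (auto simp: t_power_def simp flip: power_add)
  have "admissible n q b S E"
    unfolding admissible_def
  proof (intro allI impI)
    fix i a j assume *: "i < n" "a < q" "j < q"
    have "b (Suc i) a \<le> b i a" using il * by (simp add: interlacing_def)
    moreover have "b i (Suc a) \<le> b (Suc i) a" if "j = Suc a" using il * that by (auto simp: interlacing_def)
    ultimately show "S i a j * t_power (b i j) = t_power (b (Suc i) a) * E i a j"
      using * ed[of "b (Suc i) a" "b i a"] ed[of "b i (Suc a)" "b (Suc i) a"]
      by (cases "b (Suc i) a"; cases "b i a"; cases "b i (Suc a)") (auto simp: S_def E_def mult.commute)
  qed
  moreover have "det (mof q (S i)) dvd 1" for i
  proof -
    have "det (mof q (S i)) = prod_list (diag_mat (mof q (S i)))"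
      by (intro det_upper_triangular[OF _ mof_carrier]) (auto simp: upper_triangular_def mof_def S_def)
    then show ?thesis by (simp add: prod_list_diag_one S_def)
  qed
  moreover have "\<exists>Z y N. det (mof q (gen_mat q (b (Suc i)) (E i) (w (Suc i)) Z y N)) dvd 1" for i
  proof -
    \<comment> \<open>\<open>Z\<close> shifts the columns of \<open>E\<close> by one, so that the
      ones above the diagonal move onto it. The last column is supplied by the new column
      \<open>w\<close>.\<close>
    define Z :: "nat \<Rightarrow> nat \<Rightarrow> 'k fps" where "Z k j = (if k = Suc j then 1 else 0)" for k j
    define U where "U = gen_mat q (b (Suc i)) (E i) (w (Suc i)) Z (\<lambda>j. if Suc j = q then 1 else 0) (\<lambda>_ _. 0)"
    have U: "U a j = (if Suc j < q then E i a (Suc j) else 0) + (if Suc a = q \<and> Suc j = q then 1 else 0)" for a j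
      by (auto simp: U_def gen_mat_def w_def mm_def Z_def if_distrib cong: if_cong)
    have "det (mof q U) = prod_list (diag_mat (mof q U))"
      by (intro det_lower_triangular[OF _ mof_carrier]) (auto simp: mof_def U E_def)
    also have "\<dots> = 1" by (intro prod_list_diag_one) (auto simp: U E_def)
    finally show ?thesis unfolding U_def by (metis dvd_refl)
  qed
  ultimately show ?thesis unfolding nondegenerate_def by blast
qed

lemma exists_arc_with_profile:
  assumes "plane_partition k (n - k) \<beta>" "k \<le> n"
  shows "\<exists>\<Lambda> :: 'k::field fps vec set. is_arc k n \<Lambda> \<and> profile k n \<Lambda> = \<beta>"
proof -
  obtain S E :: "nat \<Rightarrow> nat \<Rightarrow> nat \<Rightarrow> 'k fps" and w where
    *: "admissible n (n - k) (full_profile k (n - k) \<beta>) S E"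
      "nondegenerate n (n - k) (full_profile k (n - k) \<beta>) S E w"
    using exists_nondegenerate[OF full_profile_interlacing[OF assms]] by blast
  show ?thesis using family_arc[OF assms *] is_arc_iff by blast
qed

section \<open>Determinantal divisors\<close>

text \<open>Rows and columns are selected by arbitrary functions, so that expansions of determinants
  can run over all functions; a repetition gives 0, and reordering changes only the sign.\<close>

definition minor :: "nat \<Rightarrow> ('a \<Rightarrow> 'c \<Rightarrow> 'r::comm_ring_1) \<Rightarrow> (nat \<Rightarrow> 'a) \<Rightarrow> (nat \<Rightarrow> 'c) \<Rightarrow> 'r" where
  "minor r H \<rho> \<kappa> = det (mof r (\<lambda>i j. H (\<rho> i) (\<kappa> j)))"

text \<open>For \<open>g = 0\<close> this is the vanishing of all minors of size \<open>r\<close>,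
  for a power of \<open>t\<close> a lower bound on their orders.\<close>

definition dvd_minors :: "'r::comm_ring_1 \<Rightarrow> nat \<Rightarrow> 'a set \<Rightarrow> 'c set \<Rightarrow> ('a \<Rightarrow> 'c \<Rightarrow> 'r) \<Rightarrow> bool" where
  "dvd_minors g r S C H \<longleftrightarrow> (\<forall>\<rho> \<kappa>. (\<forall>i<r. \<rho> i \<in> S) \<longrightarrow> (\<forall>i<r. \<kappa> i \<in> C) \<longrightarrow> g dvd minor r H \<rho> \<kappa>)"

lemma det_mof: "det (mof r M) = (\<Sum>\<pi> | \<pi> permutes {..<r}. signof \<pi> * (\<Prod>i<r. M i (\<pi> i)))"
proof -
  have "(\<Prod>i<r. mof r M $$ (i, \<pi> i)) = (\<Prod>i<r. M i (\<pi> i))" if "\<pi> permutes {..<r}" for \<pi>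
    using permutes_in_image[OF that] by (intro prod.cong) (auto simp: mof_def)
  then show ?thesis unfolding det_def'[OF mof_carrier] lessThan_atLeast0[symmetric]
    by (intro sum.cong) auto
qed

lemma mof_cong: "(\<And>i j. i < r \<Longrightarrow> j < r \<Longrightarrow> M i j = M' i j) \<Longrightarrow> mof r M = mof r M'"
  by (intro eq_matI) (auto simp: mof_def)

lemma minor_cong:
  "(\<And>i j. i < r \<Longrightarrow> j < r \<Longrightarrow> H (\<rho> i) (\<kappa> j) = H' (\<rho>' i) (\<kappa>' j)) \<Longrightarrow> minor r H \<rho> \<kappa> = minor r H' \<rho>' \<kappa>'"
  unfolding minor_def by (rule arg_cong[of _ _ det], rule mof_cong)

lemma minor_transpose: "minor r (\<lambda>c a. H a c) \<kappa> \<rho> = minor r H \<rho> \<kappa>"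
proof -
  have "mof r (\<lambda>i j. H (\<rho> j) (\<kappa> i)) = transpose_mat (mof r (\<lambda>i j. H (\<rho> i) (\<kappa> j)))"
    by (intro eq_matI) (auto simp: mof_def)
  then show ?thesis unfolding minor_def by (simp add: det_transpose[OF mof_carrier])
qed

lemma dvd_minors_transpose: "dvd_minors g r C S (\<lambda>c a. H a c) \<longleftrightarrow> dvd_minors g r S C H"
proof -
  have "minor r (\<lambda>c a. H a c) \<rho> \<kappa> = minor r H \<kappa> \<rho>" for \<rho> \<kappa> by (rule minor_transpose)
  then show ?thesis unfolding dvd_minors_def by (simp only:) blast
qed

lemma dvd_minors_cong:
  assumes "\<And>a c. a \<in> S \<Longrightarrow> c \<in> C \<Longrightarrow> H a c = H' a c"
  shows "dvd_minors g r S C H \<longleftrightarrow> dvd_minors g r S C H'"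
proof -
  have "minor r H \<rho> \<kappa> = minor r H' \<rho> \<kappa>" if "\<forall>i<r. \<rho> i \<in> S" "\<forall>i<r. \<kappa> i \<in> C" for \<rho> \<kappa>
    using that assms by (intro minor_cong) auto
  then show ?thesis unfolding dvd_minors_def by auto
qed

text \<open>The Cauchy-Binet formula before terms are collected by the image of
  \<open>h\<close>.\<close>

lemma minor_mult_left:
  assumes "finite S"
  shows "minor r (mm S P H) \<rho> \<kappa> = (\<Sum>h\<in>{..<r} \<rightarrow>\<^sub>E S. (\<Prod>i<r. P (\<rho> i) (h i)) * minor r H h \<kappa>)"
proof -
  let ?\<Pi> = "{\<pi>. \<pi> permutes {..<r}}" and ?F = "{..<r} \<rightarrow>\<^sub>E S"
  have "minor r (mm S P H) \<rho> \<kappa> = (\<Sum>\<pi>\<in>?\<Pi>. signof \<pi> * (\<Prod>i<r. \<Sum>a\<in>S. P (\<rho> i) a * H a (\<kappa> (\<pi> i))))"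
    by (simp add: minor_def det_mof mm_def)
  also have "\<dots> = (\<Sum>\<pi>\<in>?\<Pi>. signof \<pi> * (\<Sum>h\<in>?F. \<Prod>i<r. P (\<rho> i) (h i) * H (h i) (\<kappa> (\<pi> i))))"
    using assms by (subst prod_sum_PiE) simp_all
  also have "\<dots> = (\<Sum>\<pi>\<in>?\<Pi>. \<Sum>h\<in>?F. (\<Prod>i<r. P (\<rho> i) (h i)) * (signof \<pi> * (\<Prod>i<r. H (h i) (\<kappa> (\<pi> i)))))"
    by (simp add: sum_distrib_left prod.distrib mult_ac)
  also have "\<dots> = (\<Sum>h\<in>?F. \<Sum>\<pi>\<in>?\<Pi>. (\<Prod>i<r. P (\<rho> i) (h i)) * (signof \<pi> * (\<Prod>i<r. H (h i) (\<kappa> (\<pi> i)))))"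
    by (rule sum.swap)
  also have "\<dots> = (\<Sum>h\<in>?F. (\<Prod>i<r. P (\<rho> i) (h i)) * minor r H h \<kappa>)"
    by (simp add: minor_def det_mof sum_distrib_left)
  finally show ?thesis .
qed

lemma dvd_minors_mult_left:
  assumes "finite S" "dvd_minors g r S C H"
  shows "dvd_minors g r S' C (mm S P H)"
  unfolding dvd_minors_def
proof (intro allI impI)
  fix \<rho> \<kappa> assume "\<forall>i<r. \<kappa> i \<in> C"
  then have m: "g dvd minor r H h \<kappa>" if "h \<in> {..<r} \<rightarrow>\<^sub>E S" for h
    using assms(2) that unfolding dvd_minors_def by (simp add: PiE_iff)
  show "g dvd minor r (mm S P H) \<rho> \<kappa>"
    unfolding minor_mult_left[OF assms(1)]
  proof (rule dvd_sum)
    fix h assume "h \<in> {..<r} \<rightarrow>\<^sub>E S"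
    then show "g dvd (\<Prod>i<r. P (\<rho> i) (h i)) * minor r H h \<kappa>" by (rule dvd_mult[OF m])
  qed
qed

lemma dvd_minors_mult_right:
  assumes "finite C" "dvd_minors g r S C H"
  shows "dvd_minors g r S C' (mm C H P)"
proof -
  have "dvd_minors g r C' S (mm C (\<lambda>c' c. P c c') (\<lambda>c a. H a c))"
    by (rule dvd_minors_mult_left[OF assms(1) dvd_minors_transpose[THEN iffD2, OF assms(2)]])
  also have "mm C (\<lambda>c' c. P c c') (\<lambda>c a. H a c) = (\<lambda>c a. mm C H P a c)"
    by (simp add: mm_def mult.commute fun_eq_iff)
  finally show ?thesis by (rule dvd_minors_transpose[THEN iffD1])
qed

lemma minor_not_inj:
  assumes "i < r" "j < r" "i \<noteq> j" "\<rho> i = \<rho> j"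
  shows "minor r H \<rho> \<kappa> = 0"
  unfolding minor_def
  by (rule det_identical_rows[OF mof_carrier assms(3,1,2)]) (use assms in \<open>auto simp: mof_def\<close>)

lemma minor_eq_0_of_card:
  assumes "finite S" "card S < r" "\<forall>i<r. \<rho> i \<in> S"
  shows "minor r H \<rho> \<kappa> = 0"
proof -
  have "\<not> inj_on \<rho> {..<r}"
  proof
    assume "inj_on \<rho> {..<r}"
    then have "card {..<r} \<le> card S" using assms by (intro card_inj_on_le[of \<rho>]) auto
    then show False using assms by simp
  qed
  then obtain i j where "i < r" "j < r" "i \<noteq> j" "\<rho> i = \<rho> j" by (auto simp: inj_on_def)
  then show ?thesis by (rule minor_not_inj)
qed

definition diagm :: "('a \<Rightarrow> 'r::comm_ring_1) \<Rightarrow> 'a \<Rightarrow> 'a \<Rightarrow> 'r" where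
  "diagm d a c = (if a = c then d a else 0)"

lemma mm_diagm_left: "finite S \<Longrightarrow> a \<in> S \<Longrightarrow> mm S (diagm d) H a c = d a * H a c"
  by (simp add: mm_def diagm_def if_distrib if_distribR cong: if_cong)

lemma mm_diagm_right: "finite S \<Longrightarrow> c \<in> S \<Longrightarrow> mm S H (diagm d) a c = H a c * d c"
  by (simp add: mm_def diagm_def if_distrib if_distribR cong: if_cong)

lemma minor_diagm_principal:
  assumes "inj_on \<rho> {..<r}"
  shows "minor r (diagm d) \<rho> \<rho> = (\<Prod>i<r. d (\<rho> i))"
proof -
  have "minor r (diagm d) \<rho> \<rho> = prod_list (diag_mat (mof r (\<lambda>i j. diagm d (\<rho> i) (\<rho> j))))"
  proof -
    have "\<rho> i \<noteq> \<rho> j" if "j < i" "i < r" for i j using that assms by (auto dest: inj_onD)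
    then show ?thesis unfolding minor_def
      by (intro det_upper_triangular[OF _ mof_carrier]) (simp add: upper_triangular_def mof_def diagm_def)
  qed
  also have "diag_mat (mof r (\<lambda>i j. diagm d (\<rho> i) (\<rho> j))) = map (\<lambda>i. d (\<rho> i)) [0..<r]"
    by (auto simp: diag_mat_def mof_def diagm_def)
  also have "prod_list (map (\<lambda>i. d (\<rho> i)) [0..<r]) = (\<Prod>i<r. d (\<rho> i))"
    using prod.distinct_set_conv_list[of "[0..<r]" "\<lambda>i. d (\<rho> i)"] by (simp add: lessThan_atLeast0)
  finally show ?thesis .
qed

lemma dvd_minors_diagm:
  assumes "\<And>R. R \<subseteq> S \<Longrightarrow> card R = r \<Longrightarrow> finite R \<Longrightarrow> g dvd (\<Prod>a\<in>R. d a)"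
  shows "dvd_minors g r S C (diagm d)"
  unfolding dvd_minors_def
proof (intro allI impI)
  fix \<rho> \<kappa> assume \<rho>: "\<forall>i<r. \<rho> i \<in> S"
  show "g dvd minor r (diagm d) \<rho> \<kappa>"
  proof (cases "inj_on \<rho> {..<r}")
    case False
    then obtain i j where "i < r" "j < r" "i \<noteq> j" "\<rho> i = \<rho> j" by (auto simp: inj_on_def)
    then show ?thesis by (simp add: minor_not_inj)
  next
    case True
    have "g dvd (\<Prod>i<r. diagm d (\<rho> i) (\<kappa> (\<pi> i)))" if "\<pi> permutes {..<r}" for \<pi>
    proof (cases "\<forall>i<r. \<rho> i = \<kappa> (\<pi> i)")
      case eq: True
      then have "(\<Prod>i<r. diagm d (\<rho> i) (\<kappa> (\<pi> i))) = (\<Prod>i<r. d (\<rho> i))"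
        by (intro prod.cong) (auto simp: diagm_def)
      also have "\<dots> = (\<Prod>a\<in>\<rho> ` {..<r}. d a)" using True by (simp add: prod.reindex)
      also have "g dvd \<dots>" using \<rho> True by (intro assms) (auto simp: card_image)
      finally show ?thesis .
    next
      case False
      then have "(\<Prod>i<r. diagm d (\<rho> i) (\<kappa> (\<pi> i))) = 0"
        by (intro prod_zero) (auto simp: diagm_def)
      then show ?thesis by simp
    qed
    then show ?thesis unfolding minor_def det_mof by (intro dvd_sum dvd_mult) auto
  qed
qed

text \<open>On the index sets \<open>diag(d) = T' H Y\<close> and \<open>H = T diag(d) Q\<close>.
  Each matrix arises from the other by multiplication on both sides, which preserves divisibility of
  the minors.\<close>

lemma dvd_minors_smith_iff:
  fixes H :: "'i \<Rightarrow> 'c \<Rightarrow> 'r::comm_ring_1"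
  assumes sm: "smith S C H T T' d Q Y" and fin: "finite S" "finite C"
  shows "dvd_minors g r S C H \<longleftrightarrow> (\<forall>R\<subseteq>S. card R = r \<longrightarrow> g dvd (\<Prod>a\<in>R. d a))"
proof
  assume H: "dvd_minors g r S C H"
  have D: "dvd_minors g r S S (diagm d)"
  proof -
    have "dvd_minors g r S S (mm C (mm S T' H) Y)"
      by (intro dvd_minors_mult_right[OF fin(2)] dvd_minors_mult_left[OF fin(1)] H)
    moreover have "mm C (mm S T' H) Y a j = diagm d a j" if "a \<in> S" "j \<in> S" for a j
    proof -
      have "mm C (mm S T' H) Y a j = mm S T' (mm C H Y) a j" by (simp add: mm_assoc)
      also have "\<dots> = mm S T' (mm S T (diagm d)) a j"
        using sm that fin by (intro mm_cong) (auto simp: smith_def mm_diagm_right)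
      also have "\<dots> = diagm d a j"
        by (rule inv_pair_cancel[OF inv_pair_sym]) (use sm that fin in \<open>auto simp: smith_def\<close>)
      finally show ?thesis .
    qed
    ultimately show ?thesis using dvd_minors_cong[of S S "mm C (mm S T' H) Y" "diagm d"] by simp
  qed
  show "\<forall>R\<subseteq>S. card R = r \<longrightarrow> g dvd (\<Prod>a\<in>R. d a)"
  proof (intro allI impI)
    fix R assume R: "R \<subseteq> S" "card R = r"
    then have "finite R" using fin finite_subset by blast
    then obtain \<rho> where \<rho>: "bij_betw \<rho> {..<r} R"
      using R ex_bij_betw_nat_finite lessThan_atLeast0 by metis
    then have "\<forall>i<r. \<rho> i \<in> S" using R by (auto simp: bij_betw_def)
    then have "g dvd minor r (diagm d) \<rho> \<rho>" using D by (simp add: dvd_minors_def)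
    also have "minor r (diagm d) \<rho> \<rho> = (\<Prod>i<r. d (\<rho> i))"
      using \<rho> by (intro minor_diagm_principal) (simp add: bij_betw_def)
    also have "\<dots> = (\<Prod>a\<in>R. d a)" using prod.reindex_bij_betw[OF \<rho>] .
    finally show "g dvd (\<Prod>a\<in>R. d a)" .
  qed
next
  assume "\<forall>R\<subseteq>S. card R = r \<longrightarrow> g dvd (\<Prod>a\<in>R. d a)"
  then have "dvd_minors g r S S (diagm d)" by (intro dvd_minors_diagm) auto
  then have "dvd_minors g r S C (mm S (mm S T (diagm d)) Q)"
    by (intro dvd_minors_mult_right[OF fin(1)] dvd_minors_mult_left[OF fin(1)])
  moreover have "mm S (mm S T (diagm d)) Q a c = H a c" if "a \<in> S" "c \<in> C" for a c
  proof -
    have "mm S (mm S T (diagm d)) Q a c = (\<Sum>k\<in>S. T a k * (d k * Q k c))"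
      using fin by (simp add: mm_assoc) (simp add: mm_def[of S T] mm_diagm_left)
    then show ?thesis using smith_factor[OF sm fin(1) that] by simp
  qed
  ultimately show "dvd_minors g r S C H"
    using dvd_minors_cong[of S C "mm S (mm S T (diagm d)) Q" H] by simp
qed

lemma sum_last_le_sum_subset:
  fixes b :: "nat \<Rightarrow> enat"
  assumes "antitone_below q b" "A \<subseteq> {..<q}" "card A = r"
  shows "(\<Sum>j\<in>{q - r..<q}. b j) \<le> (\<Sum>j\<in>A. b j)"
  using assms
proof (induction q arbitrary: A r)
  case 0
  then show ?case by simp
next
  case (Suc q)
  have anti: "antitone_below q b" using Suc.prems(1) by (auto simp: antitone_below_def)
  have fin: "finite A" using Suc.prems(2) finite_subset by blast
  show ?case
  proof (cases "q \<in> A")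
    case True
    define r' where "r' = r - 1"
    have r: "r = Suc r'" using Suc.prems(3) True fin by (cases r) (auto simp: r'_def)
    have "r' \<le> q" using Suc.prems(2,3) card_mono[of "{..<Suc q}" A] r by simp
    then have "{Suc q - r..<Suc q} = insert q {q - r'..<q}" using r by auto
    moreover have "(\<Sum>j\<in>{q - r'..<q}. b j) \<le> (\<Sum>j\<in>A - {q}. b j)"
      using Suc.prems True fin r by (intro Suc.IH[OF anti]) (auto simp: less_Suc_eq)
    moreover have "(\<Sum>j\<in>A. b j) = b q + (\<Sum>j\<in>A - {q}. b j)"
      using True fin by (simp add: sum.remove)
    ultimately show ?thesis by (simp add: add_left_mono)
  next
    case False
    then have A: "A \<subseteq> {..<q}" using Suc.prems(2) by (auto simp: less_Suc_eq)
    then have "r \<le> q" using Suc.prems(3) card_mono[of "{..<q}" A] by simp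
    then have "(\<Sum>j\<in>{Suc q - r..<Suc q}. b j) = (\<Sum>j\<in>{q - r..<q}. b (Suc j))"
      by (simp only: Suc_diff_le sum.shift_bounds_Suc_ivl)
    also have "\<dots> \<le> (\<Sum>j\<in>{q - r..<q}. b j)"
      using Suc.prems(1) by (intro sum_mono) (auto simp: antitone_below_def)
    also have "\<dots> \<le> (\<Sum>j\<in>A. b j)" by (rule Suc.IH[OF anti A Suc.prems(3)])
    finally show ?thesis .
  qed
qed

lemma t_power_sum: "finite A \<Longrightarrow> t_power (\<Sum>j\<in>A. b j) = (\<Prod>j\<in>A. t_power (b j))"
  by (induction A rule: finite_induct) (simp_all add: t_power_add)

text \<open>Among the products of \<open>r\<close> diagonal entries the least order is attained at
  the last \<open>r\<close> indices, where the exponents are smallest.\<close>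

lemma dvd_minors_t_power_iff:
  fixes H :: "nat \<Rightarrow> 'c \<Rightarrow> 'k::field fps"
  assumes sm: "smith {..<q} C H T T' (\<lambda>j. t_power (b j)) Q Y" and fin: "finite C"
    and anti: "antitone_below q b" and "r \<le> q"
  shows "dvd_minors (t_power e) r {..<q} C H \<longleftrightarrow> e \<le> (\<Sum>j\<in>{q - r..<q}. b j)"
proof -
  have "t_power e dvd (\<Prod>a\<in>R. t_power (b a) :: 'k fps) \<longleftrightarrow> e \<le> (\<Sum>j\<in>R. b j)" if "R \<subseteq> {..<q}" for R
  proof -
    have "finite R" using that finite_subset by blast
    then show ?thesis by (simp flip: t_power_sum add: t_power_dvd_t_power_iff)
  qed
  then have "dvd_minors (t_power e) r {..<q} C H \<longleftrightarrow> (\<forall>R\<subseteq>{..<q}. card R = r \<longrightarrow> e \<le> (\<Sum>j\<in>R. b j))"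
    unfolding dvd_minors_smith_iff[OF sm finite_lessThan fin] by auto
  also have "\<dots> \<longleftrightarrow> e \<le> (\<Sum>j\<in>{q - r..<q}. b j)"
  proof
    assume *: "\<forall>R\<subseteq>{..<q}. card R = r \<longrightarrow> e \<le> (\<Sum>j\<in>R. b j)"
    show "e \<le> (\<Sum>j\<in>{q - r..<q}. b j)"
      by (rule *[rule_format]) (use \<open>r \<le> q\<close> in auto)
  next
    assume "e \<le> (\<Sum>j\<in>{q - r..<q}. b j)"
    then show "\<forall>R\<subseteq>{..<q}. card R = r \<longrightarrow> e \<le> (\<Sum>j\<in>R. b j)"
      using sum_last_le_sum_subset[OF anti] order_trans by blast
  qed
  finally show ?thesis .
qed

section \<open>Charts and kernels of matrices\<close>

lemma bij_betw_pick: "finite I \<Longrightarrow> bij_betw (pick I) {..<card I} I"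
proof -
  assume I: "finite I"
  have "pick I i \<noteq> pick I j" if "i < j" "j < card I" for i j
    using pick_mono_le[of j I i] that by simp
  then have inj: "inj_on (pick I) {..<card I}"
    by (intro linorder_inj_onI) auto
  moreover have "pick I ` {..<card I} \<subseteq> I" using pick_in_set_le by auto
  moreover have "card (pick I ` {..<card I}) = card I" using card_image[OF inj] by simp
  ultimately show ?thesis using card_subset_eq[OF I] by (simp add: bij_betw_def)
qed

text \<open>The position of \<open>c\<close> in the increasing enumeration of \<open>J\<close>; on
  \<open>J\<close> it is inverse to \<open>pick J\<close>.\<close>

definition pos :: "nat set \<Rightarrow> nat \<Rightarrow> nat" where
  "pos J c = card {a \<in> J. a < c}"

lemma pick_pos: "c \<in> J \<Longrightarrow> pick J (pos J c) = c"
  unfolding pos_def by (rule pick_card_in_set)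

lemma pos_less: "finite J \<Longrightarrow> c \<in> J \<Longrightarrow> pos J c < card J"
  unfolding pos_def by (intro psubset_card_mono) auto

lemma pos_pick: "finite J \<Longrightarrow> j < card J \<Longrightarrow> pos J (pick J j) = j"
proof -
  assume J: "finite J" "j < card J"
  have "pick J j \<in> J" using pick_in_set_le J by blast
  then have "pick J (pos J (pick J j)) = pick J j" "pos J (pick J j) < card J"
    using J by (auto simp: pick_pos pos_less)
  then show ?thesis using bij_betw_pick[OF J(1)] J by (auto simp: bij_betw_def inj_on_def)
qed

lemma sum_pick: "finite I \<Longrightarrow> (\<Sum>c\<in>I. f c) = (\<Sum>a<card I. f (pick I a))"
  using sum.reindex_bij_betw[OF bij_betw_pick, of I f] by simp

lemma is_chart_facts:
  assumes "is_chart k n I"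
  shows "finite I" "finite ({..<n} - I)" "card I = k" "card ({..<n} - I) = n - k" "I \<subseteq> {..<n}" "k \<le> n"
proof -
  show 1: "finite I" "I \<subseteq> {..<n}" "card I = k" using assms by (auto simp: is_chart_def finite_subset)
  show "finite ({..<n} - I)" by simp
  show "card ({..<n} - I) = n - k" using 1 by (simp add: card_Diff_subset)
  show "k \<le> n" using card_mono[OF _ 1(2)] 1(3) by simp
qed

lemma represents_iff:
  fixes A :: "'a::comm_ring_1 mat"
  assumes "is_chart k n I"
  shows "represents k n I A W \<longleftrightarrow> A \<in> carrier_mat k n \<and> (\<forall>a<k. \<forall>j<k. A $$ (a, pick I j) = idm a j) \<and>
    W = range (\<lambda>x. vec n (\<lambda>c. \<Sum>a<k. x a * A $$ (a, c)))"
proof -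
  note I = is_chart_facts[OF assms]
  have s: "submatrix A UNIV I = mat k k (\<lambda>(a, j). A $$ (a, pick I j))" if "A \<in> carrier_mat k n"
  proof -
    have "{j. j < n \<and> j \<in> I} = I" using I by auto
    then show ?thesis using that I by (simp add: submatrix_def pick_UNIV)
  qed
  have e: "mat k k (\<lambda>(a, j). A $$ (a, pick I j)) = 1\<^sub>m k \<longleftrightarrow> (\<forall>a<k. \<forall>j<k. A $$ (a, pick I j) = idm a j)"
    by (auto simp: mat_eq_iff idm_def)
  have v: "vspan n (set (rows A)) = range (\<lambda>x. vec n (\<lambda>c. \<Sum>a<k. x a * A $$ (a, c)))" if A: "A \<in> carrier_mat k n"
  proof -
    have "set (rows A) = row A ` {..<k}" using A by (auto simp: rows_def lessThan_atLeast0)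
    then have "vspan n (set (rows A)) = range (\<lambda>x. vec n (\<lambda>c. \<Sum>a<k. x a * row A a $ c))"
      using vspan_image[of "{..<k}" "row A" n] A by simp
    moreover have "vec n (\<lambda>c. \<Sum>a<k. x a * row A a $ c) = vec n (\<lambda>c. \<Sum>a<k. x a * A $$ (a, c))" for x
      using A by (intro eq_vecI) (auto intro!: sum.cong)
    ultimately show ?thesis by simp
  qed
  show ?thesis
  proof (cases "A \<in> carrier_mat k n")
    case True
    then show ?thesis unfolding represents_def s[OF True] e v[OF True] by blast
  qed (simp add: represents_def)
qed

lemma represents_unique:
  fixes A :: "'a::comm_ring_1 mat"
  assumes I: "is_chart k n I" and A: "represents k n I A W" and B: "represents k n I B W"
  shows "A = B"
proof (rule eq_matI)
  note A' = A[unfolded represents_iff[OF I]] and B' = B[unfolded represents_iff[OF I]]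
  fix a c assume "a < dim_row B" "c < dim_col B"
  then have ac: "a < k" "c < n" using B' by auto
  have "vec n (\<lambda>c. A $$ (a, c)) = vec n (\<lambda>c. \<Sum>b<k. idm a b * A $$ (b, c))"
    using mm_idm_left[of "{..<k}" a "\<lambda>b c. A $$ (b, c)"] ac by (simp add: mm_def)
  then have "vec n (\<lambda>c. A $$ (a, c)) \<in> W" using A' by auto
  then obtain x where x: "vec n (\<lambda>c. A $$ (a, c)) = vec n (\<lambda>c. \<Sum>b<k. x b * B $$ (b, c))"
    using B' by auto
  have e: "A $$ (a, c) = (\<Sum>b<k. x b * B $$ (b, c))" if "c < n" for c
    using arg_cong[OF x, of "\<lambda>v. v $ c"] that by simp
  have "x j = idm a j" if j: "j < k" for j
  proof -
    have "pick I j < n" using is_chart_facts[OF I] pick_in_set_le j by blast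
    from e[OF this] have "idm a j = (\<Sum>b<k. x b * idm b j)" using A' B' ac j by simp
    also have "\<dots> = x j" using mm_idm_right[of "{..<k}" j "\<lambda>_. x"] j by (simp add: mm_def)
    finally show ?thesis by simp
  qed
  then have "A $$ (a, c) = (\<Sum>b<k. idm a b * B $$ (b, c))" using e ac by simp
  also have "\<dots> = B $$ (a, c)"
    using mm_idm_left[of "{..<k}" a "\<lambda>b c. B $$ (b, c)"] ac by (simp add: mm_def)
  finally show "A $$ (a, c) = B $$ (a, c)" .
qed (use A B in \<open>auto simp: represents_iff[OF I]\<close>)

lemma chart_mat_eq:
  assumes "is_chart k n I" "represents k n I A W"
  shows "chart_mat k n I W = A"
  unfolding chart_mat_def using assms represents_unique by blast

abbreviation cols_mat :: "nat \<Rightarrow> nat set \<Rightarrow> (nat \<Rightarrow> nat \<Rightarrow> 'r) \<Rightarrow> nat \<Rightarrow> nat \<Rightarrow> 'r" where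
  "cols_mat n I H \<equiv> \<lambda>i j. H i (pick ({..<n} - I) j)"

text \<open>The coordinates in the chart \<open>I\<close> of the kernel of \<open>H\<close>, by Cramer's rule; \<open>u\<close> is the inverse
  of the minor of \<open>H\<close> on the columns outside \<open>I\<close>.\<close>
definition chart_coord :: "'r::comm_ring_1 \<Rightarrow> nat \<Rightarrow> nat \<Rightarrow> nat set \<Rightarrow> (nat \<Rightarrow> nat \<Rightarrow> 'r) \<Rightarrow> nat \<Rightarrow> nat \<Rightarrow> 'r" where
  "chart_coord u n q I H a c =
     - (\<Sum>j<q. u * adj_mat (mof q (cols_mat n I H)) $$ (pos ({..<n} - I) c, j) * H j (pick I a))"

definition chart_repr :: "'r::comm_ring_1 \<Rightarrow> nat \<Rightarrow> nat \<Rightarrow> nat set \<Rightarrow> (nat \<Rightarrow> nat \<Rightarrow> 'r) \<Rightarrow> 'r mat" where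
  "chart_repr u k n I H =
     mat k n (\<lambda>(a, c). if c \<in> I then idm c (pick I a) else chart_coord u n (n - k) I H a c)"

text \<open>As the columns outside \<open>I\<close> form an invertible block, \<open>H v = 0\<close>
  can be solved for the coordinates of \<open>v\<close> outside \<open>I\<close>. The coordinates in
  \<open>I\<close> are free and are the coefficients of \<open>v\<close> in terms of the rows of the
  matrix.\<close>

lemma represents_kernel:
  fixes H :: "nat \<Rightarrow> nat \<Rightarrow> 'r::comm_ring_1"
  assumes I: "is_chart k n I" and u: "det (mof (n - k) (cols_mat n I H)) * u = 1"
  shows "represents k n I (chart_repr u k n I H) (mat_kernel_set n (n - k) H)"
proof -
  let ?q = "n - k" and ?J = "{..<n} - I"
  note F = is_chart_facts[OF I]
  define N where "N = (\<lambda>i j. u * adj_mat (mof ?q (cols_mat n I H)) $$ (i, j))"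
  have N: "inv_pair {..<?q} (cols_mat n I H) N" unfolding N_def by (rule det_unit_inverse[OF u])
  let ?A = "chart_repr u k n I H"
  have cc: "chart_coord u n ?q I H a c = - mm {..<?q} N H (pos ?J c) (pick I a)" for a c
    by (simp add: chart_coord_def N_def mm_def)
  have pI: "pick I a \<in> I" "pick I a < n" if "a < k" for a using F that pick_in_set_le by blast+
  have pJ: "pick ?J j \<in> ?J" if "j < ?q" for j using F that pick_in_set_le by metis
  have inj: "pick I a = pick I b \<longleftrightarrow> a = b" if "a < k" "b < k" for a b
    using bij_betw_pick[OF F(1)] F(3) that by (auto simp: bij_betw_def inj_on_def)
  have A: "?A $$ (a, c) = (if c \<in> I then idm c (pick I a) else chart_coord u n ?q I H a c)" if "a < k" "c < n" for a c
    using that by (simp add: chart_repr_def)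
  have sumn: "(\<Sum>c<n. f c) = (\<Sum>a<k. f (pick I a)) + (\<Sum>j<?q. f (pick ?J j))" for f :: "nat \<Rightarrow> 'r"
  proof -
    have "(\<Sum>c<n. f c) = (\<Sum>c\<in>?J. f c) + (\<Sum>c\<in>I. f c)"
      using F(5) by (intro sum.subset_diff) auto
    then show ?thesis using sum_pick[OF F(1), of f] sum_pick[OF F(2), of f] F by (simp add: add.commute)
  qed
  have ker: "app n H v i = (\<Sum>a<k. H i (pick I a) * v $ pick I a) + (\<Sum>j<?q. H i (pick ?J j) * v $ pick ?J j)" for v i
    unfolding app_def by (rule sumn)
  have "v \<in> mat_kernel_set n ?q H \<longleftrightarrow> v \<in> range (\<lambda>x. vec n (\<lambda>c. \<Sum>a<k. x a * ?A $$ (a, c)))" for v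
  proof
    assume v: "v \<in> mat_kernel_set n ?q H"
    have "v = vec n (\<lambda>c. \<Sum>a<k. v $ pick I a * ?A $$ (a, c))"
    proof (rule eq_vecI)
      fix c assume "c < dim_vec (vec n (\<lambda>c. \<Sum>a<k. v $ pick I a * ?A $$ (a, c)))"
      then have c: "c < n" by simp
      have "v $ c = (\<Sum>a<k. v $ pick I a * ?A $$ (a, c))"
      proof (cases "c \<in> I")
        case True
        then obtain b where b: "b < k" "c = pick I b"
          using bij_betw_pick[OF F(1)] F(3) by (auto simp: bij_betw_def)
        then have "(\<Sum>a<k. v $ pick I a * ?A $$ (a, c)) = (\<Sum>a<k. v $ pick I a * idm a b)"
          using c True inj by (intro sum.cong) (auto simp: A idm_def)
        also have "\<dots> = v $ c" using b mm_idm_right[of "{..<k}" b "\<lambda>_ a. v $ pick I a"] by (simp add: mm_def)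
        finally show ?thesis by simp
      next
        case False
        then have cJ: "c \<in> ?J" using c by simp
        define p where "p = pos ?J c"
        have p: "p < ?q" "pick ?J p = c" using pos_less[OF F(2) cJ] F(4) pick_pos[OF cJ] by (simp_all add: p_def)
        have "0 = (\<Sum>i<?q. N p i * app n H v i)" using v by (simp add: mat_kernel_set_def)
        also have "\<dots> = (\<Sum>i<?q. N p i * (\<Sum>a<k. H i (pick I a) * v $ pick I a))
            + (\<Sum>i<?q. N p i * (\<Sum>j<?q. H i (pick ?J j) * v $ pick ?J j))"
          unfolding ker by (simp add: distrib_left sum.distrib)
        also have "(\<Sum>i<?q. N p i * (\<Sum>j<?q. H i (pick ?J j) * v $ pick ?J j))
            = mm {..<?q} N (mm {..<?q} (cols_mat n I H) (\<lambda>j _. v $ pick ?J j)) p ()"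
          by (simp add: mm_def)
        also have "\<dots> = v $ c" by (subst inv_pair_cancel[OF inv_pair_sym[OF N]]) (simp_all add: p)
        also have "(\<Sum>i<?q. N p i * (\<Sum>a<k. H i (pick I a) * v $ pick I a))
            = mm {..<?q} N (mm {..<k} (\<lambda>i a. H i (pick I a)) (\<lambda>a _. v $ pick I a)) p ()"
          by (simp add: mm_def)
        also have "\<dots> = mm {..<k} (mm {..<?q} N (\<lambda>i a. H i (pick I a))) (\<lambda>a _. v $ pick I a) p ()"
          by (simp add: mm_assoc)
        also have "\<dots> = (\<Sum>a<k. mm {..<?q} N H p (pick I a) * v $ pick I a)" by (simp add: mm_def)
        also have "\<dots> = - (\<Sum>a<k. v $ pick I a * ?A $$ (a, c))"
          using False c by (simp add: A cc p_def sum_negf mult.commute)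
        finally show ?thesis by simp
      qed
      then show "v $ c = vec n (\<lambda>c. \<Sum>a<k. v $ pick I a * ?A $$ (a, c)) $ c" using c by simp
    qed (use v in \<open>simp add: mat_kernel_set_def\<close>)
    then show "v \<in> range (\<lambda>x. vec n (\<lambda>c. \<Sum>a<k. x a * ?A $$ (a, c)))"
      by (rule range_eqI[where x = "\<lambda>a. v $ pick I a"])
  next
    assume "v \<in> range (\<lambda>x. vec n (\<lambda>c. \<Sum>a<k. x a * ?A $$ (a, c)))"
    then obtain x where v: "v = vec n (\<lambda>c. \<Sum>a<k. x a * ?A $$ (a, c))" by (rule rangeE)
    have vI: "v $ pick I a = x a" if "a < k" for a
    proof -
      have "v $ pick I a = (\<Sum>b<k. x b * idm b a)"
        using that pI inj by (auto simp: v A idm_def intro!: sum.cong)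
      then show ?thesis using that mm_idm_right[of "{..<k}" a "\<lambda>_. x"] by (simp add: mm_def)
    qed
    have vJ: "v $ pick ?J j = - (\<Sum>a<k. mm {..<?q} N H j (pick I a) * x a)" if "j < ?q" for j
      using that pJ[OF that] F by (simp add: v A cc pos_pick sum_negf mult.commute)
    have "app n H v i = 0" if i: "i < ?q" for i
    proof -
      have "(\<Sum>j<?q. H i (pick ?J j) * v $ pick ?J j) = - (\<Sum>j<?q. H i (pick ?J j) * (\<Sum>a<k. mm {..<?q} N H j (pick I a) * x a))"
        using vJ by (simp add: sum_negf)
      also have "(\<Sum>j<?q. H i (pick ?J j) * (\<Sum>a<k. mm {..<?q} N H j (pick I a) * x a))
         = mm {..<?q} (cols_mat n I H) (mm {..<k} (mm {..<?q} N (\<lambda>j a. H j (pick I a))) (\<lambda>a _. x a)) i ()"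
        by (simp add: mm_def)
      also have "\<dots> = mm {..<?q} (cols_mat n I H) (mm {..<?q} N (mm {..<k} (\<lambda>j a. H j (pick I a)) (\<lambda>a _. x a))) i ()"
        by (simp add: mm_assoc)
      also have "\<dots> = mm {..<k} (\<lambda>j a. H j (pick I a)) (\<lambda>a _. x a) i ()"
        by (rule inv_pair_cancel[OF N]) (simp_all add: i)
      finally show ?thesis unfolding ker using vI by (simp add: mm_def)
    qed
    then show "v \<in> mat_kernel_set n ?q H" by (simp add: mat_kernel_set_def v)
  qed
  then have "mat_kernel_set n ?q H = range (\<lambda>x. vec n (\<lambda>c. \<Sum>a<k. x a * ?A $$ (a, c)))"
    by (rule Set.set_eqI)
  moreover have "?A $$ (a, pick I j) = idm a j" if "a < k" "j < k" for a j
    using that pI inj by (auto simp: A idm_def)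
  moreover have "?A \<in> carrier_mat k n" by (simp add: chart_repr_def)
  ultimately show ?thesis unfolding represents_iff[OF I] by blast
qed

text \<open>If the kernel is a graph over the coordinates in \<open>I\<close>, its basis expresses
  the columns of \<open>H\<close> in \<open>I\<close> by those outside. Substituted into
  \<open>H Y = 1\<close>, this yields a right inverse of the square block outside
  \<open>I\<close>.\<close>

lemma in_chart_kernel_imp_unit:
  fixes H :: "nat \<Rightarrow> nat \<Rightarrow> 'r::comm_ring_1"
  assumes I: "is_chart k n I" and ch: "in_chart k n I (mat_kernel_set n (n - k) H)"
    and Y: "\<And>i j. i < n - k \<Longrightarrow> j < n - k \<Longrightarrow> mm {..<n} H Y i j = idm i j"
  shows "det (mof (n - k) (cols_mat n I H)) dvd 1"
proof -
  let ?q = "n - k" and ?J = "{..<n} - I"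
  note F = is_chart_facts[OF I]
  obtain A where A: "A \<in> carrier_mat k n" "\<And>a j. a < k \<Longrightarrow> j < k \<Longrightarrow> A $$ (a, pick I j) = idm a j"
    and W: "mat_kernel_set n ?q H = range (\<lambda>x. vec n (\<lambda>c. \<Sum>a<k. x a * A $$ (a, c)))"
    using ch unfolding in_chart_def represents_iff[OF I] by blast
  have sumn: "(\<Sum>c<n. f c) = (\<Sum>a<k. f (pick I a)) + (\<Sum>j<?q. f (pick ?J j))" for f :: "nat \<Rightarrow> 'r"
  proof -
    have "(\<Sum>c<n. f c) = (\<Sum>c\<in>?J. f c) + (\<Sum>c\<in>I. f c)"
      using F(5) by (intro sum.subset_diff) auto
    then show ?thesis using sum_pick[OF F(1), of f] sum_pick[OF F(2), of f] F by (simp add: add.commute)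
  qed
  have row: "H i (pick I a) = - (\<Sum>j<?q. H i (pick ?J j) * A $$ (a, pick ?J j))" if i: "i < ?q" and a: "a < k" for i a
  proof -
    have "vec n (\<lambda>c. A $$ (a, c)) = vec n (\<lambda>c. \<Sum>b<k. idm a b * A $$ (b, c))"
      using mm_idm_left[of "{..<k}" a "\<lambda>b c. A $$ (b, c)"] a by (simp add: mm_def)
    then have "vec n (\<lambda>c. A $$ (a, c)) \<in> mat_kernel_set n ?q H" unfolding W by (rule range_eqI[where x = "idm a"])
    then have "0 = (\<Sum>c<n. H i c * A $$ (a, c))" using i by (simp add: mat_kernel_set_def app_def)
    also have "\<dots> = (\<Sum>b<k. H i (pick I b) * idm a b) + (\<Sum>j<?q. H i (pick ?J j) * A $$ (a, pick ?J j))"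
      unfolding sumn using A(2) a by simp
    also have "(\<Sum>b<k. H i (pick I b) * idm a b) = (\<Sum>b<k. H i (pick I b) * idm b a)"
      by (intro sum.cong) (auto simp: idm_def)
    also have "\<dots> = H i (pick I a)"
      using mm_idm_right[of "{..<k}" a "\<lambda>_ b. H i (pick I b)"] a by (simp add: mm_def)
    finally show ?thesis by (simp add: eq_neg_iff_add_eq_0)
  qed
  define X' where "X' = (\<lambda>j l. Y (pick ?J j) l - (\<Sum>a<k. A $$ (a, pick ?J j) * Y (pick I a) l))"
  have "mm {..<?q} (cols_mat n I H) X' i l = idm i l" if "i < ?q" "l < ?q" for i l
  proof -
    have "idm i l = (\<Sum>a<k. H i (pick I a) * Y (pick I a) l) + (\<Sum>j<?q. H i (pick ?J j) * Y (pick ?J j) l)"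
      using Y[OF that] sumn[of "\<lambda>c. H i c * Y c l"] by (simp add: mm_def)
    also have "(\<Sum>a<k. H i (pick I a) * Y (pick I a) l)
       = - (\<Sum>a<k. \<Sum>j<?q. H i (pick ?J j) * A $$ (a, pick ?J j) * Y (pick I a) l)"
      using row that by (simp add: sum_distrib_right sum_negf)
    also have "(\<Sum>a<k. \<Sum>j<?q. H i (pick ?J j) * A $$ (a, pick ?J j) * Y (pick I a) l)
       = (\<Sum>j<?q. H i (pick ?J j) * (\<Sum>a<k. A $$ (a, pick ?J j) * Y (pick I a) l))"
      by (subst sum.swap) (simp add: sum_distrib_left mult.assoc)
    finally show ?thesis by (simp add: mm_def X'_def right_diff_distrib sum_subtractf)
  qed
  then have "inv_pair {..<?q} X' (cols_mat n I H)" by (intro left_inverse_imp_inv_pair) auto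
  then have "det (mof ?q (cols_mat n I H)) * det (mof ?q X') = 1"
    using inv_pair_det[OF inv_pair_sym] by blast
  then show ?thesis by (metis dvd_triv_left)
qed

lemma arc_mat_section:
  assumes A: "arc_mat n q \<Lambda> H"
  shows "\<exists>Y. \<forall>i<q. \<forall>j<q. mm {..<n} H Y i j = idm i j"
proof -
  have "\<exists>v. v \<in> carrier_vec n \<and> (\<forall>i<q. app n H v i = idm i j)" for j
    by (rule presents_lift[OF A, where y = "\<lambda>i. idm i j"]) auto
  from choice[OF allI[OF this]] obtain V where
    "\<forall>j. V j \<in> carrier_vec n \<and> (\<forall>i<q. app n H (V j) i = idm i j)" ..
  then have "\<forall>i<q. \<forall>j<q. mm {..<n} H (\<lambda>c j. V j $ c) i j = idm i j"
    by (simp add: mm_def app_def)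
  then show ?thesis by blast
qed

text \<open>If every maximal minor had constant term 0, then \<open>t\<close> would divide the
  maximal minors of \<open>H Y\<close>, which is the identity.\<close>

lemma exists_unit_columns:
  fixes H :: "nat \<Rightarrow> nat \<Rightarrow> 'k::field fps"
  assumes Y: "\<And>i j. i < n - k \<Longrightarrow> j < n - k \<Longrightarrow> mm {..<n} H Y i j = idm i j" and "k \<le> n"
  shows "\<exists>I. is_chart k n I \<and> det (mof (n - k) (cols_mat n I H)) dvd 1"
proof -
  let ?q = "n - k"
  have "\<not> dvd_minors fps_X ?q {..<?q} {..<n} H"
  proof
    assume "dvd_minors fps_X ?q {..<?q} {..<n} H"
    then have "dvd_minors fps_X ?q {..<?q} {..<?q} (mm {..<n} H Y)"
      by (intro dvd_minors_mult_right) auto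
    then have "fps_X dvd minor ?q (mm {..<n} H Y) (\<lambda>i. i) (\<lambda>i. i)" by (simp add: dvd_minors_def)
    also have "minor ?q (mm {..<n} H Y) (\<lambda>i. i) (\<lambda>i. i) = det (1\<^sub>m ?q)"
      unfolding minor_def using Y by (intro arg_cong[of _ _ det]) (simp add: mof_eq_one)
    finally show False by simp
  qed
  then obtain \<rho> \<kappa> where \<rho>: "\<forall>i<?q. \<rho> i < ?q" and \<kappa>: "\<forall>i<?q. \<kappa> i < n"
    and nd: "\<not> fps_X dvd minor ?q H \<rho> \<kappa>" by (auto simp: dvd_minors_def)
  have inj: "inj_on \<kappa> {..<?q}"
  proof (rule ccontr)
    assume "\<not> inj_on \<kappa> {..<?q}"
    then obtain i j where ij: "i < ?q" "j < ?q" "i \<noteq> j" "\<kappa> i = \<kappa> j" by (auto simp: inj_on_def)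
    have "minor ?q H \<rho> \<kappa> = minor ?q (\<lambda>c a. H a c) \<kappa> \<rho>" using minor_transpose[of ?q H \<kappa> \<rho>] by simp
    also have "\<dots> = 0" by (rule minor_not_inj[OF ij])
    finally show False using nd by simp
  qed
  define J where "J = \<kappa> ` {..<?q}"
  define I where "I = {..<n} - J"
  have J: "J \<subseteq> {..<n}" "card J = ?q" "finite J" using \<kappa> inj by (auto simp: J_def card_image)
  have JI: "{..<n} - I = J" using J by (auto simp: I_def)
  have I: "is_chart k n I" using J \<open>k \<le> n\<close> by (simp add: is_chart_def I_def card_Diff_subset)
  let ?M = "cols_mat n I H"
  \<comment> \<open>The minor found has its rows and columns in some order. \<open>P\<close> and
    \<open>P'\<close> are selection matrices relating it to the block with increasing
    columns.\<close>
  define P where "P = (\<lambda>i a. if a = \<rho> i then 1 else 0 :: 'k fps)"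
  define P' where "P' = (\<lambda>b j. if b = pos J (\<kappa> j) then 1 else 0 :: 'k fps)"
  have "mm {..<?q} (mm {..<?q} P ?M) P' i j = H (\<rho> i) (\<kappa> j)" if "i < ?q" "j < ?q" for i j
  proof -
    have "mm {..<?q} P ?M i b = ?M (\<rho> i) b" for b
      using \<rho> that by (simp add: mm_def P_def if_distrib if_distribR cong: if_cong)
    moreover have "\<kappa> j \<in> J" using that by (simp add: J_def)
    ultimately show ?thesis
      unfolding mm_def[of "{..<?q}" "mm {..<?q} P ?M" P'] using pos_less[OF J(3), of "\<kappa> j"] J(2)
      by (simp add: P'_def JI pick_pos if_distrib if_distribR cong: if_cong)
  qed
  then have "minor ?q H \<rho> \<kappa> = det (mof ?q (mm {..<?q} (mm {..<?q} P ?M) P'))"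
    unfolding minor_def by (intro arg_cong[of _ _ det] mof_cong) simp
  also have "\<dots> = det (mof ?q P) * det (mof ?q ?M) * det (mof ?q P')"
    by (simp only: mof_mult[symmetric] det_mult[OF mof_carrier mof_carrier]
        det_mult[OF mult_carrier_mat[OF mof_carrier mof_carrier] mof_carrier])
  finally have "\<not> fps_X dvd det (mof ?q ?M)" using nd by (metis dvd_mult dvd_mult2)
  then have "fps_nth (det (mof ?q ?M)) 0 \<noteq> 0"
    using t_power_dvd_iff[of "enat 1" "det (mof ?q ?M)"] by (auto simp: t_power_enat)
  then show ?thesis using I by auto
qed

lemma arc_in_some_chart:
  assumes A: "arc_mat n (n - k) \<Lambda> H" and "k \<le> n"
  shows "\<exists>I. is_chart k n I \<and> in_chart k n I \<Lambda>"
proof -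
  obtain Y where "\<And>i j. i < n - k \<Longrightarrow> j < n - k \<Longrightarrow> mm {..<n} H Y i j = idm i j"
    using arc_mat_section[OF A] by blast
  from exists_unit_columns[OF this \<open>k \<le> n\<close>] obtain I where
    I: "is_chart k n I" "det (mof (n - k) (cols_mat n I H)) dvd 1" by blast
  then obtain u where "1 = det (mof (n - k) (cols_mat n I H)) * u" by (elim dvdE)
  then show ?thesis
    using represents_kernel[OF I(1), of H u] I arc_mat_imp_kernel[OF A] by (auto simp: in_chart_def)
qed

text \<open>The directions are Cramer's rule and its converse for a surjective \<open>H\<close>. In
  this form membership in a chart is the nonvanishing of one coefficient, which persists along a
  line.\<close>

lemma arc_in_chart_iff:
  assumes A: "arc_mat n (n - k) \<Lambda> H" and I: "is_chart k n I"
  shows "in_chart k n I \<Lambda> \<longleftrightarrow> fps_nth (det (mof (n - k) (cols_mat n I H))) 0 \<noteq> 0"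
proof
  obtain Y where Y: "\<And>i j. i < n - k \<Longrightarrow> j < n - k \<Longrightarrow> mm {..<n} H Y i j = idm i j"
    using arc_mat_section[OF A] by blast
  assume "in_chart k n I \<Lambda>"
  from in_chart_kernel_imp_unit[OF I this[unfolded arc_mat_imp_kernel[OF A]] Y]
  show "fps_nth (det (mof (n - k) (cols_mat n I H))) 0 \<noteq> 0" by simp
next
  assume "fps_nth (det (mof (n - k) (cols_mat n I H))) 0 \<noteq> 0"
  then have "det (mof (n - k) (cols_mat n I H)) dvd 1" by simp
  then obtain u where "1 = det (mof (n - k) (cols_mat n I H)) * u" by (elim dvdE)
  then show "in_chart k n I \<Lambda>"
    using represents_kernel[OF I, of H u] arc_mat_imp_kernel[OF A] by (auto simp: in_chart_def)
qed

lemma chart_mat_kernel: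
  assumes I: "is_chart k n I" and u: "det (mof (n - k) (cols_mat n I H)) * u = 1"
    and "a < k" "c \<in> {..<n} - I"
  shows "chart_mat k n I (mat_kernel_set n (n - k) H) $$ (a, c) = chart_coord u n (n - k) I H a c"
  using chart_mat_eq[OF I represents_kernel[OF I u]] assms(3,4) by (simp add: chart_repr_def)

section \<open>Polynomials vanishing where minors vanish\<close>

text \<open>\<open>F\<close> and \<open>G\<close> are given by one and the same polynomial over \<open>\<complex>\<close> in the variables \<open>Vs\<close>,
  evaluated in \<open>\<complex>\<close> and, along \<open>\<psi>\<close>, in a second ring.\<close>
inductive polyf :: "(complex \<Rightarrow> 'r::idom) \<Rightarrow> 'v set \<Rightarrow> (('v \<Rightarrow> complex) \<Rightarrow> complex) \<Rightarrow> (('v \<Rightarrow> 'r) \<Rightarrow> 'r) \<Rightarrow> bool"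
  for \<psi> Vs where
  const: "polyf \<psi> Vs (\<lambda>_. c) (\<lambda>_. \<psi> c)"
| var: "v \<in> Vs \<Longrightarrow> polyf \<psi> Vs (\<lambda>x. x v) (\<lambda>x. x v)"
| add: "polyf \<psi> Vs F G \<Longrightarrow> polyf \<psi> Vs F' G' \<Longrightarrow> polyf \<psi> Vs (\<lambda>x. F x + F' x) (\<lambda>x. G x + G' x)"
| mult: "polyf \<psi> Vs F G \<Longrightarrow> polyf \<psi> Vs F' G' \<Longrightarrow> polyf \<psi> Vs (\<lambda>x. F x * F' x) (\<lambda>x. G x * G' x)"

lemma polyf_mono:
  assumes "polyf \<psi> Us F G" "Us \<subseteq> Vs"
  shows "polyf \<psi> Vs F G"
  using assms(1) by induction (use assms(2) in \<open>auto intro: polyf.intros\<close>)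

lemma polyf_finite:
  assumes "polyf \<psi> Vs F G"
  shows "\<exists>Us. finite Us \<and> Us \<subseteq> Vs \<and> polyf \<psi> Us F G"
  using assms
proof induction
  case (const c)
  then show ?case by (intro exI[of _ "{}"]) (auto intro: polyf.const)
next
  case (var v)
  then show ?case by (intro exI[of _ "{v}"]) (auto intro: polyf.var)
next
  case (add F G F' G')
  then obtain U U' where "finite U" "U \<subseteq> Vs" "polyf \<psi> U F G" "finite U'" "U' \<subseteq> Vs" "polyf \<psi> U' F' G'" by blast
  then show ?case
    by (intro exI[of _ "U \<union> U'"] conjI polyf.add) (auto intro: polyf_mono)
next
  case (mult F G F' G')
  then obtain U U' where "finite U" "U \<subseteq> Vs" "polyf \<psi> U F G" "finite U'" "U' \<subseteq> Vs" "polyf \<psi> U' F' G'" by blast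
  then show ?case
    by (intro exI[of _ "U \<union> U'"] conjI polyf.mult) (auto intro: polyf_mono)
qed

lemma polyf_subst:
  assumes "polyf \<psi> Vs F G" "\<And>v. v \<in> Vs \<Longrightarrow> polyf \<psi> Ws (f v) (g v)"
  shows "polyf \<psi> Ws (\<lambda>x. F (\<lambda>v. f v x)) (\<lambda>x. G (\<lambda>v. g v x))"
  using assms(1) by induction (use assms(2) in \<open>auto intro: polyf.intros\<close>)

lemma polyf_empty:
  assumes "polyf \<psi> {} F G" and \<psi>: "comm_ring_hom \<psi>"
  shows "\<exists>c. F = (\<lambda>_. c) \<and> G = (\<lambda>_. \<psi> c)"
proof -
  interpret comm_ring_hom \<psi> by (rule \<psi>)
  show ?thesis using assms(1)
  proof induction
    case (add F G F' G')
    then obtain c c' where "F = (\<lambda>_. c)" "G = (\<lambda>_. \<psi> c)" "F' = (\<lambda>_. c')" "G' = (\<lambda>_. \<psi> c')" by blast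
    then show ?case by (intro exI[of _ "c + c'"]) (simp add: hom_add)
  next
    case (mult F G F' G')
    then obtain c c' where "F = (\<lambda>_. c)" "G = (\<lambda>_. \<psi> c)" "F' = (\<lambda>_. c')" "G' = (\<lambda>_. \<psi> c')" by blast
    then show ?case by (intro exI[of _ "c * c'"]) (simp add: hom_mult)
  qed auto
qed

lemma sum_extend_zero:
  fixes f :: "nat \<Rightarrow> 'c::comm_ring_1"
  assumes "k \<le> m" "\<forall>i>k. f i = 0"
  shows "(\<Sum>i\<le>m. f i * t ^ i) = (\<Sum>i\<le>k. f i * t ^ i)"
  using assms by (intro sum.mono_neutral_right) auto

lemma convolution_zero:
  fixes f g :: "nat \<Rightarrow> 'c::comm_ring_1"
  assumes "i > d + d'" "\<forall>i>d. f i = 0" "\<forall>i>d'. g i = 0"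
  shows "(\<Sum>k\<le>i. f k * g (i - k)) = 0"
proof (rule sum.neutral, rule ballI)
  fix k assume "k \<in> {..i}"
  show "f k * g (i - k) = 0"
  proof (cases "k > d")
    case False
    then have "i - k > d'" using assms(1) by linarith
    then show ?thesis using assms by simp
  qed (use assms in simp)
qed

lemma product_split:
  fixes a :: "'c::comm_ring_1"
  assumes "a = a0 + t * h" "a' = a0' + t * h'"
  shows "a * a' = a0 * a0' + t * (h * a' + a0 * h')"
  using assms by (simp add: algebra_simps)

lemma sum_Pow_insert:
  fixes x :: "'v \<Rightarrow> 'c::comm_ring_1"
  assumes "finite Bs" "v \<notin> Bs"
  shows "(\<Sum>R\<in>Pow (insert v Bs). (\<Prod>v\<in>R. x v) * (if v \<in> R then g (R - {v}) else f R))
     = (\<Sum>R\<in>Pow Bs. (\<Prod>v\<in>R. x v) * f R) + x v * (\<Sum>R\<in>Pow Bs. (\<Prod>v\<in>R. x v) * g R)"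
proof -
  have v: "v \<notin> R" "finite R" if "R \<in> Pow Bs" for R using that assms finite_subset by auto
  have "Pow (insert v Bs) = Pow Bs \<union> insert v ` Pow Bs" by (rule Pow_insert)
  moreover have "Pow Bs \<inter> insert v ` Pow Bs = {}" using assms by auto
  ultimately have "(\<Sum>R\<in>Pow (insert v Bs). (\<Prod>v\<in>R. x v) * (if v \<in> R then g (R - {v}) else f R))
    = (\<Sum>R\<in>Pow Bs. (\<Prod>v\<in>R. x v) * (if v \<in> R then g (R - {v}) else f R))
    + (\<Sum>R\<in>insert v ` Pow Bs. (\<Prod>v\<in>R. x v) * (if v \<in> R then g (R - {v}) else f R))"
    using assms by (simp add: sum.union_disjoint)
  also have "(\<Sum>R\<in>Pow Bs. (\<Prod>v\<in>R. x v) * (if v \<in> R then g (R - {v}) else f R)) = (\<Sum>R\<in>Pow Bs. (\<Prod>v\<in>R. x v) * f R)"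
    using v by (intro sum.cong) auto
  also have "(\<Sum>R\<in>insert v ` Pow Bs. (\<Prod>v\<in>R. x v) * (if v \<in> R then g (R - {v}) else f R))
    = (\<Sum>R\<in>Pow Bs. (\<Prod>v\<in>insert v R. x v) * (if v \<in> insert v R then g (insert v R - {v}) else f (insert v R)))"
  proof -
    have "inj_on (insert v) (Pow Bs)" using v(1) by (intro inj_onI) (metis insert_ident)
    then show ?thesis by (simp only: sum.reindex o_def)
  qed
  also have "\<dots> = (\<Sum>R\<in>Pow Bs. x v * ((\<Prod>v\<in>R. x v) * g R))"
  proof (intro sum.cong refl)
    fix R assume "R \<in> Pow Bs"
    then have "v \<notin> R" "finite R" "insert v R - {v} = R" using v by auto
    then show "(\<Prod>v\<in>insert v R. x v) * (if v \<in> insert v R then g (insert v R - {v}) else f (insert v R)) = x v * ((\<Prod>v\<in>R. x v) * g R)"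
      by (simp add: mult.assoc)
  qed
  finally show ?thesis by (simp add: sum_distrib_left)
qed

section \<open>Vanishing and expansion of pairs of polynomial functions\<close>

locale poly_pair = comm_ring_hom \<psi> for \<psi> :: "complex \<Rightarrow> 'r::idom"
begin

lemma zero: "polyf \<psi> Vs (\<lambda>_. 0) (\<lambda>_. 0)" using polyf.const[of \<psi> Vs 0] by simp
lemma one: "polyf \<psi> Vs (\<lambda>_. 1) (\<lambda>_. 1)" using polyf.const[of \<psi> Vs 1] by simp

lemma of_sum:
  "(\<And>i. i \<in> A \<Longrightarrow> polyf \<psi> Vs (F i) (G i)) \<Longrightarrow> polyf \<psi> Vs (\<lambda>x. \<Sum>i\<in>A. F i x) (\<lambda>x. \<Sum>i\<in>A. G i x)"
  by (induction A rule: infinite_finite_induct) (auto intro: zero polyf.add)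

lemma of_prod:
  "(\<And>i. i \<in> A \<Longrightarrow> polyf \<psi> Vs (F i) (G i)) \<Longrightarrow> polyf \<psi> Vs (\<lambda>x. \<Prod>i\<in>A. F i x) (\<lambda>x. \<Prod>i\<in>A. G i x)"
  by (induction A rule: infinite_finite_induct) (auto intro: one polyf.mult)

lemma of_power: "polyf \<psi> Vs F G \<Longrightarrow> polyf \<psi> Vs (\<lambda>x. F x ^ m) (\<lambda>x. G x ^ m)"
  by (induction m) (auto intro: one polyf.mult)

lemma of_uminus: "polyf \<psi> Vs F G \<Longrightarrow> polyf \<psi> Vs (\<lambda>x. - F x) (\<lambda>x. - G x)"
  using polyf.mult[OF polyf.const[of \<psi> Vs "- 1"], of F G] by (simp add: hom_uminus)

lemma of_neg_one_power: "polyf \<psi> Vs (\<lambda>_. (- 1) ^ m) (\<lambda>_. (- 1) ^ m)"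
  by (intro of_power of_uminus one)

lemma of_sign: "polyf \<psi> Vs (\<lambda>_. signof p) (\<lambda>_. signof p)"
  using one of_uminus[OF one] by (cases "sign p = 1") (auto simp: sign_def)

lemma of_det:
  assumes "\<And>i j. i < q \<Longrightarrow> j < q \<Longrightarrow> polyf \<psi> Vs (\<lambda>x. M x i j) (\<lambda>x. N x i j)"
  shows "polyf \<psi> Vs (\<lambda>x. det (mof q (M x))) (\<lambda>x. det (mof q (N x)))"
  unfolding det_mof using assms
  by (intro of_sum polyf.mult of_sign of_prod) (auto dest: permutes_in_image)

lemma expand:
  assumes "polyf \<psi> Vs F G"
  shows "\<exists>d Fs Gs. (\<forall>i. polyf \<psi> (Vs - {v}) (Fs i) (Gs i)) \<and> (\<forall>i>d. Fs i = (\<lambda>_. 0) \<and> Gs i = (\<lambda>_. 0)) \<and>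
     (\<forall>x. F x = (\<Sum>i\<le>d. Fs i x * x v ^ i)) \<and> (\<forall>x. G x = (\<Sum>i\<le>d. Gs i x * x v ^ i))"
  using assms
proof induction
  case (const c)
  show ?case
    by (rule exI[of _ 0], rule exI[of _ "\<lambda>i _. if i = 0 then c else 0"], rule exI[of _ "\<lambda>i _. if i = 0 then \<psi> c else 0"])
      (auto intro: polyf.const zero)
next
  case (var u)
  show ?case
  proof (cases "u = v")
    case True
    show ?thesis
      by (rule exI[of _ 1], rule exI[of _ "\<lambda>i _. if i = 1 then 1 else 0"], rule exI[of _ "\<lambda>i _. if i = 1 then 1 else 0"])
        (auto intro: one zero simp: True)
  next
    case False
    have "polyf \<psi> (Vs - {v}) (\<lambda>x. if i = (0::nat) then x u else 0) (\<lambda>x. if i = 0 then x u else 0)" for i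
      using var False by (cases "i = 0") (auto intro: polyf.var zero)
    then show ?thesis
      by (intro exI[of _ 0] exI[of _ "\<lambda>i x. if i = 0 then x u else 0"] conjI) auto
  qed
next
  case (add F G F' G')
  then obtain d Fs Gs d' Fs' Gs' where
    1: "\<forall>i. polyf \<psi> (Vs - {v}) (Fs i) (Gs i)" "\<forall>i>d. Fs i = (\<lambda>_. 0) \<and> Gs i = (\<lambda>_. 0)"
      "\<forall>x. F x = (\<Sum>i\<le>d. Fs i x * x v ^ i)" "\<forall>x. G x = (\<Sum>i\<le>d. Gs i x * x v ^ i)"
    and 2: "\<forall>i. polyf \<psi> (Vs - {v}) (Fs' i) (Gs' i)" "\<forall>i>d'. Fs' i = (\<lambda>_. 0) \<and> Gs' i = (\<lambda>_. 0)"
      "\<forall>x. F' x = (\<Sum>i\<le>d'. Fs' i x * x v ^ i)" "\<forall>x. G' x = (\<Sum>i\<le>d'. Gs' i x * x v ^ i)" by blast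
  let ?m = "max d d'"
  show ?case
  proof (rule exI[of _ ?m], rule exI[of _ "\<lambda>i x. Fs i x + Fs' i x"], rule exI[of _ "\<lambda>i x. Gs i x + Gs' i x"],
      intro conjI allI impI)
    fix x :: "_ \<Rightarrow> complex"
    show "F x + F' x = (\<Sum>i\<le>?m. (Fs i x + Fs' i x) * x v ^ i)"
      using 1 2 sum_extend_zero[where k = d and m = ?m and f = "\<lambda>i. Fs i x" and t = "x v"]
        sum_extend_zero[where k = d' and m = ?m and f = "\<lambda>i. Fs' i x" and t = "x v"] by (simp add: distrib_right sum.distrib)
  next
    fix x :: "_ \<Rightarrow> 'r"
    show "G x + G' x = (\<Sum>i\<le>?m. (Gs i x + Gs' i x) * x v ^ i)"
      using 1 2 sum_extend_zero[where k = d and m = ?m and f = "\<lambda>i. Gs i x" and t = "x v"]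
        sum_extend_zero[where k = d' and m = ?m and f = "\<lambda>i. Gs' i x" and t = "x v"] by (simp add: distrib_right sum.distrib)
  qed (use 1 2 in \<open>auto intro: polyf.add\<close>)
next
  case (mult F G F' G')
  then obtain d Fs Gs d' Fs' Gs' where
    1: "\<forall>i. polyf \<psi> (Vs - {v}) (Fs i) (Gs i)" "\<forall>i>d. Fs i = (\<lambda>_. 0) \<and> Gs i = (\<lambda>_. 0)"
      "\<forall>x. F x = (\<Sum>i\<le>d. Fs i x * x v ^ i)" "\<forall>x. G x = (\<Sum>i\<le>d. Gs i x * x v ^ i)"
    and 2: "\<forall>i. polyf \<psi> (Vs - {v}) (Fs' i) (Gs' i)" "\<forall>i>d'. Fs' i = (\<lambda>_. 0) \<and> Gs' i = (\<lambda>_. 0)"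
      "\<forall>x. F' x = (\<Sum>i\<le>d'. Fs' i x * x v ^ i)" "\<forall>x. G' x = (\<Sum>i\<le>d'. Gs' i x * x v ^ i)" by blast
  show ?case
  proof (rule exI[of _ "d + d'"], rule exI[of _ "\<lambda>i x. \<Sum>k\<le>i. Fs k x * Fs' (i - k) x"],
      rule exI[of _ "\<lambda>i x. \<Sum>k\<le>i. Gs k x * Gs' (i - k) x"], intro conjI allI impI)
    show "polyf \<psi> (Vs - {v}) (\<lambda>x. \<Sum>k\<le>i. Fs k x * Fs' (i - k) x) (\<lambda>x. \<Sum>k\<le>i. Gs k x * Gs' (i - k) x)" for i
      using 1 2 by (intro of_sum polyf.mult) auto
    show "(\<lambda>x. \<Sum>k\<le>i. Fs k x * Fs' (i - k) x) = (\<lambda>_. 0)" if "d + d' < i" for i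

    proof
      fix x show "(\<Sum>k\<le>i. Fs k x * Fs' (i - k) x) = 0"
        by (rule convolution_zero[OF that]) (use 1(2) 2(2) in auto)
    qed
    show "(\<lambda>x. \<Sum>k\<le>i. Gs k x * Gs' (i - k) x) = (\<lambda>_. 0)" if "d + d' < i" for i

    proof
      fix x show "(\<Sum>k\<le>i. Gs k x * Gs' (i - k) x) = 0"
        by (rule convolution_zero[OF that]) (use 1(2) 2(2) in auto)
    qed
    show "F x * F' x = (\<Sum>i\<le>d + d'. (\<Sum>k\<le>i. Fs k x * Fs' (i - k) x) * x v ^ i)" for x
      using polynomial_product[where m = d and a = "\<lambda>i. Fs i x" and n = d' and b = "\<lambda>i. Fs' i x" and x = "x v"] 1 2 by simp
    show "G x * G' x = (\<Sum>i\<le>d + d'. (\<Sum>k\<le>i. Gs k x * Gs' (i - k) x) * x v ^ i)" for x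
      using polynomial_product[where m = d and a = "\<lambda>i. Gs i x" and n = d' and b = "\<lambda>i. Gs' i x" and x = "x v"] 1 2 by simp
  qed
qed

end

lemma polyf_local:
  assumes "polyf \<psi> Vs F G"
  shows "(\<forall>v\<in>Vs. x v = x' v) \<Longrightarrow> F x = F x'" "(\<forall>v\<in>Vs. y v = y' v) \<Longrightarrow> G y = G y'"
proof -
  have "((\<forall>v\<in>Vs. x v = x' v) \<longrightarrow> F x = F x') \<and> ((\<forall>v\<in>Vs. y v = y' v) \<longrightarrow> G y = G y')"
    using assms by induction auto
  then show "(\<forall>v\<in>Vs. x v = x' v) \<Longrightarrow> F x = F x'" "(\<forall>v\<in>Vs. y v = y' v) \<Longrightarrow> G y = G y'" by auto
qed

lemma complex_poly_coeffs_zero: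
  assumes "\<And>s :: complex. (\<Sum>i\<le>d. c i * s ^ i) = 0" "i \<le> d"
  shows "c i = 0"
proof -
  define p where "p = (\<Sum>i\<le>d. monom (c i) i)"
  have "poly p s = 0" for s using assms(1)[of s] by (simp add: p_def poly_sum poly_monom)
  then have "p = 0" by (simp add: poly_all_0_iff_0[symmetric])
  then have "coeff p i = 0" by simp
  then show ?thesis using assms(2) by (simp add: p_def coeff_sum)
qed

context poly_pair
begin

text \<open>A polynomial function that is 0 at all complex points has zero coefficients. Expanding
  in one variable at a time and descending to constants carries this over to the second ring; the
  induction ends because only finitely many variables occur.\<close>

lemma zero_transfer:
  assumes "polyf \<psi> Vs F G" "\<And>x. F x = 0"
  shows "G y = 0"
proof -
  obtain Us where "finite Us" "polyf \<psi> Us F G" using polyf_finite[OF assms(1)] by blast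
  then show ?thesis using assms(2)
  proof (induction Us arbitrary: F G y rule: finite_induct)
    case empty
    then obtain c where "F = (\<lambda>_. c)" "G = (\<lambda>_. \<psi> c)" using polyf_empty[OF _ comm_ring_hom_axioms] by blast
    then show ?case using empty by simp
  next
    case (insert v Us)
    from expand[OF insert.prems(1), of v]
    obtain d Fs Gs where *: "\<forall>i. polyf \<psi> (insert v Us - {v}) (Fs i) (Gs i)"
      "\<forall>x. F x = (\<Sum>i\<le>d. Fs i x * x v ^ i)" "\<forall>x. G x = (\<Sum>i\<le>d. Gs i x * x v ^ i)"
      by (elim exE conjE)
    have U: "insert v Us - {v} = Us" using insert by auto
    have "Fs i x = 0" if "i \<le> d" for i x
    proof (rule complex_poly_coeffs_zero[where d = d and c = "\<lambda>i. Fs i x", OF _ that])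
      fix s
      have "Fs i (x(v := s)) = Fs i x" for i
        by (rule polyf_local(1)[OF *(1)[rule_format]]) simp
      then have "(\<Sum>i\<le>d. Fs i x * s ^ i) = (\<Sum>i\<le>d. Fs i (x(v := s)) * (x(v := s)) v ^ i)"
        by (simp only: fun_upd_same)
      also have "\<dots> = F (x(v := s))" by (rule *(2)[rule_format, symmetric])
      finally show "(\<Sum>i\<le>d. Fs i x * s ^ i) = 0" by (simp only: insert.prems(2))
    qed
    then have "Gs i y = 0" if "i \<le> d" for i
      using insert.IH[OF *(1)[rule_format, unfolded U]] that by blast
    then have "(\<Sum>i\<le>d. Gs i y * y v ^ i) = 0" by (intro sum.neutral) simp
    then show ?case by (simp only: *(3)[rule_format])
  qed
qed

lemma restrict_zero:
  assumes "polyf \<psi> Vs F G"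
  shows "polyf \<psi> Vs (\<lambda>x. F (x(v := 0))) (\<lambda>x. G (x(v := 0)))"
proof -
  have "polyf \<psi> Vs (\<lambda>x. F (\<lambda>u. if u = v then 0 else x u)) (\<lambda>x. G (\<lambda>u. if u = v then 0 else x u))"
  proof (rule polyf_subst[OF assms, where f = "\<lambda>u x. if u = v then 0 else x u" and g = "\<lambda>u x. if u = v then 0 else x u"])
    fix u assume "u \<in> Vs"
    then show "polyf \<psi> Vs (\<lambda>x. if u = v then 0 else x u) (\<lambda>x. if u = v then 0 else x u)"
      by (cases "u = v") (auto intro: zero polyf.var)
  qed
  then show ?thesis by (simp only: fun_upd_def)
qed

lemma split_variable:
  assumes "polyf \<psi> Vs F G"
  shows "\<exists>F1 G1. polyf \<psi> Vs F1 G1 \<and> (\<forall>x. F x = F (x(v := 0)) + x v * F1 x) \<and> (\<forall>x. G x = G (x(v := 0)) + x v * G1 x)"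
  using assms
proof induction
  case (const c)
  show ?case by (rule exI[of _ "\<lambda>_. 0"], rule exI[of _ "\<lambda>_. 0"]) (simp add: zero)
next
  case (var u)
  show ?case
  proof (cases "u = v")
    case True
    then show ?thesis by (intro exI[of _ "\<lambda>_. 1"]) (simp add: one)
  next
    case False
    then show ?thesis by (intro exI[of _ "\<lambda>_. 0"]) (simp add: zero)
  qed
next
  case (add F G F' G')
  then obtain F1 G1 F1' G1' where *: "polyf \<psi> Vs F1 G1" "\<forall>x. F x = F (x(v := 0)) + x v * F1 x"
    "\<forall>x. G x = G (x(v := 0)) + x v * G1 x" "polyf \<psi> Vs F1' G1'" "\<forall>x. F' x = F' (x(v := 0)) + x v * F1' x"
    "\<forall>x. G' x = G' (x(v := 0)) + x v * G1' x" by blast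
  have e: "F x + F' x = F (x(v := 0)) + F' (x(v := 0)) + x v * (F1 x + F1' x)"
    "G y + G' y = G (y(v := 0)) + G' (y(v := 0)) + y v * (G1 y + G1' y)" for x y
    using *(2)[rule_format, of x] *(5)[rule_format, of x] *(3)[rule_format, of y] *(6)[rule_format, of y]
    by (simp_all add: distrib_left)
  show ?case
    by (rule exI[of _ "\<lambda>x. F1 x + F1' x"], rule exI[of _ "\<lambda>x. G1 x + G1' x"])
      (use * e in \<open>blast intro: polyf.add\<close>)
next
  case (mult F G F' G')
  then obtain F1 G1 F1' G1' where *: "polyf \<psi> Vs F1 G1" "\<forall>x. F x = F (x(v := 0)) + x v * F1 x"
    "\<forall>x. G x = G (x(v := 0)) + x v * G1 x" "polyf \<psi> Vs F1' G1'" "\<forall>x. F' x = F' (x(v := 0)) + x v * F1' x"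
    "\<forall>x. G' x = G' (x(v := 0)) + x v * G1' x" by blast
  have z: "polyf \<psi> Vs (\<lambda>x. F (x(v := 0))) (\<lambda>x. G (x(v := 0)))"
    by (rule restrict_zero[OF mult.hyps(1)])
  note e = product_split
  have e1: "F x * F' x = F (x(v := 0)) * F' (x(v := 0)) + x v * (F1 x * F' x + F (x(v := 0)) * F1' x)" for x
    by (rule e[OF *(2)[rule_format] *(5)[rule_format]])
  have e2: "G x * G' x = G (x(v := 0)) * G' (x(v := 0)) + x v * (G1 x * G' x + G (x(v := 0)) * G1' x)" for x
    by (rule e[OF *(3)[rule_format] *(6)[rule_format]])
  have "polyf \<psi> Vs (\<lambda>x. F1 x * F' x + F (x(v := 0)) * F1' x) (\<lambda>x. G1 x * G' x + G (x(v := 0)) * G1' x)"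
    using * mult.hyps z by (intro polyf.add polyf.mult)
  then show ?case using e1 e2 by (intro exI[of _ "\<lambda>x. F1 x * F' x + F (x(v := 0)) * F1' x"]
      exI[of _ "\<lambda>x. G1 x * G' x + G (x(v := 0)) * G1' x"] conjI allI)
qed

lemma line_poly:
  assumes "polyf \<psi> Vs F G"
  shows "\<exists>p. \<forall>s. F (x(v := s)) = poly p s"
  using assms
proof induction
  case (const c)
  show ?case by (rule exI[of _ "[:c:]"]) simp
next
  case (var u)
  show ?case
  proof (cases "u = v")
    case True
    then show ?thesis by (intro exI[of _ "[:0, 1:]"]) simp
  next
    case False
    then show ?thesis by (intro exI[of _ "[:x u:]"]) simp
  qed
next
  case (add F G F' G')
  then obtain p p' where p: "\<forall>s. F (x(v := s)) = poly p s" "\<forall>s. F' (x(v := s)) = poly p' s" by blast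
  show ?case by (rule exI[of _ "p + p'"]) (simp only: p[rule_format] poly_add simp_thms)
next
  case (mult F G F' G')
  then obtain p p' where p: "\<forall>s. F (x(v := s)) = poly p s" "\<forall>s. F' (x(v := s)) = poly p' s" by blast
  show ?case by (rule exI[of _ "p * p'"]) (simp only: p[rule_format] poly_mult simp_thms)
qed

text \<open>A polynomial in \<open>s\<close> with every nonzero number as a root is 0. This serves
  as a continuity argument at points where a variable vanishes.\<close>

lemma line_zero:
  assumes "polyf \<psi> Vs F G" "\<And>s. s \<noteq> 0 \<Longrightarrow> F (x(v := s)) = 0"
  shows "F x = 0"
proof -
  obtain p where p: "\<forall>s. F (x(v := s)) = poly p s" using line_poly[OF assms(1)] by blast
  have "p = 0"
  proof (rule ccontr)
    assume "p \<noteq> 0"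
    then have "finite {s. poly p s = 0}" by (rule poly_roots_finite)
    moreover have "UNIV - {0} \<subseteq> {s. poly p s = 0}" using assms(2) p by auto
    ultimately have "finite (UNIV - {0 :: complex})" using finite_subset by blast
    then show False using infinite_UNIV_char_0[where 'a = complex] by simp
  qed
  then show ?thesis using p[rule_format, of "x v"] by simp
qed

text \<open>Expansion by the support of the monomials in the variables \<open>Bs\<close>. A coefficient vanishes at a
  point if the polynomial vanishes for all values of the variables in its support, the other
  variables of \<open>Bs\<close> being set to zero.\<close>
lemma support_expansion:
  assumes "finite Bs" "polyf \<psi> Vs F G"
  shows "\<exists>hF hG. (\<forall>R\<subseteq>Bs. polyf \<psi> Vs (hF R) (hG R)) \<and>
    (\<forall>x. F x = (\<Sum>R\<in>Pow Bs. (\<Prod>v\<in>R. x v) * hF R x)) \<and> (\<forall>x. G x = (\<Sum>R\<in>Pow Bs. (\<Prod>v\<in>R. x v) * hG R x)) \<and>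
    (\<forall>R\<subseteq>Bs. \<forall>x. (\<forall>x'. (\<forall>u. u \<notin> Bs \<longrightarrow> x' u = x u) \<longrightarrow> (\<forall>u\<in>Bs - R. x' u = 0) \<longrightarrow> F x' = 0) \<longrightarrow> hF R x = 0)"
  using assms
proof (induction Bs arbitrary: F G rule: finite_induct)
  case empty
  have "F x = 0" if "\<forall>x'. (\<forall>u. x' u = x u) \<longrightarrow> F x' = 0" for x using that by simp
  then show ?case using empty by (intro exI[of _ "\<lambda>_. F"] exI[of _ "\<lambda>_. G"]) auto
next
  case (insert v Bs)
  obtain F1 G1 where 1: "polyf \<psi> Vs F1 G1" "\<forall>x. F x = F (x(v := 0)) + x v * F1 x" "\<forall>x. G x = G (x(v := 0)) + x v * G1 x"
    using split_variable[OF insert.prems, of v] by (elim exE conjE)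
  define F0 G0 where "F0 = (\<lambda>x. F (x(v := 0)))" and "G0 = (\<lambda>x. G (x(v := 0)))"
  have 0: "polyf \<psi> Vs F0 G0" unfolding F0_def G0_def by (rule restrict_zero[OF insert.prems])
  from insert.IH[OF 0] obtain aF aG where a: "\<forall>R\<subseteq>Bs. polyf \<psi> Vs (aF R) (aG R)"
    "\<forall>x. F0 x = (\<Sum>R\<in>Pow Bs. (\<Prod>v\<in>R. x v) * aF R x)" "\<forall>x. G0 x = (\<Sum>R\<in>Pow Bs. (\<Prod>v\<in>R. x v) * aG R x)"
    "\<forall>R\<subseteq>Bs. \<forall>x. (\<forall>x'. (\<forall>u. u \<notin> Bs \<longrightarrow> x' u = x u) \<longrightarrow> (\<forall>u\<in>Bs - R. x' u = 0) \<longrightarrow> F0 x' = 0) \<longrightarrow> aF R x = 0"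
    by (elim exE conjE)
  from insert.IH[OF 1(1)] obtain bF bG where b: "\<forall>R\<subseteq>Bs. polyf \<psi> Vs (bF R) (bG R)"
    "\<forall>x. F1 x = (\<Sum>R\<in>Pow Bs. (\<Prod>v\<in>R. x v) * bF R x)" "\<forall>x. G1 x = (\<Sum>R\<in>Pow Bs. (\<Prod>v\<in>R. x v) * bG R x)"
    "\<forall>R\<subseteq>Bs. \<forall>x. (\<forall>x'. (\<forall>u. u \<notin> Bs \<longrightarrow> x' u = x u) \<longrightarrow> (\<forall>u\<in>Bs - R. x' u = 0) \<longrightarrow> F1 x' = 0) \<longrightarrow> bF R x = 0"
    by (elim exE conjE)
  define hF hG where "hF R = (if v \<in> R then bF (R - {v}) else aF R)"
    and "hG R = (if v \<in> R then bG (R - {v}) else aG R)" for R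
  note sum = sum_Pow_insert[OF insert.hyps]
  have "hF R x = 0"
    if R: "R \<subseteq> insert v Bs" and van: "\<forall>x'. (\<forall>u. u \<notin> insert v Bs \<longrightarrow> x' u = x u) \<longrightarrow> (\<forall>u\<in>insert v Bs - R. x' u = 0) \<longrightarrow> F x' = 0"
    for R x
  proof (cases "v \<in> R")
    case False
    have "aF R x = 0"
    proof (rule a(4)[THEN spec, THEN mp, THEN spec, THEN mp], goal_cases)
      case 2
      show ?case
      proof (intro allI impI)
        fix x' assume x': "\<forall>u. u \<notin> Bs \<longrightarrow> x' u = x u" "\<forall>u\<in>Bs - R. x' u = 0"
        have "F (x'(v := 0)) = 0" using x' by (intro van[rule_format]) auto
        then show "F0 x' = 0" by (simp add: F0_def)
      qed
    next
      case 1
      then show ?case using R False by auto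
    qed
    then show ?thesis using False by (simp add: hF_def)
  next
    case True
    have "bF (R - {v}) x = 0"
    proof (rule b(4)[THEN spec, THEN mp, THEN spec, THEN mp], goal_cases)
      case 2
      show ?case
      proof (intro allI impI)
        fix x' assume x': "\<forall>u. u \<notin> Bs \<longrightarrow> x' u = x u" "\<forall>u\<in>Bs - (R - {v}). x' u = 0"
        \<comment> \<open>As \<open>v\<close> belongs to the support, its value is free. Splitting
          off \<open>v\<close> at a value \<open>s \<noteq> 0\<close> shows that \<open>F1\<close>
          vanishes there, and \<open>line_zero\<close> gives the remaining value.\<close>
        have z: "F (x'(v := s)) = 0" for s
          using x' True insert.hyps by (intro van[rule_format]) auto
        show "F1 x' = 0"
        proof (rule line_zero[OF 1(1)])
          fix s :: complex assume "s \<noteq> 0"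
          then show "F1 (x'(v := s)) = 0" using 1(2)[rule_format, of "x'(v := s)"] z[of s] z[of 0] by simp
        qed
      qed
    next
      case 1
      then show ?case using R by auto
    qed
    then show ?thesis using True by (simp add: hF_def)
  qed
  then have van: "\<forall>R\<subseteq>insert v Bs. \<forall>x. (\<forall>x'. (\<forall>u. u \<notin> insert v Bs \<longrightarrow> x' u = x u) \<longrightarrow> (\<forall>u\<in>insert v Bs - R. x' u = 0) \<longrightarrow> F x' = 0) \<longrightarrow> hF R x = 0"
    by (intro allI impI)
  have p: "\<forall>R\<subseteq>insert v Bs. polyf \<psi> Vs (hF R) (hG R)"
  proof (intro allI impI)
    fix R assume "R \<subseteq> insert v Bs"
    then show "polyf \<psi> Vs (hF R) (hG R)"
      using a(1) b(1) by (cases "v \<in> R") (auto simp: hF_def hG_def subset_insert_iff)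
  qed
  have Fe: "F x = (\<Sum>R\<in>Pow (insert v Bs). (\<Prod>v\<in>R. x v) * hF R x)" for x
  proof -
    have "F x = F0 x + x v * F1 x" using 1(2) unfolding F0_def by blast
    also have "\<dots> = (\<Sum>R\<in>Pow (insert v Bs). (\<Prod>v\<in>R. x v) * (if v \<in> R then bF (R - {v}) x else aF R x))"
      unfolding a(2)[rule_format, of x] b(2)[rule_format, of x] by (rule sum[symmetric])
    finally show ?thesis by (simp only: hF_def if_distribR)
  qed
  have Ge: "G x = (\<Sum>R\<in>Pow (insert v Bs). (\<Prod>v\<in>R. x v) * hG R x)" for x
  proof -
    have "G x = G0 x + x v * G1 x" using 1(3) unfolding G0_def by blast
    also have "\<dots> = (\<Sum>R\<in>Pow (insert v Bs). (\<Prod>v\<in>R. x v) * (if v \<in> R then bG (R - {v}) x else aG R x))"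
      unfolding a(3)[rule_format, of x] b(3)[rule_format, of x] by (rule sum[symmetric])
    finally show ?thesis by (simp only: hG_def if_distribR)
  qed
  show ?case
    by (rule exI[of _ hF], rule exI[of _ hG], rule conjI[OF p conjI[OF allI[OF Fe] conjI[OF allI[OF Ge] van]]])
qed

end

text \<open>The substitution \<open>H = T diag(d) Q\<close>: the entries of \<open>H\<close> are the variables with first index 0,
  those of \<open>Q\<close>, \<open>T\<close>, \<open>d\<close> the ones with first index 0, 1, 2.\<close>
definition diag_subst :: "nat set \<Rightarrow> nat set \<Rightarrow> (nat \<times> nat \<times> nat \<Rightarrow> 'c::comm_ring_1) \<Rightarrow> nat \<times> nat \<times> nat \<Rightarrow> 'c" where
  "diag_subst S C x = (\<lambda>(l, a, c). if l = 0 then if a \<in> S \<and> c \<in> C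
     then \<Sum>b\<in>S. x (1, a, b) * x (2, b, 0) * x (0, b, c) else x (0, a, c) else x (l + 2, a, c))"

text \<open>\<open>g'\<close> plays the role of \<open>g / d\<close>: it is 1 if \<open>g\<close>
  divides \<open>d\<close>, and the exact quotient otherwise.\<close>

lemma quotient_dvd_iff:
  assumes "(g :: 'r::idom) dvd d \<or> d dvd g"
  shows "\<exists>g'. \<forall>z. g dvd d * z \<longleftrightarrow> g' dvd z"
proof (cases "g dvd d")
  case True
  then show ?thesis by (intro exI[of _ 1]) simp
next
  case False
  then obtain g' where "g = d * g'" "d \<noteq> 0" using assms by (auto elim: dvdE)
  then show ?thesis by (intro exI[of _ g']) simp
qed

context poly_pair
begin

lemma diag_subst: "polyf \<psi> UNIV F G \<Longrightarrow> polyf \<psi> UNIV (\<lambda>x. F (diag_subst S C x)) (\<lambda>x. G (diag_subst S C x))"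
proof -
  assume FG: "polyf \<psi> UNIV F G"
  have "polyf \<psi> UNIV (\<lambda>x. F (\<lambda>v. diag_subst S C x v)) (\<lambda>x. G (\<lambda>v. diag_subst S C x v))"
  proof (rule polyf_subst[OF FG])
    fix v :: "nat \<times> nat \<times> nat"
    obtain l a c where v: "v = (l, a, c)" by (rule prod_cases3)
    have 1: "polyf \<psi> UNIV (\<lambda>x. \<Sum>b\<in>S. x (1 :: nat, a, b) * x (2, b, 0) * x (0, b, c)) (\<lambda>x. \<Sum>b\<in>S. x (1 :: nat, a, b) * x (2, b, 0) * x (0, b, c))"
      by (intro of_sum polyf.mult polyf.var UNIV_I)
    have 2: "polyf \<psi> UNIV (\<lambda>x. x u) (\<lambda>x. x u)" for u :: "nat \<times> nat \<times> nat" by (rule polyf.var[OF UNIV_I])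
    show "polyf \<psi> UNIV (\<lambda>x. diag_subst S C x v) (\<lambda>x. diag_subst S C x v)"
      unfolding v diag_subst_def prod.case
      by (cases "l = 0"; cases "a \<in> S \<and> c \<in> C") (simp_all only: if_True if_False simp_thms 1 2)
  qed
  then show ?thesis by simp
qed

text \<open>Diagonalise the matrix on the largest set of columns and expand by the supports of the
  monomials in the diagonal entries.  On a support with less than \<open>r\<close> elements the first
  condition holds automatically, and induction applies to the corresponding coefficient.\<close>
lemma dvd_of_minors_dvd:
  fixes g :: 'r and y :: "nat \<times> nat \<times> nat \<Rightarrow> 'r"
  assumes tot: "\<And>x y :: 'r. x dvd y \<or> y dvd x"
    and "finite S" "\<forall>(r, C)\<in>set cs. finite C" "sorted_wrt (\<lambda>(r, C) (r', C'). C' \<subseteq> C) cs"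
    and "polyf \<psi> UNIV F G"
    and "\<And>x. (\<forall>(r, C)\<in>set cs. dvd_minors 0 r S C (\<lambda>a c. x (0, a, c))) \<Longrightarrow> F x = 0"
    and "\<forall>(r, C)\<in>set cs. dvd_minors g r S C (\<lambda>a c. y (0, a, c))"
  shows "g dvd G y"
  using assms(2-)
proof (induction cs arbitrary: S F G g y)
  case Nil
  then have "G y = 0" by (intro zero_transfer[OF Nil.prems(4)]) simp
  then show ?case by simp
next
  case (Cons rC cs)
  obtain r C where rC: "rC = (r, C)" by (rule prod.exhaust)
  have C: "finite C" and sub: "\<And>r' C'. (r', C') \<in> set cs \<Longrightarrow> C' \<subseteq> C"
    using Cons.prems(2,3) by (auto simp: rC)
  obtain T T' d Q Y where sm: "smith S C (\<lambda>a c. y (0, a, c)) T T' d Q Y"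
    using smith_exists[OF tot Cons.prems(1) C] by blast
  define y' where "y' = (\<lambda>(l, a, c). if l = 0 then if a \<in> S \<and> c \<in> C then Q a c else y (0, a, c)
    else if l = 1 then T a c else if l = 2 then d a else y (l - 2, a, c))"
  have y: "diag_subst S C y' = y"
  proof
    fix v :: "nat \<times> nat \<times> nat"
    obtain l a c where v: "v = (l, a, c)" by (rule prod_cases3)
    have "(\<Sum>b\<in>S. T a b * d b * (if b \<in> S \<and> c \<in> C then Q b c else y (0, b, c))) = y (0, a, c)"
      if "a \<in> S" "c \<in> C"
      using smith_factor[OF sm Cons.prems(1) that] that(2) by (simp add: mult.assoc)
    then show "diag_subst S C y' v = y v" by (simp add: v diag_subst_def y'_def)
  qed
  define B :: "nat set \<Rightarrow> (nat \<times> nat \<times> nat) set" where "B R = (\<lambda>b. (2, b, 0)) ` R" for R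
  have injB: "inj_on (\<lambda>b :: nat. (2 :: nat, b, 0 :: nat)) R" for R by (simp add: inj_on_def)
  have finB: "finite (B S)" using Cons.prems(1) by (simp add: B_def)
  from support_expansion[OF finB diag_subst[OF Cons.prems(4), of S C]]
  obtain hF hG where h: "\<forall>R\<subseteq>B S. polyf \<psi> UNIV (hF R) (hG R)"
    "\<forall>x. F (diag_subst S C x) = (\<Sum>R\<in>Pow (B S). (\<Prod>v\<in>R. x v) * hF R x)"
    "\<forall>x. G (diag_subst S C x) = (\<Sum>R\<in>Pow (B S). (\<Prod>v\<in>R. x v) * hG R x)"
    "\<forall>R\<subseteq>B S. \<forall>x. (\<forall>x'. (\<forall>u. u \<notin> B S \<longrightarrow> x' u = x u) \<longrightarrow> (\<forall>u\<in>B S - R. x' u = 0) \<longrightarrow> F (diag_subst S C x') = 0) \<longrightarrow> hF R x = 0"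
    by (elim exE conjE)
  have "g dvd (\<Sum>R\<in>Pow (B S). (\<Prod>v\<in>R. y' v) * hG R y')"
  proof (rule dvd_sum)
    fix R assume "R \<in> Pow (B S)"
    then have "R \<subseteq> (\<lambda>b. (2, b, 0)) ` S" by (simp add: B_def)
    then obtain S1 where S1: "S1 \<subseteq> S" "R = B S1" unfolding B_def by (rule subset_imageE)
    have fin1: "finite S1" using S1 Cons.prems(1) finite_subset by blast
    have dR: "(\<Prod>v\<in>R. y' v) = (\<Prod>b\<in>S1. d b)"
      unfolding S1 B_def by (simp add: prod.reindex[OF injB] y'_def)
    \<comment> \<open>A large support contributes a product of \<open>r\<close> diagonal entries,
      which \<open>g\<close> divides by the first condition. For a small support the coefficient has
      to supply the remaining divisibility.\<close>
    show "g dvd (\<Prod>v\<in>R. y' v) * hG R y'"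
    proof (cases "r \<le> card S1")
      case True
      obtain R' where R': "R' \<subseteq> S1" "card R' = r" using obtain_subset_with_card_n[OF True] by blast
      have "dvd_minors g r S C (\<lambda>a c. y (0, a, c))" using Cons.prems(6) by (simp add: rC)
      then have "g dvd (\<Prod>b\<in>R'. d b)"
        using dvd_minors_smith_iff[OF sm Cons.prems(1) C, of g r] R' order_trans[OF R'(1) S1(1)] by simp
      also have "\<dots> dvd (\<Prod>b\<in>S1. d b)" by (rule prod_dvd_prod_subset[OF fin1 R'(1)])
      finally show ?thesis by (simp add: dR)
    next
      case False
      have hR: "polyf \<psi> UNIV (hF R) (hG R)" by (rule h(1)[rule_format]) (use S1 in \<open>auto simp: B_def\<close>)
      \<comment> \<open>With the diagonal entries outside \<open>S1\<close> set to 0, the matrix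
        factors through the rows \<open>S1\<close>. Its minors of size \<open>r\<close> then vanish,
        and the other conditions follow from those on the rows \<open>S1\<close> of the right
        factor.\<close>
      have van: "hF R x = 0" if x: "\<forall>(r, C)\<in>set cs. dvd_minors 0 r S1 C (\<lambda>a c. x (0, a, c))" for x
      proof (rule h(4)[THEN spec, THEN mp, THEN spec, THEN mp])
        show "R \<subseteq> B S" using S1 by (auto simp: B_def)
        show "\<forall>x'. (\<forall>u. u \<notin> B S \<longrightarrow> x' u = x u) \<longrightarrow> (\<forall>u\<in>B S - R. x' u = 0) \<longrightarrow> F (diag_subst S C x') = 0"
        proof (intro allI impI)
          fix x' assume x': "\<forall>u. u \<notin> B S \<longrightarrow> x' u = x u" "\<forall>u\<in>B S - R. x' u = 0"
          have z: "x' (2, b, 0) = 0" if "b \<in> S" "b \<notin> S1" for b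
            using x'(2) that S1 by (auto simp: B_def)
          have x0: "x' (0, b, c) = x (0, b, c)" for b c by (rule x'(1)[rule_format]) (auto simp: B_def)
          have eq: "diag_subst S C x' (0, a, c) = mm S1 (\<lambda>a b. x' (1, a, b) * x' (2, b, 0)) (\<lambda>b c. x (0, b, c)) a c"
            if "a \<in> S" "c \<in> C" for a c
          proof -
            have "diag_subst S C x' (0, a, c) = (\<Sum>b\<in>S. x' (1, a, b) * x' (2, b, 0) * x (0, b, c))"
              using that x0 by (simp add: diag_subst_def)
            also have "\<dots> = (\<Sum>b\<in>S1. x' (1, a, b) * x' (2, b, 0) * x (0, b, c))"
              using z by (intro sum.mono_neutral_right Cons.prems(1) S1) auto
            finally show ?thesis by (simp add: mm_def)
          qed
          have tr: "dvd_minors 0 r' S C' (\<lambda>a c. diag_subst S C x' (0, a, c))"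
            if "dvd_minors 0 r' S1 C' (\<lambda>b c. x (0, b, c))" "C' \<subseteq> C" for r' C'
            using dvd_minors_mult_left[OF fin1 that(1), of S "\<lambda>a b. x' (1, a, b) * x' (2, b, 0)"] eq that(2)
            by (subst dvd_minors_cong) auto
          have "dvd_minors 0 r S1 C (\<lambda>b c. x (0, b, c))"
            using minor_eq_0_of_card[OF fin1] False by (auto simp: dvd_minors_def not_le)
          then show "F (diag_subst S C x') = 0"
            using x sub by (intro Cons.prems(5)) (auto simp: rC intro!: tr)
        qed
      qed
      obtain g' where g': "\<forall>z. g dvd (\<Prod>b\<in>S1. d b) * z \<longleftrightarrow> g' dvd z"
        using quotient_dvd_iff[OF tot] by blast
      have "g' dvd hG R y'"
      proof (rule Cons.IH[OF fin1 _ _ hR van])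
        show "\<forall>(r, C)\<in>set cs. finite C" "sorted_wrt (\<lambda>(r, C) (r', C'). C' \<subseteq> C) cs"
          using Cons.prems(2,3) by auto
        \<comment> \<open>A minor of \<open>T' H\<close> with rows in \<open>S1\<close> is the
          corresponding minor of \<open>Q\<close> times the diagonal entries of its rows. So
          \<open>g\<close> divides the minor of \<open>Q\<close> times the whole product over
          \<open>S1\<close>, which means that \<open>g'\<close> divides the minor of
          \<open>Q\<close>.\<close>
        have "dvd_minors g' r' S1 C' (\<lambda>a c. y' (0, a, c))" if m: "(r', C') \<in> set cs" for r' C'
          unfolding dvd_minors_def
        proof (intro allI impI)
          fix \<rho> \<kappa> assume \<rho>: "\<forall>i<r'. \<rho> i \<in> S1" "\<forall>i<r'. \<kappa> i \<in> C'"
          show "g' dvd minor r' (\<lambda>a c. y' (0, a, c)) \<rho> \<kappa>"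
          proof (cases "inj_on \<rho> {..<r'}")
            case False
            then obtain i j where "i < r'" "j < r'" "i \<noteq> j" "\<rho> i = \<rho> j" by (auto simp: inj_on_def)
            then have "minor r' (\<lambda>a c. y' (0, a, c)) \<rho> \<kappa> = 0" by (rule minor_not_inj)
            then show ?thesis by simp
          next
            case True
            have "dvd_minors g r' S C' (\<lambda>a c. y (0, a, c))" using Cons.prems(6) m by auto
            then have "dvd_minors g r' S C' (mm S T' (\<lambda>a c. y (0, a, c)))"
              by (rule dvd_minors_mult_left[OF Cons.prems(1)])
            then have "g dvd minor r' (mm S T' (\<lambda>a c. y (0, a, c))) \<rho> \<kappa>"
              using \<rho> S1 by (auto simp: dvd_minors_def)
            also have "minor r' (mm S T' (\<lambda>a c. y (0, a, c))) \<rho> \<kappa> = minor r' (\<lambda>a c. d a * y' (0, a, c)) \<rho> \<kappa>"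
            proof (rule minor_cong)
              fix i j assume "i < r'" "j < r'"
              then have "\<rho> i \<in> S" "\<kappa> j \<in> C" using \<rho> S1 sub[OF m] by auto
              then show "mm S T' (\<lambda>a c. y (0, a, c)) (\<rho> i) (\<kappa> j) = d (\<rho> i) * y' (0, \<rho> i, \<kappa> j)"
                using sm by (simp add: smith_def y'_def)
            qed
            also have "\<dots> = (\<Prod>i<r'. d (\<rho> i)) * minor r' (\<lambda>a c. y' (0, a, c)) \<rho> \<kappa>"
              by (simp add: minor_def det_mof prod.distrib sum_distrib_left mult_ac)
            also have "\<dots> dvd (\<Prod>b\<in>S1. d b) * minor r' (\<lambda>a c. y' (0, a, c)) \<rho> \<kappa>"
            proof (rule mult_dvd_mono[OF _ dvd_refl])
              have "(\<Prod>i<r'. d (\<rho> i)) = (\<Prod>b\<in>\<rho> ` {..<r'}. d b)" by (simp add: prod.reindex[OF True])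
              also have "\<dots> dvd (\<Prod>b\<in>S1. d b)" using \<rho> by (intro prod_dvd_prod_subset fin1) auto
              finally show "(\<Prod>i<r'. d (\<rho> i)) dvd (\<Prod>b\<in>S1. d b)" .
            qed
            finally show ?thesis using g' by blast
          qed
        qed
        then show "\<forall>(r, C)\<in>set cs. dvd_minors g' r S1 C (\<lambda>a c. y' (0, a, c))" by auto
      qed
      then show ?thesis using g' by (simp add: dR)
    qed
  qed
  also have "\<dots> = G y" using h(3)[rule_format, of y'] by (simp add: y)
  finally show ?case .
qed

end

section \<open>Irreducibility of the contact strata\<close>

text \<open>Functions on a line that are given by one rational function regular at \<open>s0\<close>, outside of its poles.\<close>
definition regular_at :: "'k::field \<Rightarrow> ('k \<Rightarrow> 'k) \<Rightarrow> bool" where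
  "regular_at s0 g \<longleftrightarrow> (\<exists>p d. poly d s0 \<noteq> 0 \<and> (\<forall>s. poly d s \<noteq> 0 \<longrightarrow> g s = poly p s / poly d s))"

lemma regular_at_const: "regular_at s0 (\<lambda>_. c)"
  unfolding regular_at_def by (rule exI[of _ "[:c:]"], rule exI[of _ 1]) simp

lemma regular_at_ident: "regular_at s0 (\<lambda>s. s)"
  unfolding regular_at_def by (rule exI[of _ "[:0, 1:]"], rule exI[of _ 1]) simp

lemma regular_at_add:
  assumes "regular_at s0 f" "regular_at s0 g"
  shows "regular_at s0 (\<lambda>s. f s + g s)"
proof -
  obtain p d p' d' where "poly d s0 \<noteq> 0" "\<And>s. poly d s \<noteq> 0 \<Longrightarrow> f s = poly p s / poly d s"
    "poly d' s0 \<noteq> 0" "\<And>s. poly d' s \<noteq> 0 \<Longrightarrow> g s = poly p' s / poly d' s"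
    using assms unfolding regular_at_def by metis
  then show ?thesis unfolding regular_at_def
    by (intro exI[of _ "p * d' + p' * d"] exI[of _ "d * d'"]) (auto simp: field_simps)
qed

lemma regular_at_mult:
  assumes "regular_at s0 f" "regular_at s0 g"
  shows "regular_at s0 (\<lambda>s. f s * g s)"
proof -
  obtain p d p' d' where "poly d s0 \<noteq> 0" "\<And>s. poly d s \<noteq> 0 \<Longrightarrow> f s = poly p s / poly d s"
    "poly d' s0 \<noteq> 0" "\<And>s. poly d' s \<noteq> 0 \<Longrightarrow> g s = poly p' s / poly d' s"
    using assms unfolding regular_at_def by metis
  then show ?thesis unfolding regular_at_def
    by (intro exI[of _ "p * p'"] exI[of _ "d * d'"]) auto
qed

lemma regular_at_inverse:
  assumes "regular_at s0 f" "f s0 \<noteq> 0"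
  shows "regular_at s0 (\<lambda>s. inverse (f s))"
proof -
  obtain p d where *: "poly d s0 \<noteq> 0" "\<And>s. poly d s \<noteq> 0 \<Longrightarrow> f s = poly p s / poly d s"
    using assms unfolding regular_at_def by metis
  then have "poly p s0 \<noteq> 0" using assms(2) by auto
  then show ?thesis unfolding regular_at_def using *
    by (intro exI[of _ "d * d"] exI[of _ "p * d"]) auto
qed

lemma regular_at_sum: "(\<And>i. i \<in> A \<Longrightarrow> regular_at s0 (f i)) \<Longrightarrow> regular_at s0 (\<lambda>s. \<Sum>i\<in>A. f i s)"
  by (induction A rule: infinite_finite_induct) (auto intro: regular_at_const regular_at_add)

lemma regular_at_prod: "(\<And>i. i \<in> A \<Longrightarrow> regular_at s0 (f i)) \<Longrightarrow> regular_at s0 (\<lambda>s. \<Prod>i\<in>A. f i s)"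
  by (induction A rule: infinite_finite_induct) (auto intro: regular_at_const regular_at_mult)

lemma regular_at_power: "regular_at s0 f \<Longrightarrow> regular_at s0 (\<lambda>s. f s ^ m)"
  by (induction m) (auto intro: regular_at_const regular_at_mult)

lemma regular_at_uminus: "regular_at s0 f \<Longrightarrow> regular_at s0 (\<lambda>s. - f s)"
  using regular_at_mult[OF regular_at_const[of s0 "- 1"], of f] by simp

lemma regular_at_imp_eventually_nonzero:
  assumes "regular_at s0 g" "g s0 \<noteq> 0"
  shows "\<forall>\<^sub>F s in cofinite. g s \<noteq> 0"
proof -
  obtain p d where *: "poly d s0 \<noteq> 0" "\<And>s. poly d s \<noteq> 0 \<Longrightarrow> g s = poly p s / poly d s"
    using assms unfolding regular_at_def by metis
  then have "poly (p * d) s0 \<noteq> 0" using assms(2) by auto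
  then have "p * d \<noteq> 0" by auto
  then have "finite {s. poly (p * d) s = 0}" by (rule poly_roots_finite)
  moreover have "{s. \<not> g s \<noteq> 0} \<subseteq> {s. poly (p * d) s = 0}" using * by auto
  ultimately show ?thesis unfolding eventually_cofinite using finite_subset by blast
qed

text \<open>Each coefficient has its own denominator, because inverting a power series brings in
  ever higher powers of the constant term. This is enough, since a polynomial on the arc space
  involves finitely many coefficients.\<close>

definition fps_regular_at :: "'k::field \<Rightarrow> ('k \<Rightarrow> 'k fps) \<Rightarrow> bool" where
  "fps_regular_at s0 G \<longleftrightarrow> (\<forall>m. regular_at s0 (\<lambda>s. fps_nth (G s) m))"

lemma fps_regular_at_const: "fps_regular_at s0 (\<lambda>_. c)"
  by (simp add: fps_regular_at_def regular_at_const)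

lemma fps_regular_at_fps_const: "regular_at s0 f \<Longrightarrow> fps_regular_at s0 (\<lambda>s. fps_const (f s))"
  unfolding fps_regular_at_def
proof
  fix m assume "regular_at s0 f"
  then show "regular_at s0 (\<lambda>s. fps_nth (fps_const (f s)) m)"
    by (cases "m = 0") (simp_all add: regular_at_const)
qed

lemma fps_regular_at_add:
  "fps_regular_at s0 F \<Longrightarrow> fps_regular_at s0 G \<Longrightarrow> fps_regular_at s0 (\<lambda>s. F s + G s)"
  by (simp add: fps_regular_at_def regular_at_add)

lemma fps_regular_at_mult:
  "fps_regular_at s0 F \<Longrightarrow> fps_regular_at s0 G \<Longrightarrow> fps_regular_at s0 (\<lambda>s. F s * G s)"
  by (auto simp: fps_regular_at_def fps_mult_nth intro!: regular_at_sum regular_at_mult)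

lemma fps_regular_at_uminus: "fps_regular_at s0 F \<Longrightarrow> fps_regular_at s0 (\<lambda>s. - F s)"
  by (simp add: fps_regular_at_def regular_at_uminus)

lemma fps_regular_at_sum:
  "(\<And>i. i \<in> A \<Longrightarrow> fps_regular_at s0 (f i)) \<Longrightarrow> fps_regular_at s0 (\<lambda>s. \<Sum>i\<in>A. f i s)"
  by (induction A rule: infinite_finite_induct) (auto intro: fps_regular_at_const fps_regular_at_add)

lemma fps_regular_at_prod:
  "(\<And>i. i \<in> A \<Longrightarrow> fps_regular_at s0 (f i)) \<Longrightarrow> fps_regular_at s0 (\<lambda>s. \<Prod>i\<in>A. f i s)"
  by (induction A rule: infinite_finite_induct) (auto intro: fps_regular_at_const fps_regular_at_mult)

lemma fps_regular_at_inverse: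
  assumes G: "fps_regular_at s0 G" and "fps_nth (G s0) 0 \<noteq> 0"
  shows "fps_regular_at s0 (\<lambda>s. inverse (G s))"
  unfolding fps_regular_at_def
proof
  fix m
  have a: "regular_at s0 (\<lambda>s. inverse (fps_nth (G s) 0))"
    using assms by (intro regular_at_inverse) (auto simp: fps_regular_at_def)
  have "regular_at s0 (\<lambda>s. natfun_inverse (G s) m)"
  proof (induction m rule: less_induct)
    case (less m)
    show ?case
    proof (cases m)
      case 0
      then show ?thesis using a by simp
    next
      case (Suc l)
      have "regular_at s0 (\<lambda>s. - inverse (fps_nth (G s) 0) *
          (\<Sum>i\<in>{1..Suc l}. fps_nth (G s) i * natfun_inverse (G s) (Suc l - i)))"
        using less Suc G
        by (intro regular_at_mult regular_at_uminus regular_at_sum a) (auto simp: fps_regular_at_def)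
      then show ?thesis using Suc by simp
    qed
  qed
  then show "regular_at s0 (\<lambda>s. fps_nth (inverse (G s)) m)" by (simp add: fps_inverse_def)
qed

lemma fps_regular_at_det:
  assumes "\<And>i j. i < q \<Longrightarrow> j < q \<Longrightarrow> fps_regular_at s0 (\<lambda>s. M s i j)"
  shows "fps_regular_at s0 (\<lambda>s. det (mof q (M s)))"
  unfolding det_mof using assms
  by (intro fps_regular_at_sum fps_regular_at_mult fps_regular_at_const fps_regular_at_prod)
    (auto dest: permutes_in_image)

lemma adj_mat_mof:
  assumes "i < q" "j < q"
  shows "adj_mat (mof q M) $$ (i, j) = (- 1) ^ (j + i) *
    det (mof (q - 1) (\<lambda>a b. M (if a < j then a else Suc a) (if b < i then b else Suc b)))"
proof -
  have "mat_delete (mof q M) j i = mof (q - 1) (\<lambda>a b. M (if a < j then a else Suc a) (if b < i then b else Suc b))"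
    by (intro eq_matI) (auto simp: mat_delete_def mof_def)
  then show ?thesis using assms by (simp add: adj_mat_def cofactor_def mof_def)
qed

lemma fps_regular_at_chart_coord:
  assumes H: "\<And>i j. fps_regular_at s0 (\<lambda>s. H s i j)" and u: "fps_regular_at s0 u"
    and c: "pos ({..<n} - I) c < q"
  shows "fps_regular_at s0 (\<lambda>s. chart_coord (u s) n q I (H s) a c)"
proof -
  have "fps_regular_at s0 (\<lambda>s. adj_mat (mof q (cols_mat n I (H s))) $$ (pos ({..<n} - I) c, j))" if "j < q" for j
    unfolding adj_mat_mof[OF c that]
    by (intro fps_regular_at_mult fps_regular_at_const fps_regular_at_det H)
  then show ?thesis unfolding chart_coord_def
    by (intro fps_regular_at_uminus fps_regular_at_sum fps_regular_at_mult u H) auto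
qed

lemma fps_regular_at_chain_prod:
  assumes "\<And>i a j. fps_regular_at s0 (\<lambda>s. S s i a j)"
  shows "fps_regular_at s0 (\<lambda>s. chain_prod n q (S s) c a j)"
proof (induction c arbitrary: a j)
  case (Suc c)
  then show ?case unfolding chain_prod.simps mm_def
    by (intro fps_regular_at_sum fps_regular_at_mult assms)
qed (use assms in simp)

lemma fps_regular_at_family_mat:
  assumes "\<And>i a j. fps_regular_at s0 (\<lambda>s. S s i a j)" "\<And>i a. fps_regular_at s0 (\<lambda>s. w s i a)"
  shows "fps_regular_at s0 (\<lambda>s. family_mat n q b (S s) (w s) j c)"
  unfolding family_mat_def
  by (intro fps_regular_at_sum fps_regular_at_mult fps_regular_at_const fps_regular_at_chain_prod assms)

text \<open>For an arc this means that its point lies in the principal open set of the chart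
  \<open>I\<close> given by \<open>f\<close>.\<close>

definition arc_cond ::
  "(complex \<Rightarrow> 'k::field) \<Rightarrow> nat \<Rightarrow> nat \<Rightarrow> nat set \<Rightarrow> (nat \<times> nat \<times> nat) cpoly \<Rightarrow> 'k fps vec set \<Rightarrow> bool" where
  "arc_cond \<phi> k n I f \<Lambda> \<longleftrightarrow> in_chart k n I \<Lambda> \<and>
     eval_cpoly \<phi> (\<lambda>(a, c, m). fps_nth (chart_mat k n I \<Lambda> $$ (a, c)) m) f \<noteq> 0"

text \<open>By Cramer's rule the finitely many coefficients of chart coordinates that occur in
  \<open>f\<close> are rational in \<open>s\<close> and regular at \<open>s0\<close>, and so is the
  value of \<open>f\<close>. Being nonzero at \<open>s0\<close>, it vanishes for finitely many
  \<open>s\<close> at most.\<close>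

lemma arc_cond_eventually:
  fixes H :: "'k::field \<Rightarrow> nat \<Rightarrow> nat \<Rightarrow> 'k fps"
  assumes H: "\<And>i j. fps_regular_at s0 (\<lambda>s. H s i j)"
    and arc: "arc_mat n (n - k) (mat_kernel_set n (n - k) (H s0)) (H s0)"
      "\<forall>\<^sub>F s in cofinite. arc_mat n (n - k) (mat_kernel_set n (n - k) (H s)) (H s)"
    and I: "is_chart k n I" and f: "f \<in> cpolys (arc_vars k n I)"
    and cond: "arc_cond \<phi> k n I f (mat_kernel_set n (n - k) (H s0))"
  shows "\<forall>\<^sub>F s in cofinite. arc_cond \<phi> k n I f (mat_kernel_set n (n - k) (H s))"
proof -
  let ?q = "n - k" and ?L = "\<lambda>s. mat_kernel_set n (n - k) (H s)"
  define \<delta> where "\<delta> s = det (mof ?q (cols_mat n I (H s)))" for s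
  \<comment> \<open>Cramer's rule applies where \<open>\<delta> s\<close> has a nonzero constant
    term; the finitely many other values of \<open>s\<close> are discarded at the end.\<close>
  define x where "x s = (\<lambda>(a, c, m). fps_nth (chart_coord (inverse (\<delta> s)) n ?q I (H s) a c) m)" for s
  define g where "g s = eval_cpoly \<phi> (x s) f" for s
  have \<delta>: "fps_regular_at s0 \<delta>" unfolding \<delta>_def by (intro fps_regular_at_det H)
  have \<delta>0: "fps_nth (\<delta> s0) 0 \<noteq> 0"
    using cond arc_in_chart_iff[OF arc(1) I] by (simp add: arc_cond_def \<delta>_def)
  have vars: "\<exists>a c m. v = (a, c, m) \<and> a < k \<and> c \<in> {..<n} - I"
    if "m' \<in> Poly_Mapping.keys f" "v \<in> Poly_Mapping.keys m'" for m' v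
    using f that unfolding cpolys_def arc_vars_def by fastforce
  have ev: "eval_cpoly \<phi> (\<lambda>(a, c, m). fps_nth (chart_mat k n I (?L s) $$ (a, c)) m) f = g s"
    if "fps_nth (\<delta> s) 0 \<noteq> 0" for s
  proof -
    have "\<delta> s * inverse (\<delta> s) = 1" using that inverse_mult_eq_1'[of "\<delta> s"] by simp
    then have "chart_mat k n I (?L s) $$ (a, c) = chart_coord (inverse (\<delta> s)) n ?q I (H s) a c"
      if "a < k" "c \<in> {..<n} - I" for a c
      using chart_mat_kernel[OF I _ that] by (simp add: \<delta>_def)
    then show ?thesis unfolding g_def eval_cpoly_def
      by (intro sum.cong refl arg_cong2[of _ _ _ _ "(*)"] prod.cong arg_cong2[of _ _ _ _ "(^)"])
        (auto dest!: vars simp: x_def)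
  qed
  have "regular_at s0 (\<lambda>s. x s v)" if "m' \<in> Poly_Mapping.keys f" "v \<in> Poly_Mapping.keys m'" for m' v
  proof -
    from vars[OF that] obtain a c m where v: "v = (a, c, m)" "a < k" "c \<in> {..<n} - I" by blast
    have "pos ({..<n} - I) c < ?q" using pos_less[OF _ v(3)] is_chart_facts[OF I] by simp
    then have "fps_regular_at s0 (\<lambda>s. chart_coord (inverse (\<delta> s)) n ?q I (H s) a c)"
      by (intro fps_regular_at_chart_coord H fps_regular_at_inverse \<delta> \<delta>0)
    then show ?thesis by (simp add: x_def v fps_regular_at_def)
  qed
  then have "regular_at s0 g"
    unfolding g_def eval_cpoly_def
    by (intro regular_at_sum regular_at_mult regular_at_const regular_at_prod regular_at_power)
  moreover have "g s0 \<noteq> 0" using cond ev[OF \<delta>0] by (simp add: arc_cond_def)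
  ultimately have "\<forall>\<^sub>F s in cofinite. g s \<noteq> 0" by (rule regular_at_imp_eventually_nonzero)
  moreover have "\<forall>\<^sub>F s in cofinite. fps_nth (\<delta> s) 0 \<noteq> 0"
    using \<delta> \<delta>0 by (intro regular_at_imp_eventually_nonzero) (auto simp: fps_regular_at_def)
  ultimately show ?thesis using arc(2)
  proof eventually_elim
    case (elim s)
    then show ?case using ev[of s] arc_in_chart_iff[OF elim(3) I] by (simp add: arc_cond_def \<delta>_def)
  qed
qed

definition mix :: "'k::field \<Rightarrow> 'k fps \<Rightarrow> 'k fps \<Rightarrow> 'k fps" where
  "mix s x y = fps_const (1 - s) * x + fps_const s * y"

lemma mix_0 [simp]: "mix 0 x y = x" and mix_1 [simp]: "mix 1 x y = y"
  by (simp_all add: mix_def)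

lemma fps_regular_at_mix: "fps_regular_at s0 (\<lambda>s. mix s x y)"
proof -
  have "regular_at s0 (\<lambda>s. 1 + - s)"
    by (intro regular_at_add regular_at_uminus regular_at_const regular_at_ident)
  then show ?thesis unfolding mix_def
    by (intro fps_regular_at_add fps_regular_at_mult fps_regular_at_fps_const fps_regular_at_const regular_at_ident) simp
qed

lemma admissible_mix:
  assumes "admissible n q b S1 E1" "admissible n q b S2 E2"
  shows "admissible n q b (\<lambda>i a j. mix s (S1 i a j) (S2 i a j)) (\<lambda>i a j. mix s (E1 i a j) (E2 i a j))"
  unfolding admissible_def
proof (intro allI impI)
  fix i a j assume *: "i < n" "a < q" "j < q"
  have "S1 i a j * t_power (b i j) = t_power (b (Suc i) a) * E1 i a j"
    "S2 i a j * t_power (b i j) = t_power (b (Suc i) a) * E2 i a j"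
    using assms * by (auto simp: admissible_def)
  then show "mix s (S1 i a j) (S2 i a j) * t_power (b i j) = t_power (b (Suc i) a) * mix s (E1 i a j) (E2 i a j)"
    by (simp add: mix_def algebra_simps)
qed

text \<open>The witnesses \<open>Z\<close>, \<open>y\<close> and \<open>N\<close> found at
  \<open>s0\<close> are kept along the line, so each condition becomes the nonvanishing of a
  constant term that is regular at \<open>s0\<close>.\<close>

lemma nondegenerate_mix:
  fixes S :: "'k::field \<Rightarrow> nat \<Rightarrow> nat \<Rightarrow> nat \<Rightarrow> 'k fps"
  assumes nd: "nondegenerate n q b (S s0) (E s0) (w s0)"
    and reg: "\<And>i a j. fps_regular_at s0 (\<lambda>s. S s i a j)" "\<And>i a j. fps_regular_at s0 (\<lambda>s. E s i a j)"
      "\<And>i a. fps_regular_at s0 (\<lambda>s. w s i a)"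
  shows "\<forall>\<^sub>F s in cofinite. nondegenerate n q b (S s) (E s) (w s)"
proof -
  have u: "\<forall>\<^sub>F s in cofinite. det (mof q (M s)) dvd 1"
    if "det (mof q (M s0)) dvd 1" "\<And>i j. fps_regular_at s0 (\<lambda>s. M s i j)" for M
  proof -
    have "\<forall>\<^sub>F s in cofinite. fps_nth (det (mof q (M s))) 0 \<noteq> 0"
      using that fps_regular_at_det[of q s0 M]
      by (intro regular_at_imp_eventually_nonzero) (auto simp: fps_regular_at_def)
    then show ?thesis by (rule eventually_mono) simp
  qed
  have 1: "\<forall>\<^sub>F s in cofinite. \<forall>i\<in>{..n}. det (mof q (S s i)) dvd 1"
    using nd reg(1) by (intro eventually_ball_finite ballI u) (auto simp: nondegenerate_def)
  have "\<forall>\<^sub>F s in cofinite. \<forall>i\<in>{..<n}. \<exists>Z y N. det (mof q (gen_mat q (b (Suc i)) (E s i) (w s (Suc i)) Z y N)) dvd 1"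
  proof (intro eventually_ball_finite ballI)
    fix i assume "i \<in> {..<n}"
    then obtain Z y N where "det (mof q (gen_mat q (b (Suc i)) (E s0 i) (w s0 (Suc i)) Z y N)) dvd 1"
      using nd unfolding nondegenerate_def by blast
    then have "\<forall>\<^sub>F s in cofinite. det (mof q (gen_mat q (b (Suc i)) (E s i) (w s (Suc i)) Z y N)) dvd 1"
    proof (rule u)
      show "fps_regular_at s0 (\<lambda>s. gen_mat q (b (Suc i)) (E s i) (w s (Suc i)) Z y N a j)" for a j
        unfolding gen_mat_def mm_def
        by (intro fps_regular_at_add fps_regular_at_sum fps_regular_at_mult fps_regular_at_const reg)
    qed
    then show "\<forall>\<^sub>F s in cofinite. \<exists>Z y N. det (mof q (gen_mat q (b (Suc i)) (E s i) (w s (Suc i)) Z y N)) dvd 1"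
      by (rule eventually_mono) blast
  qed simp
  with 1 show ?thesis
    by eventually_elim (simp add: nondegenerate_def)
qed

text \<open>Two arcs with the same profile are joined by a line in the space of parameters, and finitely
  many open conditions that hold at one of them hold for all but finitely many points of the line.\<close>
lemma arcs_common_conditions:
  fixes \<Lambda>1 \<Lambda>2 :: "'k::field fps vec set"
  assumes inf: "infinite (UNIV :: 'k set)" and arcs: "is_arc k n \<Lambda>1" "is_arc k n \<Lambda>2" and kn: "k \<le> n"
    and prof: "profile k n \<Lambda>1 = \<beta>" "profile k n \<Lambda>2 = \<beta>"
    and F: "finite F1" "finite F2"
      "\<And>I f. (I, f) \<in> F1 \<union> F2 \<Longrightarrow> is_chart k n I \<and> f \<in> cpolys (arc_vars k n I)"
      "\<And>I f. (I, f) \<in> F1 \<Longrightarrow> arc_cond \<phi> k n I f \<Lambda>1" "\<And>I f. (I, f) \<in> F2 \<Longrightarrow> arc_cond \<phi> k n I f \<Lambda>2"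
  shows "\<exists>\<Lambda>. is_arc k n \<Lambda> \<and> profile k n \<Lambda> = \<beta> \<and> (\<forall>(I, f)\<in>F1 \<union> F2. arc_cond \<phi> k n I f \<Lambda>)"
proof -
  let ?q = "n - k" and ?b = "full_profile k (n - k) \<beta>"
  have \<beta>: "plane_partition k ?q \<beta>" using profile_plane_partition[OF arcs(1) kn] prof by simp
  obtain H1 H2 where A: "arc_mat n ?q \<Lambda>1 H1" "arc_mat n ?q \<Lambda>2 H2" using arcs is_arc_iff by blast
  obtain S1 E1 w1 where 1: "admissible n ?q ?b S1 E1" "nondegenerate n ?q ?b S1 E1 w1"
    "\<Lambda>1 = mat_kernel_set n ?q (family_mat n ?q ?b S1 w1)"
    using arc_in_family[OF A(1) kn] prof by auto
  obtain S2 E2 w2 where 2: "admissible n ?q ?b S2 E2" "nondegenerate n ?q ?b S2 E2 w2"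
    "\<Lambda>2 = mat_kernel_set n ?q (family_mat n ?q ?b S2 w2)"
    using arc_in_family[OF A(2) kn] prof by auto
  define S E w where "S s i a j = mix s (S1 i a j) (S2 i a j)" and "E s i a j = mix s (E1 i a j) (E2 i a j)"
    and "w s i a = mix s (w1 i a) (w2 i a)" for s i a j
  define H where "H s = family_mat n ?q ?b (S s) (w s)" for s
  have adm: "admissible n ?q ?b (S s) (E s)" for s
    using admissible_mix[OF 1(1) 2(1)] by (simp add: S_def[abs_def] E_def[abs_def])
  have reg: "fps_regular_at s0 (\<lambda>s. S s i a j)" "fps_regular_at s0 (\<lambda>s. E s i a j)" "fps_regular_at s0 (\<lambda>s. w s i a)"
    for s0 i a j by (simp_all add: S_def E_def w_def fps_regular_at_mix)
  have e0: "S 0 = S1" "E 0 = E1" "w 0 = w1" and e1: "S 1 = S2" "E 1 = E2" "w 1 = w2"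
    by (auto simp: fun_eq_iff S_def E_def w_def)
  have regH: "fps_regular_at s0 (\<lambda>s. H s i j)" for s0 i j
    unfolding H_def by (intro fps_regular_at_family_mat reg)
  have nd: "\<forall>\<^sub>F s in cofinite. nondegenerate n ?q ?b (S s) (E s) (w s)"
    using nondegenerate_mix[of n ?q ?b S 0 E w] reg 1(2) e0 by simp
  have arc: "arc_mat n ?q (mat_kernel_set n ?q (H s)) (H s)" "profile k n (mat_kernel_set n ?q (H s)) = \<beta>"
    if "nondegenerate n ?q ?b (S s) (E s) (w s)" for s
    using family_arc[OF \<beta> kn adm that] by (simp_all add: H_def)
  have ea: "\<forall>\<^sub>F s in cofinite. arc_mat n ?q (mat_kernel_set n ?q (H s)) (H s)"
    using nd by (rule eventually_mono) (rule arc(1))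
  have L: "\<Lambda>1 = mat_kernel_set n ?q (H 0)" "\<Lambda>2 = mat_kernel_set n ?q (H 1)"
    by (simp_all add: H_def 1(3) 2(3) e0 e1)
  \<comment> \<open>The conditions of each arc spread from its own end of the line,
    \<open>s = 0\<close> for \<open>\<Lambda>1\<close> and \<open>s = 1\<close> for
    \<open>\<Lambda>2\<close>. All exceptional sets are finite while the field is infinite.\<close>
  have c1: "\<forall>\<^sub>F s in cofinite. \<forall>x\<in>F1. arc_cond \<phi> k n (fst x) (snd x) (mat_kernel_set n ?q (H s))"
  proof (intro eventually_ball_finite F ballI)
    fix x assume x: "x \<in> F1"
    show "\<forall>\<^sub>F s in cofinite. arc_cond \<phi> k n (fst x) (snd x) (mat_kernel_set n ?q (H s))"
      by (rule arc_cond_eventually[of 0 H])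
        (use x F(3)[of "fst x" "snd x"] F(4)[of "fst x" "snd x"] L regH ea arc(1)[of 0] 1(2) e0 in auto)
  qed
  have c2: "\<forall>\<^sub>F s in cofinite. \<forall>x\<in>F2. arc_cond \<phi> k n (fst x) (snd x) (mat_kernel_set n ?q (H s))"
  proof (intro eventually_ball_finite F ballI)
    fix x assume x: "x \<in> F2"
    show "\<forall>\<^sub>F s in cofinite. arc_cond \<phi> k n (fst x) (snd x) (mat_kernel_set n ?q (H s))"
      by (rule arc_cond_eventually[of 1 H])
        (use x F(3)[of "fst x" "snd x"] F(5)[of "fst x" "snd x"] L regH ea arc(1)[of 1] 2(2) e1 in auto)
  qed
  from nd c1 c2 have "\<forall>\<^sub>F s in cofinite. nondegenerate n ?q ?b (S s) (E s) (w s) \<and>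
      (\<forall>x\<in>F1 \<union> F2. arc_cond \<phi> k n (fst x) (snd x) (mat_kernel_set n ?q (H s)))"
    by eventually_elim auto
  from ex_new_if_finite[OF inf this[unfolded eventually_cofinite]]
  obtain s where s: "nondegenerate n ?q ?b (S s) (E s) (w s)"
      "\<forall>x\<in>F1 \<union> F2. arc_cond \<phi> k n (fst x) (snd x) (mat_kernel_set n ?q (H s))" by blast
  have "is_arc k n (mat_kernel_set n ?q (H s))" using arc(1)[OF s(1)] is_arc_iff by blast
  moreover have "\<forall>(I, f)\<in>F1 \<union> F2. arc_cond \<phi> k n I f (mat_kernel_set n ?q (H s))"
    using s(2) by (simp add: case_prod_beta)
  ultimately show ?thesis using arc(2)[OF s(1)] by blast
qed

section \<open>From conditions on arcs to the Zariski topology\<close>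

lemma generated_topology_basis:
  assumes "generate_topology_on B U" "x \<in> U"
  shows "\<exists>F. finite F \<and> F \<subseteq> B \<and> (\<forall>V\<in>F. x \<in> V) \<and> (\<forall>y. (\<forall>V\<in>F. y \<in> V) \<longrightarrow> y \<in> U)"
  using assms
proof (induction rule: generate_topology_on.induct)
  case Empty
  then show ?case by simp
next
  case (Int a b)
  then obtain F G where "finite F" "F \<subseteq> B" "\<forall>V\<in>F. x \<in> V" "\<forall>y. (\<forall>V\<in>F. y \<in> V) \<longrightarrow> y \<in> a"
    "finite G" "G \<subseteq> B" "\<forall>V\<in>G. x \<in> V" "\<forall>y. (\<forall>V\<in>G. y \<in> V) \<longrightarrow> y \<in> b" by auto
  then show ?case by (intro exI[of _ "F \<union> G"]) auto
next
  case (UN K)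
  from UN.prems obtain a where a: "a \<in> K" "x \<in> a" by (rule UnionE)
  from UN.IH[OF a] obtain F where F: "finite F" "F \<subseteq> B" "\<forall>V\<in>F. x \<in> V" "\<forall>y. (\<forall>V\<in>F. y \<in> V) \<longrightarrow> y \<in> a"
    by (elim exE conjE)
  have "y \<in> \<Union>K" if "\<forall>V\<in>F. y \<in> V" for y using F(4) that a(1) by (intro UnionI[of a]) simp_all
  then show ?case using F(1,2,3) by (intro exI[of _ F] conjI allI impI)
next
  case (Basis s)
  then show ?case by (intro exI[of _ "{s}"]) auto
qed

definition basic_open :: "nat \<Rightarrow> nat \<Rightarrow> nat set \<Rightarrow> (nat \<times> nat \<times> nat) cpoly
    \<Rightarrow> (nat set \<times> (nat \<times> nat \<times> nat) cpoly set) set set" where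
  "basic_open k n I f = {x \<in> arc_points k n. \<exists>\<pp>. (I, \<pp>) \<in> x \<and> f \<notin> \<pp>}"

lemma arc_point_mem_basic_open:
  assumes "is_arc k n \<Lambda>" "is_chart k n I" "f \<in> cpolys (arc_vars k n I)"
  shows "arc_point to_udom k n \<Lambda> \<in> basic_open k n I f \<longleftrightarrow> arc_cond to_udom k n I f \<Lambda>"
proof -
  have "arc_point to_udom k n \<Lambda> \<in> arc_points k n" using assms(1) by (auto simp: arc_points_def)
  then show ?thesis using assms(2,3)
    by (auto simp: basic_open_def arc_point_def arc_cond_def)
qed

lemma one_in_cpolys: "1 \<in> cpolys vs"
  by (simp add: cpolys_def)

lemma eval_cpoly_one: "field_hom \<phi> \<Longrightarrow> eval_cpoly \<phi> x 1 = 1"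
proof -
  assume "field_hom \<phi>"
  then interpret field_hom \<phi> .
  show ?thesis by (simp add: eval_cpoly_def lookup_one)
qed

lemma infinite_udom: "infinite (UNIV :: udom set)"
proof -
  interpret field_hom to_udom by (rule field_hom_to_udom)
  have "inj to_udom" by (rule injI) (rule injectivity)
  then have "infinite (range to_udom)" using infinite_UNIV_char_0 finite_imageD by blast
  then show ?thesis using finite_subset[OF subset_UNIV] by blast
qed

text \<open>The complement of a proper closed subset contains, around one of its arcs, the locus of
  finitely many conditions on arcs. An arc of the stratum that satisfies the conditions of two such
  complements lies in neither closed subset.\<close>

lemma contact_stratum_irreducible:
  assumes \<beta>: "plane_partition k (n - k) \<beta>" and kn: "k \<le> n"
  shows "irreducible_subset (arc_space k n) (contact_stratum k n \<beta>)"
proof -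
  let ?C = "contact_stratum k n \<beta>" and ?T = "arc_space k n"
  let ?B = "{basic_open k n I f | I f. is_chart k n I \<and> f \<in> cpolys (arc_vars k n I)}"
  have T: "?T = topology_generated_by ?B" by (simp add: arc_space_def basic_open_def)
  have sub: "?C \<subseteq> topspace ?T"
  proof
    fix x assume "x \<in> ?C"
    then obtain \<Lambda> where L: "is_arc k n \<Lambda>" "x = arc_point to_udom k n \<Lambda>"
      by (auto simp: contact_stratum_def)
    then obtain H where "arc_mat n (n - k) \<Lambda> H" using is_arc_iff by blast
    from arc_in_some_chart[OF this kn] obtain I where I: "is_chart k n I" "in_chart k n I \<Lambda>" by blast
    \<comment> \<open>The polynomial 1 cuts out the whole chart, which shows that the generating
      sets cover the stratum.\<close>
    have "x \<in> basic_open k n I 1"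
      using L I arc_point_mem_basic_open[OF L(1) I(1) one_in_cpolys]
      by (simp add: arc_cond_def eval_cpoly_one[OF field_hom_to_udom])
    then show "x \<in> topspace ?T"
      unfolding T topology_generated_by_topspace using I(1) one_in_cpolys by blast
  qed
  then have ts: "topspace (subtopology ?T ?C) = ?C" by (metis topspace_subtopology_subset)
  obtain \<Lambda>0 :: "udom fps vec set" where "is_arc k n \<Lambda>0" "profile k n \<Lambda>0 = \<beta>"
    using exists_arc_with_profile[OF \<beta> kn] by blast
  then have "arc_point to_udom k n \<Lambda>0 \<in> ?C" by (auto simp: contact_stratum_def)
  then have ne: "?C \<noteq> {}" by blast
  have ex: "\<exists>\<Lambda> F. is_arc k n \<Lambda> \<and> profile k n \<Lambda> = \<beta> \<and> finite F
      \<and> (\<forall>(I, f)\<in>F. is_chart k n I \<and> f \<in> cpolys (arc_vars k n I) \<and> arc_cond to_udom k n I f \<Lambda>)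
      \<and> (\<forall>\<Lambda>'. is_arc k n \<Lambda>' \<longrightarrow> profile k n \<Lambda>' = \<beta> \<longrightarrow>
            (\<forall>(I, f)\<in>F. arc_cond to_udom k n I f \<Lambda>') \<longrightarrow> arc_point to_udom k n \<Lambda>' \<notin> A)"
    if A: "closedin (subtopology ?T ?C) A" "A \<noteq> ?C" for A
  proof -
    have "A \<subseteq> ?C" using closedin_subset[OF A(1)] ts by simp
    then obtain x where x: "x \<in> ?C" "x \<notin> A" using A(2) by blast
    have "openin (subtopology ?T ?C) (?C - A)" using A(1) ts by (simp add: closedin_def)
    then obtain U where U: "openin ?T U" "?C - A = U \<inter> ?C" unfolding openin_subtopology by blast
    then have "generate_topology_on ?B U" unfolding T openin_topology_generated_by_iff by blast
    moreover have "x \<in> U" using U(2) x by blast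
    ultimately obtain F where F: "finite F" "F \<subseteq> ?B" "\<forall>V\<in>F. x \<in> V" "\<forall>y. (\<forall>V\<in>F. y \<in> V) \<longrightarrow> y \<in> U"
      using generated_topology_basis[of ?B U x] by blast
    have "\<forall>V\<in>F. \<exists>p. V = basic_open k n (fst p) (snd p) \<and> is_chart k n (fst p) \<and> snd p \<in> cpolys (arc_vars k n (fst p))"
      using F(2) by force
    from bchoice[OF this] obtain p where p: "\<forall>V\<in>F. V = basic_open k n (fst (p V)) (snd (p V))
        \<and> is_chart k n (fst (p V)) \<and> snd (p V) \<in> cpolys (arc_vars k n (fst (p V)))" ..
    obtain \<Lambda> where L: "is_arc k n \<Lambda>" "profile k n \<Lambda> = \<beta>" "x = arc_point to_udom k n \<Lambda>"
      using x(1) by (auto simp: contact_stratum_def)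
    have mem: "arc_point to_udom k n \<Lambda>' \<in> V \<longleftrightarrow> arc_cond to_udom k n (fst (p V)) (snd (p V)) \<Lambda>'"
      if V: "V \<in> F" and L': "is_arc k n \<Lambda>'" for V \<Lambda>'
      using arc_point_mem_basic_open[OF L'] bspec[OF p V] by metis
    show ?thesis
    proof (intro exI[of _ \<Lambda>] exI[of _ "p ` F"] conjI allI impI)
      show "\<forall>(I, f)\<in>p ` F. is_chart k n I \<and> f \<in> cpolys (arc_vars k n I) \<and> arc_cond to_udom k n I f \<Lambda>"
      proof
        fix z assume "z \<in> p ` F"
        then obtain V where V: "V \<in> F" "z = p V" by blast
        then have "x \<in> V" using F(3) by blast
        then show "case z of (I, f) \<Rightarrow> is_chart k n I \<and> f \<in> cpolys (arc_vars k n I) \<and> arc_cond to_udom k n I f \<Lambda>"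
          using bspec[OF p V(1)] mem[OF V(1) L(1)] L(3) V(2) by (simp add: case_prod_beta)
      qed
      fix \<Lambda>' assume L': "is_arc k n \<Lambda>'" "profile k n \<Lambda>' = \<beta>"
        and "\<forall>(I, f)\<in>p ` F. arc_cond to_udom k n I f \<Lambda>'"
      then have "\<forall>V\<in>F. arc_point to_udom k n \<Lambda>' \<in> V" using mem by (auto simp: case_prod_beta)
      then have "arc_point to_udom k n \<Lambda>' \<in> U" using F(4) by blast
      moreover have "arc_point to_udom k n \<Lambda>' \<in> ?C" using L' by (auto simp: contact_stratum_def)
      ultimately show "arc_point to_udom k n \<Lambda>' \<notin> A" using U(2) by blast
    qed (use L F(1) in auto)
  qed
  have "A = ?C \<or> B = ?C"
    if cl: "closedin (subtopology ?T ?C) A" "closedin (subtopology ?T ?C) B" "A \<union> B = ?C" for A B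
  proof (rule ccontr)
    assume "\<not> (A = ?C \<or> B = ?C)"
    then have n: "A \<noteq> ?C" "B \<noteq> ?C" by auto
    from ex[OF cl(1) n(1)] obtain \<Lambda>1 F1 where 1: "is_arc k n \<Lambda>1" "profile k n \<Lambda>1 = \<beta>" "finite F1"
      "\<forall>(I, f)\<in>F1. is_chart k n I \<and> f \<in> cpolys (arc_vars k n I) \<and> arc_cond to_udom k n I f \<Lambda>1"
      "\<forall>\<Lambda>'. is_arc k n \<Lambda>' \<longrightarrow> profile k n \<Lambda>' = \<beta> \<longrightarrow>
            (\<forall>(I, f)\<in>F1. arc_cond to_udom k n I f \<Lambda>') \<longrightarrow> arc_point to_udom k n \<Lambda>' \<notin> A" by blast
    from ex[OF cl(2) n(2)] obtain \<Lambda>2 F2 where 2: "is_arc k n \<Lambda>2" "profile k n \<Lambda>2 = \<beta>" "finite F2"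
      "\<forall>(I, f)\<in>F2. is_chart k n I \<and> f \<in> cpolys (arc_vars k n I) \<and> arc_cond to_udom k n I f \<Lambda>2"
      "\<forall>\<Lambda>'. is_arc k n \<Lambda>' \<longrightarrow> profile k n \<Lambda>' = \<beta> \<longrightarrow>
            (\<forall>(I, f)\<in>F2. arc_cond to_udom k n I f \<Lambda>') \<longrightarrow> arc_point to_udom k n \<Lambda>' \<notin> B" by blast
    obtain \<Lambda> where L: "is_arc k n \<Lambda>" "profile k n \<Lambda> = \<beta>" "\<forall>(I, f)\<in>F1 \<union> F2. arc_cond to_udom k n I f \<Lambda>"
      using arcs_common_conditions[OF infinite_udom 1(1) 2(1) kn 1(2) 2(2) 1(3) 2(3), of to_udom] 1(4) 2(4)
      by blast
    then have "arc_point to_udom k n \<Lambda> \<notin> A" "arc_point to_udom k n \<Lambda> \<notin> B" using 1(5) 2(5) by auto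
    moreover have "arc_point to_udom k n \<Lambda> \<in> ?C" using L by (auto simp: contact_stratum_def)
    ultimately show False using cl(3) by blast
  qed
  then show ?thesis
    using sub ne ts by (auto simp: irreducible_subset_def irreducible_space_def)
qed

section \<open>Schubert varieties in terms of minors\<close>

abbreviation monomial_value :: "('v \<Rightarrow> 'r::comm_ring_1) \<Rightarrow> ('v \<Rightarrow>\<^sub>0 nat) \<Rightarrow> 'r" where
  "monomial_value x m \<equiv> (\<Prod>v\<in>Poly_Mapping.keys m. x v ^ Poly_Mapping.lookup m v)"

lemma monomial_value_superset:
  "finite V \<Longrightarrow> Poly_Mapping.keys m \<subseteq> V \<Longrightarrow> monomial_value x m = (\<Prod>v\<in>V. x v ^ Poly_Mapping.lookup m v)"
  by (intro prod.mono_neutral_left) (auto simp: in_keys_iff)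

lemma monomial_value_add: "monomial_value x (m + m') = monomial_value x m * monomial_value x m'"
proof -
  let ?V = "Poly_Mapping.keys m \<union> Poly_Mapping.keys m'"
  have "monomial_value x (m + m') = (\<Prod>v\<in>?V. x v ^ Poly_Mapping.lookup (m + m') v)"
    by (intro monomial_value_superset) (use Poly_Mapping.keys_add[of m m'] in auto)
  also have "\<dots> = (\<Prod>v\<in>?V. x v ^ Poly_Mapping.lookup m v) * (\<Prod>v\<in>?V. x v ^ Poly_Mapping.lookup m' v)"
    by (simp add: lookup_add power_add prod.distrib)
  also have "\<dots> = monomial_value x m * monomial_value x m'"
    by (intro arg_cong2[where f = "(*)"] monomial_value_superset[symmetric]) auto
  finally show ?thesis .
qed

lemma eval_cpoly_superset:
  assumes "comm_ring_hom \<phi>" "finite M" "Poly_Mapping.keys f \<subseteq> M"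
  shows "eval_cpoly \<phi> x f = (\<Sum>m\<in>M. \<phi> (Poly_Mapping.lookup f m) * monomial_value x m)"
proof -
  interpret comm_ring_hom \<phi> by (rule assms(1))
  show ?thesis unfolding eval_cpoly_def
    by (intro sum.mono_neutral_left assms) (auto simp: in_keys_iff)
qed

lemma eval_cpoly_add:
  assumes "comm_ring_hom \<phi>"
  shows "eval_cpoly \<phi> x (f + g) = eval_cpoly \<phi> x f + eval_cpoly \<phi> x g"
proof -
  interpret comm_ring_hom \<phi> by (rule assms)
  let ?M = "Poly_Mapping.keys f \<union> Poly_Mapping.keys g"
  have 1: "eval_cpoly \<phi> x h = (\<Sum>m\<in>?M. \<phi> (Poly_Mapping.lookup h m) * monomial_value x m)"
    if "Poly_Mapping.keys h \<subseteq> ?M" for h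
    by (rule eval_cpoly_superset[OF assms _ that]) simp
  show ?thesis
    using 1[of f] 1[of g] 1[of "f + g"] Poly_Mapping.keys_add[of f g]
    by (simp add: lookup_add hom_add distrib_right sum.distrib)
qed

lemma eval_cpoly_zero: "eval_cpoly \<phi> x 0 = 0"
  by (simp add: eval_cpoly_def)

lemma eval_cpoly_single:
  assumes "comm_ring_hom \<phi>"
  shows "eval_cpoly \<phi> x (Poly_Mapping.single m c) = \<phi> c * monomial_value x m"
  using eval_cpoly_superset[OF assms, of "{m}" "Poly_Mapping.single m c" x] by simp

lemma eval_cpoly_sum_list:
  "comm_ring_hom \<phi> \<Longrightarrow> eval_cpoly \<phi> x (\<Sum>(c, m)\<leftarrow>ts. Poly_Mapping.single m c) = (\<Sum>(c, m)\<leftarrow>ts. \<phi> c * monomial_value x m)"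
  by (induction ts) (auto simp: eval_cpoly_zero eval_cpoly_add eval_cpoly_single)

lemma comm_ring_hom_ident: "comm_ring_hom (\<lambda>z :: 'a::comm_ring_1. z)"
  by unfold_locales auto

lemma sum_list_mult_pairs:
  fixes f :: "'a \<Rightarrow> 'c::comm_ring_1"
  shows "(\<Sum>x\<leftarrow>xs. f x) * (\<Sum>y\<leftarrow>ys. g y) = (\<Sum>(x, y)\<leftarrow>List.product xs ys. f x * g y)"
  by (induction xs) (auto simp: distrib_right sum_list_const_mult o_def)

context poly_pair
begin

lemma of_eval_cpoly:
  "f \<in> cpolys Vs \<Longrightarrow> polyf \<psi> Vs (\<lambda>x. eval_cpoly (\<lambda>z. z) x f) (\<lambda>y. eval_cpoly \<psi> y f)"
  unfolding eval_cpoly_def cpolys_def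
  by (intro of_sum polyf.mult polyf.const of_prod of_power polyf.var) auto

text \<open>Terms form a list because products yield the same monomial repeatedly; collecting them
  is left to the sum of formal polynomials.\<close>

lemma as_terms:
  assumes "polyf \<psi> Vs F G"
  shows "\<exists>ts. (\<forall>(c, m)\<in>set ts. Poly_Mapping.keys m \<subseteq> Vs) \<and>
    (\<forall>x. F x = (\<Sum>(c, m)\<leftarrow>ts. c * monomial_value x m)) \<and> (\<forall>y. G y = (\<Sum>(c, m)\<leftarrow>ts. \<psi> c * monomial_value y m))"
  using assms
proof induction
  case (const c)
  show ?case by (intro exI[of _ "[(c, 0)]"]) simp
next
  case (var v)
  then show ?case by (intro exI[of _ "[(1, Poly_Mapping.single v 1)]"]) simp
next
  case (add F G F' G')
  then obtain ts ts' where "\<forall>(c, m)\<in>set ts. Poly_Mapping.keys m \<subseteq> Vs"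
    "\<forall>x. F x = (\<Sum>(c, m)\<leftarrow>ts. c * monomial_value x m)" "\<forall>y. G y = (\<Sum>(c, m)\<leftarrow>ts. \<psi> c * monomial_value y m)"
    "\<forall>(c, m)\<in>set ts'. Poly_Mapping.keys m \<subseteq> Vs"
    "\<forall>x. F' x = (\<Sum>(c, m)\<leftarrow>ts'. c * monomial_value x m)" "\<forall>y. G' y = (\<Sum>(c, m)\<leftarrow>ts'. \<psi> c * monomial_value y m)"
    by (elim exE conjE)
  then show ?case by (intro exI[of _ "ts @ ts'"]) auto
next
  case (mult F G F' G')
  then obtain ts ts' where *: "\<forall>(c, m)\<in>set ts. Poly_Mapping.keys m \<subseteq> Vs"
    "\<forall>x. F x = (\<Sum>(c, m)\<leftarrow>ts. c * monomial_value x m)" "\<forall>y. G y = (\<Sum>(c, m)\<leftarrow>ts. \<psi> c * monomial_value y m)"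
    "\<forall>(c, m)\<in>set ts'. Poly_Mapping.keys m \<subseteq> Vs"
    "\<forall>x. F' x = (\<Sum>(c, m)\<leftarrow>ts'. c * monomial_value x m)" "\<forall>y. G' y = (\<Sum>(c, m)\<leftarrow>ts'. \<psi> c * monomial_value y m)"
    by (elim exE conjE)
  define us where "us = map (\<lambda>((c, m), (c', m')). (c * c', m + m')) (List.product ts ts')"
  show ?case
  proof (intro exI[of _ us] conjI allI)
    show "\<forall>(c, m)\<in>set us. Poly_Mapping.keys m \<subseteq> Vs"
      using *(1,4) Poly_Mapping.keys_add unfolding us_def by fastforce
    show "F x * F' x = (\<Sum>(c, m)\<leftarrow>us. c * monomial_value x m)" for x
      unfolding *(2)[rule_format] *(5)[rule_format] sum_list_mult_pairs us_def
      by (simp add: o_def case_prod_unfold monomial_value_add mult_ac)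
    show "G x * G' x = (\<Sum>(c, m)\<leftarrow>us. \<psi> c * monomial_value x m)" for x
      unfolding *(3)[rule_format] *(6)[rule_format] sum_list_mult_pairs us_def
      by (simp add: o_def case_prod_unfold monomial_value_add hom_mult mult_ac)
  qed
qed

lemma as_cpoly:
  assumes "polyf \<psi> Vs F G"
  shows "\<exists>f\<in>cpolys Vs. (\<forall>x. eval_cpoly (\<lambda>z. z) x f = F x) \<and> (\<forall>y. eval_cpoly \<psi> y f = G y)"
proof -
  obtain ts where ts: "\<forall>(c, m)\<in>set ts. Poly_Mapping.keys m \<subseteq> Vs"
    "\<forall>x. F x = (\<Sum>(c, m)\<leftarrow>ts. c * monomial_value x m)" "\<forall>y. G y = (\<Sum>(c, m)\<leftarrow>ts. \<psi> c * monomial_value y m)"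
    using as_terms[OF assms] by (elim exE conjE)
  let ?f = "\<Sum>(c, m)\<leftarrow>ts. Poly_Mapping.single m c"
  have "?f \<in> cpolys Vs" using ts(1)
  proof (induction ts)
    case (Cons t ts)
    obtain c m where "t = (c, m)" by (rule prod.exhaust)
    then show ?case using Cons Poly_Mapping.keys_add[of "Poly_Mapping.single m c"]
      unfolding cpolys_def by (fastforce split: if_splits)
  qed (simp add: cpolys_def)
  then show ?thesis
    using ts(2,3) eval_cpoly_sum_list[OF comm_ring_hom_ident] eval_cpoly_sum_list[OF comm_ring_hom_axioms]
    by (intro bexI[of _ ?f]) auto
qed

text \<open>A sufficiently high power of \<open>D\<close> times the value at the fractions
  \<open>f v / D\<close> is polynomial. The inverse of \<open>D\<close> occurs as an element
  \<open>u\<close>, because the second ring has no division.\<close>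

lemma clear_denominators:
  assumes "polyf \<psi> Vs F G" "polyf \<psi> Ws D E" "\<forall>v\<in>Vs. polyf \<psi> Ws (f v) (g v)"
  shows "\<exists>N F' G'. polyf \<psi> Ws F' G' \<and> (\<forall>x u. D x * u = 1 \<longrightarrow> F' x = D x ^ N * F (\<lambda>v. u * f v x)) \<and>
    (\<forall>y u. E y * u = 1 \<longrightarrow> G' y = E y ^ N * G (\<lambda>v. u * g v y))"
  using assms(1)
proof induction
  case (const c)
  show ?case
    by (rule exI[of _ 0], rule exI[of _ "\<lambda>_. c"], rule exI[of _ "\<lambda>_. \<psi> c"]) (simp add: polyf.const)
next
  case (var v)
  then show ?case
    by (intro exI[of _ 1] exI[of _ "f v"] exI[of _ "g v"]) (simp add: assms(3) mult.assoc[symmetric])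
next
  case (add F1 G1 F2 G2)
  then obtain N1 F1' G1' N2 F2' G2' where *: "polyf \<psi> Ws F1' G1'"
    "\<forall>x u. D x * u = 1 \<longrightarrow> F1' x = D x ^ N1 * F1 (\<lambda>v. u * f v x)"
    "\<forall>y u. E y * u = 1 \<longrightarrow> G1' y = E y ^ N1 * G1 (\<lambda>v. u * g v y)"
    "polyf \<psi> Ws F2' G2'"
    "\<forall>x u. D x * u = 1 \<longrightarrow> F2' x = D x ^ N2 * F2 (\<lambda>v. u * f v x)"
    "\<forall>y u. E y * u = 1 \<longrightarrow> G2' y = E y ^ N2 * G2 (\<lambda>v. u * g v y)"
    by (elim exE conjE)
  have "polyf \<psi> Ws (\<lambda>x. D x ^ N2 * F1' x + D x ^ N1 * F2' x) (\<lambda>x. E x ^ N2 * G1' x + E x ^ N1 * G2' x)"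
    by (intro polyf.add polyf.mult of_power assms(2) *)
  moreover have "\<forall>x u. D x * u = 1 \<longrightarrow> D x ^ N2 * F1' x + D x ^ N1 * F2' x
      = D x ^ (N1 + N2) * (F1 (\<lambda>v. u * f v x) + F2 (\<lambda>v. u * f v x))"
    using *(2,5) by (simp add: power_add algebra_simps)
  moreover have "\<forall>y u. E y * u = 1 \<longrightarrow> E y ^ N2 * G1' y + E y ^ N1 * G2' y
      = E y ^ (N1 + N2) * (G1 (\<lambda>v. u * g v y) + G2 (\<lambda>v. u * g v y))"
    using *(3,6) by (simp add: power_add algebra_simps)
  ultimately show ?case
    by (intro exI[of _ "N1 + N2"] exI[of _ "\<lambda>x. D x ^ N2 * F1' x + D x ^ N1 * F2' x"]
        exI[of _ "\<lambda>x. E x ^ N2 * G1' x + E x ^ N1 * G2' x"] conjI)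
next
  case (mult F1 G1 F2 G2)
  then obtain N1 F1' G1' N2 F2' G2' where *: "polyf \<psi> Ws F1' G1'"
    "\<forall>x u. D x * u = 1 \<longrightarrow> F1' x = D x ^ N1 * F1 (\<lambda>v. u * f v x)"
    "\<forall>y u. E y * u = 1 \<longrightarrow> G1' y = E y ^ N1 * G1 (\<lambda>v. u * g v y)"
    "polyf \<psi> Ws F2' G2'"
    "\<forall>x u. D x * u = 1 \<longrightarrow> F2' x = D x ^ N2 * F2 (\<lambda>v. u * f v x)"
    "\<forall>y u. E y * u = 1 \<longrightarrow> G2' y = E y ^ N2 * G2 (\<lambda>v. u * g v y)"
    by (elim exE conjE)
  have "polyf \<psi> Ws (\<lambda>x. F1' x * F2' x) (\<lambda>x. G1' x * G2' x)"
    by (intro polyf.mult *)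
  moreover have "\<forall>x u. D x * u = 1 \<longrightarrow> F1' x * F2' x
      = D x ^ (N1 + N2) * (F1 (\<lambda>v. u * f v x) * F2 (\<lambda>v. u * f v x))"
    using *(2,5) by (simp add: power_add algebra_simps)
  moreover have "\<forall>y u. E y * u = 1 \<longrightarrow> G1' y * G2' y
      = E y ^ (N1 + N2) * (G1 (\<lambda>v. u * g v y) * G2 (\<lambda>v. u * g v y))"
    using *(3,6) by (simp add: power_add algebra_simps)
  ultimately show ?case
    by (intro exI[of _ "N1 + N2"] exI[of _ "\<lambda>x. F1' x * F2' x"] exI[of _ "\<lambda>x. G1' x * G2' x"] conjI)
qed

end

section \<open>Dimensions of intersections with the flag\<close>

lemma app_vec_inverse:
  assumes "\<And>i j. i < m \<Longrightarrow> j < m \<Longrightarrow> mm {..<n} M Y i j = idm i j" "w \<in> carrier_vec m"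
  shows "\<exists>v\<in>carrier_vec n. \<forall>i<m. app n M v i = w $ i"
proof (intro bexI[of _ "vec n (\<lambda>c. mm {..<m} Y (\<lambda>j (_ :: unit). w $ j) c ())"] allI impI)
  fix i assume i: "i < m"
  have "app n M (vec n (\<lambda>c. mm {..<m} Y (\<lambda>j (_ :: unit). w $ j) c ())) i = mm {..<n} M (mm {..<m} Y (\<lambda>j _. w $ j)) i ()"
    by (simp add: app_def mm_def)
  also have "\<dots> = mm {..<m} (mm {..<n} M Y) (\<lambda>j _. w $ j) i ()" by (simp add: mm_assoc)
  also have "\<dots> = mm {..<m} idm (\<lambda>j _. w $ j) i ()" using assms(1) i by (intro mm_cong) auto
  also have "\<dots> = w $ i" using i by (simp add: mm_idm_left)
  finally show "app n M (vec n (\<lambda>c. mm {..<m} Y (\<lambda>j (_ :: unit). w $ j) c ())) i = w $ i" .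
qed simp

lemma sub_dim_mat_kernel_set:
  fixes M :: "nat \<Rightarrow> nat \<Rightarrow> complex"
  assumes "\<And>i j. i < m \<Longrightarrow> j < m \<Longrightarrow> mm {..<n} M Y i j = idm i j"
  shows "VectorSpace.subspace class_ring (mat_kernel_set n m M) (module_vec TYPE(complex) n)"
    and "m + sub_dim n (mat_kernel_set n m M) = n"
proof -
  interpret V: vec_space "TYPE(complex)" n .
  interpret W: vec_space "TYPE(complex)" m .
  let ?T = "\<lambda>v. vec m (app n M v)"
  interpret L: linear_map class_ring "module_vec TYPE(complex) n" "module_vec TYPE(complex) m" ?T
  proof unfold_locales
    show "?T \<in> module_hom class_ring (module_vec TYPE(complex) n) (module_vec TYPE(complex) m)"
      by (auto simp: module_hom_def module_vec_simps app_add app_smult intro!: eq_vecI)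
  qed
  have ker: "L.ker = mat_kernel_set n m M"
    by (auto simp: L.ker_def mat_kernel_set_def module_vec_simps vec_eq_iff)
  have "w \<in> ?T ` carrier_vec n" if w: "w \<in> carrier_vec m" for w
  proof -
    obtain v where "v \<in> carrier_vec n" "\<forall>i<m. app n M v i = w $ i"
      using app_vec_inverse[OF assms w] by blast
    then show ?thesis using w by (intro image_eqI[of _ _ v] eq_vecI) auto
  qed
  then have im: "L.im = carrier_vec m"
    by (auto simp: L.im_def module_vec_simps)
  show "VectorSpace.subspace class_ring (mat_kernel_set n m M) (module_vec TYPE(complex) n)"
    using L.kerT_is_subspace by (simp only: ker)
  have "W.vs (carrier_vec m) = module_vec TYPE(complex) m"
    by (simp add: module_vec_def)
  then have "vectorspace.dim class_ring (W.vs (carrier_vec m)) = m" by (simp only: W.dim_is_n)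
  then show "m + sub_dim n (mat_kernel_set n m M) = n"
    using L.rank_nullity[OF V.fin_dim] unfolding ker im sub_dim_def V.dim_is_n by simp
qed

text \<open>Over the complex numbers the nonzero diagonal entries of a Smith form count the rank of
  the last \<open>a\<close> columns. The intersection has dimension \<open>a\<close> minus this
  rank, and a rank of at most \<open>a - p\<close> is the vanishing of the minors of size
  \<open>a - p + 1\<close>.\<close>

lemma sub_dim_kernel_flag:
  fixes H :: "nat \<Rightarrow> nat \<Rightarrow> complex"
  assumes "a \<le> n" "p \<le> a"
  shows "p \<le> sub_dim n (mat_kernel_set n q H \<inter> flag n a) \<longleftrightarrow> dvd_minors 0 (a - p + 1) {..<q} {n - a..<n} H"
proof -
  let ?S = "{..<q}" and ?C = "{n - a..<n}"
  have tot: "x dvd y \<or> y dvd x" for x y :: complex by (cases "x = 0") (auto simp: dvd_field_iff)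
  obtain T T' d Q Y where sm: "smith ?S ?C H T T' d Q Y"
    using smith_exists[of ?S ?C H, OF tot] by auto
  define D where "D = {j. j < q \<and> d j \<noteq> 0}"
  have D: "finite D" by (simp add: D_def)
  have pick: "pick D j < q" "d (pick D j) \<noteq> 0" if "j < card D" for j
    using bij_betw_pick[OF D] that by (auto simp: bij_betw_def D_def)
  define m where "m = n - a + card D"
  \<comment> \<open>\<open>M\<close> has the intersection as its kernel: the first
    \<open>n - a\<close> rows cut out the flag, the others are the rows of \<open>Q\<close> with
    nonzero diagonal entry. \<open>Y'\<close> is a right inverse, so that rank-nullity gives the
    dimension.\<close>
  define M where "M i c = (if i < n - a then idm i c else if c \<in> ?C then Q (pick D (i - (n - a))) c else 0)" for i c
  define Y' where "Y' c j = (if j < n - a then idm c j else if c \<in> ?C then Y c (pick D (j - (n - a))) else 0)" for c j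
  have QY: "mm ?C Q Y i j = idm i j" if "i < q" "d i \<noteq> 0" "j < q" for i j
  proof -
    have "d i * mm ?C Q Y i j = mm ?C (mm ?S T' H) Y i j"
      unfolding mm_def[of ?C] sum_distrib_left
      using sm that by (intro sum.cong) (auto simp: smith_def)
    also have "\<dots> = mm ?S T' (mm ?C H Y) i j" by (simp add: mm_assoc)
    also have "\<dots> = mm ?S T' (mm ?S T (diagm d)) i j"
      using sm that by (intro mm_cong) (auto simp: smith_def mm_diagm_right)
    also have "\<dots> = diagm d i j"
      by (rule inv_pair_cancel[OF inv_pair_sym]) (use sm that in \<open>auto simp: smith_def\<close>)
    finally have "d i * mm ?C Q Y i j = d i * idm i j" by (simp add: diagm_def idm_def)
    then show ?thesis using that by simp
  qed
  have split: "(\<Sum>c<n. f c) = (\<Sum>c<n - a. f c) + (\<Sum>c\<in>?C. f c)" for f :: "nat \<Rightarrow> complex"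
    unfolding lessThan_atLeast0 by (rule sum.atLeastLessThan_concat[symmetric]) auto
  have MY: "mm {..<n} M Y' i j = idm i j" if "i < m" "j < m" for i j
  proof -
    have 1: "(\<Sum>c<n - a. M i c * Y' c j) = (if i < n - a \<and> j < n - a then idm i j else 0)"
    proof (cases "i < n - a")
      case True
      then have "(\<Sum>c<n - a. M i c * Y' c j) = mm {..<n - a} idm Y' i j" by (simp add: mm_def M_def)
      also have "\<dots> = Y' i j" using True by (simp add: mm_idm_left)
      finally show ?thesis using True by (simp add: Y'_def)
    next
      case False
      then show ?thesis by (simp add: M_def)
    qed
    have 2: "(\<Sum>c\<in>?C. M i c * Y' c j) = (if n - a \<le> i \<and> n - a \<le> j then mm ?C Q Y (pick D (i - (n - a))) (pick D (j - (n - a))) else 0)"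
    proof (cases "n - a \<le> i \<and> n - a \<le> j")
      case True
      then show ?thesis unfolding mm_def by (simp add: M_def Y'_def)
    next
      case False
      then have "M i c * Y' c j = 0" if "c \<in> ?C" for c
        using that by (cases "i < n - a") (auto simp: M_def Y'_def idm_def)
      then show ?thesis using False by (simp only: if_False sum.neutral_const cong: sum.cong)
    qed
    have "idm (pick D (i - (n - a))) (pick D (j - (n - a))) = (idm i j :: complex)" if "n - a \<le> i" "n - a \<le> j"
    proof -
      have "i - (n - a) < card D" "j - (n - a) < card D" using \<open>i < m\<close> \<open>j < m\<close> that by (auto simp: m_def)
      then have "pick D (i - (n - a)) = pick D (j - (n - a)) \<longleftrightarrow> i - (n - a) = j - (n - a)"
        using bij_betw_pick[OF D] by (auto simp: bij_betw_def inj_on_def)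
      then show ?thesis using that by (auto simp: idm_def)
    qed
    then show ?thesis
      unfolding mm_def[of "{..<n}"] split 1 2 using pick that QY by (auto simp: m_def idm_def)
  qed
  have "mat_kernel_set n q H \<inter> flag n a = mat_kernel_set n m M"
  proof -
    have "(\<forall>j<q. app n H v j = 0) \<longleftrightarrow> (\<forall>j<card D. app n M v (n - a + j) = 0)" if z: "\<forall>c<n - a. v $ c = 0" for v
    proof -
      have app: "app n G v j = mm ?C G (\<lambda>c (_ :: unit). v $ c) j ()" for G j
        unfolding app_def split mm_def using z by simp
      let ?v = "\<lambda>c (_ :: unit). v $ c"
      have T'H: "mm ?S T' (mm ?C H ?v) j () = d j * mm ?C Q ?v j ()" if "j < q" for j
      proof -
        have "mm ?S T' (mm ?C H ?v) j () = mm ?C (mm ?S T' H) ?v j ()" by (simp add: mm_assoc)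
        also have "\<dots> = (\<Sum>c\<in>?C. d j * Q j c * v $ c)"
          using sm that unfolding mm_def[of ?C] by (intro sum.cong) (auto simp: smith_def)
        finally show ?thesis by (simp add: mm_def sum_distrib_left mult.assoc)
      qed
      have "(\<forall>j<q. app n H v j = 0) \<longleftrightarrow> (\<forall>j<q. d j * mm ?C Q ?v j () = 0)"
      proof (intro iffI allI impI)
        fix j assume "\<forall>j<q. app n H v j = 0" "j < q"
        then show "d j * mm ?C Q ?v j () = 0"
          using T'H[of j] by (simp add: app mm_def[of ?S])
      next
        fix j assume *: "\<forall>j<q. d j * mm ?C Q ?v j () = 0" "j < q"
        have "mm ?C H ?v j () = mm ?S T (mm ?S T' (mm ?C H ?v)) j ()"
          by (rule inv_pair_cancel[symmetric]) (use sm * in \<open>auto simp: smith_def\<close>)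
        also have "\<dots> = (\<Sum>i\<in>?S. T j i * mm ?S T' (mm ?C H ?v) i ())" by (simp add: mm_def[of ?S T])
        also have "\<dots> = 0" using T'H * by (intro sum.neutral) auto
        finally show "app n H v j = 0" by (simp add: app)
      qed
      also have "\<dots> \<longleftrightarrow> (\<forall>j\<in>D. mm ?C Q ?v j () = 0)" by (auto simp: D_def)
      also have "D = pick D ` {..<card D}" using bij_betw_pick[OF D] by (simp add: bij_betw_def)
      also have "(\<forall>j\<in>pick D ` {..<card D}. mm ?C Q ?v j () = 0) \<longleftrightarrow> (\<forall>j<card D. app n M v (n - a + j) = 0)"
        by (auto simp: app mm_def M_def)
      finally show ?thesis .
    qed
    moreover have "app n M v i = v $ i" if "i < n - a" for v i
    proof -
      have "app n M v i = mm {..<n} idm (\<lambda>c (_ :: unit). v $ c) i ()"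
        using that by (simp add: app_def mm_def M_def)
      then show ?thesis using that by (simp add: mm_idm_left)
    qed
    moreover have "(\<forall>i<m. P i) \<longleftrightarrow> (\<forall>i<n - a. P i) \<and> (\<forall>j<card D. P (n - a + j))" for P
    proof (intro iffI conjI allI impI)
      fix i assume *: "(\<forall>i<n - a. P i) \<and> (\<forall>j<card D. P (n - a + j))" "i < m"
      show "P i"
      proof (cases "i < n - a")
        case False
        then have "i - (n - a) < card D" "n - a + (i - (n - a)) = i" using *(2) by (auto simp: m_def)
        then show ?thesis using *(1) by metis
      qed (use * in simp)
    qed (auto simp: m_def)
    ultimately show ?thesis
      unfolding mat_kernel_set_def flag_eq by auto
  qed
  moreover have "m + sub_dim n (mat_kernel_set n m M) = n"
    by (rule sub_dim_mat_kernel_set(2)[OF MY])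
  ultimately have "p \<le> sub_dim n (mat_kernel_set n q H \<inter> flag n a) \<longleftrightarrow> card D < a - p + 1"
    using assms by (auto simp: m_def)
  also have "\<dots> \<longleftrightarrow> dvd_minors 0 (a - p + 1) ?S ?C H"
    unfolding dvd_minors_smith_iff[OF sm finite_lessThan finite_atLeastLessThan]
  proof (intro iffI allI impI)
    fix R assume "card D < a - p + 1" "R \<subseteq> ?S" "card R = a - p + 1"
    then have "\<not> R \<subseteq> D" using card_mono[OF D, of R] by auto
    then show "0 dvd (\<Prod>b\<in>R. d b)"
      using \<open>R \<subseteq> ?S\<close> finite_subset[OF \<open>R \<subseteq> ?S\<close>] by (auto simp: D_def)
  next
    assume *: "\<forall>R\<subseteq>?S. card R = a - p + 1 \<longrightarrow> 0 dvd (\<Prod>b\<in>R. d b)"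
    show "card D < a - p + 1"
    proof (rule ccontr)
      assume "\<not> card D < a - p + 1"
      then obtain R where R: "R \<subseteq> D" "card R = a - p + 1" using obtain_subset_with_card_n[of "a - p + 1" D] by auto
      then have "R \<subseteq> ?S" by (auto simp: D_def)
      then have "(\<Prod>b\<in>R. d b) = 0" using *[rule_format, OF _ R(2)] by simp
      then show False using R(1) finite_subset[OF R(1) D] by (auto simp: D_def)
    qed
  qed
  finally show ?thesis .
qed

text \<open>The pairs \<open>(r, C)\<close> such that the kernel of \<open>H\<close> lies in \<open>\<Omega>\<^sub>\<mu>\<close> if and only if the minors of
  size \<open>r\<close> of \<open>H\<close> on the columns \<open>C\<close> vanish.\<close>
definition schubert_conds :: "nat \<Rightarrow> nat \<Rightarrow> (nat \<Rightarrow> nat) \<Rightarrow> (nat \<times> nat set) list" where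
  "schubert_conds k n \<mu> = rev (map (\<lambda>p. (n - k - \<mu> p + 1, {k - p + \<mu> p..<n})) [1..<Suc k])"

lemma set_schubert_conds:
  "set (schubert_conds k n \<mu>) = (\<lambda>p. (n - k - \<mu> p + 1, {k - p + \<mu> p..<n})) ` {1..k}"
  unfolding schubert_conds_def by (simp only: set_rev set_map set_upt atLeastLessThanSuc_atLeastAtMost)

lemma is_partition_antimono:
  assumes "is_partition k n \<mu>" "1 \<le> p" "p \<le> p'" "p' \<le> k"
  shows "\<mu> p' \<le> \<mu> p"
  using assms(3,4)
proof (induction p' rule: dec_induct)
  case (step p')
  then have "\<mu> (p' + 1) \<le> \<mu> p'" using assms(1,2) by (auto simp: is_partition_def)
  then show ?case using step by simp
qed simp

text \<open>As \<open>p\<close> grows, \<open>k - p + \<mu> p\<close> falls and the sets of columns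
  grow. The reversed list therefore begins with the largest set, as the induction in
  \<open>dvd_of_minors_dvd\<close> requires.\<close>

lemma sorted_schubert_conds:
  assumes "is_partition k n \<mu>"
  shows "sorted_wrt (\<lambda>(r, C) (r', C'). C' \<subseteq> C) (schubert_conds k n \<mu>)"
proof -
  have *: "k - p' + \<mu> p' \<le> k - p + \<mu> p" if "1 \<le> p" "p < p'" "p' < Suc k" for p p'
    using is_partition_antimono[OF assms, of p p'] that by auto
  have "sorted_wrt (\<lambda>p p'. k - p' + \<mu> p' \<le> k - p + \<mu> p) [1..<Suc k]"
  proof (rule sorted_wrt_mono_rel[OF _ sorted_wrt_upt])
    fix p p' assume "p \<in> set [1..<Suc k]" "p' \<in> set [1..<Suc k]" "p < p'"
    then have "1 \<le> p" "p < p'" "p' < Suc k" by (simp_all only: set_upt atLeastLessThan_iff)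
    then show "k - p' + \<mu> p' \<le> k - p + \<mu> p" by (rule *)
  qed
  then show ?thesis
    unfolding schubert_conds_def sorted_wrt_rev sorted_wrt_map
    by (rule sorted_wrt_mono_rel[rotated]) auto
qed

lemma mat_kernel_set_schubert_iff:
  fixes H :: "nat \<Rightarrow> nat \<Rightarrow> complex"
  assumes "k \<le> n" "is_partition k n \<mu>"
    and Y: "\<And>i j. i < n - k \<Longrightarrow> j < n - k \<Longrightarrow> mm {..<n} H Y i j = idm i j"
  shows "mat_kernel_set n (n - k) H \<in> schubert k n \<mu> \<longleftrightarrow>
    (\<forall>(r, C)\<in>set (schubert_conds k n \<mu>). dvd_minors 0 r {..<n - k} C H)"
proof -
  let ?V = "mat_kernel_set n (n - k) H"
  have "?V \<in> grassmannian k n"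
    using sub_dim_mat_kernel_set[of "n - k" n H Y] Y assms(1) by (simp add: grassmannian_def)
  then have "?V \<in> schubert k n \<mu> \<longleftrightarrow>
      (\<forall>s\<in>{1..k}. k + 1 - s \<le> sub_dim n (?V \<inter> flag n (n + 1 - (s + \<mu> (k + 1 - s)))))"
    by (simp add: schubert_def)
  also have "\<dots> \<longleftrightarrow> (\<forall>p\<in>{1..k}. p \<le> sub_dim n (?V \<inter> flag n (n - (k - p + \<mu> p))))"
  proof -
    \<comment> \<open>Reindexing by \<open>p = k + 1 - s\<close>, the dimension demanded of the
      intersection; \<open>s - 1\<close> becomes \<open>k - p\<close>.\<close>
    have "n + 1 - (s + \<mu> (k + 1 - s)) = n - (k - (k + 1 - s) + \<mu> (k + 1 - s))" if "s \<in> {1..k}" for s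
      using that by auto
    then have "(\<forall>s\<in>{1..k}. k + 1 - s \<le> sub_dim n (?V \<inter> flag n (n + 1 - (s + \<mu> (k + 1 - s))))) \<longleftrightarrow>
      (\<forall>p\<in>(\<lambda>s. k + 1 - s) ` {1..k}. p \<le> sub_dim n (?V \<inter> flag n (n - (k - p + \<mu> p))))" by simp
    also have "(\<lambda>s. k + 1 - s) ` {1..k} = {1..k}"
    proof
      show "{1..k} \<subseteq> (\<lambda>s. k + 1 - s) ` {1..k}"
      proof
        fix p assume "p \<in> {1..k}"
        then show "p \<in> (\<lambda>s. k + 1 - s) ` {1..k}" by (intro image_eqI[of _ _ "k + 1 - p"]) auto
      qed
    qed auto
    finally show ?thesis .
  qed
  also have "\<dots> \<longleftrightarrow> (\<forall>p\<in>{1..k}. dvd_minors 0 (n - k - \<mu> p + 1) {..<n - k} {k - p + \<mu> p..<n} H)"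
  proof (rule ball_cong[OF refl])
    fix p assume p: "p \<in> {1..k}"
    then have m: "\<mu> p \<le> n - k" using assms(2) by (simp add: is_partition_def)
    let ?a = "n - (k - p + \<mu> p)"
    have "?a \<le> n" "p \<le> ?a" "?a - p + 1 = n - k - \<mu> p + 1" "n - ?a = k - p + \<mu> p"
      using p m assms(1) by auto
    then show "p \<le> sub_dim n (?V \<inter> flag n ?a) \<longleftrightarrow> dvd_minors 0 (n - k - \<mu> p + 1) {..<n - k} {k - p + \<mu> p..<n} H"
      using sub_dim_kernel_flag[of ?a n p "n - k" H] by metis
  qed
  finally show ?thesis by (simp only: set_schubert_conds ball_simps prod.case)
qed

section \<open>Orders of contact\<close>

text \<open>The right inverse is the inverse of the block outside \<open>I\<close>, with zero rows
  at the columns in \<open>I\<close>.\<close>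

lemma unit_columns_section:
  fixes H :: "nat \<Rightarrow> nat \<Rightarrow> 'r::comm_ring_1"
  assumes I: "is_chart k n I" and u: "det (mof (n - k) (cols_mat n I H)) * u = 1"
  shows "\<exists>Y. \<forall>i j. i < n - k \<longrightarrow> j < n - k \<longrightarrow> mm {..<n} H Y i j = idm i j"
proof -
  let ?q = "n - k" and ?J = "{..<n} - I"
  note F = is_chart_facts[OF I]
  define N where "N = (\<lambda>i j. u * adj_mat (mof ?q (cols_mat n I H)) $$ (i, j))"
  have N: "inv_pair {..<?q} (cols_mat n I H) N" unfolding N_def by (rule det_unit_inverse[OF u])
  define Y where "Y c j = (if c \<in> ?J then N (pos ?J c) j else 0)" for c j
  have "mm {..<n} H Y i j = idm i j" if "i < ?q" "j < ?q" for i j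
  proof -
    have "mm {..<n} H Y i j = (\<Sum>c\<in>?J. H i c * Y c j)"
      unfolding mm_def by (intro sum.mono_neutral_right) (auto simp: Y_def)
    also have "\<dots> = (\<Sum>b<?q. H i (pick ?J b) * Y (pick ?J b) j)"
      using sum_pick[OF F(2), of "\<lambda>c. H i c * Y c j"] F(4) by simp
    also have "\<dots> = mm {..<?q} (cols_mat n I H) N i j"
      unfolding mm_def
    proof (intro sum.cong refl)
      fix b assume "b \<in> {..<?q}"
      then have "b < card ?J" using F(4) by simp
      then have "pick ?J b \<in> ?J" "pos ?J (pick ?J b) = b"
        using pick_in_set_le[of b ?J] pos_pick[OF F(2)] by auto
      then show "H i (pick ?J b) * Y (pick ?J b) j = H i (pick ?J b) * N b j" by (simp add: Y_def)
    qed
    also have "\<dots> = idm i j" using N that by (simp add: inv_pair_def)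
    finally show ?thesis .
  qed
  then show ?thesis by blast
qed

text \<open>The matrix with the kernel given by \<open>x\<close> in the chart \<open>I\<close> that is the identity on the columns outside \<open>I\<close>.\<close>
definition chart_normal :: "nat \<Rightarrow> nat set \<Rightarrow> (nat \<times> nat \<Rightarrow> 'r::comm_ring_1) \<Rightarrow> nat \<Rightarrow> nat \<Rightarrow> 'r" where
  "chart_normal n I x j c =
     (if c \<in> I then - x (pos I c, pick ({..<n} - I) j) else idm (pos ({..<n} - I) c) j)"

lemma chart_normal_cols:
  assumes "is_chart k n I" "i < n - k" "j < n - k"
  shows "cols_mat n I (chart_normal n I x) i j = idm i j"
proof -
  let ?J = "{..<n} - I"
  note F = is_chart_facts[OF assms(1)]
  have "j < card ?J" using F(4) assms(3) by simp
  then have "pick ?J j \<in> ?J" "pos ?J (pick ?J j) = j"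
    using pick_in_set_le[of j ?J] pos_pick[OF F(2)] by auto
  then show ?thesis by (simp add: chart_normal_def idm_def)
qed

text \<open>The usual passage from a generator matrix \<open>(1 | A)\<close> to a parity check
  matrix \<open>(- A^T | 1)\<close>, with the columns distributed according to
  \<open>I\<close>.\<close>

lemma represents_chart_normal:
  fixes A :: "'r::comm_ring_1 mat"
  assumes I: "is_chart k n I" and A: "represents k n I A W"
  shows "W = mat_kernel_set n (n - k) (chart_normal n I (\<lambda>v. A $$ v))"
proof -
  let ?q = "n - k" and ?J = "{..<n} - I"
  note F = is_chart_facts[OF I]
  note A' = A[unfolded represents_iff[OF I]]
  have sumn: "(\<Sum>c<n. f c) = (\<Sum>a<k. f (pick I a)) + (\<Sum>j<?q. f (pick ?J j))" for f :: "nat \<Rightarrow> 'r"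
  proof -
    have "(\<Sum>c<n. f c) = (\<Sum>c\<in>?J. f c) + (\<Sum>c\<in>I. f c)"
      using F(5) by (intro sum.subset_diff) auto
    then show ?thesis using sum_pick[OF F(1), of f] sum_pick[OF F(2), of f] F by (simp add: add.commute)
  qed
  have pI: "pick I a \<in> I" "pick I a < n" "pos I (pick I a) = a" if "a < k" for a
    using that F pick_in_set_le[of a I] pos_pick[OF F(1), of a] by auto
  have pJ: "pick ?J j \<in> ?J" if "j < ?q" for j using that F(4) pick_in_set_le[of j ?J] by auto
  have app: "app n (chart_normal n I (\<lambda>v. A $$ v)) v j = v $ pick ?J j - (\<Sum>a<k. v $ pick I a * A $$ (a, pick ?J j))"
    if j: "j < ?q" for v j
  proof -
    have "(\<Sum>a<k. chart_normal n I (\<lambda>v. A $$ v) j (pick I a) * v $ pick I a) = - (\<Sum>a<k. v $ pick I a * A $$ (a, pick ?J j))"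
      using pI by (simp add: chart_normal_def sum_negf mult.commute)
    moreover have "(\<Sum>b<?q. chart_normal n I (\<lambda>v. A $$ v) j (pick ?J b) * v $ pick ?J b) = mm {..<?q} idm (\<lambda>b (_ :: unit). v $ pick ?J b) j ()"
      unfolding mm_def using chart_normal_cols[OF I j, of _ "\<lambda>v. A $$ v"] by (intro sum.cong) auto
    ultimately show ?thesis unfolding app_def sumn using j by (simp add: mm_idm_left)
  qed
  have e: "(\<Sum>a<k. x a * A $$ (a, pick I b)) = x b" if "b < k" for x b
    using A' that mm_idm_right[of "{..<k}" b "\<lambda>_ a. x a"] by (simp add: mm_def)
  have "v \<in> W \<longleftrightarrow> v \<in> mat_kernel_set n ?q (chart_normal n I (\<lambda>v. A $$ v))" for v
  proof
    assume "v \<in> W"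
    then obtain x where v: "v = vec n (\<lambda>c. \<Sum>a<k. x a * A $$ (a, c))" using A' by blast
    then have "v $ pick I a = x a" if "a < k" for a using pI that e by simp
    then show "v \<in> mat_kernel_set n ?q (chart_normal n I (\<lambda>v. A $$ v))"
      using v pJ by (auto simp: mat_kernel_set_def app)
  next
    assume v: "v \<in> mat_kernel_set n ?q (chart_normal n I (\<lambda>v. A $$ v))"
    have "v = vec n (\<lambda>c. \<Sum>a<k. v $ pick I a * A $$ (a, c))"
    proof (rule eq_vecI)
      fix c assume "c < dim_vec (vec n (\<lambda>c. \<Sum>a<k. v $ pick I a * A $$ (a, c)))"
      then have c: "c < n" by simp
      have "v $ c = (\<Sum>a<k. v $ pick I a * A $$ (a, c))"
      proof (cases "c \<in> I")
        case True
        then obtain b where "b < k" "c = pick I b"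
          using bij_betw_pick[OF F(1)] F(3) by (auto simp: bij_betw_def)
        then show ?thesis using e by simp
      next
        case False
        then obtain j where "j < ?q" "c = pick ?J j"
          using bij_betw_pick[OF F(2)] F(4) c by (auto simp: bij_betw_def)
        then show ?thesis using v app[of j v] by (simp add: mat_kernel_set_def)
      qed
      then show "v $ c = vec n (\<lambda>c. \<Sum>a<k. v $ pick I a * A $$ (a, c)) $ c" using c by simp
    qed (use v in \<open>auto simp: mat_kernel_set_def\<close>)
    then have "v \<in> range (\<lambda>x. vec n (\<lambda>c. \<Sum>a<k. x a * A $$ (a, c)))"
      by (rule range_eqI[where x = "\<lambda>a. v $ pick I a"])
    then show "v \<in> W" using A' by (simp only:)
  qed
  then show ?thesis by blast
qed

lemma chart_normal_section:
  assumes "is_chart k n I"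
  shows "\<exists>Y. \<forall>i j. i < n - k \<longrightarrow> j < n - k \<longrightarrow> mm {..<n} (chart_normal n I x) Y i j = idm i j"
proof (rule unit_columns_section[OF assms, where u = 1])
  have "mof (n - k) (cols_mat n I (chart_normal n I x)) = 1\<^sub>m (n - k)"
    unfolding mof_eq_one using chart_normal_cols[OF assms] by blast
  then show "det (mof (n - k) (cols_mat n I (chart_normal n I x))) * 1 = 1" by simp
qed

text \<open>\<open>chart_normal\<close> is \<open>H\<close> multiplied from the left by the inverse
  of its block outside \<open>I\<close>. Multiplying back by the block carries divisibility of the
  minors over to \<open>H\<close>.\<close>

lemma dvd_minors_chart_normal:
  fixes H :: "nat \<Rightarrow> nat \<Rightarrow> 'r::comm_ring_1"
  assumes I: "is_chart k n I" and u: "det (mof (n - k) (cols_mat n I H)) * u = 1" and C: "C \<subseteq> {..<n}"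
    and x: "\<And>a c. a < k \<Longrightarrow> c \<in> {..<n} - I \<Longrightarrow> x (a, c) = chart_coord u n (n - k) I H a c"
    and dv: "dvd_minors g r {..<n - k} C (chart_normal n I x)"
  shows "dvd_minors g r {..<n - k} C H"
proof -
  let ?q = "n - k" and ?J = "{..<n} - I"
  note F = is_chart_facts[OF I]
  define N where "N = (\<lambda>i j. u * adj_mat (mof ?q (cols_mat n I H)) $$ (i, j))"
  have N: "inv_pair {..<?q} (cols_mat n I H) N" unfolding N_def by (rule det_unit_inverse[OF u])
  have NH: "chart_normal n I x j c = mm {..<?q} N H j c" if j: "j < ?q" and c: "c < n" for j c
  proof (cases "c \<in> I")
    case True
    have "j < card ?J" using F(4) j by simp
    then have pJ: "pick ?J j \<in> ?J" "pos ?J (pick ?J j) = j"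
      using pick_in_set_le[of j ?J] pos_pick[OF F(2)] by auto
    have "pos I c < k" "pick I (pos I c) = c" using True pos_less[OF F(1) True] F(3) pick_pos[OF True] by auto
    then show ?thesis
      using True x[OF _ pJ(1)] pJ(2) by (simp add: chart_normal_def chart_coord_def N_def mm_def)
  next
    case False
    then have cJ: "c \<in> ?J" using c by simp
    then have "pos ?J c < ?q" "pick ?J (pos ?J c) = c" using pos_less[OF F(2) cJ] F(4) pick_pos[OF cJ] by auto
    moreover have "mm {..<?q} N (cols_mat n I H) j (pos ?J c) = idm j (pos ?J c)"
      using N j calculation(1) by (simp add: inv_pair_def)
    ultimately have "mm {..<?q} N H j c = idm j (pos ?J c)" by (simp only: mm_def)
    then show ?thesis using False by (simp add: chart_normal_def idm_def eq_commute[of j])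
  qed
  have "mm {..<?q} (cols_mat n I H) (chart_normal n I x) j c = H j c" if "j < ?q" "c < n" for j c
  proof -
    have "mm {..<?q} (cols_mat n I H) (chart_normal n I x) j c = mm {..<?q} (cols_mat n I H) (mm {..<?q} N H) j c"
      using NH that by (intro mm_cong) auto
    also have "\<dots> = H j c" by (rule inv_pair_cancel[OF N]) (use that in auto)
    finally show ?thesis .
  qed
  then have "dvd_minors g r {..<?q} C (mm {..<?q} (cols_mat n I H) (chart_normal n I x)) \<longleftrightarrow> dvd_minors g r {..<?q} C H"
    using C by (intro dvd_minors_cong) auto
  then show ?thesis using dvd_minors_mult_left[OF finite_lessThan dv, of "{..<?q}" "cols_mat n I H"] by blast
qed

lemma chart_coord_scale: "chart_coord u n q I H a c = u * chart_coord 1 n q I H a c"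
  by (simp add: chart_coord_def sum_distrib_left mult.assoc)

lemma chart_mat_kernel_coord:
  fixes K :: "nat \<Rightarrow> nat \<Rightarrow> 'r::comm_ring_1"
  assumes "is_chart k n I" "v \<in> {..<k} \<times> ({..<n} - I)" "det (mof (n - k) (cols_mat n I K)) * w = 1"
  shows "chart_mat k n I (mat_kernel_set n (n - k) K) $$ v = w * chart_coord 1 n (n - k) I K (fst v) (snd v)"
  using chart_mat_eq[OF assms(1) represents_kernel[OF assms(1,3)]] assms(2)
  by (auto simp: chart_repr_def chart_coord_scale[of w])

lemma eval_cpoly_cong:
  assumes "f \<in> cpolys vs" "\<And>v. v \<in> vs \<Longrightarrow> x v = x' v"
  shows "eval_cpoly \<phi> x f = eval_cpoly \<phi> x' f"
  unfolding eval_cpoly_def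
proof (intro sum.cong refl arg_cong2[where f = "(*)"] prod.cong)
  fix m v assume "m \<in> Poly_Mapping.keys f" "v \<in> Poly_Mapping.keys m"
  then have "v \<in> vs" using assms(1) by (auto simp: cpolys_def)
  then show "x v ^ Poly_Mapping.lookup m v = x' v ^ Poly_Mapping.lookup m v" using assms(2) by simp
qed

context poly_pair
begin

text \<open>With \<open>u = 1\<close> the coordinates are the numerators in Cramer's rule, which
  cofactors express as polynomials in the entries.\<close>

lemma of_chart_coord:
  assumes "pos ({..<n} - I) c < q"
    and "\<And>i j. polyf \<psi> Vs (\<lambda>x. H x i j) (\<lambda>x. H' x i j)"
  shows "polyf \<psi> Vs (\<lambda>x. chart_coord 1 n q I (H x) a c) (\<lambda>x. chart_coord 1 n q I (H' x) a c)"
proof -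
  have *: "chart_coord 1 n q I K a c = - (\<Sum>j<q. (- 1) ^ (j + pos ({..<n} - I) c) *
      det (mof (q - 1) (\<lambda>a b. cols_mat n I K (if a < j then a else Suc a) (if b < pos ({..<n} - I) c then b else Suc b)))
      * K j (pick I a))" for K :: "nat \<Rightarrow> nat \<Rightarrow> 'b::comm_ring_1"
    unfolding chart_coord_def by (simp add: adj_mat_mof[OF assms(1)])
  show ?thesis
    unfolding * by (intro of_uminus of_sum polyf.mult of_neg_one_power of_det assms(2))
qed

text \<open>A function on the chart that vanishes on the Schubert variety is pulled back along
  Cramer's rule. After clearing denominators it is a polynomial in the entries of \<open>H\<close>,
  to which \<open>dvd_of_minors_dvd\<close> applies.\<close>

lemma dvd_eval_vanishing:
  fixes g :: 'r and H :: "nat \<Rightarrow> nat \<Rightarrow> 'r"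
  assumes tot: "\<And>x y :: 'r. x dvd y \<or> y dvd x"
    and I: "is_chart k n I" and \<mu>: "is_partition k n \<mu>"
    and u: "det (mof (n - k) (cols_mat n I H)) * u = 1"
    and f: "f \<in> vanishing_ideal k n I (schubert k n \<mu>)"
    and dv: "\<forall>(r, C)\<in>set (schubert_conds k n \<mu>). dvd_minors g r {..<n - k} C H"
  shows "g dvd eval_cpoly \<psi> (\<lambda>v. chart_mat k n I (mat_kernel_set n (n - k) H) $$ v) f"
proof -
  let ?q = "n - k" and ?J = "{..<n} - I" and ?Vs = "{..<k} \<times> ({..<n} - I)"
  note F = is_chart_facts[OF I]
  have f': "f \<in> cpolys ?Vs" using f by (simp add: vanishing_ideal_def)
  note coords = chart_mat_kernel_coord[OF I]
  define D E where "D x = det (mof ?q (cols_mat n I (\<lambda>i j. x (0, i, j))))"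
    and "E y = det (mof ?q (cols_mat n I (\<lambda>i j. y (0, i, j))))"
    for x :: "nat \<times> nat \<times> nat \<Rightarrow> complex" and y :: "nat \<times> nat \<times> nat \<Rightarrow> 'r"
  have DE: "polyf \<psi> UNIV D E" unfolding D_def E_def by (intro of_det polyf.var UNIV_I)
  have num: "\<forall>v\<in>?Vs. polyf \<psi> UNIV (\<lambda>x. chart_coord 1 n ?q I (\<lambda>i j. x (0 :: nat, i, j)) (fst v) (snd v))
      (\<lambda>x. chart_coord 1 n ?q I (\<lambda>i j. x (0 :: nat, i, j)) (fst v) (snd v))"
  proof (intro ballI of_chart_coord[OF _ polyf.var[OF UNIV_I]])
    fix v assume "v \<in> ?Vs"
    then have "snd v \<in> ?J" by auto
    then show "pos ?J (snd v) < ?q" using pos_less[OF F(2)] F(4) by metis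
  qed
  from clear_denominators[OF of_eval_cpoly[OF f'] DE, where
      f = "\<lambda>v x. chart_coord 1 n ?q I (\<lambda>i j. x (0 :: nat, i, j)) (fst v) (snd v)" and
      g = "\<lambda>v x. chart_coord 1 n ?q I (\<lambda>i j. x (0 :: nat, i, j)) (fst v) (snd v)", OF num] obtain N F' G' where
    FG: "polyf \<psi> UNIV F' G'"
    "\<forall>x w. D x * w = 1 \<longrightarrow> F' x = D x ^ N * eval_cpoly (\<lambda>z. z) (\<lambda>v. w * chart_coord 1 n ?q I (\<lambda>i j. x (0, i, j)) (fst v) (snd v)) f"
    "\<forall>y w. E y * w = 1 \<longrightarrow> G' y = E y ^ N * eval_cpoly \<psi> (\<lambda>v. w * chart_coord 1 n ?q I (\<lambda>i j. y (0, i, j)) (fst v) (snd v)) f"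
    by (elim exE conjE)
  define y where "y = (\<lambda>(l :: nat, i, j). H i j)"
  have y: "(\<lambda>i j. y (0, i, j)) = H" by (simp add: y_def)
  have Eu: "E y * u = 1" using u by (simp add: E_def y_def)
  note G'y = FG(3)[rule_format, OF Eu, unfolded y]
  \<comment> \<open>The extra factor \<open>D\<close> makes the polynomial vanish at every complex
    matrix that satisfies the conditions on minors, also where the block outside \<open>I\<close> is
    singular and \<open>f\<close> gives no information.\<close>
  have "g dvd E y * G' y"
  proof (rule dvd_of_minors_dvd[OF tot finite_lessThan _ sorted_schubert_conds[OF \<mu>] polyf.mult[OF DE FG(1)]])
    show "\<forall>(r, C)\<in>set (schubert_conds k n \<mu>). finite C" by (auto simp: set_schubert_conds)
    show "\<forall>(r, C)\<in>set (schubert_conds k n \<mu>). dvd_minors g r {..<?q} C (\<lambda>a c. y (0, a, c))"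
      unfolding y by (rule dv)
    fix x :: "nat \<times> nat \<times> nat \<Rightarrow> complex"
    let ?H = "\<lambda>a c. x (0, a, c)"
    assume x: "\<forall>(r, C)\<in>set (schubert_conds k n \<mu>). dvd_minors 0 r {..<?q} C ?H"
    show "D x * F' x = 0"
    proof (cases "D x = 0")
      case False
      define w where "w = inverse (D x)"
      have w: "D x * w = 1" using False by (simp add: w_def)
      let ?V = "mat_kernel_set n ?q ?H"
      obtain Y where Y: "\<forall>i j. i < ?q \<longrightarrow> j < ?q \<longrightarrow> mm {..<n} ?H Y i j = idm i j"
        using unit_columns_section[OF I w[unfolded D_def]] by blast
      have "?V \<in> schubert k n \<mu>"
        using mat_kernel_set_schubert_iff[OF F(6) \<mu>, of ?H Y] Y x by blast
      moreover have "in_chart k n I ?V"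
        using represents_kernel[OF I w[unfolded D_def]] by (auto simp: in_chart_def)
      ultimately have "eval_cpoly (\<lambda>z. z) (\<lambda>v. chart_mat k n I ?V $$ v) f = 0"
        using f by (simp add: vanishing_ideal_def)
      moreover have "eval_cpoly (\<lambda>z. z) (\<lambda>v. chart_mat k n I ?V $$ v) f =
          eval_cpoly (\<lambda>z. z) (\<lambda>v. w * chart_coord 1 n ?q I ?H (fst v) (snd v)) f"
        by (rule eval_cpoly_cong[OF f' coords]) (use w in \<open>auto simp: D_def\<close>)
      ultimately show ?thesis using FG(2) w by simp
    qed simp
  qed
  also have "E y * G' y = E y ^ (N + 1) * eval_cpoly \<psi> (\<lambda>v. u * chart_coord 1 n ?q I H (fst v) (snd v)) f"
    by (simp add: G'y)
  also have "eval_cpoly \<psi> (\<lambda>v. u * chart_coord 1 n ?q I H (fst v) (snd v)) f =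
      eval_cpoly \<psi> (\<lambda>v. chart_mat k n I (mat_kernel_set n ?q H) $$ v) f"
    by (rule eval_cpoly_cong[OF f' coords[symmetric]]) (use u in auto)
  finally have "g dvd u ^ (N + 1) * (E y ^ (N + 1) * eval_cpoly \<psi> (\<lambda>v. chart_mat k n I (mat_kernel_set n ?q H) $$ v) f)"
    by (rule dvd_mult)
  also have "u ^ (N + 1) * (E y ^ (N + 1) * eval_cpoly \<psi> (\<lambda>v. chart_mat k n I (mat_kernel_set n ?q H) $$ v) f) =
      (E y * u) ^ (N + 1) * eval_cpoly \<psi> (\<lambda>v. chart_mat k n I (mat_kernel_set n ?q H) $$ v) f"
    by (simp only: power_mult_distrib mult_ac)
  also have "E y * u = 1" by (rule Eu)
  finally show ?thesis by simp
qed

text \<open>The minors of \<open>chart_normal\<close> for one condition are polynomials in the chart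
  coordinates and vanish on the Schubert variety. One of them is not divisible by \<open>g\<close>
  at the arc, as otherwise \<open>g\<close> would divide the minors of \<open>H\<close>.\<close>

lemma not_dvd_eval_vanishing:
  fixes g :: 'r and H :: "nat \<Rightarrow> nat \<Rightarrow> 'r"
  assumes I: "is_chart k n I" and \<mu>: "is_partition k n \<mu>"
    and u: "det (mof (n - k) (cols_mat n I H)) * u = 1"
    and rC: "(r, C) \<in> set (schubert_conds k n \<mu>)" "\<not> dvd_minors g r {..<n - k} C H"
  shows "\<exists>f\<in>vanishing_ideal k n I (schubert k n \<mu>).
    \<not> g dvd eval_cpoly \<psi> (\<lambda>v. chart_mat k n I (mat_kernel_set n (n - k) H) $$ v) f"
proof -
  let ?q = "n - k" and ?J = "{..<n} - I" and ?Vs = "{..<k} \<times> ({..<n} - I)"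
  note F = is_chart_facts[OF I]
  let ?A = "\<lambda>v. chart_mat k n I (mat_kernel_set n ?q H) $$ v"
  have C: "C \<subseteq> {..<n}" using rC(1) by (auto simp: set_schubert_conds)
  have "\<not> dvd_minors g r {..<?q} C (chart_normal n I ?A)"
  proof
    assume "dvd_minors g r {..<?q} C (chart_normal n I ?A)"
    then have "dvd_minors g r {..<?q} C H"
      by (rule dvd_minors_chart_normal[OF I u C, rotated])
        (use chart_mat_eq[OF I represents_kernel[OF I u]] in \<open>auto simp: chart_repr_def\<close>)
    then show False using rC(2) by simp
  qed
  then obtain \<rho> \<kappa> where rk: "\<forall>i<r. \<rho> i < ?q" "\<forall>i<r. \<kappa> i \<in> C" "\<not> g dvd minor r (chart_normal n I ?A) \<rho> \<kappa>"
    by (auto simp: dvd_minors_def)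
  have "polyf \<psi> ?Vs (\<lambda>x. minor r (chart_normal n I x) \<rho> \<kappa>) (\<lambda>x. minor r (chart_normal n I x) \<rho> \<kappa>)"
    unfolding minor_def
  proof (rule of_det)
    fix i j assume ij: "i < r" "j < r"
    show "polyf \<psi> ?Vs (\<lambda>x. chart_normal n I x (\<rho> i) (\<kappa> j)) (\<lambda>x. chart_normal n I x (\<rho> i) (\<kappa> j))"
    proof (cases "\<kappa> j \<in> I")
      case True
      have "pos I (\<kappa> j) < k" using pos_less[OF F(1) True] F(3) by simp
      moreover have "\<rho> i < card ?J" using rk(1) ij F(4) by simp
      then have "pick ?J (\<rho> i) \<in> ?J" by (rule pick_in_set_le)
      ultimately have "(pos I (\<kappa> j), pick ?J (\<rho> i)) \<in> ?Vs" by simp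
      then show ?thesis
        unfolding chart_normal_def using True by (simp only: if_True) (intro of_uminus polyf.var)
    next
      case False
      then show ?thesis unfolding chart_normal_def idm_def
        by (cases "pos ?J (\<kappa> j) = \<rho> i") (simp_all add: zero one)
    qed
  qed
  from as_cpoly[OF this] obtain f where f: "f \<in> cpolys ?Vs"
    "\<forall>x. eval_cpoly (\<lambda>z. z) x f = minor r (chart_normal n I x) \<rho> \<kappa>"
    "\<forall>y. eval_cpoly \<psi> y f = minor r (chart_normal n I y) \<rho> \<kappa>" by blast
  have "f \<in> vanishing_ideal k n I (schubert k n \<mu>)"
    unfolding vanishing_ideal_def
  proof (intro CollectI conjI f(1) ballI impI)
    fix V :: "complex vec set" assume V: "V \<in> schubert k n \<mu>" "in_chart k n I V"
    then obtain A where A: "represents k n I A V" by (auto simp: in_chart_def)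
    let ?H = "chart_normal n I (\<lambda>v. A $$ v)"
    obtain Y where Y: "\<forall>i j. i < ?q \<longrightarrow> j < ?q \<longrightarrow> mm {..<n} ?H Y i j = idm i j"
      using chart_normal_section[OF I] by blast
    have "\<forall>(r, C)\<in>set (schubert_conds k n \<mu>). dvd_minors 0 r {..<?q} C ?H"
      using mat_kernel_set_schubert_iff[OF F(6) \<mu>, of ?H Y] Y V(1) represents_chart_normal[OF I A] by metis
    then have "dvd_minors 0 r {..<?q} C ?H" using rC(1) by blast
    then have "minor r ?H \<rho> \<kappa> = 0" using rk by (auto simp: dvd_minors_def)
    then show "eval_cpoly (\<lambda>z. z) (\<lambda>v. chart_mat k n I V $$ v) f = 0"
      using f(2) chart_mat_eq[OF I A] by simp
  qed
  then show ?thesis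
  proof (rule bexI[rotated])
    show "\<not> g dvd eval_cpoly \<psi> ?A f" unfolding f(3)[rule_format] by (rule rk(3))
  qed
qed

end

text \<open>\<open>dvd_eval_vanishing\<close> puts the contact ideal inside the ideal of
  \<open>t_power E\<close>. Conversely, if \<open>E = m\<close> is finite, some minor is not
  divisible by t^(m + 1), so the contact ideal contains a series of order at most \<open>m\<close>
  and with it t^m.\<close>

lemma contact_order_eqI:
  fixes H :: "nat \<Rightarrow> nat \<Rightarrow> 'k::field fps"
  assumes \<phi>: "field_hom \<phi>" and A: "arc_mat n (n - k) \<Lambda> H" and "k \<le> n" and \<mu>: "is_partition k n \<mu>"
    and E: "\<And>e. (\<forall>(r, C)\<in>set (schubert_conds k n \<mu>). dvd_minors (t_power e) r {..<n - k} C H) \<longleftrightarrow> e \<le> E"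
  shows "contact_order \<phi> k n \<Lambda> (schubert k n \<mu>) = E"
proof -
  interpret \<phi>: field_hom \<phi> by (rule \<phi>)
  interpret poly_pair "\<lambda>z. fps_const (\<phi> z)"
    by unfold_locales (simp_all add: \<phi>.hom_add \<phi>.hom_mult fps_const_add[symmetric] fps_const_mult[symmetric]
      del: fps_const_add fps_const_mult)
  let ?R = "class_ring :: 'k fps ring"
  define S where "S = {eval_cpoly (\<lambda>z. fps_const (\<phi> z)) (\<lambda>v. chart_mat k n I \<Lambda> $$ v) f | I f.
        is_chart k n I \<and> in_chart k n I \<Lambda> \<and> f \<in> vanishing_ideal k n I (schubert k n \<mu>)}"
  have \<Lambda>: "\<Lambda> = mat_kernel_set n (n - k) H" by (rule arc_mat_imp_kernel[OF A])
  have unit: "\<exists>u. det (mof (n - k) (cols_mat n I H)) * u = 1" if "is_chart k n I" "in_chart k n I \<Lambda>" for I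
  proof -
    have "det (mof (n - k) (cols_mat n I H)) dvd 1" using arc_in_chart_iff[OF A that(1)] that(2) by simp
    then show ?thesis by (metis dvdE)
  qed
  have R: "cring ?R" "ring ?R" by unfold_locales
  have carr: "carrier ?R = UNIV" by (simp add: class_ring_simps)
  have ci: "ideal (PIdl\<^bsub>?R\<^esub> x) ?R" for x :: "'k fps"
    by (rule cring.cgenideal_ideal[OF R(1)]) (simp add: carr)
  have idl: "ideal (Idl\<^bsub>?R\<^esub> S) ?R" by (rule ring.genideal_ideal[OF R(2)]) (simp add: carr)
  have "Idl\<^bsub>?R\<^esub> S \<subseteq> PIdl\<^bsub>?R\<^esub> (t_power E)"
  proof (rule ring.genideal_minimal[OF R(2) ci])
    show "S \<subseteq> PIdl\<^bsub>?R\<^esub> (t_power E)"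
    proof
      fix w assume "w \<in> S"
      then obtain I f where I: "is_chart k n I" "in_chart k n I \<Lambda>" "f \<in> vanishing_ideal k n I (schubert k n \<mu>)"
        and w: "w = eval_cpoly (\<lambda>z. fps_const (\<phi> z)) (\<lambda>v. chart_mat k n I \<Lambda> $$ v) f" by (auto simp: S_def)
      obtain u where "det (mof (n - k) (cols_mat n I H)) * u = 1" using unit[OF I(1,2)] by blast
      from dvd_eval_vanishing[OF fps_total_dvd I(1) \<mu> this I(3)] E[of E]
      show "w \<in> PIdl\<^bsub>?R\<^esub> (t_power E)" by (simp add: PIdl_t_power w \<Lambda>)
    qed
  qed
  moreover have "PIdl\<^bsub>?R\<^esub> (t_power E) \<subseteq> Idl\<^bsub>?R\<^esub> S"
  proof (rule ring.cgenideal_minimal[OF R(2) idl])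
    show "t_power E \<in> Idl\<^bsub>?R\<^esub> S"
    proof (cases E)
      case infinity
      then show ?thesis
        using additive_subgroup.zero_closed[OF ideal.axioms(1)[OF idl]] by (simp add: class_ring_simps)
    next
      case (enat m)
      have "\<not> enat (Suc m) \<le> E" by (simp add: enat)
      then obtain r C where rC: "(r, C) \<in> set (schubert_conds k n \<mu>)" "\<not> dvd_minors (t_power (enat (Suc m))) r {..<n - k} C H"
        using E[of "enat (Suc m)"] by blast
      obtain I where I: "is_chart k n I" "in_chart k n I \<Lambda>" using arc_in_some_chart[OF A \<open>k \<le> n\<close>] by blast
      obtain u where u: "det (mof (n - k) (cols_mat n I H)) * u = 1" using unit[OF I] by blast
      from not_dvd_eval_vanishing[OF I(1) \<mu> u rC] obtain f where
        f: "f \<in> vanishing_ideal k n I (schubert k n \<mu>)"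
          "\<not> t_power (enat (Suc m)) dvd eval_cpoly (\<lambda>z. fps_const (\<phi> z)) (\<lambda>v. chart_mat k n I \<Lambda> $$ v) f"
        unfolding \<Lambda> by blast
      define w where "w = eval_cpoly (\<lambda>z. fps_const (\<phi> z)) (\<lambda>v. chart_mat k n I \<Lambda> $$ v) f"
      have "w \<in> S" using I f by (auto simp: S_def w_def)
      then have w: "w \<in> Idl\<^bsub>?R\<^esub> S" using ring.genideal_self[OF R(2), of S] by (auto simp: carr)
      have "fps_nth w m \<noteq> 0 \<or> (\<exists>i<m. fps_nth w i \<noteq> 0)"
        using f(2) by (auto simp: t_power_dvd_iff w_def less_Suc_eq)
      then have "w \<noteq> 0" "subdegree w \<le> m" by (auto intro: subdegree_leI) (meson less_imp_le order_trans subdegree_leI)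
      then have "w dvd t_power E" by (simp add: enat t_power_enat fps_dvd_iff)
      then obtain v where "t_power E = w * v" by (elim dvdE)
      then show ?thesis using ideal.I_r_closed[OF idl w, of v] by (simp add: class_ring_simps)
    qed
  qed
  ultimately have eq: "contact_ideal \<phi> k n \<Lambda> (schubert k n \<mu>) = PIdl\<^bsub>?R\<^esub> (t_power E)"
    by (simp add: contact_ideal_def S_def)
  show ?thesis
    unfolding contact_order_def
  proof (rule the_equality)
    show "contact_ideal \<phi> k n \<Lambda> (schubert k n \<mu>) = PIdl\<^bsub>?R\<^esub> (t_power E)" by (rule eq)
    fix e assume "contact_ideal \<phi> k n \<Lambda> (schubert k n \<mu>) = PIdl\<^bsub>?R\<^esub> (t_power e)"
    from trans[OF this[symmetric] eq] have "{x :: 'k fps. t_power e dvd x} = {x. t_power E dvd x}"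
      unfolding PIdl_t_power .
    from fun_cong[OF Collect_inj[OF this]] have "(t_power e :: 'k fps) dvd x \<longleftrightarrow> t_power E dvd x" for x .
    from this[of "t_power E"] this[of "t_power e"]
    have "(t_power e :: 'k fps) dvd t_power E" "(t_power E :: 'k fps) dvd t_power e" by simp_all
    then show "e = E" by (simp add: t_power_dvd_t_power_iff)
  qed
qed

section \<open>Diagonal sums of a plane partition and orders of contact\<close>

definition diagonal_sum :: "nat \<Rightarrow> nat \<Rightarrow> enat mat \<Rightarrow> nat \<Rightarrow> nat \<Rightarrow> enat" where
  "diagonal_sum k q \<beta> r c = (\<Sum>j\<in>{c..<q}. if r + (j - c) < k then \<beta> $$ (r + (j - c), j) else 0)"

text \<open>At stage \<open>q + p - m\<close> the exponents from index \<open>m - 1\<close> on run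
  along the diagonal of the profile that starts in position \<open>(p - 1, m - 1)\<close>. Beyond
  the last row they are 0, whence the default value in \<open>diagonal_sum\<close>.\<close>

lemma full_profile_diagonal:
  assumes "1 \<le> p" "1 \<le> m" "m \<le> q"
  shows "(\<Sum>j\<in>{m - 1..<q}. full_profile k q \<beta> (q + p - m) j) = diagonal_sum k q \<beta> (p - 1) (m - 1)"
  unfolding diagonal_sum_def
proof (rule sum.cong[OF refl])
  fix j assume "j \<in> {m - 1..<q}"
  then have "\<not> q + p - m + j < q" "q + k \<le> q + p - m + j \<longleftrightarrow> \<not> p - 1 + (j - (m - 1)) < k"
    "q + p - m + j - q = p - 1 + (j - (m - 1))" using assms by auto
  then show "full_profile k q \<beta> (q + p - m) j =
      (if p - 1 + (j - (m - 1)) < k then \<beta> $$ (p - 1 + (j - (m - 1)), j) else 0)"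
    unfolding full_profile_def by simp
qed

text \<open>For \<open>\<mu> p = 0\<close> the minors have size \<open>n - k + 1\<close>, which
  exceeds the number of rows, so the condition is void. The infimum over the empty set is
  \<infinity>, the order of contact with the whole Grassmannian.\<close>

lemma contact_order_schubert:
  fixes \<Lambda> :: "'k::field fps vec set"
  assumes "field_hom \<phi>" and "is_arc k n \<Lambda>" and "k \<le> n" and \<mu>: "is_partition k n \<mu>"
  shows "contact_order \<phi> k n \<Lambda> (schubert k n \<mu>) =
    (INF p\<in>{p\<in>{1..k}. 1 \<le> \<mu> p}. diagonal_sum k (n - k) (profile k n \<Lambda>) (p - 1) (\<mu> p - 1))"
proof -
  let ?q = "n - k" and ?\<beta> = "profile k n \<Lambda>"
  obtain H where A: "arc_mat n ?q \<Lambda> H" using assms(2) is_arc_iff by blast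
  obtain T T' b Q Y where
    sm: "\<And>i. smith {..<?q} {n - i..<n} H (T i) (T' i) (\<lambda>j. t_power (b i j)) (Q i) (Y i)"
    and anti: "\<And>i. antitone_below ?q (b i)"
    and b: "\<And>i j. i \<le> n \<Longrightarrow> j < ?q \<Longrightarrow> b i j = full_profile k ?q ?\<beta> i j"
    using arc_chain[OF A assms(3)] by metis
  show ?thesis
  proof (rule contact_order_eqI[OF assms(1) A assms(3) \<mu>])
    fix e
    have "dvd_minors (t_power e) (?q - \<mu> p + 1) {..<?q} {k - p + \<mu> p..<n} H \<longleftrightarrow>
        (1 \<le> \<mu> p \<longrightarrow> e \<le> diagonal_sum k ?q ?\<beta> (p - 1) (\<mu> p - 1))" if p: "p \<in> {1..k}" for p
    proof (cases "\<mu> p = 0")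
      case True
      have "minor (?q + 1) H \<rho> \<kappa> = 0" if "\<forall>i<?q + 1. \<rho> i \<in> {..<?q}" for \<rho> \<kappa>
        by (rule minor_eq_0_of_card[OF _ _ that]) auto
      then show ?thesis using True by (simp add: dvd_minors_def)
    next
      case False
      have m: "\<mu> p \<le> ?q" using \<mu> p by (simp add: is_partition_def)
      let ?i = "?q + p - \<mu> p"
      have i: "?i \<le> n" "n - ?i = k - p + \<mu> p" using m p assms(3) by auto
      have r: "?q - \<mu> p + 1 \<le> ?q" "?q - (?q - \<mu> p + 1) = \<mu> p - 1" using m False by auto
      have "(\<Sum>j\<in>{\<mu> p - 1..<?q}. b ?i j) = (\<Sum>j\<in>{\<mu> p - 1..<?q}. full_profile k ?q ?\<beta> ?i j)"
        using b[OF i(1)] by (intro sum.cong) auto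
      also have "\<dots> = diagonal_sum k ?q ?\<beta> (p - 1) (\<mu> p - 1)"
        using p m False by (intro full_profile_diagonal) auto
      finally show ?thesis
        using dvd_minors_t_power_iff[OF sm[of ?i] _ anti[of ?i] r(1), of e] False
        unfolding i(2) r(2) by simp
    qed
    then show "(\<forall>(r, C)\<in>set (schubert_conds k n \<mu>). dvd_minors (t_power e) r {..<?q} C H) \<longleftrightarrow>
        e \<le> (INF p\<in>{p\<in>{1..k}. 1 \<le> \<mu> p}. diagonal_sum k ?q ?\<beta> (p - 1) (\<mu> p - 1))"
      unfolding set_schubert_conds le_INF_iff by auto
  qed
qed

lemma plane_partition_antimono:
  assumes \<beta>: "plane_partition k q \<beta>" and "r \<le> r'" "r' < k" "c \<le> c'" "c' < q"
  shows "\<beta> $$ (r', c') \<le> \<beta> $$ (r, c)"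
proof -
  have "\<beta> $$ (r', c') \<le> \<beta> $$ (r, c')" using assms(2,3)
  proof (induction r' rule: dec_induct)
    case (step r')
    then have "\<beta> $$ (r' + 1, c') \<le> \<beta> $$ (r', c')" using \<beta> assms(5) by (simp add: plane_partition_def)
    then show ?case using step by simp
  qed simp
  also have "\<beta> $$ (r, c') \<le> \<beta> $$ (r, c)" using assms(4,5)
  proof (induction c' rule: dec_induct)
    case (step c')
    then have "\<beta> $$ (r, c' + 1) \<le> \<beta> $$ (r, c')" using \<beta> assms(2,3) by (simp add: plane_partition_def)
    then show ?case using step by simp
  qed simp
  finally show ?thesis .
qed

lemma diagonal_sum_antimono:
  assumes "plane_partition k q \<beta>" "r \<le> r'"
  shows "diagonal_sum k q \<beta> r' c \<le> diagonal_sum k q \<beta> r c"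
  unfolding diagonal_sum_def
  using assms by (intro sum_mono) (auto intro: plane_partition_antimono)

lemma diagonal_sum_step:
  assumes "r < k" "c < q"
  shows "diagonal_sum k q \<beta> r c = \<beta> $$ (r, c) + diagonal_sum k q \<beta> (r + 1) (c + 1)"
proof -
  have "{c..<q} = insert c {c + 1..<q}" using assms by auto
  then have "diagonal_sum k q \<beta> r c = \<beta> $$ (r, c) + (\<Sum>j\<in>{c + 1..<q}. if r + (j - c) < k then \<beta> $$ (r + (j - c), j) else 0)"
    using assms(1) by (simp add: diagonal_sum_def)
  also have "(\<Sum>j\<in>{c + 1..<q}. if r + (j - c) < k then \<beta> $$ (r + (j - c), j) else 0) = diagonal_sum k q \<beta> (r + 1) (c + 1)"
    unfolding diagonal_sum_def
  proof (rule sum.cong[OF refl])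
    fix j assume "j \<in> {c + 1..<q}"
    then have "r + (j - c) = r + 1 + (j - (c + 1))" by auto
    then show "(if r + (j - c) < k then \<beta> $$ (r + (j - c), j) else 0) =
      (if r + 1 + (j - (c + 1)) < k then \<beta> $$ (r + 1 + (j - (c + 1)), j) else 0)" by simp
  qed
  finally show ?thesis .
qed

text \<open>Subtraction of the rest of a diagonal fails if the rest is infinite. But then one of its
  finitely many entries is \<infinity>, and the entry at \<open>(r, c)\<close> is at least as
  large.\<close>

lemma diagonal_sum_infinite_entry:
  assumes \<beta>: "plane_partition k q \<beta>" and "r < k" "c < q" "diagonal_sum k q \<beta> (r + 1) (c + 1) = \<infinity>"
  shows "\<beta> $$ (r, c) = \<infinity>"
proof (rule ccontr)
  assume *: "\<beta> $$ (r, c) \<noteq> \<infinity>"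
  have "(if r + 1 + (j - (c + 1)) < k then \<beta> $$ (r + 1 + (j - (c + 1)), j) else 0) \<le> \<beta> $$ (r, c)" if "j \<in> {c + 1..<q}" for j
    using that assms(1) by (auto intro: plane_partition_antimono)
  then have "diagonal_sum k q \<beta> (r + 1) (c + 1) \<le> (\<Sum>j\<in>{c + 1..<q}. \<beta> $$ (r, c))"
    unfolding diagonal_sum_def by (intro sum_mono)
  also have "\<dots> < \<infinity>" using * by (auto simp: of_nat_eq_enat)
  finally show False using assms(4) by simp
qed

lemma plane_partition_eqI:
  assumes \<beta>: "plane_partition k q \<beta>" "plane_partition k q \<beta>'"
    and G: "\<And>r c. r < k \<Longrightarrow> c < q \<Longrightarrow> diagonal_sum k q \<beta> r c = diagonal_sum k q \<beta>' r c"
  shows "\<beta> = \<beta>'"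
proof (rule eq_matI)
  fix r c assume "r < dim_row \<beta>'" "c < dim_col \<beta>'"
  then have rc: "r < k" "c < q" using \<beta>(2) by (auto simp: plane_partition_def)
  have eq: "diagonal_sum k q \<beta> (r + 1) (c + 1) = diagonal_sum k q \<beta>' (r + 1) (c + 1)"
  proof (cases "r + 1 < k \<and> c + 1 < q")
    \<comment> \<open>Outside of the profile the sum is empty or consists of default values
      0.\<close>
    case False
    then have "diagonal_sum k q \<gamma> (r + 1) (c + 1) = 0" for \<gamma>
      unfolding diagonal_sum_def by (intro sum.neutral) auto
    then show ?thesis by simp
  qed (use G in simp)
  show "\<beta> $$ (r, c) = \<beta>' $$ (r, c)"
  proof (cases "diagonal_sum k q \<beta> (r + 1) (c + 1) = \<infinity>")
    case True
    then show ?thesis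
      using diagonal_sum_infinite_entry[OF \<beta>(1) rc] diagonal_sum_infinite_entry[OF \<beta>(2) rc] eq by simp
  next
    case False
    then show ?thesis
      using G[OF rc] eq diagonal_sum_step[OF rc, of \<beta>] diagonal_sum_step[OF rc, of \<beta>']
      by (simp add: add.commute[of _ "diagonal_sum k q \<beta>' _ _"] enat_add_left_cancel) auto
  qed
qed (use \<beta> in \<open>auto simp: plane_partition_def\<close>)

text \<open>A rectangle with \<open>r + 1\<close> rows and \<open>c + 1\<close> columns yields the
  diagonal sums that start in column \<open>c\<close> and in rows up to \<open>r\<close>.
  Monotonicity makes the lowest of them the least, so the infimum is a single diagonal sum.\<close>

lemma contact_order_rectangle:
  fixes \<Lambda> :: "'k::field fps vec set"
  assumes "field_hom \<phi>" and "is_arc k n \<Lambda>" and "k \<le> n" and "r < k" "c < n - k"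
  shows "is_partition k n (\<lambda>s. if s \<le> r + 1 then c + 1 else 0)"
    and "contact_order \<phi> k n \<Lambda> (schubert k n (\<lambda>s. if s \<le> r + 1 then c + 1 else 0)) =
      diagonal_sum k (n - k) (profile k n \<Lambda>) r c"
proof -
  let ?\<mu> = "\<lambda>s. if s \<le> r + 1 then c + 1 else 0" and ?G = "diagonal_sum k (n - k) (profile k n \<Lambda>)"
  show p: "is_partition k n ?\<mu>" using assms by (auto simp: is_partition_def)
  have "{p \<in> {1..k}. 1 \<le> ?\<mu> p} = {1..r + 1}" using assms(4) by auto
  then have "contact_order \<phi> k n \<Lambda> (schubert k n ?\<mu>) = (INF p\<in>{1..r + 1}. ?G (p - 1) (?\<mu> p - 1))"
    by (simp only: contact_order_schubert[OF assms(1-3) p])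
  also have "\<dots> = (INF p\<in>{1..r + 1}. ?G (p - 1) c)" by (intro INF_cong) auto
  also have "\<dots> = ?G r c"
  proof (rule antisym)
    show "(INF p\<in>{1..r + 1}. ?G (p - 1) c) \<le> ?G r c" by (rule INF_lower2[of "r + 1"]) auto
    show "?G r c \<le> (INF p\<in>{1..r + 1}. ?G (p - 1) c)"
      using profile_plane_partition[OF assms(2,3)] by (intro INF_greatest diagonal_sum_antimono) auto
  qed
  finally show "contact_order \<phi> k n \<Lambda> (schubert k n ?\<mu>) = ?G r c" .
qed

theorem theorem0p1:
  fixes k n :: nat
  assumes "0 < k" and "k < n"
  shows "(\<forall>(\<phi> :: complex \<Rightarrow> 'k::field) (\<psi> :: complex \<Rightarrow> 'l::field) \<Lambda> \<Lambda>'.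
            field_hom \<phi> \<and> field_hom \<psi> \<and> is_arc k n (\<Lambda> :: 'k fps vec set) \<and>
            is_arc k n (\<Lambda>' :: 'l fps vec set) \<longrightarrow>
              (profile k n \<Lambda> = profile k n \<Lambda>' \<longleftrightarrow>
                (\<forall>\<mu>. is_partition k n \<mu> \<longrightarrow>
                   contact_order \<phi> k n \<Lambda> (schubert k n \<mu>) =
                   contact_order \<psi> k n \<Lambda>' (schubert k n \<mu>)))) \<and>
         (\<forall>(\<phi> :: complex \<Rightarrow> 'k::field) \<Lambda>.
            field_hom \<phi> \<and> is_arc k n (\<Lambda> :: 'k fps vec set) \<longrightarrow>
              plane_partition k (n - k) (profile k n \<Lambda>)) \<and>
         (\<forall>\<beta>. plane_partition k (n - k) \<beta> \<longrightarrow>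
            (\<exists>\<Lambda> :: complex fps vec set. is_arc k n \<Lambda> \<and> profile k n \<Lambda> = \<beta>)) \<and>
         (\<forall>\<beta>. plane_partition k (n - k) \<beta> \<longrightarrow>
            irreducible_subset (arc_space k n) (contact_stratum k n \<beta>))"
proof (intro conjI allI impI)
  fix \<phi> :: "complex \<Rightarrow> 'k" and \<psi> :: "complex \<Rightarrow> 'l"
    and \<Lambda> :: "'k fps vec set" and \<Lambda>' :: "'l fps vec set"
  assume *: "field_hom \<phi> \<and> field_hom \<psi> \<and> is_arc k n \<Lambda> \<and> is_arc k n \<Lambda>'"
  then have a: "field_hom \<phi>" "field_hom \<psi>" "is_arc k n \<Lambda>" "is_arc k n \<Lambda>'" and kn: "k \<le> n"
    using assms by auto
  show "profile k n \<Lambda> = profile k n \<Lambda>' \<longleftrightarrow> (\<forall>\<mu>. is_partition k n \<mu> \<longrightarrow>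
      contact_order \<phi> k n \<Lambda> (schubert k n \<mu>) = contact_order \<psi> k n \<Lambda>' (schubert k n \<mu>))"
  proof
    assume "profile k n \<Lambda> = profile k n \<Lambda>'"
    then show "\<forall>\<mu>. is_partition k n \<mu> \<longrightarrow>
      contact_order \<phi> k n \<Lambda> (schubert k n \<mu>) = contact_order \<psi> k n \<Lambda>' (schubert k n \<mu>)"
      using contact_order_schubert[OF a(1,3) kn] contact_order_schubert[OF a(2,4) kn] by simp
  next
    assume eq: "\<forall>\<mu>. is_partition k n \<mu> \<longrightarrow>
      contact_order \<phi> k n \<Lambda> (schubert k n \<mu>) = contact_order \<psi> k n \<Lambda>' (schubert k n \<mu>)"
    show "profile k n \<Lambda> = profile k n \<Lambda>'"
    proof (rule plane_partition_eqI[OF profile_plane_partition[OF a(3) kn] profile_plane_partition[OF a(4) kn]])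
      fix r c assume rc: "r < k" "c < n - k"
      note 1 = contact_order_rectangle[OF a(1,3) kn rc] and 2 = contact_order_rectangle[OF a(2,4) kn rc]
      show "diagonal_sum k (n - k) (profile k n \<Lambda>) r c = diagonal_sum k (n - k) (profile k n \<Lambda>') r c"
        using eq[rule_format, OF 1(1)] unfolding 1(2) 2(2) .
    qed
  qed
next
  fix \<phi> :: "complex \<Rightarrow> 'k" and \<Lambda> :: "'k fps vec set"
  assume "field_hom \<phi> \<and> is_arc k n \<Lambda>"
  then show "plane_partition k (n - k) (profile k n \<Lambda>)"
    using assms(2) by (intro profile_plane_partition) auto
next
  fix \<beta> assume "plane_partition k (n - k) \<beta>"
  then show "\<exists>\<Lambda> :: complex fps vec set. is_arc k n \<Lambda> \<and> profile k n \<Lambda> = \<beta>"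
    using assms(2) by (intro exists_arc_with_profile) auto
next
  fix \<beta> assume "plane_partition k (n - k) \<beta>"
  then show "irreducible_subset (arc_space k n) (contact_stratum k n \<beta>)"
    using assms(2) by (intro contact_stratum_irreducible) auto
qed

end
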